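(* Let $1<p,s<\infty$ and $\omega\in\mathcal{D}$. If $f\in\mathrm{BMO}(\Delta)_{\omega,p}$, then the little Hankel operators $h^\omega_f,h^\omega_{\overline{f}}:A^s_\omega\to\overline{A^s_\omega}$ are bounded, and $$\|h^\omega_f\|_{A^s_\omega\to\overline{A^s_\omega}}+\|h^\omega_{\overline{f}}\|_{A^s_\omega\to\overline{A^s_\omega}}\lesssim\|f\|_{\mathrm{BMO}(\Delta)_{\omega,p}},$$ where the implied constant does not depend on $f$.
   Context: $\mathbb{D}$ is the open unit disc, $dA(z)=\frac{dx\,dy}{\pi}$, $\mathcal{H}(\mathbb{D})$ is the space of analytic functions in $\mathbb{D}$, and $H^\infty$ is the space of bounded analytic functions in $\mathbb{D}$. A radial weight is a non-negative function $\omega\in L^1([0,1))$ extended to $\mathbb{D}$ by $\omega(z)=\omega(|z|)$; it is always assumed that $\widehat{\omega}(z)=\int_{|z|}^1\omega(s)\,ds>0$ for all $z\in\mathbb{D}$. Moments: $\omega_x=\int_0^1r^x\omega(r)\,dr$; $\omega(E)=\int_E\omega\,dA$. Classes: $\omega\in\widehat{\mathcal{D}}$ if there is $C>1$ with $\widehat{\omega}(r)\le C\widehat{\omega}\left(\frac{1+r}{2}\right)$ for all $0\le r<1$; $\omega\in\mathcal{M}$ if there are $C>1$, $K>1$ with $\omega_x\ge C\omega_{Kx}$ for all $x\ge1$; $\omega\in\check{\mathcal{D}}$ if there are $K>1$, $C>1$ with $\widehat{\omega}(r)\ge C\widehat{\omega}\left(1-\frac{1-r}{K}\right)$ for all $0\le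 r<1$. Then $\mathcal{D}=\widehat{\mathcal{D}}\cap\mathcal{M}=\widehat{\mathcal{D}}\cap\check{\mathcal{D}}$ (the equality is known). $L^p_\omega$ is the Lebesgue space on $\mathbb{D}$ with respect to $\omega\,dA$, $A^p_\omega=L^p_\omega\cap\mathcal{H}(\mathbb{D})$, and $\overline{A^p_\omega}=\{\overline{g}:g\in A^p_\omega\}$ with the $L^p_\omega$-norm. $B^\omega_z(\zeta)=\sum_{n=0}^\infty\frac{(\overline{z}\zeta)^n}{2\omega_{2n+1}}$ are the reproducing kernels of $A^2_\omega$. The little Hankel operator with symbol $f\in L^1_\omega$ is $h^\omega_f(g)(z)=\int_{\mathbb{D}}f(\zeta)g(\zeta)B^\omega_z(\zeta)\omega(\zeta)\,dA(\zeta)$, defined for $g\in H^\infty$, which is dense in $A^s_\omega$; boundedness $A^s_\omega\to\overline{A^s_\omega}$ means $\|h^\omega_f(g)\|_{L^s_\omega}\le C\|g\|_{A^s_\omega}$ for all $g\in H^\infty$, the operator norm being the best such $C$. $\beta(z,\zeta)=\frac12\log\frac{1+|\varphi_z(\zeta)|}{1-|\varphi_z(\zeta)|}$, $\varphi_z(\zeta)=\frac{z-\zeta}{1-\overline{z}\zeta}$, is the hyperbolic distance, and $\Delta(z,r)=\{\zeta\in\mathbb{D}:\beta(z,\zeta)<r\}$. If $0<r<\infty$ and $\omega(\Delta(z,r))>0$ for all $z\in\mathbb{D}$, set $$\widehat{f}_{r,\omega}(z)=\frac{1}{\omega(\Delta(z,r))}\int_{\Delta(z,r)}f\omega\,dA,\qquad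 \mathrm{MO}_{\omega,p,r}(f)(z)=\left(\frac{1}{\omega(\Delta(z,r))}\int_{\Delta(z,r)}|f(\zeta)-\widehat{f}_{r,\omega}(z)|^p\omega(\zeta)\,dA(\zeta)\right)^{1/p}.$$ $\mathrm{BMO}(\Delta)_{\omega,p,r}$ consists of $f\in L^p_\omega$ with $$\|f\|_{\mathrm{BMO}(\Delta)_{\omega,p,r}}=\sup_{z\in\mathbb{D}}\mathrm{MO}_{\omega,p,r}(f)(z)<\infty.$$ It is known that for each $\omega\in\mathcal{D}$ there is $r_0=r_0(\omega)>0$ such that these spaces are well defined and coincide for all $r\ge r_0$; the common space is $\mathrm{BMO}(\Delta)_{\omega,p}$, and $\|f\|_{\mathrm{BMO}(\Delta)_{\omega,p}}$ is computed for a fixed $r\ge r_0$.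
   Formalization: The displayed bound is proved with ‖f‖_BMO + |f̂_{r,ω}(0)| on the right instead of ‖f‖_BMO alone, since the latter vanishes on constants while h_1(g)=g(0) is nonzero; for f̂_{r,ω}(0)=0 it is the stated bound. *)

theory Defs
  imports "HOL-Complex_Analysis.Complex_Analysis"
begin

section \<open>Radial weights\<close>

text \<open>
  A radial weight is a function on \<open>[0,1)\<close>; its values elsewhere are irrelevant, and its
  extension to the disc is \<open>\<lambda>z. \<omega> (cmod z)\<close>.
\<close>

definition weight_tail :: "(real \<Rightarrow> real) \<Rightarrow> real \<Rightarrow> real" where
  "weight_tail \<omega> r = (LBINT s:{r..<1}. \<omega> s)"

definition radial_weight :: "(real \<Rightarrow> real) \<Rightarrow> bool" where
  "radial_weight \<omega> \<longleftrightarrow>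
     (\<forall>r\<in>{0..<1}. 0 \<le> \<omega> r) \<and>
     set_integrable lborel {0..<1} \<omega> \<and>
     (\<forall>r\<in>{0..<1}. 0 < weight_tail \<omega> r)"

definition moment :: "(real \<Rightarrow> real) \<Rightarrow> real \<Rightarrow> real" where
  "moment \<omega> x = (LBINT r:{0..<1}. r powr x * \<omega> r)"

definition D_hat :: "(real \<Rightarrow> real) set" where
  "D_hat = {\<omega>. radial_weight \<omega> \<and>
     (\<exists>C>1. \<forall>r\<in>{0..<1}. weight_tail \<omega> r \<le> C * weight_tail \<omega> ((1 + r) / 2))}"

definition M_class :: "(real \<Rightarrow> real) set" where
  "M_class = {\<omega>. radial_weight \<omega> \<and>
     (\<exists>C>1. \<exists>K>1. \<forall>x\<ge>1. moment \<omega> x \<ge> C * moment \<omega> (K * x))}"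

definition D_class :: "(real \<Rightarrow> real) set" where
  "D_class = D_hat \<inter> M_class"

section \<open>Weighted Lebesgue and Bergman spaces\<close>

text \<open>
  The measure \<open>\<omega> dA\<close> on the unit disc, with \<open>dA\<close> normalised to have total mass one. Its
  space is \<open>ball 0 1\<close>, so measurability and integrals do not see values outside the disc.
\<close>

definition weight_measure :: "(real \<Rightarrow> real) \<Rightarrow> complex measure" where
  "weight_measure \<omega> =
     density (restrict_space lborel (ball 0 1)) (\<lambda>z. ennreal (\<omega> (cmod z) / pi))"

definition Lp_space :: "(real \<Rightarrow> real) \<Rightarrow> real \<Rightarrow> (complex \<Rightarrow> complex) set" where
  "Lp_space \<omega> p = {f \<in> borel_measurable (weight_measure \<omega>).
     integrable (weight_measure \<omega>) (\<lambda>z. cmod (f z) powr p)}"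

definition Lp_norm :: "(real \<Rightarrow> real) \<Rightarrow> real \<Rightarrow> (complex \<Rightarrow> complex) \<Rightarrow> real" where
  "Lp_norm \<omega> p f = (LINT z|weight_measure \<omega>. cmod (f z) powr p) powr (1 / p)"

definition bergman_space :: "(real \<Rightarrow> real) \<Rightarrow> real \<Rightarrow> (complex \<Rightarrow> complex) set" where
  "bergman_space \<omega> p = {g \<in> Lp_space \<omega> p. g holomorphic_on ball 0 1}"

definition conj_bergman_space :: "(real \<Rightarrow> real) \<Rightarrow> real \<Rightarrow> (complex \<Rightarrow> complex) set" where
  "conj_bergman_space \<omega> p = {\<lambda>z. cnj (g z) | g. g \<in> bergman_space \<omega> p}"

definition H_infinity :: "(complex \<Rightarrow> complex) set" where
  "H_infinity = {g. g holomorphic_on ball 0 1 \<and> bounded (g ` ball 0 1)}"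

section \<open>Little Hankel operators\<close>

definition bergman_kernel :: "(real \<Rightarrow> real) \<Rightarrow> complex \<Rightarrow> complex \<Rightarrow> complex" where
  "bergman_kernel \<omega> z \<zeta> =
     (\<Sum>n. (cnj z * \<zeta>) ^ n / complex_of_real (2 * moment \<omega> (real (2 * n + 1))))"

definition little_hankel ::
  "(real \<Rightarrow> real) \<Rightarrow> (complex \<Rightarrow> complex) \<Rightarrow> (complex \<Rightarrow> complex) \<Rightarrow> complex \<Rightarrow> complex" where
  "little_hankel \<omega> f g z =
     (LINT \<zeta>|weight_measure \<omega>. f \<zeta> * g \<zeta> * bergman_kernel \<omega> z \<zeta>)"

text \<open>
  Bounds for the operator from the Bergman space to its conjugate, tested on the dense subspace
  of bounded analytic functions. Membership in the target space is demanded explicitly because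
  \<^const>\<open>Lp_norm\<close> is zero for a function that is not in the Lebesgue space.
\<close>

definition little_hankel_bound ::
  "(real \<Rightarrow> real) \<Rightarrow> real \<Rightarrow> (complex \<Rightarrow> complex) \<Rightarrow> real \<Rightarrow> bool" where
  "little_hankel_bound \<omega> s f C \<longleftrightarrow> 0 \<le> C \<and>
     (\<forall>g\<in>H_infinity. little_hankel \<omega> f g \<in> conj_bergman_space \<omega> s \<and>
        Lp_norm \<omega> s (little_hankel \<omega> f g) \<le> C * Lp_norm \<omega> s g)"

definition little_hankel_bounded ::
  "(real \<Rightarrow> real) \<Rightarrow> real \<Rightarrow> (complex \<Rightarrow> complex) \<Rightarrow> bool" where
  "little_hankel_bounded \<omega> s f \<longleftrightarrow> (\<exists>C. little_hankel_bound \<omega> s f C)"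

definition little_hankel_norm ::
  "(real \<Rightarrow> real) \<Rightarrow> real \<Rightarrow> (complex \<Rightarrow> complex) \<Rightarrow> real" where
  "little_hankel_norm \<omega> s f = Inf {C. little_hankel_bound \<omega> s f C}"

section \<open>Bounded mean oscillation in the hyperbolic metric\<close>

definition disc_involution :: "complex \<Rightarrow> complex \<Rightarrow> complex" where
  "disc_involution z \<zeta> = (z - \<zeta>) / (1 - cnj z * \<zeta>)"

definition hyp_dist :: "complex \<Rightarrow> complex \<Rightarrow> real" where
  "hyp_dist z \<zeta> =
     1 / 2 * ln ((1 + cmod (disc_involution z \<zeta>)) / (1 - cmod (disc_involution z \<zeta>)))"

definition hyp_disc :: "complex \<Rightarrow> real \<Rightarrow> complex set" where
  "hyp_disc z r = {\<zeta> \<in> ball 0 1. hyp_dist z \<zeta> < r}"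

definition hyp_mean ::
  "(real \<Rightarrow> real) \<Rightarrow> real \<Rightarrow> (complex \<Rightarrow> complex) \<Rightarrow> complex \<Rightarrow> complex" where
  "hyp_mean \<omega> r f z =
     (LINT \<zeta>:hyp_disc z r|weight_measure \<omega>. f \<zeta>) /
       complex_of_real (measure (weight_measure \<omega>) (hyp_disc z r))"

definition mean_osc ::
  "(real \<Rightarrow> real) \<Rightarrow> real \<Rightarrow> real \<Rightarrow> (complex \<Rightarrow> complex) \<Rightarrow> complex \<Rightarrow> real" where
  "mean_osc \<omega> p r f z =
     ((LINT \<zeta>:hyp_disc z r|weight_measure \<omega>. cmod (f \<zeta> - hyp_mean \<omega> r f z) powr p) /
        measure (weight_measure \<omega>) (hyp_disc z r)) powr (1 / p)"

definition BMO_space :: "(real \<Rightarrow> real) \<Rightarrow> real \<Rightarrow> real \<Rightarrow> (complex \<Rightarrow> complex) set" where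
  "BMO_space \<omega> p r = {f \<in> Lp_space \<omega> p. bdd_above (mean_osc \<omega> p r f ` ball 0 1)}"

text \<open>
  This is only a seminorm, vanishing on constants, so alone it cannot control little Hankel
  operators: for the constant symbol 1 the operator is \<open>\<lambda>g z. g 0\<close>, by the mean value property
  of the analytic function \<open>\<lambda>\<zeta>. g \<zeta> * bergman_kernel \<omega> z \<zeta>\<close>. The usual norm that fixes the
  additive constant is \<open>BMO_seminorm \<omega> p r f + cmod (hyp_mean \<omega> r f 0)\<close>.
\<close>

definition BMO_seminorm ::
  "(real \<Rightarrow> real) \<Rightarrow> real \<Rightarrow> real \<Rightarrow> (complex \<Rightarrow> complex) \<Rightarrow> real" where
  "BMO_seminorm \<omega> p r f = (SUP z\<in>ball 0 1. mean_osc \<omega> p r f z)"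

text \<open>
  From the radius \<open>r\<^sub>0\<close> on, the hyperbolic discs have positive weight and the space does not
  depend on the radius, so that \<open>BMO_space \<omega> p r\<close> for any \<open>r \<ge> r\<^sub>0\<close> is the common space.
\<close>

definition BMO_stable_radius :: "(real \<Rightarrow> real) \<Rightarrow> real \<Rightarrow> bool" where
  "BMO_stable_radius \<omega> r\<^sub>0 \<longleftrightarrow> 0 < r\<^sub>0 \<and>
     (\<forall>r\<ge>r\<^sub>0. \<forall>z\<in>ball 0 1. 0 < measure (weight_measure \<omega>) (hyp_disc z r)) \<and>
     (\<forall>p>1. \<forall>r\<ge>r\<^sub>0. BMO_space \<omega> p r = BMO_space \<omega> p r\<^sub>0)"

end

theory Submission
  imports Defs "HOL-Real_Asymp.Real_Asymp"
begin

text \<open>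
  Only the local averages of the symbol \<open>f\<close> enter. If \<open>b z\<close> is the mean of \<open>f\<close> over the hyperbolic
  disc at \<open>z\<close>, then \<open>b\<close> changes by a bounded amount between points at bounded hyperbolic distance,
  so for every \<open>\<delta> > 0\<close> the difference \<open>\<bar>b z - b w\<bar>\<close> is at most a multiple of the oscillation times
  \<open>(cosh \<beta>(z, w))\<close> to the power \<open>2 \<delta>\<close>. The reproducing property at the origin allows \<open>f\<close> to be
  replaced by \<open>f - b z\<close> in \<open>h g z\<close>, up to the harmless term \<open>b z * g 0\<close>. In the remaining integral
  the modulus of the analytic function \<open>\<zeta> \<mapsto> g \<zeta> * B z \<zeta>\<close> is subharmonic, so \<open>\<bar>f - b z\<bar>\<close> may be
  averaged over hyperbolic discs. Together with the estimate
  \<open>\<bar>B z w\<bar> \<le> C / (\<bar>1 - cnj z * w\<bar> * \<tau> \<bar>1 - cnj z * w\<bar>)\<close> of the kernel by the tail \<open>\<tau>\<close> of the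
  weight this bounds \<open>\<bar>h g\<bar>\<close> by a positive integral operator applied to \<open>\<bar>g\<bar>\<close>, to which the Schur
  test applies once \<open>\<delta>\<close> is small.
\<close>

section \<open>Circular averages on the disc\<close>

text \<open>The obstacle is that \<open>\<omega>\<close> may vanish on whole hyperbolic discs of
  moderate radius, so only its tails are regular. Averaging over hyperbolic discs therefore replaces
  \<open>\<omega>\<close> by the density \<open>\<tau> (1 - cmod w) / (1 - cmod w)\<close>, and the
  norm of \<open>g\<close> for this density has to be brought back to the norm for
  \<open>\<omega>\<close>. Analyticity is used here a second time: the circular means of
  \<open>g\<close> increase with the radius and may be moved outward to a place where
  \<open>\<omega>\<close> has mass. The exponent \<open>\<delta>\<close> is paid for by the moment
  condition, which forces the tail to decay like a power \<open>\<alpha>\<close>; hence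
  \<open>1 - cmod w\<close> to the power \<open>- \<gamma>\<close> is integrable over boxes for all
  \<open>\<gamma> < \<alpha>\<close>. The upper doubling condition controls the moments and all
  their differences, from which summation by parts gives the kernel bound. The term
  \<open>b z * g 0\<close> is harmless because \<open>b z\<close> grows at most like
  \<open>1 - cmod z\<close> to the power \<open>- \<delta>\<close>, starting from its value at the
  origin; this value is why the mean of \<open>f\<close> at \<open>0\<close> enters the final
  estimate.\<close>

lemma ball_in_borel [measurable]: "ball x e \<in> sets borel"
  by simp

section \<open>Translation and rotation invariance of area; polar coordinates\<close>

lemma nn_integral_lborel_shift:
  fixes F :: "'a::euclidean_space \<Rightarrow> ennreal"
  assumes [measurable]: "F \<in> borel_measurable borel"
  shows "(\<integral>\<^sup>+z. F (z + a) \<partial>lborel) = (\<integral>\<^sup>+z. F z \<partial>lborel)"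
proof -
  have "(\<integral>\<^sup>+z. F z \<partial>lborel) = (\<integral>\<^sup>+z. F z \<partial>distr lborel borel ((+) a))"
    by (simp add: lborel_distr_plus)
  then show ?thesis
    by (simp add: nn_integral_distr add.commute)
qed

text \<open>Uniqueness argument for an invariant measure: the double integral of
  \<open>h y * F (c * z + y)\<close> over \<open>y\<close> and \<open>z\<close> is evaluated in two
  ways by Fubini and translations. The unit disc behind \<open>h\<close> is mapped to itself by the
  rotation, so both evaluations carry the same factor \<open>pi\<close>, which cancels.\<close>

lemma nn_integral_lborel_rotate:
  fixes F :: "complex \<Rightarrow> ennreal" and c :: complex
  assumes [measurable]: "F \<in> borel_measurable borel" and c: "cmod c = 1"
  shows "(\<integral>\<^sup>+z. F (c * z) \<partial>lborel) = (\<integral>\<^sup>+z. F z \<partial>lborel)"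
proof -
  define h :: "complex \<Rightarrow> ennreal" where "h = indicator (ball 0 1)"
  have [measurable]: "h \<in> borel_measurable borel"
    unfolding h_def by measurable
  have c0: "c \<noteq> 0" using c by auto
  have h_shift: "(\<integral>\<^sup>+z. h (y - c * z) \<partial>lborel) = ennreal pi" for y
  proof -
    have "h (y - c * z) = indicator (ball (y / c) 1) z" for z
    proof -
      have "y - c * z = c * (y / c - z)"
        using c0 by (simp add: field_simps)
      then have "cmod (y - c * z) = dist (y / c) z"
        by (simp add: norm_mult c dist_norm)
      then show ?thesis
        by (simp add: h_def indicator_def)
    qed
    then show ?thesis
      by (simp add: emeasure_ball unit_ball_vol_2)
  qed
  have h_int: "(\<integral>\<^sup>+y. h y \<partial>lborel) = ennreal pi"
    unfolding h_def by (simp add: emeasure_ball unit_ball_vol_2)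
  have "ennreal pi * (\<integral>\<^sup>+z. F (c * z) \<partial>lborel) = (\<integral>\<^sup>+y. h y * (\<integral>\<^sup>+z. F (c * z) \<partial>lborel) \<partial>lborel)"
    by (simp add: nn_integral_multc h_int)
  also have "\<dots> = (\<integral>\<^sup>+y. h y * (\<integral>\<^sup>+z. F (c * z + y) \<partial>lborel) \<partial>lborel)"
  proof (rule nn_integral_cong)
    fix y
    have "(\<integral>\<^sup>+z. F (c * (z + y / c)) \<partial>lborel) = (\<integral>\<^sup>+z. F (c * z) \<partial>lborel)"
      by (rule nn_integral_lborel_shift) measurable
    then show "h y * (\<integral>\<^sup>+z. F (c * z) \<partial>lborel) = h y * (\<integral>\<^sup>+z. F (c * z + y) \<partial>lborel)"
      using c0 by (simp add: algebra_simps)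
  qed
  also have "\<dots> = (\<integral>\<^sup>+y. (\<integral>\<^sup>+z. h y * F (c * z + y) \<partial>lborel) \<partial>lborel)"
    by (simp add: nn_integral_cmult)
  also have "\<dots> = (\<integral>\<^sup>+z. (\<integral>\<^sup>+y. h y * F (c * z + y) \<partial>lborel) \<partial>lborel)"
    by (rule lborel_pair.Fubini') measurable
  also have "\<dots> = (\<integral>\<^sup>+z. (\<integral>\<^sup>+y. h (y - c * z) * F y \<partial>lborel) \<partial>lborel)"
  proof (rule nn_integral_cong)
    fix z
    have "(\<integral>\<^sup>+y. h (y + c * z - c * z) * F (y + c * z) \<partial>lborel) = (\<integral>\<^sup>+y. h (y - c * z) * F y \<partial>lborel)"
      by (rule nn_integral_lborel_shift) measurable
    then show "(\<integral>\<^sup>+y. h y * F (c * z + y) \<partial>lborel) = (\<integral>\<^sup>+y. h (y - c * z) * F y \<partial>lborel)"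
      by (simp add: add.commute)
  qed
  also have "\<dots> = (\<integral>\<^sup>+y. (\<integral>\<^sup>+z. h (y - c * z) * F y \<partial>lborel) \<partial>lborel)"
    by (rule lborel_pair.Fubini') measurable
  also have "\<dots> = ennreal pi * (\<integral>\<^sup>+y. F y \<partial>lborel)"
    by (simp add: nn_integral_multc h_shift nn_integral_cmult)
  finally show ?thesis
    by (simp add: ennreal_mult_cancel_left)
qed

lemma borel_measurable_cis [measurable]: "cis \<in> borel_measurable borel"
  by (intro borel_measurable_continuous_onI continuous_intros)

text \<open>One turn is parametrised by the unit interval, so integration over \<open>{0..1}\<close>
  is the normalised average over a circle.\<close>

abbreviation circ :: "real \<Rightarrow> complex" where
  "circ t \<equiv> cis (2 * pi * t)"

text \<open>Rotation invariance is averaged over all angles and the integrals are exchanged. This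
  serves as the angular half of polar coordinates.\<close>

lemma nn_integral_lborel_circle:
  fixes F :: "complex \<Rightarrow> ennreal"
  assumes [measurable]: "F \<in> borel_measurable borel"
  shows "(\<integral>\<^sup>+z. F z \<partial>lborel)
       = (\<integral>\<^sup>+z. (\<integral>\<^sup>+t. F (circ t * z) * indicator {0..1} t \<partial>lborel) \<partial>lborel)"
proof -
  have "(\<integral>\<^sup>+z. F z \<partial>lborel) = (\<integral>\<^sup>+t. (\<integral>\<^sup>+z. F z \<partial>lborel) * indicator {0..1::real} t \<partial>lborel)"
    by (simp add: nn_integral_cmult)
  also have "\<dots> = (\<integral>\<^sup>+t. (\<integral>\<^sup>+z. F (circ t * z) * indicator {0..1} t \<partial>lborel) \<partial>lborel)"
    by (intro nn_integral_cong) (simp add: nn_integral_multc nn_integral_lborel_rotate)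
  also have "\<dots> = (\<integral>\<^sup>+z. (\<integral>\<^sup>+t. F (circ t * z) * indicator {0..1} t \<partial>lborel) \<partial>lborel)"
    by (rule lborel_pair.Fubini') measurable
  finally show ?thesis .
qed

text \<open>Both measures are finite and are compared on half-lines \<open>{x<..}\<close>, where for
  \<open>0 \<le> x \<le> 1\<close> they give the area \<open>pi * (1 - x\<^sup>2)\<close> of an
  annulus.\<close>

lemma distr_cmod_lborel_ball:
  "distr (density lborel (indicator (ball 0 1) :: complex \<Rightarrow> ennreal)) borel cmod
   = density lborel (\<lambda>r. ennreal (2 * pi * r) * indicator {0..1} r)" (is "?M = ?N")
proof (rule measure_eqI_lessThan)
  have M: "emeasure ?M {x<..} = ennreal (pi * (1 - (max 0 (min 1 x))\<^sup>2))" if "x \<ge> 0" for x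
  proof -
    let ?y = "min 1 x"
    have "emeasure ?M {x<..} = emeasure (density lborel (indicator (ball 0 1) :: complex \<Rightarrow> ennreal)) {z. x < cmod z}"
      by (subst emeasure_distr) (auto simp: vimage_def)
    also have "\<dots> = (\<integral>\<^sup>+z. indicator (ball (0::complex) 1) z * indicator {z. x < cmod z} z \<partial>lborel)"
      by (rule emeasure_density) measurable
    also have "\<dots> = emeasure lborel (ball (0::complex) 1 \<inter> {z. x < cmod z})"
      unfolding indicator_inter_arith[symmetric] by (rule nn_integral_indicator) measurable
    also have "ball (0::complex) 1 \<inter> {z. x < cmod z} = ball 0 1 - ball 0 1 \<inter> cball 0 ?y"
      by auto
    also have "emeasure lborel \<dots> = emeasure lborel (ball (0::complex) 1) - emeasure lborel (ball (0::complex) 1 \<inter> cball 0 ?y)"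
    proof (rule emeasure_Diff)
      have "emeasure lborel (ball (0::complex) 1 \<inter> cball 0 ?y) \<le> emeasure lborel (cball (0::complex) ?y)"
        by (intro emeasure_mono) auto
      also have "\<dots> < \<infinity>"
        using that by (simp add: emeasure_cball)
      finally show "emeasure lborel (ball (0::complex) 1 \<inter> cball 0 ?y) \<noteq> \<infinity>" by simp
    qed auto
    also have "emeasure lborel (ball (0::complex) 1 \<inter> cball 0 ?y) = ennreal (pi * ?y\<^sup>2)"
    proof (cases "x < 1")
      case True
      then have "ball (0::complex) 1 \<inter> cball 0 ?y = cball 0 x" by auto
      then show ?thesis using True that by (simp add: emeasure_cball unit_ball_vol_2)
    next
      case False
      then have "ball (0::complex) 1 \<inter> cball 0 ?y = ball 0 1" by auto
      then show ?thesis using False by (simp add: emeasure_ball unit_ball_vol_2)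
    qed
    also have "emeasure lborel (ball (0::complex) 1) = ennreal pi"
      by (simp add: emeasure_ball unit_ball_vol_2)
    also have "ennreal pi - ennreal (pi * ?y\<^sup>2) = ennreal (pi - pi * ?y\<^sup>2)"
      by (rule ennreal_minus) auto
    finally show ?thesis using that by (simp add: algebra_simps)
  qed
  have N: "emeasure ?N {x<..} = ennreal (pi * (1 - (max 0 (min 1 x))\<^sup>2))" for x
  proof -
    let ?y = "max 0 (min 1 x)"
    have "emeasure ?N {x<..} = (\<integral>\<^sup>+r. (ennreal (2 * pi * r) * indicator {0..1} r) * indicator {x<..} r \<partial>lborel)"
      by (subst emeasure_density) auto
    also have "\<dots> = (\<integral>\<^sup>+r. ennreal (2 * pi * r) * indicator {?y..1} r \<partial>lborel)"
    proof (rule nn_integral_cong_AE)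
      have "AE r in lborel. r \<noteq> x \<and> r \<noteq> ?y \<and> r \<noteq> 1"
        by (intro AE_conjI AE_lborel_singleton)
      then show "AE r in lborel. (ennreal (2 * pi * r) * indicator {0..1} r) * indicator {x<..} r
          = ennreal (2 * pi * r) * indicator {?y..1} r"
        by eventually_elim (auto simp: indicator_def)
    qed
    also have "\<dots> = ennreal (pi * 1\<^sup>2 - pi * ?y\<^sup>2)"
      by (rule nn_integral_FTC_Icc) (auto intro!: derivative_eq_intros)
    finally show ?thesis by (simp add: algebra_simps)
  qed
  have neg: "emeasure ?M {x<..} = emeasure ?N {x<..}" if "x < 0" for x
  proof -
    have "emeasure ?M {x<..} = emeasure (density lborel (indicator (ball 0 1) :: complex \<Rightarrow> ennreal)) (cmod -` {x<..})"
      by (subst emeasure_distr) auto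
    also have "cmod -` {x<..} = UNIV"
      using that by (auto simp: less_le_trans[OF _ norm_ge_zero])
    also have "emeasure (density lborel (indicator (ball 0 1) :: complex \<Rightarrow> ennreal)) UNIV = ennreal pi"
      by (subst emeasure_density) (auto simp: emeasure_ball unit_ball_vol_2)
    finally show ?thesis using N[of x] that by simp
  qed
  show "emeasure ?M {x<..} = emeasure ?N {x<..}" for x
    using M[of x] N[of x] neg[of x] by (cases "x < 0") auto
  then show "emeasure ?M {x<..} < \<infinity>" for x
    using N by simp
qed auto

lemma nn_integral_lborel_radial:
  fixes h :: "real \<Rightarrow> ennreal"
  assumes [measurable]: "h \<in> borel_measurable borel"
  shows "(\<integral>\<^sup>+z. h (cmod z) * indicator (ball 0 1) z \<partial>lborel)
       = (\<integral>\<^sup>+r. h r * ennreal (2 * pi * r) * indicator {0..<1} r \<partial>lborel)"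
proof -
  have "(\<integral>\<^sup>+z. h (cmod z) * indicator (ball 0 1) z \<partial>lborel)
      = (\<integral>\<^sup>+r. h r \<partial>distr (density lborel (indicator (ball 0 1) :: complex \<Rightarrow> ennreal)) borel cmod)"
  proof (subst nn_integral_distr)
    show "cmod \<in> density lborel (indicator (ball 0 1)) \<rightarrow>\<^sub>M borel"
      by simp
    show "(\<integral>\<^sup>+z. h (cmod z) * indicator (ball 0 1) z \<partial>lborel) =
        (\<integral>\<^sup>+z. h (cmod z) \<partial>density lborel (indicator (ball 0 1)))"
      by (subst nn_integral_density) (measurable, simp add: mult.commute)
  qed simp
  also have "\<dots> = (\<integral>\<^sup>+r. (ennreal (2 * pi * r) * indicator {0..1} r) * h r \<partial>lborel)"
    unfolding distr_cmod_lborel_ball by (subst nn_integral_density) auto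
  also have "\<dots> = (\<integral>\<^sup>+r. h r * ennreal (2 * pi * r) * indicator {0..<1} r \<partial>lborel)"
  proof (rule nn_integral_cong_AE)
    have "AE r in lborel. r \<noteq> (1::real)"
      by (rule AE_lborel_singleton)
    then show "AE r in lborel. (ennreal (2 * pi * r) * indicator {0..1} r) * h r
        = h r * ennreal (2 * pi * r) * indicator {0..<1} r"
      by eventually_elim (auto simp: indicator_def mult_ac)
  qed
  finally show ?thesis .
qed

text \<open>The window \<open>{b..b+1}\<close> with \<open>0 \<le> b \<le> 1\<close> is cut at
  \<open>1\<close> and its right piece moved back by one period; integer periods reduce a general
  shift to its fractional part.\<close>

lemma nn_integral_periodic:
  fixes f :: "real \<Rightarrow> ennreal"
  assumes [measurable]: "f \<in> borel_measurable borel" and per: "\<And>t. f (t + 1) = f t"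
  shows "(\<integral>\<^sup>+t. f (t + a) * indicator {0..1} t \<partial>lborel) = (\<integral>\<^sup>+t. f t * indicator {0..1} t \<partial>lborel)"
proof -
  have unit: "(\<integral>\<^sup>+t. f (t + b) * indicator {0..1} t \<partial>lborel) = (\<integral>\<^sup>+t. f t * indicator {0..1} t \<partial>lborel)"
    if b: "0 \<le> b" "b \<le> 1" for b
  proof -
    have "(\<integral>\<^sup>+t. f (t + b) * indicator {0..1} t \<partial>lborel)
        = (\<integral>\<^sup>+t. f (t + b) * indicator {b..b+1} (t + b) \<partial>lborel)"
      by (intro nn_integral_cong) (auto simp: indicator_def)
    also have "\<dots> = (\<integral>\<^sup>+t. f t * indicator {b..b+1} t \<partial>lborel)"
      by (rule nn_integral_lborel_shift) measurable
    also have "\<dots> = (\<integral>\<^sup>+t. f t * indicator {b..1} t + f t * indicator {1..b+1} t \<partial>lborel)"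
    proof (rule nn_integral_cong_AE)
      have "AE r in lborel. r \<noteq> (1::real)"
        by (rule AE_lborel_singleton)
      then show "AE t in lborel. f t * indicator {b..b+1} t
          = f t * indicator {b..1} t + f t * indicator {1..b+1} t"
        by eventually_elim (use b in \<open>auto simp: indicator_def\<close>)
    qed
    also have "\<dots> = (\<integral>\<^sup>+t. f t * indicator {b..1} t \<partial>lborel) + (\<integral>\<^sup>+t. f t * indicator {1..b+1} t \<partial>lborel)"
      by (rule nn_integral_add) auto
    also have "(\<integral>\<^sup>+t. f t * indicator {1..b+1} t \<partial>lborel) = (\<integral>\<^sup>+t. f (t + 1) * indicator {1..b+1} (t + 1) \<partial>lborel)"
      by (rule nn_integral_lborel_shift[symmetric]) measurable
    also have "\<dots> = (\<integral>\<^sup>+t. f t * indicator {0..b} t \<partial>lborel)"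
      unfolding per by (intro nn_integral_cong) (auto simp: indicator_def)
    also have "(\<integral>\<^sup>+t. f t * indicator {b..1} t \<partial>lborel) + \<dots>
        = (\<integral>\<^sup>+t. f t * indicator {b..1} t + f t * indicator {0..b} t \<partial>lborel)"
      by (rule nn_integral_add[symmetric]) auto
    also have "\<dots> = (\<integral>\<^sup>+t. f t * indicator {0..1} t \<partial>lborel)"
    proof (rule nn_integral_cong_AE)
      have "AE r in lborel. r \<noteq> b"
        by (rule AE_lborel_singleton)
      then show "AE t in lborel. f t * indicator {b..1} t + f t * indicator {0..b} t
          = f t * indicator {0..1} t"
        by eventually_elim (use b in \<open>auto simp: indicator_def\<close>)
    qed
    finally show ?thesis .
  qed
  have per_nat: "f (t + real n) = f t" for t n
  proof (induction n)
    case (Suc n)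
    have "f (t + real (Suc n)) = f ((t + real n) + 1)" by (simp add: algebra_simps)
    then show ?case using per Suc by simp
  qed simp
  have per_int: "f (t + of_int k) = f t" for t k
  proof (cases "k \<ge> 0")
    case True
    then show ?thesis using per_nat[of t "nat k"] by simp
  next
    case False
    then show ?thesis using per_nat[of "t + of_int k" "nat (- k)"] by simp
  qed
  have "f (t + a) = f (t + frac a)" for t
    using per_int[of "t + frac a" "\<lfloor>a\<rfloor>"] by (simp add: frac_def)
  then show ?thesis
    using unit[of "frac a"] frac_lt_1[of a] by (simp add: less_imp_le)
qed

text \<open>Points of equal modulus differ by a rotation \<open>circ a\<close>, which becomes a
  shift of the parameter in a function of period one.\<close>

lemma nn_integral_circ_rotate:
  fixes F :: "complex \<Rightarrow> ennreal"
  assumes [measurable]: "F \<in> borel_measurable borel" and vw: "cmod v = cmod w"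
  shows "(\<integral>\<^sup>+t. F (circ t * v) * indicator {0..1} t \<partial>lborel) = (\<integral>\<^sup>+t. F (circ t * w) * indicator {0..1} t \<partial>lborel)"
proof -
  obtain a where a: "v = circ a * w"
  proof (cases "w = 0")
    case True
    then show ?thesis using vw that[of 0] by simp
  next
    case False
    then have "cmod (v / w) = 1" using vw by (simp add: norm_divide)
    then obtain \<theta> where "v / w = cis \<theta>"
      by (metis cis_Arg is_Arg_def norm_zero zero_neq_one sgn_eq div_by_1 of_real_1)
    then show ?thesis using that[of "\<theta> / (2 * pi)"] False by (simp add: field_simps)
  qed
  have "(\<integral>\<^sup>+t. F (circ (t + a) * w) * indicator {0..1} t \<partial>lborel) = (\<integral>\<^sup>+t. F (circ t * w) * indicator {0..1} t \<partial>lborel)"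
  proof (rule nn_integral_periodic)
    show "F (circ (t + 1) * w) = F (circ t * w)" for t
      by (simp add: distrib_left flip: cis_mult)
  qed measurable
  moreover have "circ (t + a) * w = circ t * v" for t
    by (simp add: a distrib_left mult.assoc flip: cis_mult)
  ultimately show ?thesis by simp
qed

section \<open>Mean values of analytic functions over circles and discs\<close>

lemma circle_mean_value:
  fixes G :: "complex \<Rightarrow> complex"
  assumes hol: "G holomorphic_on ball \<zeta> R" and v: "cmod v < R"
  shows "((\<lambda>t. G (\<zeta> + circ t * v)) has_integral G \<zeta>) {0..1}"
proof (cases "v = 0")
  case True
  then show ?thesis using has_integral_const_real[of "G \<zeta>" 0 1] by simp
next
  case False
  define r where "r = cmod v"
  have r: "0 < r" "r < R" using False v by (auto simp: r_def)
  \<comment> \<open>\<open>G\<close> recentred at the origin and turned so that \<open>v\<close>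
    corresponds to the point \<open>r\<close> of the positive axis; Cauchy's formula for
    \<open>H\<close> at \<open>0\<close> is then the required average.\<close>
  define H where "H = (\<lambda>z. G (\<zeta> + (v / of_real r) * z))"
  have vr: "cmod (v / of_real r) = 1" using r by (simp add: norm_divide r_def)
  have "H holomorphic_on cball 0 r"
    unfolding H_def
  proof (rule holomorphic_on_compose_gen[unfolded o_def, OF _ hol])
    show "(\<lambda>z. \<zeta> + (v / of_real r) * z) ` cball 0 r \<subseteq> ball \<zeta> R"
    proof clarsimp
      fix z assume "cmod z \<le> r"
      have "dist \<zeta> (\<zeta> + v * z / complex_of_real r) = cmod ((v / of_real r) * z)"
        by (simp add: dist_norm)
      also have "\<dots> = cmod z"
        using vr by (simp only: norm_mult mult_1_left)
      finally show "dist \<zeta> (\<zeta> + v * z / complex_of_real r) < R"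
        using \<open>cmod z \<le> r\<close> r by simp
    qed
  qed (intro holomorphic_intros)
  then have "((\<lambda>u. H u / (u - 0)) has_contour_integral (2 * of_real pi * \<i> * H 0)) (circlepath 0 r)"
    by (rule Cauchy_integral_circlepath_simple) (use r in auto)
  then have "((\<lambda>x. H (circlepath 0 r x) / (circlepath 0 r x - 0) *
      vector_derivative (circlepath 0 r) (at x)) has_integral (2 * of_real pi * \<i> * H 0)) {0..1}"
    by (simp add: has_contour_integral)
  moreover have "H (circlepath 0 r x) / (circlepath 0 r x - 0) * vector_derivative (circlepath 0 r) (at x)
      = (2 * of_real pi * \<i>) * G (\<zeta> + circ x * v)" for x
  proof -
    have e: "exp (2 * of_real pi * \<i> * of_real x) = circ x"
      by (simp add: cis_conv_exp mult_ac)
    have vd: "vector_derivative (circlepath 0 r) (at x) = 2 * of_real pi * \<i> * of_real r * circ x"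
      using e by (simp add: vector_derivative_circlepath)
    have cp: "circlepath 0 r x = of_real r * circ x"
      using e by (simp add: circlepath)
    have Hc: "H (circlepath 0 r x) = G (\<zeta> + circ x * v)"
      using r by (simp add: H_def cp mult.commute)
    then show ?thesis
      using r Hc by (simp add: vd cp)
  qed
  ultimately have "((\<lambda>x. (2 * of_real pi * \<i>) * G (\<zeta> + circ x * v)) has_integral (2 * of_real pi * \<i> * G \<zeta>)) {0..1}"
    by (simp add: H_def)
  from has_integral_mult_right[OF this, of "inverse (2 * of_real pi * \<i>)"]
  have "((\<lambda>x. (inverse (2 * of_real pi * \<i>) * (2 * of_real pi * \<i>)) * G (\<zeta> + circ x * v)) has_integral
      (inverse (2 * of_real pi * \<i>) * (2 * of_real pi * \<i>)) * G \<zeta>) {0..1}"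
    by (simp only: mult.assoc)
  moreover have "inverse (2 * of_real pi * \<i>) * (2 * of_real pi * \<i>) = (1::complex)"
    by (rule left_inverse) simp
  ultimately show ?thesis by (simp only: mult_1_left)
qed

lemma holomorphic_ball_indicator_measurable [measurable (raw)]:
  fixes g :: "complex \<Rightarrow> complex"
  assumes "g holomorphic_on ball \<zeta> R"
  shows "(\<lambda>z. indicator (ball \<zeta> R) z *\<^sub>R g z) \<in> borel_measurable borel"
  by (intro borel_measurable_continuous_on_indicator holomorphic_on_imp_continuous_on assms) auto

lemma circle_mean_norm:
  fixes G :: "complex \<Rightarrow> complex"
  assumes hol: "G holomorphic_on ball \<zeta> R" and v: "cmod v < R"
  shows "ennreal (cmod (G \<zeta>)) \<le> (\<integral>\<^sup>+t. ennreal (cmod (G (\<zeta> + circ t * v))) * indicator {0..1} t \<partial>lborel)"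
proof -
  have mv: "((\<lambda>t. G (\<zeta> + circ t * v)) has_integral G \<zeta>) {0..1}"
    by (rule circle_mean_value[OF assms])
  have cont: "continuous_on {0..1} (\<lambda>t. G (\<zeta> + circ t * v))"
  proof (rule continuous_on_compose2[OF holomorphic_on_imp_continuous_on[OF hol]])
    show "(\<lambda>t. \<zeta> + circ t * v) ` {0..1} \<subseteq> ball \<zeta> R"
      using v by (auto simp: dist_norm norm_mult)
  qed (intro continuous_intros)
  then have intg: "(\<lambda>t. cmod (G (\<zeta> + circ t * v))) integrable_on {0..1}"
    by (intro integrable_continuous_interval continuous_intros)
  have "cmod (G \<zeta>) \<le> integral {0..1} (\<lambda>t. cmod (G (\<zeta> + circ t * v)))"
    using mv cont intg integral_norm_bound_integral[of "\<lambda>t. G (\<zeta> + circ t * v)" "{0..1}" "\<lambda>t. cmod (G (\<zeta> + circ t * v))"]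
    by (auto simp: has_integral_iff)
  also have "ennreal \<dots> = (\<integral>\<^sup>+t. ennreal (cmod (G (\<zeta> + circ t * v))) * indicator {0..1} t \<partial>lborel)"
    by (rule nn_integral_has_integral_lebesgue'[symmetric]) (use intg in \<open>auto intro: integrable_integral\<close>)
  finally show ?thesis by (simp add: ennreal_leI)
qed

text \<open>The circular inequality is integrated over all \<open>v\<close> in the disc of radius
  \<open>R\<close>; undoing the average over \<open>t\<close> restores the area integral.\<close>

lemma area_submean:
  fixes G :: "complex \<Rightarrow> complex"
  assumes hol: "G holomorphic_on ball \<zeta> R" and R: "0 < R"
  shows "ennreal (pi * R\<^sup>2 * cmod (G \<zeta>)) \<le> (\<integral>\<^sup>+z. ennreal (cmod (G z)) * indicator (ball \<zeta> R) z \<partial>lborel)"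
proof -
  \<comment> \<open>The indicator makes the integrand Borel on the whole plane, although nothing is
    known about \<open>G\<close> outside the disc.\<close>
  define F :: "complex \<Rightarrow> ennreal" where "F = (\<lambda>z. ennreal (cmod (indicator (ball \<zeta> R) z *\<^sub>R G z)))"
  have [measurable]: "F \<in> borel_measurable borel"
    unfolding F_def using holomorphic_ball_indicator_measurable[OF hol] by measurable
  have F: "F z = ennreal (cmod (G z)) * indicator (ball \<zeta> R) z" for z
    by (auto simp: F_def indicator_def)
  have "ennreal (pi * R\<^sup>2 * cmod (G \<zeta>)) = (\<integral>\<^sup>+v. ennreal (cmod (G \<zeta>)) * indicator (ball (0::complex) R) v \<partial>lborel)"
    using R by (subst nn_integral_cmult) (auto simp: emeasure_ball unit_ball_vol_2 ennreal_mult'[symmetric] mult_ac)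
  also have "\<dots> \<le> (\<integral>\<^sup>+v. (\<integral>\<^sup>+t. F (circ t * v + \<zeta>) * indicator {0..1} t \<partial>lborel) \<partial>lborel)"
  proof (rule nn_integral_mono)
    fix v :: complex
    show "ennreal (cmod (G \<zeta>)) * indicator (ball (0::complex) R) v \<le> (\<integral>\<^sup>+t. F (circ t * v + \<zeta>) * indicator {0..1} t \<partial>lborel)"
    proof (cases "cmod v < R")
      case True
      have "ennreal (cmod (G \<zeta>)) \<le> (\<integral>\<^sup>+t. ennreal (cmod (G (\<zeta> + circ t * v))) * indicator {0..1} t \<partial>lborel)"
        by (rule circle_mean_norm[OF hol True])
      also have "\<dots> = (\<integral>\<^sup>+t. F (circ t * v + \<zeta>) * indicator {0..1} t \<partial>lborel)"
        using True by (intro nn_integral_cong) (simp add: F indicator_def dist_norm norm_mult add.commute)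
      finally show ?thesis using True by simp
    qed simp
  qed
  also have "\<dots> = (\<integral>\<^sup>+v. F (v + \<zeta>) \<partial>lborel)"
    by (rule nn_integral_lborel_circle[symmetric]) measurable
  also have "\<dots> = (\<integral>\<^sup>+z. F z \<partial>lborel)"
    by (rule nn_integral_lborel_shift) measurable
  finally show ?thesis by (simp add: F)
qed

lemma nn_integral_unit_interval:
  fixes f :: "real \<Rightarrow> real"
  assumes "continuous_on {0..1} f" "\<And>t. t \<in> {0..1} \<Longrightarrow> 0 \<le> f t"
  shows "(\<integral>\<^sup>+t. ennreal (f t) * indicator {0..1} t \<partial>lborel) = ennreal (integral {0..1} f)"
  by (rule nn_integral_has_integral_lebesgue')
     (use assms in \<open>auto intro!: integrable_integral integrable_continuous_interval\<close>)

text \<open>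
  Testing \<open>g\<close> against the function \<open>c\<close> dual to its restriction to the inner circle gives an
  analytic function to which the maximum principle applies.
\<close>

lemma circle_mean_powr_mono:
  fixes g :: "complex \<Rightarrow> complex"
  assumes hol: "g holomorphic_on ball 0 1" and s: "1 < s" and vw: "cmod v \<le> cmod w" "cmod w < 1"
  shows "(\<integral>\<^sup>+t. ennreal (cmod (g (circ t * v)) powr s) * indicator {0..1} t \<partial>lborel)
       \<le> (\<integral>\<^sup>+t. ennreal (cmod (g (circ t * w)) powr s) * indicator {0..1} t \<partial>lborel)"
proof (cases "w = 0")
  case True
  then show ?thesis using vw by simp
next
  case False
  have contg: "continuous_on {0..1} (\<lambda>t. g (circ t * z))" if "cmod z < 1" for z
    by (rule continuous_on_compose2[OF holomorphic_on_imp_continuous_on[OF hol]])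
       (use that in \<open>auto intro!: continuous_intros simp: norm_mult\<close>)
  have contP: "continuous_on {0..1} (\<lambda>t. cmod (g (circ t * z)) powr s)" if "cmod z < 1" for z
    using contg[OF that] s by (intro continuous_on_powr' continuous_intros) auto
  define P where "P z = integral {0..1} (\<lambda>t. cmod (g (circ t * z)) powr s)" for z
  have PI: "(\<integral>\<^sup>+t. ennreal (cmod (g (circ t * z)) powr s) * indicator {0..1} t \<partial>lborel) = ennreal (P z)"
    if "cmod z < 1" for z
    unfolding P_def using contP[OF that] by (intro nn_integral_unit_interval) auto
  have P_pos: "0 \<le> P z" if "cmod z < 1" for z
    unfolding P_def using contP[OF that] by (intro integral_nonneg integrable_continuous_interval) auto
  have P_rot: "P z = P w" if z: "cmod z = cmod w" for z
  proof -
    define F :: "complex \<Rightarrow> ennreal" where "F = (\<lambda>z. ennreal (cmod (indicator (ball 0 1) z *\<^sub>R g z) powr s))"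
    have [measurable]: "F \<in> borel_measurable borel"
      unfolding F_def using holomorphic_ball_indicator_measurable[OF hol] by measurable
    have F: "F (circ t * z) = ennreal (cmod (g (circ t * z)) powr s)" if "cmod z < 1" for t z
      using that by (simp add: F_def norm_mult)
    have "ennreal (P z) = ennreal (P w)"
      using nn_integral_circ_rotate[of F z w] z vw by (simp add: F PI)
    then show ?thesis
      using P_pos z vw by simp
  qed
  define s' where "s' = s / (s - 1)"
  have s': "s' > 1" "1 / s + 1 / s' = 1" "(s - 1) * s' = s"
    using s by (auto simp: s'_def field_simps)
  \<comment> \<open>The extremal function in Hoelder's inequality:
    \<open>g (circ t * v) * c t\<close> and \<open>cmod (c t) powr s'\<close> are both equal to
    \<open>cmod (g (circ t * v)) powr s\<close>.\<close>
  define c where "c t = cnj (sgn (g (circ t * v))) * of_real (cmod (g (circ t * v)) powr (s - 1))" for t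
  have norm_c: "cmod (c t) = cmod (g (circ t * v)) powr (s - 1)" for t
    by (simp add: c_def norm_mult norm_sgn)
  have c_mult: "g (circ t * v) * c t = of_real (cmod (g (circ t * v)) powr s)" for t
  proof (cases "g (circ t * v) = 0")
    case False
    let ?x = "g (circ t * v)"
    have "?x * cnj (sgn ?x) = of_real (cmod ?x)"
      using False by (simp add: sgn_eq complex_norm_square[symmetric] power2_eq_square)
    then have "?x * c t = of_real (cmod ?x) * of_real (cmod ?x powr (s - 1))"
      by (simp add: c_def mult.assoc[symmetric])
    also have "\<dots> = of_real (cmod ?x powr 1 * cmod ?x powr (s - 1))"
      by simp
    also have "\<dots> = of_real (cmod ?x powr s)"
      by (subst powr_add[symmetric]) simp
    finally show ?thesis .
  qed (simp add: c_def)
  have contc: "continuous_on {0..1} c"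
  proof -
    \<comment> \<open>At the origin \<open>sgn\<close> is discontinuous; the factor
      \<open>cmod x powr (s - 1)\<close> with its positive exponent makes the product tend to
      \<open>0\<close>.\<close>
    have K: "isCont (\<lambda>x::complex. cnj (sgn x) * of_real (cmod x powr (s - 1))) x" for x
    proof (cases "x = 0")
      case True
      have "((\<lambda>x::complex. cmod x powr (s - 1)) \<longlongrightarrow> cmod 0 powr (s - 1)) (at 0)"
        by (intro tendsto_powr' tendsto_intros) (use s in auto)
      then have "((\<lambda>x::complex. cnj (sgn x) * of_real (cmod x powr (s - 1))) \<longlongrightarrow> 0) (at 0)"
      proof (intro Lim_null_comparison[where g = "\<lambda>x::complex. cmod x powr (s - 1)" and f = "\<lambda>x::complex. cnj (sgn x) * of_real (cmod x powr (s - 1))"])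
        show "\<forall>\<^sub>F x::complex in at 0. norm (cnj (sgn x) * of_real (cmod x powr (s - 1))) \<le> cmod x powr (s - 1)"
          by (auto simp: norm_mult norm_sgn)
      qed (use s in simp)
      then show ?thesis using True by (simp add: isCont_def)
    next
      case False
      then show ?thesis by (intro continuous_intros) auto
    qed
    have "continuous_on UNIV (\<lambda>x::complex. cnj (sgn x) * of_real (cmod x powr (s - 1)))"
      using K by (simp add: continuous_on_eq_continuous_within)
    from continuous_on_compose2[OF this contg[of v]] show ?thesis
      using vw by (simp add: c_def[abs_def])
  qed
  \<comment> \<open>Analytic in \<open>z\<close>, since \<open>c\<close> depends on the fixed point
    \<open>v\<close> only. On the circle through \<open>w\<close> Young's inequality bounds it by
    \<open>P w / s + P v / s'\<close>, and at \<open>z = v\<close> it equals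
    \<open>P v\<close>.\<close>
  define \<Phi> where "\<Phi> z = integral (cbox 0 1) (\<lambda>t. g (z * circ t) * c t)" for z
  have cont_int: "continuous_on {0..1} (\<lambda>t. g (z * circ t) * c t)" if "cmod z < 1" for z
    using contg[OF that] contc by (intro continuous_intros) (simp add: mult.commute)
  have hol\<Phi>: "\<Phi> holomorphic_on ball 0 1"
    unfolding \<Phi>_def
  proof (rule leibniz_rule_holomorphic[where fx = "\<lambda>z t. deriv g (z * circ t) * circ t * c t"])
    fix z :: complex and t :: real assume z: "z \<in> ball 0 1" and "t \<in> cbox 0 1"
    then have "z * circ t \<in> ball 0 1" by (simp add: norm_mult)
    then have "(g has_field_derivative deriv g (z * circ t)) (at (z * circ t))"
      using hol holomorphic_derivI open_ball by blast
    then have "((\<lambda>z. g (z * circ t)) has_field_derivative deriv g (z * circ t) * circ t) (at z within ball 0 1)"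
      by (intro DERIV_chain2[where f = g] ) (auto intro!: derivative_eq_intros)
    then show "((\<lambda>z. g (z * circ t) * c t) has_field_derivative deriv g (z * circ t) * circ t * c t) (at z within ball 0 1)"
      by (rule DERIV_cmult_right)
  next
    fix z :: complex assume "z \<in> ball 0 1"
    then show "(\<lambda>t. g (z * circ t) * c t) integrable_on cbox 0 1"
      using cont_int[of z] by (simp add: integrable_continuous_interval)
  next
    have d: "continuous_on (ball 0 1) (deriv g)"
      by (intro holomorphic_on_imp_continuous_on holomorphic_deriv hol) auto
    have 1: "continuous_on (ball 0 1 \<times> cbox 0 1) (\<lambda>x::complex\<times>real. deriv g (fst x * circ (snd x)))"
      by (rule continuous_on_compose2[OF d]) (auto intro!: continuous_intros simp: norm_mult)
    have 2: "continuous_on (ball 0 1 \<times> cbox 0 1) (\<lambda>x::complex\<times>real. c (snd x))"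
      by (rule continuous_on_compose2[OF contc]) (auto intro!: continuous_intros)
    show "continuous_on (ball 0 1 \<times> cbox 0 1) (\<lambda>(z, t). deriv g (z * circ t) * circ t * c t)"
      unfolding case_prod_beta using 1 2 by (intro continuous_intros)
  qed auto
  have bound: "cmod (\<Phi> z) \<le> P w / s + P v / s'" if z: "cmod z = cmod w" for z
  proof -
    have zz: "cmod z < 1" "cmod v < 1" using vw z by auto
    have "cmod (\<Phi> z) \<le> integral (cbox 0 1) (\<lambda>t. cmod (g (circ t * z)) powr s / s + cmod (g (circ t * v)) powr s / s')"
      unfolding \<Phi>_def
    proof (rule integral_norm_bound_integral)
      show "(\<lambda>t. g (z * circ t) * c t) integrable_on cbox 0 1"
        using cont_int zz by (simp add: integrable_continuous_interval)
      show "(\<lambda>t. cmod (g (circ t * z)) powr s / s + cmod (g (circ t * v)) powr s / s') integrable_on cbox 0 1"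
        using zz s s' unfolding box_real(2)
        by (intro integrable_continuous_interval continuous_on_add continuous_on_divide
            continuous_on_const contP) auto
      fix t :: real
      have "cmod (g (z * circ t) * c t) = cmod (g (circ t * z)) * cmod (c t)"
        by (simp add: norm_mult mult.commute)
      also have "\<dots> \<le> cmod (g (circ t * z)) powr s / s + cmod (c t) powr s' / s'"
        using s s' by (intro Youngs_inequality) auto
      finally show "cmod (g (z * circ t) * c t) \<le> cmod (g (circ t * z)) powr s / s + cmod (g (circ t * v)) powr s / s'"
        by (simp add: norm_c powr_powr s')
    qed
    also have "\<dots> = P z / s + P v / s'"
      unfolding P_def box_real(2) using zz s s'
      by (subst integral_add) (auto intro!: integrable_continuous_interval continuous_on_divide
            continuous_on_const contP)
    finally show ?thesis using P_rot[OF z] by simp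
  qed
  have "cmod (\<Phi> v) \<le> P w / s + P v / s'"
  proof (rule maximum_modulus_frontier[where f = \<Phi> and S = "cball 0 (cmod w)"])
    show "\<Phi> holomorphic_on interior (cball 0 (cmod w))"
      using hol\<Phi> vw by (auto elim!: holomorphic_on_subset)
    show "continuous_on (closure (cball 0 (cmod w))) \<Phi>"
      using holomorphic_on_imp_continuous_on[OF hol\<Phi>] vw by (auto elim!: continuous_on_subset)
    show "cmod (\<Phi> z) \<le> P w / s + P v / s'" if "z \<in> frontier (cball 0 (cmod w))" for z
      using that False vw by (intro bound) (auto simp: frontier_cball)
  next
    show "v \<in> cball 0 (cmod w)" using vw by simp
  qed auto
  moreover have "\<Phi> v = of_real (P v)"
  proof -
    have "\<Phi> v = integral {0..1} (\<lambda>t. of_real (cmod (g (circ t * v)) powr s))"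
      unfolding \<Phi>_def box_real(2) by (intro arg_cong[where f = "integral {0..1}"] ext) (simp add: c_mult mult.commute[of v])
    also have "\<dots> = of_real (P v)"
      unfolding P_def using contP[of v] vw
      by (intro integral_unique has_integral_linear[OF _ bounded_linear_of_real, unfolded o_def]
          integrable_integral integrable_continuous_interval) auto
    finally show ?thesis .
  qed
  \<comment> \<open>As \<open>1 - 1 / s' = 1 / s\<close>, the term \<open>P v / s'\<close> can be
    absorbed on the left.\<close>
  ultimately have "P v \<le> P w / s + P v / s'"
    using P_pos[of v] vw by simp
  also have "P v / s' = P v - P v / s"
  proof -
    have "1 / s' = 1 - 1 / s" using s'(2) by linarith
    then have "P v * (1 / s') = P v * (1 - 1 / s)" by (rule arg_cong)
    then show ?thesis by (simp add: right_diff_distrib)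
  qed
  finally have "P v \<le> P w"
    using s by (simp add: field_simps)
  then show ?thesis
    using vw by (simp add: PI ennreal_leI)
qed

section \<open>Radial weights with doubling tails\<close>

text \<open>The values of \<open>\<omega>\<close> outside \<open>[0, 1)\<close> are arbitrary; the
  cut-off is what makes integrals over the whole line meaningful.\<close>

definition wt :: "(real \<Rightarrow> real) \<Rightarrow> real \<Rightarrow> real" where
  "wt \<omega> r = indicator {0..<1} r * \<omega> r"

text \<open>The argument is the distance to the boundary; the function is constant on \<open>[1, \<infinity>)\<close>.\<close>

definition tau :: "(real \<Rightarrow> real) \<Rightarrow> real \<Rightarrow> real" where
  "tau \<omega> t = weight_tail \<omega> (max 0 (1 - t))"

lemma wt_measurable:
  assumes "radial_weight \<omega>"
  shows "wt \<omega> \<in> borel_measurable borel"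
proof -
  have "(\<lambda>r. indicator {0..<1} r *\<^sub>R \<omega> r) \<in> borel_measurable borel"
    using assms by (auto simp: radial_weight_def set_integrable_def)
  then show ?thesis by (simp add: wt_def[abs_def])
qed

lemma wt_nonneg: "radial_weight \<omega> \<Longrightarrow> 0 \<le> wt \<omega> r"
  by (auto simp: wt_def radial_weight_def indicator_def)

lemma wt_integrable: "radial_weight \<omega> \<Longrightarrow> integrable lborel (wt \<omega>)"
  by (auto simp: wt_def[abs_def] radial_weight_def set_integrable_def)

text \<open>For \<open>t > 1\<close> the range \<open>{1 - t..}\<close> sticks out below
  \<open>0\<close>, where \<open>wt\<close> vanishes. This is the form in which the tail enters
  Fubini arguments.\<close>

lemma tau_nn_integral:
  assumes rw: "radial_weight \<omega>" and t: "0 < t"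
  shows "(\<integral>\<^sup>+r. ennreal (wt \<omega> r) * indicator {1 - t..} r \<partial>lborel) = ennreal (tau \<omega> t)"
proof -
  note [measurable] = wt_measurable[OF rw]
  have eq: "indicator {max 0 (1 - t)..<1} r *\<^sub>R \<omega> r = wt \<omega> r * indicator {1 - t..} r" for r
    using t by (auto simp: wt_def indicator_def)
  have "(\<integral>\<^sup>+r. ennreal (wt \<omega> r) * indicator {1 - t..} r \<partial>lborel)
      = (\<integral>\<^sup>+r. ennreal (wt \<omega> r * indicator {1 - t..} r) \<partial>lborel)"
    by (intro nn_integral_cong) (auto simp: indicator_def)
  also have "\<dots> = ennreal (\<integral>r. wt \<omega> r * indicator {1 - t..} r \<partial>lborel)"
    using wt_nonneg[OF rw] integrable_real_mult_indicator[OF _ wt_integrable[OF rw], of "{1 - t..}"]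
    by (intro nn_integral_eq_integral) (auto simp: mult.commute)
  also have "(\<integral>r. wt \<omega> r * indicator {1 - t..} r \<partial>lborel) = tau \<omega> t"
    unfolding tau_def weight_tail_def set_lebesgue_integral_def eq ..
  finally show ?thesis .
qed

lemma tau_pos: "radial_weight \<omega> \<Longrightarrow> 0 < t \<Longrightarrow> 0 < tau \<omega> t"
  by (auto simp: tau_def radial_weight_def)

lemma tau_mono:
  assumes rw: "radial_weight \<omega>" and "0 < s" "s \<le> t"
  shows "tau \<omega> s \<le> tau \<omega> t"
proof -
  have "ennreal (tau \<omega> s) \<le> ennreal (tau \<omega> t)"
    unfolding tau_nn_integral[OF rw \<open>0 < s\<close>, symmetric] tau_nn_integral[OF rw less_le_trans[OF assms(2,3)], symmetric]
    by (intro nn_integral_mono mult_left_mono) (use assms in \<open>auto simp: indicator_def\<close>)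
  then show ?thesis
    using tau_pos[OF rw, of t] assms by (simp add: ennreal_le_iff)
qed

lemma tau_nonpos: "t \<le> 0 \<Longrightarrow> tau \<omega> t = 0"
  by (simp add: tau_def weight_tail_def set_lebesgue_integral_def)

lemma tau_measurable:
  assumes rw: "radial_weight \<omega>"
  shows "tau \<omega> \<in> borel_measurable borel"
proof (rule borel_measurable_mono, rule monoI)
  fix s t :: real assume "s \<le> t"
  then show "tau \<omega> s \<le> tau \<omega> t"
    using tau_mono[OF rw, of s t] tau_pos[OF rw, of t] tau_nonpos[of s \<omega>] tau_nonpos[of t \<omega>]
    by (cases "0 < s"; cases "0 < t") auto
qed

text \<open>Layer-cake formula, by exchanging the integrals over the set
  \<open>1 - r \<le> v\<close>. It reduces estimates against \<open>\<omega>\<close> to estimates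
  against its tail, once a function of \<open>1 - r\<close> is written, or dominated, as the
  integral of some \<open>q\<close> over \<open>{1 - r..}\<close>.\<close>

lemma nn_integral_wt_layer:
  assumes rw: "radial_weight \<omega>" and [measurable]: "q \<in> borel_measurable borel"
  shows "(\<integral>\<^sup>+r. ennreal (wt \<omega> r) * (\<integral>\<^sup>+v. q v * indicator {1 - r..} v \<partial>lborel) \<partial>lborel)
       = (\<integral>\<^sup>+v. q v * ennreal (tau \<omega> v) * indicator {0<..} v \<partial>lborel)"
proof -
  note [measurable] = wt_measurable[OF rw] tau_measurable[OF rw]
  have "(\<integral>\<^sup>+r. ennreal (wt \<omega> r) * (\<integral>\<^sup>+v. q v * indicator {1 - r..} v \<partial>lborel) \<partial>lborel)
      = (\<integral>\<^sup>+r. (\<integral>\<^sup>+v. ennreal (wt \<omega> r) * (q v * indicator {0..} (v - (1 - r))) \<partial>lborel) \<partial>lborel)"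
  proof (rule nn_integral_cong)
    fix r
    have "(\<lambda>v. q v * indicator {1 - r..} v) = (\<lambda>v. q v * indicator {0..} (v - (1 - r)))"
      by (auto simp: indicator_def)
    then show "ennreal (wt \<omega> r) * (\<integral>\<^sup>+v. q v * indicator {1 - r..} v \<partial>lborel)
        = (\<integral>\<^sup>+v. ennreal (wt \<omega> r) * (q v * indicator {0..} (v - (1 - r))) \<partial>lborel)"
      by (simp add: nn_integral_cmult)
  qed
  also have "\<dots> = (\<integral>\<^sup>+v. (\<integral>\<^sup>+r. ennreal (wt \<omega> r) * (q v * indicator {0..} (v - (1 - r))) \<partial>lborel) \<partial>lborel)"
    by (rule lborel_pair.Fubini') measurable
  also have "\<dots> = (\<integral>\<^sup>+v. q v * ennreal (tau \<omega> v) * indicator {0<..} v \<partial>lborel)"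
  proof (rule nn_integral_cong)
    fix v
    have "(\<integral>\<^sup>+r. ennreal (wt \<omega> r) * (q v * indicator {0..} (v - (1 - r))) \<partial>lborel)
        = q v * (\<integral>\<^sup>+r. ennreal (wt \<omega> r) * indicator {1 - v..} r \<partial>lborel)"
    proof (subst nn_integral_cmult[symmetric])
      show "(\<integral>\<^sup>+r. ennreal (wt \<omega> r) * (q v * indicator {0..} (v - (1 - r))) \<partial>lborel)
          = (\<integral>\<^sup>+r. q v * (ennreal (wt \<omega> r) * indicator {1 - v..} r) \<partial>lborel)"
        by (intro nn_integral_cong) (auto simp: indicator_def mult_ac)
    qed measurable
    also have "\<dots> = q v * ennreal (tau \<omega> v) * indicator {0<..} v"
    proof (cases "0 < v")
      case True
      then show ?thesis by (simp add: tau_nn_integral[OF rw])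
    next
      case False
      have "(\<integral>\<^sup>+r. ennreal (wt \<omega> r) * indicator {1 - v..} r \<partial>lborel) = (\<integral>\<^sup>+r. 0 \<partial>(lborel::real measure))"
        by (intro nn_integral_cong) (use False in \<open>auto simp: wt_def indicator_def\<close>)
      then show ?thesis using False by simp
    qed
    finally show "(\<integral>\<^sup>+r. ennreal (wt \<omega> r) * (q v * indicator {0..} (v - (1 - r))) \<partial>lborel)
      = q v * ennreal (tau \<omega> v) * indicator {0<..} v" .
  qed
  finally show ?thesis .
qed

lemma nn_integral_powr_atLeast:
  fixes a e :: real
  assumes "0 < a" "0 < e"
  shows "(\<integral>\<^sup>+v. ennreal (v powr (- e - 1)) * indicator {a..} v \<partial>lborel) = ennreal (a powr (- e) / e)"
  using nn_integral_has_integral_lebesgue'[OF _ has_integral_powr_to_inf[of "- e - 1" a]] assms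
  by simp

lemma nn_integral_powr_Icc:
  fixes c e :: real
  assumes "0 < e" "0 \<le> c"
  shows "(\<integral>\<^sup>+v. ennreal (v powr (e - 1)) * indicator {0..c} v \<partial>lborel) = ennreal (c powr e / e)"
  using nn_integral_has_integral_lebesgue'[OF _ has_integral_powr_from_0[of "e - 1" c]] assms
  by simp

text \<open>The doubling constant is written as a power of two so that its exponent \<open>l\<close>
  is at once a growth exponent of the tail and a natural number, which can count differences in a
  summation by parts.\<close>

locale hat_weight =
  fixes \<omega> :: "real \<Rightarrow> real" and l :: nat
  assumes rw: "radial_weight \<omega>"
    and dbl: "\<And>t. 0 < t \<Longrightarrow> tau \<omega> (2 * t) \<le> 2 ^ l * tau \<omega> t"
begin

abbreviation \<tau> where "\<tau> \<equiv> tau \<omega>"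

lemmas \<tau>_pos = tau_pos[OF rw]
lemmas \<tau>_mono = tau_mono[OF rw]
lemmas wt_meas [measurable] = wt_measurable[OF rw]
lemmas \<tau>_meas [measurable] = tau_measurable[OF rw]

text \<open>Doubling is iterated along the least \<open>n\<close> with
  \<open>t \<le> 2 ^ n * s\<close>; minimality gives \<open>2 ^ n \<le> 2 * (t / s)\<close>, whence
  the extra factor \<open>2 ^ l\<close>.\<close>

lemma \<tau>_power:
  assumes "0 < s" "s \<le> t"
  shows "\<tau> t \<le> 2 ^ l * (t / s) ^ l * \<tau> s"
proof -
  have iter: "\<tau> t \<le> (2 ^ l) ^ n * \<tau> s" if "t \<le> 2 ^ n * s" "s \<le> t" for n t
    using that
  proof (induction n arbitrary: t)
    case 0
    then show ?case by (simp add: \<tau>_mono)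
  next
    case (Suc n)
    show ?case
    proof (cases "s \<le> t / 2")
      case True
      have "\<tau> t \<le> 2 ^ l * \<tau> (t / 2)"
        using dbl[of "t / 2"] Suc.prems assms by simp
      also have "\<dots> \<le> 2 ^ l * ((2 ^ l) ^ n * \<tau> s)"
        using Suc True by (intro mult_left_mono Suc.IH) auto
      finally show ?thesis by (simp add: mult.assoc)
    next
      case False
      have "\<tau> t \<le> \<tau> (2 * s)"
        using False Suc.prems assms by (intro \<tau>_mono) auto
      also have "\<dots> \<le> 2 ^ l * \<tau> s" using dbl assms by auto
      also have "\<dots> \<le> (2 ^ l) ^ Suc n * \<tau> s"
      proof (rule mult_right_mono)
        have "1 \<le> (2::real) ^ l" by (rule one_le_power) simp
        then have "1 \<le> ((2::real) ^ l) ^ n" by (rule one_le_power)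
        then have "2 ^ l * 1 \<le> 2 ^ l * ((2::real) ^ l) ^ n"
          by (rule mult_left_mono) simp
        then show "2 ^ l \<le> ((2::real) ^ l) ^ Suc n" by (simp only: power_Suc mult_1_right)
        show "0 \<le> \<tau> s" using \<tau>_pos[of s] assms by simp
      qed
      finally show ?thesis .
    qed
  qed
  obtain n0 where "t / s < 2 ^ n0"
    using real_arch_pow[of 2 "t / s"] by auto
  then have ex: "t \<le> 2 ^ n0 * s" using assms by (simp add: field_simps)
  define n where "n = (LEAST n. t \<le> 2 ^ n * s)"
  have n: "t \<le> 2 ^ n * s" unfolding n_def by (rule LeastI, rule ex)
  have "2 ^ n \<le> 2 * (t / s)"
  proof (cases n)
    case 0
    then show ?thesis using assms by (simp add: field_simps)
  next
    case (Suc m)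
    then have "\<not> t \<le> 2 ^ m * s"
      using not_less_Least[of m "\<lambda>n. t \<le> 2 ^ n * s"] unfolding n_def by simp
    then show ?thesis using Suc assms by (simp add: field_simps)
  qed
  then have "(2 ^ n) ^ l \<le> (2 * (t / s)) ^ l"
    by (intro power_mono) auto
  then have "(2 ^ l) ^ n \<le> 2 ^ l * (t / s) ^ l"
    by (metis power_mult_distrib power_mult mult.commute)
  then show ?thesis
    using iter[OF n assms(2)] \<tau>_pos[OF assms(1)] by (meson mult_right_mono order_trans less_imp_le)
qed

end

section \<open>Moments of the weight in terms of its tail\<close>

context hat_weight
begin

text \<open>A single term of the exponential series gives
  \<open>v ^ j * exp (- v) \<le> fact j\<close>, used with \<open>j = k + l + 1\<close> for large
  \<open>v\<close>. The decay exponent \<open>l + 1\<close> is chosen to beat the growth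
  \<open>v ^ l\<close> of the tail by one power.\<close>

lemma damped_power_bound:
  fixes v :: real
  assumes "0 \<le> v"
  shows "v ^ k * exp (- v) \<le> fact (k + l + 1) * max v 1 powr - (real l + 1)"
proof -
  have e: "v ^ m / fact m \<le> exp v" for m
  proof -
    have "(\<Sum>n\<in>{m}. v ^ n /\<^sub>R fact n) \<le> (\<Sum>n. v ^ n /\<^sub>R fact n)"
      by (rule sum_le_suminf) (use assms summable_exp_generic[of v] in auto)
    then show ?thesis by (simp add: exp_def divide_inverse mult.commute)
  qed
  have bd: "v ^ m * exp (- v) \<le> fact m" for m
    using e[of m] by (simp add: exp_minus field_simps)
  show ?thesis
  proof (cases "v \<le> 1")
    case True
    have "v ^ k * exp (- v) \<le> fact k" by (rule bd)
    also have "fact k \<le> (fact (k + l + 1) :: real)" by (rule fact_mono) simp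
    finally show ?thesis using True by simp
  next
    case False
    have "v ^ k * exp (- v) = v ^ (k + l + 1) * exp (- v) * v powr - (real l + 1)"
    proof -
      have "v powr - (real l + 1) = inverse (v ^ (l + 1))"
        using False powr_minus[of v "real (l + 1)"] powr_realpow[of v "l + 1"] by (simp only: of_nat_add of_nat_1)
      then show ?thesis using False by (simp add: power_add field_simps)
    qed
    also have "\<dots> \<le> fact (k + l + 1) * v powr - (real l + 1)"
      by (intro mult_right_mono bd) auto
    finally show ?thesis using False by simp
  qed
qed

text \<open>Since \<open>r powr x \<le> exp (- (x * (1 - r)))\<close>, the integral effectively
  lives where \<open>1 - r\<close> is of order \<open>1 / x\<close>: there
  \<open>(1 - r) ^ k\<close> contributes \<open>1 / x ^ k\<close>, and farther inside the remaining
  polynomial decay beats the growth of the tail.\<close>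

lemma nn_moment_upper:
  assumes x: "1 \<le> x"
  shows "(\<integral>\<^sup>+r. ennreal (wt \<omega> r * (r powr x * (1 - r) ^ k)) \<partial>lborel)
       \<le> ennreal (fact (k + l + 1) * (real l + 1) * 2 ^ l * \<tau> (1 / x) / x ^ k)"
proof -
  let ?A = "fact (k + l + 1) :: real"
  \<comment> \<open>Integrating \<open>q\<close> over \<open>{1 - r..}\<close> returns
    \<open>max (x * (1 - r)) 1 powr - (real l + 1)\<close>, which is the shape the layer formula
    needs.\<close>
  define q where "q v = ennreal ((real l + 1) * x powr - (real l + 1) * v powr - (real l + 2)) * indicator {1 / x..} v" for v
  have [measurable]: "q \<in> borel_measurable borel" unfolding q_def by measurable
  have q_int: "(\<integral>\<^sup>+v. q v * indicator {1 - r..} v \<partial>lborel) = ennreal (max (x * (1 - r)) 1 powr - (real l + 1))" for r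
  proof -
    let ?m = "max (1 - r) (1 / x)"
    have m: "?m > 0" using x by (simp add: less_max_iff_disj)
    have "(\<integral>\<^sup>+v. q v * indicator {1 - r..} v \<partial>lborel)
        = (\<integral>\<^sup>+v. ennreal ((real l + 1) * x powr - (real l + 1)) * (ennreal (v powr (- (real l + 1) - 1)) * indicator {?m..} v) \<partial>lborel)"
      by (intro nn_integral_cong) (auto simp: q_def indicator_def ennreal_mult algebra_simps)
    also have "\<dots> = ennreal ((real l + 1) * x powr - (real l + 1)) * ennreal (?m powr - (real l + 1) / (real l + 1))"
      using nn_integral_powr_atLeast[OF m, of "real l + 1"] by (subst nn_integral_cmult) auto
    also have "\<dots> = ennreal ((x * ?m) powr - (real l + 1))"
      using x m by (simp add: ennreal_mult[symmetric] powr_mult)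
    also have "x * ?m = max (x * (1 - r)) 1"
      using x by (simp add: max_mult_distrib_left)
    finally show ?thesis .
  qed
  have "(\<integral>\<^sup>+r. ennreal (wt \<omega> r) * (\<integral>\<^sup>+v. q v * indicator {1 - r..} v \<partial>lborel) \<partial>lborel)
      = (\<integral>\<^sup>+v. q v * ennreal (\<tau> v) * indicator {0<..} v \<partial>lborel)"
    by (rule nn_integral_wt_layer[OF rw]) measurable
  also have "\<dots> \<le> (\<integral>\<^sup>+v. ennreal ((real l + 1) * 2 ^ l * \<tau> (1 / x) / x) * (ennreal (v powr (- 1 - 1)) * indicator {1 / x..} v) \<partial>lborel)"
  proof (rule nn_integral_mono)
    fix v :: real
    show "q v * ennreal (\<tau> v) * indicator {0<..} v \<le> ennreal ((real l + 1) * 2 ^ l * \<tau> (1 / x) / x) * (ennreal (v powr (- 1 - 1)) * indicator {1 / x..} v)"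
    proof (cases "1 / x \<le> v")
      case True
      have v: "0 < v" using True x by (meson divide_pos_pos less_le_trans zero_less_one)
      have p1: "x powr - (real l + 1) = inverse (x ^ (l + 1))"
        using x powr_minus[of x "real (l + 1)"] powr_realpow[of x "l + 1"] by (simp only: of_nat_add of_nat_1)
      have p2: "v powr - (real l + 2) = inverse (v ^ (l + 2))"
        using v powr_minus[of v "real (l + 2)"] powr_realpow[of v "l + 2"] by (simp only: of_nat_add of_nat_numeral)
      have p3: "v powr (- 1 - 1) = inverse (v ^ 2)"
        using v powr_minus[of v 2] powr_realpow[of v 2] by simp
      have "(real l + 1) * x powr - (real l + 1) * v powr - (real l + 2) * \<tau> v
          \<le> (real l + 1) * x powr - (real l + 1) * v powr - (real l + 2) * (2 ^ l * (v / (1 / x)) ^ l * \<tau> (1 / x))"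
        using True x by (intro mult_left_mono \<tau>_power) auto
      also have "\<dots> = (real l + 1) * 2 ^ l * \<tau> (1 / x) / x * v powr (- 1 - 1)"
        unfolding p1 p2 p3 using x v by (simp add: field_simps power_mult_distrib power_add power2_eq_square)
      finally show ?thesis
        using True v x \<tau>_pos[of v] \<tau>_pos[of "1 / x"]
        by (simp add: q_def ennreal_mult'[symmetric] ennreal_leI)
    qed (simp add: q_def)
  qed
  also have "\<dots> = ennreal ((real l + 1) * 2 ^ l * \<tau> (1 / x) / x) * ennreal ((1 / x) powr (- 1) / 1)"
    using x nn_integral_powr_atLeast[of "1 / x" 1] by (subst nn_integral_cmult) auto
  also have "\<dots> = ennreal ((real l + 1) * 2 ^ l * \<tau> (1 / x))"
    using x \<tau>_pos[of "1 / x"] by (simp add: ennreal_mult'[symmetric] powr_minus)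
  finally have I: "(\<integral>\<^sup>+r. ennreal (wt \<omega> r) * (\<integral>\<^sup>+v. q v * indicator {1 - r..} v \<partial>lborel) \<partial>lborel)
      \<le> ennreal ((real l + 1) * 2 ^ l * \<tau> (1 / x))" .
  have "(\<integral>\<^sup>+r. ennreal (wt \<omega> r * (r powr x * (1 - r) ^ k)) \<partial>lborel)
      \<le> (\<integral>\<^sup>+r. ennreal (?A / x ^ k) * (ennreal (wt \<omega> r) * (\<integral>\<^sup>+v. q v * indicator {1 - r..} v \<partial>lborel)) \<partial>lborel)"
  proof (rule nn_integral_mono)
    fix r :: real
    show "ennreal (wt \<omega> r * (r powr x * (1 - r) ^ k)) \<le> ennreal (?A / x ^ k) * (ennreal (wt \<omega> r) * (\<integral>\<^sup>+v. q v * indicator {1 - r..} v \<partial>lborel))"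
    proof (cases "0 \<le> r \<and> r < 1")
      case True
      have "r powr x \<le> exp (- (x * (1 - r)))"
      proof (cases "r = 0")
        case False
        have "x * ln r \<le> x * (r - 1)"
          using ln_le_minus_one[of r] x True False by (intro mult_left_mono) auto
        then show ?thesis using False by (simp add: powr_def algebra_simps)
      qed simp
      then have "r powr x * (1 - r) ^ k \<le> exp (- (x * (1 - r))) * (1 - r) ^ k"
        using True by (intro mult_right_mono) auto
      also have "\<dots> = (x * (1 - r)) ^ k * exp (- (x * (1 - r))) / x ^ k"
        using x by (simp add: power_mult_distrib)
      also have "\<dots> \<le> ?A * max (x * (1 - r)) 1 powr - (real l + 1) / x ^ k"
        using x True by (intro divide_right_mono damped_power_bound) auto
      finally have "wt \<omega> r * (r powr x * (1 - r) ^ k) \<le> wt \<omega> r * (?A * max (x * (1 - r)) 1 powr - (real l + 1) / x ^ k)"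
        using wt_nonneg[OF rw] by (intro mult_left_mono)
      also have "\<dots> = (?A / x ^ k) * (wt \<omega> r * max (x * (1 - r)) 1 powr - (real l + 1))"
        by simp
      finally show ?thesis
        using x wt_nonneg[OF rw] unfolding q_int by (simp add: ennreal_mult[symmetric] ennreal_leI)
    qed (auto simp: wt_def)
  qed
  also have "\<dots> = ennreal (?A / x ^ k) * (\<integral>\<^sup>+r. ennreal (wt \<omega> r) * (\<integral>\<^sup>+v. q v * indicator {1 - r..} v \<partial>lborel) \<partial>lborel)"
    unfolding q_int by (rule nn_integral_cmult) measurable
  also have "\<dots> \<le> ennreal (?A / x ^ k) * ennreal ((real l + 1) * 2 ^ l * \<tau> (1 / x))"
    by (rule mult_left_mono[OF I]) simp
  also have "\<dots> = ennreal (?A * (real l + 1) * 2 ^ l * \<tau> (1 / x) / x ^ k)"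
    using x \<tau>_pos[of "1 / x"] by (simp add: ennreal_mult'[symmetric] mult_ac)
  finally show ?thesis .
qed

text \<open>Taking \<open>k\<close> differences of moments, with steps of two in the exponent,
  inserts the factor \<open>(1 - r) ^ k\<close> up to the bounded factor
  \<open>(1 + r) ^ k\<close>.\<close>

definition Mom :: "nat \<Rightarrow> real \<Rightarrow> real" where
  "Mom k x = (\<integral>r. wt \<omega> r * (r powr x * (1 - r) ^ k) \<partial>lborel)"

lemma Mom_integrable:
  assumes "0 \<le> x"
  shows "integrable lborel (\<lambda>r. wt \<omega> r * (r powr x * (1 - r) ^ k))"
proof (rule Bochner_Integration.integrable_bound[OF wt_integrable[OF rw]])
  show "AE r in lborel. norm (wt \<omega> r * (r powr x * (1 - r) ^ k)) \<le> norm (wt \<omega> r)"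
  proof (rule AE_I2)
    fix r :: real
    show "norm (wt \<omega> r * (r powr x * (1 - r) ^ k)) \<le> norm (wt \<omega> r)"
    proof (cases "0 \<le> r \<and> r < 1")
      case True
      have "r powr x * (1 - r) ^ k \<le> 1 * 1"
        using True assms by (intro mult_mono powr_le1 power_le_one) auto
      then show ?thesis
        using True wt_nonneg[OF rw, of r] mult_left_mono[of "r powr x * (1 - r) ^ k" 1 "wt \<omega> r"]
        by (simp add: abs_mult)
    qed (auto simp: wt_def)
  qed
qed measurable

lemma Mom_nn_integral:
  assumes "0 \<le> x"
  shows "(\<integral>\<^sup>+r. ennreal (wt \<omega> r * (r powr x * (1 - r) ^ k)) \<partial>lborel) = ennreal (Mom k x)"
  unfolding Mom_def
proof (rule nn_integral_eq_integral[OF Mom_integrable[OF assms]], rule AE_I2)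
  show "0 \<le> wt \<omega> r * (r powr x * (1 - r) ^ k)" for r
    using wt_nonneg[OF rw, of r] by (cases "0 \<le> r \<and> r < 1") (auto simp: wt_def)
qed

lemma moment_eq_Mom: "moment \<omega> x = Mom 0 x"
  unfolding moment_def Mom_def set_lebesgue_integral_def
  by (intro Bochner_Integration.integral_cong) (auto simp: wt_def)

lemma Mom_upper:
  assumes "1 \<le> x"
  shows "Mom k x \<le> fact (k + l + 1) * (real l + 1) * 2 ^ l * \<tau> (1 / x) / x ^ k"
  using nn_moment_upper[OF assms, of k] assms \<tau>_pos[of "1 / x"] Mom_nn_integral[of x k]
  by (simp add: ennreal_le_iff)

text \<open>For \<open>r \<ge> 1 - y\<close> with \<open>y = 1 / (2 * x)\<close> the function
  \<open>r powr x\<close> is at least \<open>exp (- 1)\<close>; one doubling passes from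
  \<open>\<tau> y\<close> to \<open>\<tau> (1 / x)\<close>.\<close>

lemma moment_lower:
  assumes x: "1 \<le> x"
  shows "\<tau> (1 / x) \<le> exp 1 * 2 ^ l * moment \<omega> x"
proof -
  define y where "y = 1 / (2 * x)"
  have y: "0 < y" "y \<le> 1 / 2" using x by (auto simp: y_def field_simps)
  have low: "exp (- 1) \<le> r powr x" if r: "1 - y \<le> r" for r
  proof -
    have "- y - 2 * y\<^sup>2 \<le> ln (1 - y)"
      using y by (intro ln_one_minus_pos_lower_bound) auto
    moreover have "y\<^sup>2 \<le> y * (1 / 2)"
      unfolding power2_eq_square using y by (intro mult_left_mono) auto
    moreover have "ln (1 - y) \<le> ln r" using r y by (intro ln_mono) linarith+
    ultimately have "- (2 * y) \<le> ln r" by linarith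
    then have "x * (- (2 * y)) \<le> x * ln r" using x by (intro mult_left_mono) auto
    then have "- 1 \<le> x * ln r" using x by (simp add: y_def)
    moreover have "r > 0" using r y by linarith
    ultimately show ?thesis by (simp add: powr_def)
  qed
  have "ennreal (exp (- 1) * \<tau> y) = ennreal (exp (- 1)) * (\<integral>\<^sup>+r. ennreal (wt \<omega> r) * indicator {1 - y..} r \<partial>lborel)"
    using y by (subst tau_nn_integral[OF rw]) (auto simp: ennreal_mult')
  also have "\<dots> = (\<integral>\<^sup>+r. ennreal (exp (- 1)) * (ennreal (wt \<omega> r) * indicator {1 - y..} r) \<partial>lborel)"
    by (rule nn_integral_cmult[symmetric]) measurable
  also have "\<dots> \<le> (\<integral>\<^sup>+r. ennreal (wt \<omega> r * (r powr x * (1 - r) ^ 0)) \<partial>lborel)"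
  proof (rule nn_integral_mono)
    fix r :: real
    show "ennreal (exp (- 1)) * (ennreal (wt \<omega> r) * indicator {1 - y..} r) \<le> ennreal (wt \<omega> r * (r powr x * (1 - r) ^ 0))"
    proof (cases "1 - y \<le> r")
      case True
      then show ?thesis
        using mult_right_mono[OF low[OF True] wt_nonneg[OF rw, of r]] wt_nonneg[OF rw, of r]
        by (simp add: ennreal_mult[symmetric] ennreal_leI mult.commute)
    qed simp
  qed
  also have "\<dots> = ennreal (moment \<omega> x)"
    using x unfolding moment_eq_Mom by (subst Mom_nn_integral) auto
  finally have "ennreal (exp (- 1) * \<tau> y) \<le> ennreal (moment \<omega> x)" .
  moreover have "0 < exp (- 1) * \<tau> y" using \<tau>_pos[OF y(1)] by simp
  ultimately have 1: "exp (- 1) * \<tau> y \<le> moment \<omega> x"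
    by (metis ennreal_le_iff2 not_less)
  have "\<tau> (1 / x) = \<tau> (2 * y)" by (simp add: y_def)
  also have "\<dots> \<le> 2 ^ l * \<tau> y" using y by (intro dbl) auto
  also have "\<dots> = exp 1 * 2 ^ l * (exp (- 1) * \<tau> y)"
    by (simp add: exp_minus)
  also have "\<dots> \<le> exp 1 * 2 ^ l * moment \<omega> x"
    using 1 by (intro mult_left_mono) auto
  finally show ?thesis .
qed

end

section \<open>The weight classes as inequalities for the tail\<close>

lemma D_hat_imp_hat_weight:
  assumes "\<omega> \<in> D_hat"
  obtains l where "hat_weight \<omega> l"
proof -
  obtain C where rw: "radial_weight \<omega>" and C: "C > 1"
    and le: "\<And>r. 0 \<le> r \<Longrightarrow> r < 1 \<Longrightarrow> weight_tail \<omega> r \<le> C * weight_tail \<omega> ((1 + r) / 2)"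
    using assms by (auto simp: D_hat_def)
  obtain l where l: "C < 2 ^ l" using real_arch_pow[of 2 C] by auto
  have "tau \<omega> (2 * t) \<le> 2 ^ l * tau \<omega> t" if t: "0 < t" for t
  proof -
    have "tau \<omega> (2 * t) \<le> C * weight_tail \<omega> ((1 + max 0 (1 - 2 * t)) / 2)"
      unfolding tau_def using t by (intro le) auto
    \<comment> \<open>Going from \<open>r\<close> to \<open>(1 + r) / 2\<close> halves the distance
      to the boundary. For \<open>t > 1 / 2\<close> the argument \<open>2 * t\<close> lies beyond
      the saturation point \<open>1\<close> of the tail, hence the minimum with
      \<open>1 / 2\<close>.\<close>
    also have "weight_tail \<omega> ((1 + max 0 (1 - 2 * t)) / 2) = tau \<omega> (min t (1 / 2))"
      unfolding tau_def by (rule arg_cong[where f = "weight_tail \<omega>"]) (auto simp: max_def min_def)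
    also have "C * \<dots> \<le> 2 ^ l * tau \<omega> t"
      using l C t tau_pos[OF rw, of "min t (1 / 2)"] by (intro mult_mono tau_mono[OF rw]) auto
    finally show ?thesis .
  qed
  then have "hat_weight \<omega> l" by (unfold_locales) (use rw in auto)
  then show ?thesis by (rule that)
qed

text \<open>Reverse doubling with a positive exponent. The tail is constant beyond \<open>1\<close>,
  so such an inequality can hold on a bounded range only; \<open>8\<close> leaves room for boxes of
  size up to \<open>4\<close> and their doubles.\<close>

locale D_weight = hat_weight +
  fixes \<alpha> A :: real
  assumes \<alpha>: "0 < \<alpha>" and A: "1 \<le> A"
    and rev: "\<And>s t. 0 < s \<Longrightarrow> s \<le> t \<Longrightarrow> t \<le> 8 \<Longrightarrow> tau \<omega> s \<le> A * (s / t) powr \<alpha> * tau \<omega> t"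

text \<open>The moment at \<open>x\<close> is comparable to \<open>tau \<omega> (1 / x)\<close>, so
  the moment condition speaks about tails up to the constants \<open>c1\<close> and
  \<open>c2\<close>. Iterating it until \<open>C ^ n\<close> exceeds \<open>2 * c1 * c2\<close>
  overcomes these constants and leaves a halving of the tail under the fixed dilation
  \<open>L = K ^ n\<close>.\<close>

lemma D_class_imp_D_weight:
  assumes "\<omega> \<in> D_class"
  obtains l \<alpha> A where "D_weight \<omega> l \<alpha> A"
proof -
  have "\<omega> \<in> D_hat" and M: "\<omega> \<in> M_class" using assms by (auto simp: D_class_def)
  from D_hat_imp_hat_weight[OF this(1)] obtain l where "hat_weight \<omega> l" .
  then interpret hat_weight \<omega> l .
  from M obtain C K where CK: "C > 1" "K > 1"
    and le: "\<And>x. 1 \<le> x \<Longrightarrow> C * moment \<omega> (K * x) \<le> moment \<omega> x"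
    by (auto simp: M_class_def)
  have iter: "C ^ n * moment \<omega> (K ^ n * x) \<le> moment \<omega> x" if "1 \<le> x" for n x
  proof (induction n)
    case (Suc n)
    have "1 \<le> K ^ n * x"
      using that CK mult_mono[of 1 "K ^ n" 1 x] by (simp add: one_le_power)
    then have "C * moment \<omega> (K * (K ^ n * x)) \<le> moment \<omega> (K ^ n * x)" by (rule le)
    then have "C ^ n * (C * moment \<omega> (K * (K ^ n * x))) \<le> C ^ n * moment \<omega> (K ^ n * x)"
      using CK by (intro mult_left_mono) auto
    then show ?case using Suc by (simp add: mult_ac)
  qed simp
  define c1 where "c1 = fact (0 + l + 1) * (real l + 1) * (2 ^ l :: real)"
  define c2 where "c2 = exp 1 * (2 ^ l :: real)"
  have c: "c1 > 0" "c2 > 0" by (auto simp: c1_def c2_def)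
  obtain n0 where n0: "2 * c1 * c2 < C ^ n0" using real_arch_pow[OF CK(1)] by blast
  \<comment> \<open>The successor ensures \<open>L > 1\<close> even if the power \<open>0\<close> is
    already large enough.\<close>
  define n where "n = Suc n0"
  have "C ^ n0 \<le> C ^ n" using CK by (simp add: n_def)
  then have n: "2 * c1 * c2 < C ^ n" using n0 by linarith
  define L where "L = K ^ n"
  have L: "L > 1" unfolding L_def n_def using CK by (intro one_less_power) auto
  have half: "\<tau> (t / L) \<le> \<tau> t / 2" if t: "0 < t" "t \<le> 1" for t
  proof -
    have x: "1 \<le> 1 / t" and Lx: "1 \<le> L * (1 / t)"
      using t L by (auto simp: field_simps)
    have "2 * c1 * c2 * \<tau> (t / L) \<le> C ^ n * \<tau> (t / L)"
      using n \<tau>_pos[of "t / L"] t L by (intro mult_right_mono) auto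
    also have "\<dots> \<le> C ^ n * (c2 * moment \<omega> (L * (1 / t)))"
      using moment_lower[OF Lx] CK by (intro mult_left_mono) (auto simp: c2_def)
    also have "\<dots> = c2 * (C ^ n * moment \<omega> (K ^ n * (1 / t)))" by (simp add: L_def)
    also have "\<dots> \<le> c2 * moment \<omega> (1 / t)"
      using c by (intro mult_left_mono iter x) auto
    also have "\<dots> \<le> c2 * (c1 * \<tau> t)"
      using Mom_upper[OF x, of 0] c by (intro mult_left_mono) (auto simp: c1_def moment_eq_Mom)
    finally show ?thesis using c by (simp add: field_simps)
  qed
  \<comment> \<open>Chosen such that \<open>L powr \<alpha> = 2\<close>: one halving per dilation by
    \<open>L\<close> becomes a power law.\<close>
  define \<alpha> where "\<alpha> = ln 2 / ln L"
  have \<alpha>: "\<alpha> > 0" using L by (simp add: \<alpha>_def)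
  have L\<alpha>: "L powr \<alpha> = 2" using L by (simp add: powr_def \<alpha>_def)
  have halfn: "\<tau> (t / L ^ m) \<le> \<tau> t / 2 ^ m" if t: "0 < t" "t \<le> 1" for t m
  proof (induction m)
    case (Suc m)
    have tL: "t / L ^ m \<le> 1"
      using t L by (simp add: divide_le_eq one_le_power order_trans[OF _ one_le_power])
    have "\<tau> (t / L ^ m / L) \<le> \<tau> (t / L ^ m) / 2"
      using t L tL by (intro half) auto
    also have "\<dots> \<le> \<tau> t / 2 ^ m / 2" using Suc by simp
    finally show ?case by (simp add: mult.commute)
  qed simp
  have rev1: "\<tau> s \<le> 2 * (s / t) powr \<alpha> * \<tau> t" if "0 < s" "s \<le> t" "t \<le> 1" for s t
  proof -
    define m where "m = nat \<lfloor>log L (t / s)\<rfloor>"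
    have ts: "t / s \<ge> 1" using that by simp
    then have lg: "0 \<le> log L (t / s)" using L by simp
    then have m: "real m \<le> log L (t / s)" "log L (t / s) < real m + 1"
      by (auto simp: m_def of_nat_nat)
    have Lm: "L ^ m \<le> t / s"
      using m(1) L ts by (simp add: le_log_iff powr_realpow)
    have "t / s < L powr (real m + 1)"
      using m(2) L ts by (simp add: log_less_iff)
    then have "(t / s) powr \<alpha> \<le> (L powr (real m + 1)) powr \<alpha>"
      using ts \<alpha> by (intro powr_mono2) auto
    also have "\<dots> = (L powr \<alpha>) powr (real m + 1)" by (simp add: powr_powr mult.commute)
    also have "\<dots> = 2 * 2 ^ m" unfolding L\<alpha> by (simp add: powr_add powr_realpow)
    finally have 1: "(t / s) powr \<alpha> \<le> 2 * 2 ^ m" .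
    have "(s / t) powr \<alpha> = 1 / (t / s) powr \<alpha>"
      using that by (simp add: powr_divide)
    then have 2: "1 / 2 ^ m \<le> 2 * (s / t) powr \<alpha>"
    proof -
      have "2 / (2 * 2 ^ m) \<le> 2 / (t / s) powr \<alpha>"
        using 1 that by (intro divide_left_mono) auto
      then show ?thesis using \<open>(s / t) powr \<alpha> = 1 / (t / s) powr \<alpha>\<close> by simp
    qed
    have "s \<le> t / L ^ m" using Lm that L by (simp add: field_simps)
    then have "\<tau> s \<le> \<tau> (t / L ^ m)" using that by (intro \<tau>_mono) auto
    also have "\<dots> \<le> 1 / 2 ^ m * \<tau> t" using halfn[of t m] that by simp
    also have "\<dots> \<le> 2 * (s / t) powr \<alpha> * \<tau> t"
      using 2 \<tau>_pos[of t] that by (intro mult_right_mono) auto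
    finally show ?thesis .
  qed
  have const: "\<tau> t = \<tau> 1" if "1 \<le> t" for t using that by (simp add: tau_def)
  \<comment> \<open>Both arguments are cut off at \<open>1\<close>, where the tail saturates. This
    enlarges the quotient \<open>s / t\<close> by a factor of at most \<open>8\<close>, which
    accounts for \<open>8 powr \<alpha>\<close>.\<close>
  have "\<tau> s \<le> (2 * 8 powr \<alpha>) * (s / t) powr \<alpha> * \<tau> t" if st: "0 < s" "s \<le> t" "t \<le> 8" for s t
  proof -
    let ?s = "min s 1" and ?t = "min t 1"
    have "\<tau> s = \<tau> ?s" "\<tau> t = \<tau> ?t" using const[of s] const[of t] by (auto simp: min_def)
    moreover have "\<tau> ?s \<le> 2 * (?s / ?t) powr \<alpha> * \<tau> ?t"
      using st by (intro rev1) auto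
    moreover have "2 * (?s / ?t) powr \<alpha> * \<tau> ?t \<le> 2 * (8 powr \<alpha> * (s / t) powr \<alpha>) * \<tau> ?t"
    proof (intro mult_right_mono mult_left_mono)
      have "?s / ?t \<le> 8 * (s / t)"
      proof (cases "t \<le> 1")
        case True
        then have "?s / ?t = s / t" using st by simp
        moreover have "0 \<le> s / t" using st by simp
        ultimately show ?thesis by linarith
      next
        case False
        then have "?s / ?t = ?s" by simp
        also have "\<dots> \<le> s" by simp
        also have "\<dots> \<le> 8 * (s / t)" using st False by (simp add: field_simps)
        finally show ?thesis .
      qed
      then have "(?s / ?t) powr \<alpha> \<le> (8 * (s / t)) powr \<alpha>"
        using st \<alpha> by (intro powr_mono2) auto
      then show "(?s / ?t) powr \<alpha> \<le> 8 powr \<alpha> * (s / t) powr \<alpha>"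
        using st by (subst powr_mult[symmetric]) auto
      show "0 \<le> \<tau> ?t" using \<tau>_pos[of ?t] st by simp
    qed auto
    ultimately show ?thesis by (simp add: mult_ac)
  qed
  moreover have "1 \<le> 2 * 8 powr \<alpha>"
    using \<alpha> ge_one_powr_ge_zero[of 8 \<alpha>] by simp
  ultimately have "D_weight \<omega> l \<alpha> (2 * 8 powr \<alpha>)"
    by unfold_locales (use \<alpha> in auto)
  then show ?thesis by (rule that)
qed

section \<open>Pointwise estimate of the reproducing kernels\<close>

text \<open>
  Sequences with \<open>k\<close> controlled differences: the \<open>j\<close>-th difference of \<open>a\<close>
  is \<open>O(p n / (n + 1) ^ j)\<close> for all \<open>j \<le> k\<close>.
\<close>

primrec symbol :: "nat \<Rightarrow> (nat \<Rightarrow> real) \<Rightarrow> (nat \<Rightarrow> real) \<Rightarrow> bool" where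
  "symbol 0 p a \<longleftrightarrow> (\<exists>C. \<forall>n. \<bar>a n\<bar> \<le> C * p n)"
| "symbol (Suc k) p a \<longleftrightarrow> (\<exists>C. \<forall>n. \<bar>a n\<bar> \<le> C * p n) \<and>
     symbol k (\<lambda>n. p n / real (Suc n)) (\<lambda>n. a n - a (Suc n))"

lemma symbol_bound: "symbol k p a \<Longrightarrow> \<exists>C. \<forall>n. \<bar>a n\<bar> \<le> C * p n"
  by (cases k) auto

lemma symbol_Suc_imp: "symbol (Suc k) p a \<Longrightarrow> symbol k p a"
proof (induction k arbitrary: p a)
  case 0
  then show ?case by simp
next
  case (Suc k)
  note * = iffD1[OF symbol.simps(2) Suc.prems]
  show ?case
    by (rule iffD2[OF symbol.simps(2)], rule conjI[OF conjunct1[OF *] Suc.IH[OF conjunct2[OF *]]])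
qed

lemma bigo_mono:
  fixes p q :: "nat \<Rightarrow> real"
  assumes "\<exists>C. \<forall>n. \<bar>a n\<bar> \<le> C * p n" and "\<And>n. 0 \<le> p n" "\<And>n. p n \<le> c * q n" and "0 \<le> c" "\<And>n. 0 \<le> q n"
  shows "\<exists>C. \<forall>n. \<bar>a n\<bar> \<le> C * q n"
proof -
  obtain C where C: "\<And>n. \<bar>a n\<bar> \<le> C * p n" using assms(1) by blast
  have "\<bar>a n\<bar> \<le> (\<bar>C\<bar> * c) * q n" for n
  proof -
    have "\<bar>a n\<bar> \<le> C * p n" by (rule C)
    also have "\<dots> \<le> \<bar>C\<bar> * p n" using assms(2) by (intro mult_right_mono) auto
    also have "\<dots> \<le> \<bar>C\<bar> * (c * q n)" using assms(3) by (intro mult_left_mono) auto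
    finally show ?thesis by (simp add: mult.assoc)
  qed
  then show ?thesis by blast
qed

lemma symbol_add:
  assumes "symbol k p a" "symbol k p b"
  shows "symbol k p (\<lambda>n. a n + b n)"
  using assms
proof (induction k arbitrary: p a b)
  have B: "\<exists>C. \<forall>n. \<bar>a n + b n\<bar> \<le> C * p n"
    if ab: "\<exists>C. \<forall>n. \<bar>a n\<bar> \<le> C * p n" "\<exists>C. \<forall>n. \<bar>b n\<bar> \<le> C * p n" for p a b :: "nat \<Rightarrow> real"
  proof -
    obtain C1 where C1: "\<And>n. \<bar>a n\<bar> \<le> C1 * p n" using ab(1) by blast
    obtain C2 where C2: "\<And>n. \<bar>b n\<bar> \<le> C2 * p n" using ab(2) by blast
    have "\<bar>a n + b n\<bar> \<le> (C1 + C2) * p n" for n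
      using C1[of n] C2[of n] unfolding distrib_right by linarith
    then show ?thesis by blast
  qed
  {
    case 0
    then show ?case using B by simp
  next
    case (Suc k)
    have "symbol k (\<lambda>n. p n / real (Suc n)) (\<lambda>n. (a n - a (Suc n)) + (b n - b (Suc n)))"
      using Suc.prems by (intro Suc.IH) auto
    then show ?case using B Suc.prems by (simp add: algebra_simps)
  }
qed

lemma symbol_uminus: "symbol k p a \<Longrightarrow> symbol k p (\<lambda>n. - a n)"
proof (induction k arbitrary: p a)
  case (Suc k)
  have "symbol k (\<lambda>n. p n / real (Suc n)) (\<lambda>n. - (a n - a (Suc n)))"
    using Suc.prems by (intro Suc.IH) auto
  then show ?case using Suc.prems by simp
qed simp

text \<open>The growth condition on \<open>p\<close> absorbs the shift at every level; it is
  inherited by \<open>p n / real (Suc n)\<close> because the denominators increase.\<close>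

lemma symbol_shift:
  assumes "symbol k p a" and "\<And>n. 0 \<le> p n" "\<And>n. p (Suc n) \<le> c * p n" "0 \<le> c"
  shows "symbol k p (\<lambda>n. a (Suc n))"
  using assms
proof (induction k arbitrary: p a)
  have B: "\<exists>C. \<forall>n. \<bar>a (Suc n)\<bar> \<le> C * p n"
    if "\<exists>C. \<forall>n. \<bar>a n\<bar> \<le> C * p n" and p: "\<And>n. 0 \<le> p n" "\<And>n. p (Suc n) \<le> c * p n" for p a :: "nat \<Rightarrow> real"
  proof -
    have "\<exists>C. \<forall>n. \<bar>a (Suc n)\<bar> \<le> C * p (Suc n)" using that(1) by blast
    from bigo_mono[OF this, of c p] show ?thesis using p assms(4) by auto
  qed
  {
    case 0
    then show ?case using B by simp
  next
    case (Suc k)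
    have "symbol k (\<lambda>n. p n / real (Suc n)) (\<lambda>n. a (Suc n) - a (Suc (Suc n)))"
    proof (rule Suc.IH)
      show "symbol k (\<lambda>n. p n / real (Suc n)) (\<lambda>n. a n - a (Suc n))" using Suc.prems(1) by simp
      show "p (Suc n) / real (Suc (Suc n)) \<le> c * (p n / real (Suc n))" for n
      proof -
        have "p (Suc n) / real (Suc (Suc n)) \<le> p (Suc n) / real (Suc n)"
          using Suc.prems(2)[of "Suc n"] by (intro divide_left_mono) auto
        also have "\<dots> \<le> c * p n / real (Suc n)"
          using Suc.prems(3)[of n] by (intro divide_right_mono) auto
        finally show ?thesis by simp
      qed
    qed (use Suc.prems in auto)
    then show ?case using B Suc.prems by simp
  }
qed

text \<open>Discrete product rule: the difference of the product is
  \<open>(a n - a (Suc n)) * b n + a (Suc n) * (b n - b (Suc n))\<close>, so the induction rests on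
  closure under shifts and sums.\<close>

lemma symbol_mult:
  assumes "symbol k p a" "symbol k q b" and "\<And>n. 0 \<le> p n" "\<And>n. 0 \<le> q n" "\<And>n. p (Suc n) \<le> c * p n" "0 \<le> c"
  shows "symbol k (\<lambda>n. p n * q n) (\<lambda>n. a n * b n)"
  using assms
proof (induction k arbitrary: p q a b)
  have B: "\<exists>C. \<forall>n. \<bar>a n * b n\<bar> \<le> C * (p n * q n)"
    if ab: "\<exists>C. \<forall>n. \<bar>a n\<bar> \<le> C * p n" "\<exists>C. \<forall>n. \<bar>b n\<bar> \<le> C * q n" "\<And>n. 0 \<le> p n" "\<And>n. 0 \<le> q n" for p q a b :: "nat \<Rightarrow> real"
  proof -
    obtain C1 where C1: "\<And>n. \<bar>a n\<bar> \<le> C1 * p n" using ab(1) by blast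
    obtain C2 where C2: "\<And>n. \<bar>b n\<bar> \<le> C2 * q n" using ab(2) by blast
    have "\<bar>a n * b n\<bar> \<le> (C1 * C2) * (p n * q n)" for n
    proof -
      have "\<bar>a n\<bar> * \<bar>b n\<bar> \<le> (C1 * p n) * (C2 * q n)"
        using C1[of n] C2[of n] abs_ge_zero[of "a n"] by (intro mult_mono) linarith+
      then show ?thesis by (simp add: abs_mult mult_ac)
    qed
    then show ?thesis by blast
  qed
  {
    case 0
    then show ?case using B by simp
  next
    case (Suc k)
    have 1: "symbol k (\<lambda>n. (p n / real (Suc n)) * q n) (\<lambda>n. (a n - a (Suc n)) * b n)"
    proof (rule Suc.IH)
      show "p (Suc n) / real (Suc (Suc n)) \<le> c * (p n / real (Suc n))" for n
      proof -
        have "p (Suc n) / real (Suc (Suc n)) \<le> p (Suc n) / real (Suc n)"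
          using Suc.prems(3)[of "Suc n"] by (intro divide_left_mono) auto
        also have "\<dots> \<le> c * p n / real (Suc n)"
          using Suc.prems(5)[of n] by (intro divide_right_mono) auto
        finally show ?thesis by simp
      qed
    qed (use Suc.prems symbol_Suc_imp[OF Suc.prems(2)] in auto)
    have 2: "symbol k (\<lambda>n. p n * (q n / real (Suc n))) (\<lambda>n. a (Suc n) * (b n - b (Suc n)))"
    proof (rule Suc.IH)
      show "symbol k p (\<lambda>n. a (Suc n))"
        by (rule symbol_shift[OF symbol_Suc_imp[OF Suc.prems(1)] Suc.prems(3,5,6)])
    qed (use Suc.prems in auto)
    have "symbol k (\<lambda>n. p n * q n / real (Suc n)) (\<lambda>n. (a n - a (Suc n)) * b n + a (Suc n) * (b n - b (Suc n)))"
      using 1 2 by (intro symbol_add) simp_all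
    moreover have "(a n - a (Suc n)) * b n + a (Suc n) * (b n - b (Suc n)) = a n * b n - a (Suc n) * b (Suc n)" for n
      by (simp add: algebra_simps)
    ultimately show ?case using B[of a p b q] Suc.prems by simp
  }
qed

text \<open>The difference of \<open>1 / m\<close> is minus that of \<open>m\<close>, times
  \<open>1 / m n * (1 / m (Suc n))\<close>. Hence level \<open>k + 1\<close> for
  \<open>1 / m\<close> follows from level \<open>k\<close> and the product rule. The bound
  \<open>p n \<le> c * p (Suc n)\<close> makes \<open>1 / p\<close> slowly growing, as shifts
  require.\<close>

lemma symbol_inverse:
  assumes sym: "\<And>k. symbol k p m" and p: "\<And>n. 0 < p n" "\<And>n. p (Suc n) \<le> p n" "\<And>n. p n \<le> c * p (Suc n)"
    and m: "\<And>n. p n \<le> d * m n" "\<And>n. 0 < m n"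
  shows "symbol k (\<lambda>n. 1 / p n) (\<lambda>n. 1 / m n)"
proof -
  have "0 \<le> c" using p(1)[of 0] p(1)[of 1] p(3)[of 0] by (simp add: zero_less_mult_iff less_le_trans[OF p(1)])
      (metis less_le_trans less_imp_le mult.commute zero_less_mult_pos)
  have slow: "1 / p (Suc n) \<le> c * (1 / p n)" for n
    using p(1)[of n] p(1)[of "Suc n"] p(3)[of n] by (simp add: field_simps)
  have B: "\<exists>C. \<forall>n. \<bar>1 / m n\<bar> \<le> C * (1 / p n)"
  proof (intro exI allI)
    fix n
    show "\<bar>1 / m n\<bar> \<le> d * (1 / p n)"
      using p(1)[of n] m(1)[of n] m(2)[of n] by (simp add: field_simps)
  qed
  show ?thesis
  proof (induction k)
    case 0
    then show ?case using B by simp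
  next
    case (Suc k)
    have 1: "symbol k (\<lambda>n. 1 / p n) (\<lambda>n. 1 / m (Suc n))"
      using Suc p(1) slow \<open>0 \<le> c\<close> by (intro symbol_shift[where c = c]) (auto simp: less_imp_le)
    have 2: "symbol k (\<lambda>n. 1 / p n * (1 / p n)) (\<lambda>n. 1 / m n * (1 / m (Suc n)))"
      using Suc 1 p(1) slow \<open>0 \<le> c\<close> by (intro symbol_mult[where c = c]) (auto simp: less_imp_le)
    have 3: "symbol k (\<lambda>n. p n / real (Suc n)) (\<lambda>n. - (m n - m (Suc n)))"
      using sym[of "Suc k"] by (intro symbol_uminus) simp
    have "symbol k (\<lambda>n. p n / real (Suc n) * (1 / p n * (1 / p n))) (\<lambda>n. - (m n - m (Suc n)) * (1 / m n * (1 / m (Suc n))))"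
    proof (rule symbol_mult[where c = 1, OF 3 2])
      show "p (Suc n) / real (Suc (Suc n)) \<le> 1 * (p n / real (Suc n))" for n
        using p(1)[of "Suc n"] p(2)[of n] by (auto intro!: frac_le simp: less_imp_le)
    qed (use p(1) in \<open>auto simp: less_imp_le\<close>)
    moreover have "p n / real (Suc n) * (1 / p n * (1 / p n)) = 1 / p n / real (Suc n)" for n
      using p(1)[of n] by simp
    moreover have "- (m n - m (Suc n)) * (1 / m n * (1 / m (Suc n))) = 1 / m n - 1 / m (Suc n)" for n
      using m(2)[of n] m(2)[of "Suc n"] by (simp add: field_simps)
    ultimately have "symbol k (\<lambda>n. 1 / p n / real (Suc n)) (\<lambda>n. 1 / m n - 1 / m (Suc n))"
      by simp
    then show ?case using B by simp
  qed
qed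

section \<open>Power series under iterated summation by parts\<close>

definition dif :: "(nat \<Rightarrow> real) \<Rightarrow> nat \<Rightarrow> real" where
  "dif a n = a n - a (Suc n)"

lemma symbol_iterate:
  assumes "symbol k p a" "j \<le> k"
  shows "\<exists>C. \<forall>n. \<bar>(dif ^^ j) a n\<bar> \<le> C * (p n / real (Suc n) ^ j)"
  using assms
proof (induction j arbitrary: k p a)
  case 0
  then show ?case using symbol_bound by simp
next
  case (Suc j)
  then obtain k' where k: "k = Suc k'" "j \<le> k'" by (cases k) auto
  have "symbol k' (\<lambda>n. p n / real (Suc n)) (dif a)"
    using Suc.prems(1) k by (simp add: dif_def[abs_def])
  from Suc.IH[OF this k(2)] show ?case
    by (simp add: funpow_swap1 mult_ac)
qed

lemma dif_summable:
  fixes u :: complex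
  assumes "summable (\<lambda>n. of_real (b n) * u ^ n)" "cmod u < 1"
  shows "summable (\<lambda>n. of_real (dif b n) * u ^ n)"
proof (cases "u = 0")
  case True
  then show ?thesis by (intro summable_finite[of "{0}"]) auto
next
  case False
  have "summable (\<lambda>n. of_real (b (Suc n)) * u ^ Suc n)"
    using assms(1) summable_Suc_iff[of "\<lambda>n. of_real (b n) * u ^ n"] by simp
  from summable_mult[OF this, of "1 / u"] have "summable (\<lambda>n. of_real (b (Suc n)) * u ^ n)"
    using False by (simp add: mult_ac)
  from summable_diff[OF assms(1) this] show ?thesis
    by (simp add: dif_def left_diff_distrib)
qed

text \<open>Multiplication by \<open>1 - u\<close> telescopes: if \<open>S\<close> is the series and
  \<open>D\<close> the series of differences, then \<open>S * (1 - u) = b 0 - u * D\<close>.\<close>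

lemma summation_by_parts_step:
  fixes u :: complex
  assumes sm: "summable (\<lambda>n. of_real (b n) * u ^ n)" and u: "cmod u < 1"
  shows "cmod (\<Sum>n. of_real (b n) * u ^ n) * cmod (1 - u) \<le> \<bar>b 0\<bar> + cmod (\<Sum>n. of_real (dif b n) * u ^ n)"
proof -
  let ?S = "\<Sum>n. of_real (b n) * u ^ n" and ?D = "\<Sum>n. of_real (dif b n) * u ^ n"
  have smS: "summable (\<lambda>n. of_real (b (Suc n)) * u ^ Suc n)"
    using sm summable_Suc_iff[of "\<lambda>n. of_real (b n) * u ^ n"] by simp
  have "u * ?D = (\<Sum>n. u * (of_real (dif b n) * u ^ n))"
    by (rule suminf_mult[symmetric]) (rule dif_summable[OF assms])
  also have "\<dots> = (\<Sum>n. u * (of_real (b n) * u ^ n) - of_real (b (Suc n)) * u ^ Suc n)"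
    by (intro suminf_cong) (simp add: dif_def algebra_simps)
  also have "\<dots> = u * ?S - (\<Sum>n. of_real (b (Suc n)) * u ^ Suc n)"
    using sm smS by (subst suminf_diff[symmetric]) (auto intro: summable_mult simp: suminf_mult)
  also have "(\<Sum>n. of_real (b (Suc n)) * u ^ Suc n) = ?S - of_real (b 0)"
    using suminf_split_initial_segment[OF sm, of 1] by simp
  finally have "?S * (1 - u) = of_real (b 0) - u * ?D" by (simp add: algebra_simps)
  then have "cmod ?S * cmod (1 - u) = cmod (of_real (b 0) - u * ?D)"
    by (metis norm_mult)
  also have "\<dots> \<le> \<bar>b 0\<bar> + cmod u * cmod ?D"
    using norm_triangle_ineq4[of "of_real (b 0)" "u * ?D"] by (simp add: norm_mult)
  also have "\<dots> \<le> \<bar>b 0\<bar> + 1 * cmod ?D"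
    using u by (intro add_left_mono mult_right_mono) auto
  finally show ?thesis by simp
qed

text \<open>Each step trades one factor \<open>1 / cmod (1 - u)\<close> for one more difference of
  the coefficients and leaves a boundary term.\<close>

lemma summation_by_parts:
  fixes u :: complex
  assumes "summable (\<lambda>n. of_real (b n) * u ^ n)" and u: "cmod u < 1"
  shows "cmod (\<Sum>n. of_real (b n) * u ^ n)
    \<le> (\<Sum>j<k. \<bar>(dif ^^ j) b 0\<bar> / cmod (1 - u) ^ Suc j) + cmod (\<Sum>n. of_real ((dif ^^ k) b n) * u ^ n) / cmod (1 - u) ^ k"
  using assms(1)
proof (induction k arbitrary: b)
  case (Suc k)
  have d: "cmod (1 - u) > 0" using u by auto
  have "cmod (\<Sum>n. of_real (b n) * u ^ n) \<le> \<bar>b 0\<bar> / cmod (1 - u) + cmod (\<Sum>n. of_real (dif b n) * u ^ n) / cmod (1 - u)"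
    using summation_by_parts_step[OF Suc.prems u] d by (simp add: field_simps)
  also have "\<dots> \<le> \<bar>b 0\<bar> / cmod (1 - u) + ((\<Sum>j<k. \<bar>(dif ^^ j) (dif b) 0\<bar> / cmod (1 - u) ^ Suc j)
      + cmod (\<Sum>n. of_real ((dif ^^ k) (dif b) n) * u ^ n) / cmod (1 - u) ^ k) / cmod (1 - u)"
    using Suc.IH[OF dif_summable[OF Suc.prems u]] d by (intro add_left_mono divide_right_mono) auto
  also have "\<dots> = (\<Sum>j<Suc k. \<bar>(dif ^^ j) b 0\<bar> / cmod (1 - u) ^ Suc j) + cmod (\<Sum>n. of_real ((dif ^^ Suc k) b n) * u ^ n) / cmod (1 - u) ^ Suc k"
    by (subst sum.lessThan_Suc_shift) (simp add: funpow_swap1 add_divide_distrib sum_divide_distrib mult_ac)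
  finally show ?case .
qed simp

section \<open>Coefficients of the kernel and size of its series\<close>

context hat_weight
begin

definition m :: "nat \<Rightarrow> real" where "m n = moment \<omega> (real (2 * n + 1))"

text \<open>The model for the moment \<open>m n\<close>, comparable to it from both sides.\<close>

definition pn :: "nat \<Rightarrow> real" where "pn n = \<tau> (1 / real (Suc n))"

lemma pn_pos: "0 < pn n"
  unfolding pn_def by (rule \<tau>_pos) simp

lemma pn_antimono: "i \<le> j \<Longrightarrow> pn j \<le> pn i"
  unfolding pn_def by (intro \<tau>_mono) (auto simp: field_simps)

lemma pn_slow: "pn n \<le> 2 ^ l * pn (Suc n)"
proof -
  have "pn n \<le> \<tau> (2 * (1 / real (Suc (Suc n))))"
    unfolding pn_def by (intro \<tau>_mono) (auto simp: field_simps)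
  also have "\<dots> \<le> 2 ^ l * pn (Suc n)" unfolding pn_def by (rule dbl) simp
  finally show ?thesis .
qed

lemma pn_power:
  assumes "i \<le> j"
  shows "pn i \<le> 2 ^ l * (real (Suc j) / real (Suc i)) ^ l * pn j"
proof -
  have "pn i \<le> 2 ^ l * ((1 / real (Suc i)) / (1 / real (Suc j))) ^ l * pn j"
    unfolding pn_def using assms by (intro \<tau>_power) (auto simp: field_simps)
  then show ?thesis by simp
qed

lemma m_lower: "pn n \<le> exp 1 * 4 ^ l * m n"
proof -
  have "pn n \<le> \<tau> (2 * (1 / real (2 * n + 1)))"
    unfolding pn_def by (intro \<tau>_mono) (auto simp: field_simps)
  also have "\<dots> \<le> 2 ^ l * \<tau> (1 / real (2 * n + 1))" by (rule dbl) simp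
  also have "\<dots> \<le> 2 ^ l * (exp 1 * 2 ^ l * m n)"
    unfolding m_def by (intro mult_left_mono moment_lower) auto
  also have "\<dots> = exp 1 * (2 * 2) ^ l * m n" by (simp only: power_mult_distrib mult_ac)
  finally show ?thesis by simp
qed

lemma m_pos: "0 < m n"
proof -
  have "0 < exp 1 * 4 ^ l * m n" by (rule less_le_trans[OF pn_pos m_lower])
  then show ?thesis by (rule zero_less_mult_pos) simp
qed

text \<open>The exponents \<open>2 * n + 1\<close> increase by two, so a difference in
  \<open>n\<close> only inserts the factor \<open>1 - r\<^sup>2\<close> into the integral. All
  differences are again moments \<open>M k n\<close> and obey the same kind of bound, with one more
  factor \<open>1 / real (Suc n)\<close> per difference.\<close>

lemma symbol_m: "symbol k pn m"
proof -
  define M where "M k n = (\<integral>r. wt \<omega> r * (r powr real (2 * n + 1) * (1 - r\<^sup>2) ^ k) \<partial>lborel)" for k n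
  have le: "norm (wt \<omega> r * (r powr real (2 * n + 1) * (1 - r\<^sup>2) ^ k)) \<le> 2 ^ k * (wt \<omega> r * (r powr real (2 * n + 1) * (1 - r) ^ k))" for k n r
  proof (cases "0 \<le> r \<and> r < 1")
    case True
    have square_bound: "1 - r\<^sup>2 \<le> 2 * (1 - r)"
      using zero_le_power2[of "1 - r"] by (simp add: power2_eq_square algebra_simps)
    have "r\<^sup>2 \<le> 1" using True by (simp add: power_le_one)
    moreover have "(1 - r\<^sup>2) ^ k \<le> (2 * (1 - r)) ^ k"
      using True \<open>r\<^sup>2 \<le> 1\<close> by (intro power_mono) (use square_bound in auto)
    ultimately have "wt \<omega> r * (r powr real (2 * n + 1) * (1 - r\<^sup>2) ^ k) \<le> wt \<omega> r * (r powr real (2 * n + 1) * (2 ^ k * (1 - r) ^ k))"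
      unfolding power_mult_distrib[symmetric]
      using wt_nonneg[OF rw, of r] by (intro mult_left_mono) auto
    then show ?thesis
      using wt_nonneg[OF rw, of r] \<open>r\<^sup>2 \<le> 1\<close> by (simp add: abs_mult mult_ac)
  qed (auto simp: wt_def)
  have int: "integrable lborel (\<lambda>r. wt \<omega> r * (r powr real (2 * n + 1) * (1 - r\<^sup>2) ^ k))" for k n
  proof (rule Bochner_Integration.integrable_bound)
    show "integrable lborel (\<lambda>r. 2 ^ k * (wt \<omega> r * (r powr real (2 * n + 1) * (1 - r) ^ k)))"
      by (intro integrable_mult_right Mom_integrable) simp
    show "AE r in lborel. norm (wt \<omega> r * (r powr real (2 * n + 1) * (1 - r\<^sup>2) ^ k))
        \<le> norm (2 ^ k * (wt \<omega> r * (r powr real (2 * n + 1) * (1 - r) ^ k)))"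
      using le by (intro AE_I2) (metis abs_ge_self order_trans real_norm_def)
  qed measurable
  have bd: "\<bar>M k n\<bar> \<le> 2 ^ k * (fact (k + l + 1) * (real l + 1) * 2 ^ l) * (pn n / real (Suc n) ^ k)" for k n
  proof -
    have "\<bar>M k n\<bar> \<le> (\<integral>r. 2 ^ k * (wt \<omega> r * (r powr real (2 * n + 1) * (1 - r) ^ k)) \<partial>lborel)"
      unfolding M_def real_norm_def[symmetric]
    proof (rule Bochner_Integration.integral_norm_bound_integral[OF int _ le])
      show "integrable lborel (\<lambda>r. 2 ^ k * (wt \<omega> r * (r powr real (2 * n + 1) * (1 - r) ^ k)))"
        by (intro integrable_mult_right Mom_integrable) simp
    qed
    also have "\<dots> = 2 ^ k * Mom k (real (2 * n + 1))"
      unfolding Mom_def by simp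
    also have "\<dots> \<le> 2 ^ k * (fact (k + l + 1) * (real l + 1) * 2 ^ l * \<tau> (1 / real (2 * n + 1)) / real (2 * n + 1) ^ k)"
      by (intro mult_left_mono Mom_upper) auto
    also have "\<dots> \<le> 2 ^ k * (fact (k + l + 1) * (real l + 1) * 2 ^ l * pn n / real (Suc n) ^ k)"
      unfolding pn_def
      by (intro mult_left_mono frac_le power_mono \<tau>_mono mult_nonneg_nonneg less_imp_le[OF \<tau>_pos]) (auto simp: field_simps)
    finally show ?thesis by simp
  qed
  have dM: "M k n - M k (Suc n) = M (Suc k) n" for k n
  proof -
    have "M k n - M k (Suc n) = (\<integral>r. wt \<omega> r * (r powr real (2 * n + 1) * (1 - r\<^sup>2) ^ k)
        - wt \<omega> r * (r powr real (2 * Suc n + 1) * (1 - r\<^sup>2) ^ k) \<partial>lborel)"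
      unfolding M_def by (rule Bochner_Integration.integral_diff[OF int int, symmetric])
    also have "\<dots> = M (Suc k) n"
      unfolding M_def
    proof (rule Bochner_Integration.integral_cong[OF refl])
      fix r :: real
      show "wt \<omega> r * (r powr real (2 * n + 1) * (1 - r\<^sup>2) ^ k) - wt \<omega> r * (r powr real (2 * Suc n + 1) * (1 - r\<^sup>2) ^ k)
          = wt \<omega> r * (r powr real (2 * n + 1) * (1 - r\<^sup>2) ^ Suc k)"
      proof (cases "0 < r")
        case True
        have "r powr real (2 * Suc n + 1) = r powr real (2 * n + 1) * r\<^sup>2"
        proof -
          have "real (2 * Suc n + 1) = real (2 * n + 1) + real 2" by simp
          then show ?thesis using powr_realpow[OF True, of 2] by (simp only: powr_add)
        qed
        then show ?thesis by (simp add: algebra_simps)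
      next
        case False
        then show ?thesis by (cases "r = 0") (auto simp: wt_def)
      qed
    qed
    finally show ?thesis .
  qed
  have "symbol k (\<lambda>n. pn n / real (Suc n) ^ i) (M i)" for k i
  proof (induction k arbitrary: i)
    case 0
    then show ?case using bd[of i] by auto
  next
    case (Suc k)
    have "symbol k (\<lambda>n. pn n / real (Suc n) ^ i / real (Suc n)) (\<lambda>n. M i n - M i (Suc n))"
      using Suc.IH[of "Suc i"] by (simp add: dM mult_ac)
    then show ?case using bd[of i] by auto
  qed
  from this[of k 0] have "symbol k pn (M 0)" by simp
  moreover have "m = M 0"
    by (simp add: fun_eq_iff M_def m_def moment_eq_Mom Mom_def)
  ultimately show ?thesis by simp
qed

lemma symbol_kernel: "symbol k (\<lambda>n. 1 / pn n) (\<lambda>n. 1 / m n)"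
  by (rule symbol_inverse[where c = "2 ^ l" and d = "exp 1 * 4 ^ l"])
     (auto intro: symbol_m pn_pos pn_antimono pn_slow m_lower m_pos)

text \<open>Comparison with the telescoping series of
  \<open>1 / real (N + i) - 1 / real (N + Suc i)\<close>.\<close>

lemma inverse_square_tail:
  assumes "0 < N"
  shows "summable (\<lambda>i. 1 / real (N + i + 1) ^ 2)" "(\<Sum>i. 1 / real (N + i + 1) ^ 2) \<le> 1 / real N"
proof -
  have tel: "(\<lambda>i. 1 / real (N + i) - 1 / real (N + Suc i)) sums (1 / real (N + 0) - 0)"
  proof (rule telescope_sums')
    show "(\<lambda>i. 1 / real (N + i)) \<longlonglongrightarrow> 0"
      by real_asymp
  qed
  have le: "1 / real (N + i + 1) ^ 2 \<le> 1 / real (N + i) - 1 / real (N + Suc i)" for i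
  proof -
    have "1 / real (N + i) - 1 / real (N + Suc i) = 1 / (real (N + i) * real (N + i + 1))"
      using assms by (simp add: field_simps)
    moreover have "1 / real (N + i + 1) ^ 2 \<le> 1 / (real (N + i) * real (N + i + 1))"
      using assms unfolding power2_eq_square by (intro divide_left_mono mult_right_mono mult_pos_pos) auto
    ultimately show ?thesis by simp
  qed
  show sm: "summable (\<lambda>i. 1 / real (N + i + 1) ^ 2)"
    by (rule summable_comparison_test'[OF sums_summable[OF tel], of 0]) (use le in auto)
  have "(\<Sum>i. 1 / real (N + i + 1) ^ 2) \<le> (\<Sum>i. 1 / real (N + i) - 1 / real (N + Suc i))"
    using le sm sums_summable[OF tel] by (intro suminf_le) auto
  also have "\<dots> = 1 / real N" using sums_unique[OF tel] by simp
  finally show "(\<Sum>i. 1 / real (N + i + 1) ^ 2) \<le> 1 / real N" .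
qed

lemma kernel_coeff_bound: "\<exists>C>0. \<forall>n. 1 / m n \<le> C * real (Suc n) ^ l"
proof -
  obtain C where C: "\<And>n. \<bar>1 / m n\<bar> \<le> C * (1 / pn n)"
    using symbol_bound[OF symbol_kernel[of 0]] by blast
  have "1 / m n \<le> (\<bar>C\<bar> * 2 ^ l / pn 0 + 1) * real (Suc n) ^ l" for n
  proof -
    have "pn 0 \<le> 2 ^ l * real (Suc n) ^ l * pn n" using pn_power[of 0 n] by simp
    then have "1 / pn n \<le> 2 ^ l / pn 0 * real (Suc n) ^ l"
      using pn_pos[of n] pn_pos[of 0] by (simp add: field_simps)
    then have "\<bar>C\<bar> * (1 / pn n) \<le> \<bar>C\<bar> * (2 ^ l / pn 0 * real (Suc n) ^ l)"
      by (intro mult_left_mono) auto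
    moreover have "1 / m n \<le> \<bar>C\<bar> * (1 / pn n)"
    proof -
      have "C * (1 / pn n) \<le> \<bar>C\<bar> * (1 / pn n)" using pn_pos[of n] by (intro mult_right_mono) auto
      then show ?thesis using C[of n] by linarith
    qed
    ultimately have "1 / m n \<le> \<bar>C\<bar> * 2 ^ l / pn 0 * real (Suc n) ^ l" by simp
    also have "\<dots> \<le> (\<bar>C\<bar> * 2 ^ l / pn 0 + 1) * real (Suc n) ^ l"
      by (intro mult_right_mono) auto
    finally show ?thesis .
  qed
  moreover have "\<bar>C\<bar> * 2 ^ l / pn 0 + 1 > 0"
    using pn_pos[of 0] by (intro add_nonneg_pos) auto
  ultimately show ?thesis by blast
qed

lemma kernel_summable_aux:
  assumes "0 \<le> x" "x < 1"
  shows "summable (\<lambda>n. 1 / m n * x ^ n)"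
proof -
  obtain C where C: "C > 0" "\<And>n. 1 / m n \<le> C * real (Suc n) ^ l"
    using kernel_coeff_bound by blast
  obtain y where y: "x < y" "y < 1" using assms dense by blast
  have "(\<lambda>n. real (Suc n) ^ l * (x / y) ^ n) \<longlonglongrightarrow> 0"
  proof (cases "x = 0")
    case False
    define q where "q = x / y"
    have "0 < q" "q < 1" using y assms False by (auto simp: q_def)
    then have "(\<lambda>n. real (Suc n) ^ l * q ^ n) \<longlonglongrightarrow> 0" by real_asymp
    then show ?thesis by (simp add: q_def)
  qed (auto simp: power_0_left intro!: tendsto_eventually eventually_sequentiallyI[of 1])
  then have "Bseq (\<lambda>n. real (Suc n) ^ l * (x / y) ^ n)"
    by (intro convergent_imp_Bseq convergentI)
  then obtain B where B: "\<And>n. \<bar>real (Suc n) ^ l * (x / y) ^ n\<bar> \<le> B"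
    by (auto simp: Bseq_def)
  show ?thesis
  proof (rule summable_comparison_test'[of "\<lambda>n. C * B * y ^ n" 0])
    show "summable (\<lambda>n. C * B * y ^ n)"
      using y assms by (intro summable_mult summable_geometric) auto
    fix n
    have "norm (1 / m n * x ^ n) = 1 / m n * x ^ n"
      using m_pos[of n] assms by simp
    also have "\<dots> \<le> C * real (Suc n) ^ l * x ^ n"
      using C assms by (intro mult_right_mono) auto
    also have "\<dots> = C * (real (Suc n) ^ l * (x / y) ^ n) * y ^ n"
      using y assms by (simp add: power_divide)
    also have "\<dots> \<le> C * B * y ^ n"
      using B[of n] C y assms by (intro mult_right_mono mult_left_mono) auto
    finally show "norm (1 / m n * x ^ n) \<le> C * B * y ^ n" .
  qed
qed

lemma kernel_summable:
  fixes u :: complex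
  assumes "cmod u < 1"
  shows "summable (\<lambda>n. of_real (1 / m n) * u ^ n)"
proof (rule summable_norm_cancel)
  show "summable (\<lambda>n. norm (complex_of_real (1 / m n) * u ^ n))"
    using kernel_summable_aux[of "cmod u"] assms m_pos
    by (simp add: norm_mult norm_divide norm_power abs_of_pos)
qed

text \<open>The series is cut at \<open>N\<close> of order \<open>1 / cmod (1 - u)\<close>. Before
  \<open>N\<close> the terms are added up in modulus; after \<open>N\<close> the oscillation of
  \<open>u ^ n\<close> is exploited by summation by parts. Both pieces are of order
  \<open>N / pn N\<close>.\<close>

lemma kernel_series_bound:
  obtains C where "0 < C"
    "\<And>u::complex. cmod u < 1 \<Longrightarrow> cmod (\<Sum>n. of_real (1 / m n) * u ^ n) \<le> C / (cmod (1 - u) * \<tau> (cmod (1 - u)))"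
proof -
  \<comment> \<open>\<open>1 / pn\<close> may grow like the power \<open>l\<close>; two more
    differences make the remaining series comparable to that of the inverse squares.\<close>
  define k where "k = l + 2"
  have "\<forall>j\<in>{..k}. \<exists>C. \<forall>n. \<bar>(dif ^^ j) (\<lambda>n. 1 / m n) n\<bar> \<le> C * (1 / pn n / real (Suc n) ^ j)"
    using symbol_iterate[OF symbol_kernel[of k]] by auto
  then obtain Cj where Cj: "\<And>j n. j \<le> k \<Longrightarrow> \<bar>(dif ^^ j) (\<lambda>n. 1 / m n) n\<bar> \<le> Cj j * (1 / pn n / real (Suc n) ^ j)"
    unfolding bchoice_iff by blast
  define C where "C = 1 + (\<Sum>j\<le>k. \<bar>Cj j\<bar>)"
  have C: "C \<ge> 1" unfolding C_def by (simp add: sum_nonneg)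
  have db: "\<bar>(dif ^^ j) (\<lambda>n. 1 / m n) n\<bar> \<le> C * (1 / pn n / real (Suc n) ^ j)" if "j \<le> k" for j n
  proof -
    have "\<bar>Cj j\<bar> \<le> (\<Sum>j\<le>k. \<bar>Cj j\<bar>)"
      using that by (intro member_le_sum) auto
    then have "Cj j \<le> C" unfolding C_def by linarith
    then have "Cj j * (1 / pn n / real (Suc n) ^ j) \<le> C * (1 / pn n / real (Suc n) ^ j)"
      using pn_pos[of n] by (intro mult_right_mono) auto
    then show ?thesis using Cj[OF that] by (rule order_trans[rotated])
  qed
  define K where "K = C * (3 + real k + 2 ^ l * 6 ^ l) * (2 ^ l * 5 ^ l)"
  have K: "K > 0" using C by (auto simp: K_def intro!: mult_pos_pos add_nonneg_pos add_pos_nonneg)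
  have "cmod (\<Sum>n. of_real (1 / m n) * u ^ n) \<le> K / (cmod (1 - u) * \<tau> (cmod (1 - u)))" if u: "cmod u < 1" for u :: complex
  proof -
    define d where "d = cmod (1 - u)"
    have d: "0 < d" "d < 2"
      using u norm_triangle_ineq4[of 1 u] by (auto simp: d_def)
    define N where "N = nat \<lceil>1 / d\<rceil>"
    have N: "1 / d \<le> real N" "real N < 1 / d + 1"
      using d by (auto simp: N_def of_nat_nat) linarith+
    have Npos: "0 < N" using N(1) d by (cases N) auto
    have N3: "real N \<le> 3 / d"
      using N(2) d by (simp add: field_simps)
    \<comment> \<open>Starting at \<open>N\<close> puts the boundary terms there. Since
      \<open>real (Suc N) * d \<ge> 1\<close>, each of them is at most
      \<open>C / (pn N * d)\<close>, whereas boundary terms at \<open>0\<close> could be of order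
      \<open>1 / d ^ k\<close>.\<close>
    define b where "b i = 1 / m (N + i)" for i
    have dif_b: "(dif ^^ j) b i = (dif ^^ j) (\<lambda>n. 1 / m n) (N + i)" for i j
      by (induction j arbitrary: i) (auto simp: b_def dif_def)
    have sm: "summable (\<lambda>n. of_real (1 / m n) * u ^ n)" by (rule kernel_summable[OF u])
    have smN: "summable (\<lambda>n. of_real (1 / m (n + N)) * u ^ (n + N))"
      using sm by (rule summable_ignore_initial_segment)
    have smb: "summable (\<lambda>n. of_real (b n) * u ^ n)"
    proof (cases "u = 0")
      case True
      then show ?thesis by (intro summable_finite[of "{0}"]) auto
    next
      case False
      have eq: "(\<lambda>n. of_real (b n) * u ^ n) = (\<lambda>n. (1 / u ^ N) * (of_real (1 / m (n + N)) * u ^ (n + N)))"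
        using False by (auto simp: b_def power_add add.commute field_simps)
      show ?thesis unfolding eq by (rule summable_mult[OF smN])
    qed
    have tail: "cmod (\<Sum>n. of_real (b n) * u ^ n) \<le> C * (real k + 2 ^ l * 6 ^ l) / (pn N * d)"
    proof -
      have t1: "(\<Sum>j<k. \<bar>(dif ^^ j) b 0\<bar> / d ^ Suc j) \<le> (\<Sum>j<k. C / (pn N * d))"
      proof (rule sum_mono)
        fix j assume j: "j \<in> {..<k}"
        have "1 \<le> real (Suc N) * d"
          using N(1) d by (simp add: field_simps)
        then have 1: "1 \<le> (real (Suc N) * d) ^ j" by (rule one_le_power)
        have "\<bar>(dif ^^ j) b 0\<bar> / d ^ Suc j \<le> C * (1 / pn N / real (Suc N) ^ j) / d ^ Suc j"
          using db[of j N] j d unfolding dif_b by (intro divide_right_mono) auto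
        also have "\<dots> = C / (pn N * d) / (real (Suc N) * d) ^ j"
          by (simp add: power_mult_distrib mult_ac)
        also have "\<dots> \<le> C / (pn N * d) / 1"
          using 1 C pn_pos[of N] d by (intro divide_left_mono) auto
        finally show "\<bar>(dif ^^ j) b 0\<bar> / d ^ Suc j \<le> C / (pn N * d)" by simp
      qed
      have bd: "norm (of_real ((dif ^^ k) b i) * u ^ i) \<le> C * (2 ^ l / (pn N * real (Suc N) ^ l)) * (1 / real (N + i + 1) ^ 2)" for i
      proof -
        have "pn N \<le> 2 ^ l * (real (Suc (N + i)) / real (Suc N)) ^ l * pn (N + i)" by (rule pn_power) simp
        then have p: "1 / pn (N + i) \<le> 2 ^ l / (pn N * real (Suc N) ^ l) * real (Suc (N + i)) ^ l"
          using pn_pos[of N] pn_pos[of "N + i"] by (simp add: power_divide field_simps)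
        have "norm (of_real ((dif ^^ k) b i) * u ^ i) \<le> \<bar>(dif ^^ k) b i\<bar> * 1"
          using u unfolding norm_mult norm_power norm_of_real by (intro mult_left_mono power_le_one) auto
        also have "\<dots> \<le> C * (1 / pn (N + i) / real (Suc (N + i)) ^ k)"
          using db[of k "N + i"] by (simp add: dif_b)
        also have "\<dots> \<le> C * ((2 ^ l / (pn N * real (Suc N) ^ l) * real (Suc (N + i)) ^ l) / real (Suc (N + i)) ^ k)"
          using p C by (intro mult_left_mono divide_right_mono) auto
        also have "\<dots> = C * (2 ^ l / (pn N * real (Suc N) ^ l)) * (real (Suc (N + i)) ^ l / real (Suc (N + i)) ^ k)"
          by simp
        also have "real (Suc (N + i)) ^ l / real (Suc (N + i)) ^ k = 1 / real (N + i + 1) ^ 2"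
          by (simp add: k_def power_add power2_eq_square del: of_nat_Suc of_nat_add)
        finally show ?thesis .
      qed
      note sq = inverse_square_tail[OF Npos]
      have "cmod (\<Sum>i. of_real ((dif ^^ k) b i) * u ^ i) \<le> (\<Sum>i. C * (2 ^ l / (pn N * real (Suc N) ^ l)) * (1 / real (N + i + 1) ^ 2))"
        using bd sq(1) by (intro norm_suminf_le summable_mult) auto
      also have "\<dots> = C * (2 ^ l / (pn N * real (Suc N) ^ l)) * (\<Sum>i. 1 / real (N + i + 1) ^ 2)"
        by (rule suminf_mult[OF sq(1)])
      also have "\<dots> \<le> C * (2 ^ l / (pn N * real (Suc N) ^ l)) * (1 / real N)"
        using sq(2) C pn_pos[of N] by (intro mult_left_mono) auto
      also have "\<dots> \<le> C * (2 ^ l / (pn N * (1 / d) ^ l)) * (1 / (1 / d))"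
      proof (intro mult_mono mult_left_mono divide_left_mono power_mono)
        show "1 / d \<le> real (Suc N)" using N(1) by simp
      qed (use N(1) C d pn_pos[of N] Npos in auto)
      also have "\<dots> = C * 2 ^ l * d ^ Suc l / pn N"
        using d by (simp add: power_divide)
      finally have "cmod (\<Sum>i. of_real ((dif ^^ k) b i) * u ^ i) / d ^ k \<le> C * 2 ^ l * d ^ Suc l / pn N / d ^ k"
        using d by (intro divide_right_mono) auto
      also have "\<dots> = C * 2 ^ l / (pn N * d)"
        using d by (simp add: k_def)
      also have "\<dots> \<le> C * (2 ^ l * 6 ^ l) / (pn N * d)"
      proof -
        have "(2::real) ^ l * 1 \<le> 2 ^ l * 6 ^ l" by (intro mult_left_mono one_le_power) auto
        then show ?thesis using C d pn_pos[of N] by (intro divide_right_mono mult_left_mono) auto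
      qed
      finally have t2: "cmod (\<Sum>i. of_real ((dif ^^ k) b i) * u ^ i) / d ^ k \<le> C * (2 ^ l * 6 ^ l) / (pn N * d)" .
      have "cmod (\<Sum>n. of_real (b n) * u ^ n) \<le> (\<Sum>j<k. \<bar>(dif ^^ j) b 0\<bar> / d ^ Suc j) + cmod (\<Sum>n. of_real ((dif ^^ k) b n) * u ^ n) / d ^ k"
        unfolding d_def by (rule summation_by_parts[OF smb u])
      also have "\<dots> \<le> (\<Sum>j<k. C / (pn N * d)) + C * (2 ^ l * 6 ^ l) / (pn N * d)"
        by (intro add_mono t1 t2)
      also have "\<dots> = C * (real k + 2 ^ l * 6 ^ l) / (pn N * d)"
        by (simp add: algebra_simps add_divide_distrib)
      finally show ?thesis .
    qed
    have head: "cmod (\<Sum>n<N. of_real (1 / m n) * u ^ n) \<le> C * 3 / (pn N * d)"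
    proof -
      have "cmod (\<Sum>n<N. of_real (1 / m n) * u ^ n) \<le> (\<Sum>n<N. C / pn N)"
      proof (rule sum_norm_le)
        fix n assume n: "n \<in> {..<N}"
        have "norm (of_real (1 / m n) * u ^ n) \<le> \<bar>1 / m n\<bar> * 1"
          using u unfolding norm_mult norm_power norm_of_real by (intro mult_left_mono power_le_one) auto
        also have "\<dots> \<le> C * (1 / pn n)" using db[of 0 n] by simp
        also have "\<dots> \<le> C * (1 / pn N)"
          using C n pn_pos pn_antimono[of n N] by (intro mult_left_mono divide_left_mono mult_pos_pos) auto
        finally show "norm (of_real (1 / m n) * u ^ n) \<le> C / pn N" by simp
      qed
      also have "\<dots> = real N * (C / pn N)" by simp
      also have "\<dots> \<le> 3 / d * (C / pn N)"
        using N3 C pn_pos[of N] by (intro mult_right_mono) auto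
      finally show ?thesis by (simp add: mult_ac)
    qed
    \<comment> \<open>Compares the tail at \<open>d\<close> with the one at the scale
      \<open>1 / real (Suc N)\<close>; \<open>5\<close> bounds \<open>d * real (Suc N)\<close>
      because \<open>real N < 1 / d + 1\<close> and \<open>d < 2\<close>.\<close>
    have low: "\<tau> d \<le> 2 ^ l * 5 ^ l * pn N"
    proof (cases "1 / real (Suc N) \<le> d")
      case True
      have "\<tau> d \<le> 2 ^ l * (d / (1 / real (Suc N))) ^ l * \<tau> (1 / real (Suc N))"
        using True by (intro \<tau>_power) auto
      also have "\<dots> \<le> 2 ^ l * 5 ^ l * \<tau> (1 / real (Suc N))"
      proof (intro mult_right_mono mult_left_mono power_mono)
        show "d / (1 / real (Suc N)) \<le> 5" using N(2) d by (simp add: field_simps)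
        show "0 \<le> d / (1 / real (Suc N))" using d by simp
        show "0 \<le> \<tau> (1 / real (Suc N))" by (intro less_imp_le \<tau>_pos) simp
      qed simp
      finally show ?thesis by (simp add: pn_def)
    next
      case False
      then have "\<tau> d \<le> pn N" unfolding pn_def using d by (intro \<tau>_mono) auto
      also have "1 * pn N \<le> (2 ^ l * 5 ^ l) * pn N"
      proof (rule mult_right_mono)
        have "(1::real) * 1 \<le> 2 ^ l * 5 ^ l" by (intro mult_mono one_le_power) auto
        then show "(1::real) \<le> 2 ^ l * 5 ^ l" by simp
      qed (use pn_pos[of N] in simp)
      finally show ?thesis by simp
    qed
    have "(\<Sum>n. of_real (1 / m n) * u ^ n) = (\<Sum>n. of_real (1 / m (n + N)) * u ^ (n + N)) + (\<Sum>n<N. of_real (1 / m n) * u ^ n)"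
      by (rule suminf_split_initial_segment[OF sm])
    also have "(\<Sum>n. of_real (1 / m (n + N)) * u ^ (n + N)) = u ^ N * (\<Sum>n. of_real (b n) * u ^ n)"
      by (subst suminf_mult[OF smb, symmetric]) (simp add: b_def power_add mult_ac add.commute)
    finally have "cmod (\<Sum>n. of_real (1 / m n) * u ^ n)
        \<le> cmod (u ^ N * (\<Sum>n. of_real (b n) * u ^ n)) + cmod (\<Sum>n<N. of_real (1 / m n) * u ^ n)"
      by (simp add: norm_triangle_ineq)
    also have "\<dots> \<le> C * (real k + 2 ^ l * 6 ^ l) / (pn N * d) + C * 3 / (pn N * d)"
    proof (rule add_mono[OF _ head])
      have "cmod (u ^ N * (\<Sum>n. of_real (b n) * u ^ n)) \<le> 1 * cmod (\<Sum>n. of_real (b n) * u ^ n)"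
        unfolding norm_mult norm_power using u by (intro mult_right_mono power_le_one) auto
      then show "cmod (u ^ N * (\<Sum>n. of_real (b n) * u ^ n)) \<le> C * (real k + 2 ^ l * 6 ^ l) / (pn N * d)"
        using tail by simp
    qed
    also have "\<dots> = C * (3 + real k + 2 ^ l * 6 ^ l) / d * (1 / pn N)"
      by (simp add: algebra_simps add_divide_distrib)
    also have "\<dots> \<le> C * (3 + real k + 2 ^ l * 6 ^ l) / d * (2 ^ l * 5 ^ l / \<tau> d)"
    proof (rule mult_left_mono)
      show "1 / pn N \<le> 2 ^ l * 5 ^ l / \<tau> d"
        using low pn_pos[of N] \<tau>_pos[OF d(1)] by (simp add: field_simps)
    qed (use C d in auto)
    also have "\<dots> = K / (d * \<tau> d)" by (simp add: K_def)
    finally show ?thesis unfolding d_def .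
  qed
  with K show ?thesis by (rule that)
qed

lemma bergman_kernel_eq: "bergman_kernel \<omega> z \<zeta> = (\<Sum>n. of_real (1 / m n) * (cnj z * \<zeta>) ^ n) / 2" if "cmod (cnj z * \<zeta>) < 1"
proof -
  have "(\<Sum>n. of_real (1 / m n) * (cnj z * \<zeta>) ^ n) / 2 = (\<Sum>n. of_real (1 / m n) * (cnj z * \<zeta>) ^ n / 2)"
    by (rule suminf_divide[OF kernel_summable[OF that], symmetric])
  also have "\<dots> = bergman_kernel \<omega> z \<zeta>"
    unfolding bergman_kernel_def m_def by (intro suminf_cong) simp
  finally show ?thesis ..
qed

end

section \<open>Geometry of the disc\<close>

text \<open>The denominator of the Moebius map in modulus; on the disc it dominates
  \<open>1 - cmod z\<close>, \<open>1 - cmod w\<close> and \<open>cmod (z - w)\<close>.\<close>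

definition dd :: "complex \<Rightarrow> complex \<Rightarrow> real" where
  "dd z w = cmod (1 - cnj z * w)"

text \<open>\<open>Q\<close> is the square of the hyperbolic cosine of the hyperbolic distance.\<close>

definition Q :: "complex \<Rightarrow> complex \<Rightarrow> real" where
  "Q z w = (dd z w)\<^sup>2 / ((1 - (cmod z)\<^sup>2) * (1 - (cmod w)\<^sup>2))"

lemma dd_commute: "dd z w = dd w z"
proof -
  have "1 - cnj w * z = cnj (1 - cnj z * w)" by simp
  then show ?thesis unfolding dd_def by (simp only: complex_mod_cnj)
qed

lemma Q_commute: "Q z w = Q w z"
  unfolding Q_def by (simp add: dd_commute[of z w] mult.commute)

lemma borel_measurable_cnj [measurable]: "cnj \<in> borel_measurable borel"
  by (intro borel_measurable_continuous_onI continuous_intros)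

lemma dd_measurable [measurable]:
  "(\<lambda>p. dd (fst p) (snd p)) \<in> borel_measurable (borel \<Otimes>\<^sub>M borel)"
  unfolding dd_def by measurable

lemma dd_measurable1 [measurable]: "dd z \<in> borel_measurable borel"
  unfolding dd_def[abs_def] by measurable

lemma dd_ge:
  assumes "cmod w \<le> 1"
  shows "1 - cmod z \<le> dd z w"
proof -
  have "cmod (cnj z * w) \<le> cmod z * 1"
    unfolding norm_mult complex_mod_cnj using assms by (intro mult_left_mono) auto
  then show ?thesis unfolding dd_def using norm_triangle_ineq2[of 1 "cnj z * w"] by simp
qed

lemma dd_lt_2:
  assumes "cmod z < 1" "cmod w < 1"
  shows "dd z w < 2"
proof -
  have "cmod z * cmod w < 1 * 1"
    using assms by (intro mult_strict_mono') auto
  then show ?thesis unfolding dd_def using norm_triangle_ineq4[of 1 "cnj z * w"] by (simp add: norm_mult)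
qed

text \<open>With \<open>q\<close> the modulus of the disc involution this says
  \<open>1 - q\<^sup>2 = 1 / Q z w\<close>; it yields both \<open>1 \<le> Q z w\<close> and
  \<open>cmod (z - w) \<le> dd z w\<close>.\<close>

lemma dd_sq: "(dd z w)\<^sup>2 - (cmod (z - w))\<^sup>2 = (1 - (cmod z)\<^sup>2) * (1 - (cmod w)\<^sup>2)"
  unfolding dd_def cmod_power2 by (simp add: power2_eq_square algebra_simps)

lemma dist_le_dd:
  assumes "cmod z \<le> 1" "cmod w \<le> 1"
  shows "cmod (z - w) \<le> dd z w"
proof (rule power2_le_imp_le)
  have "0 \<le> (1 - (cmod z)\<^sup>2) * (1 - (cmod w)\<^sup>2)"
    using assms by (intro mult_nonneg_nonneg) (auto simp: power_le_one)
  then show "(cmod (z - w))\<^sup>2 \<le> (dd z w)\<^sup>2" using dd_sq[of z w] by linarith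
qed (simp add: dd_def)

lemma one_minus_sq:
  fixes x :: real
  assumes "0 \<le> x" "x < 1"
  shows "1 - x \<le> 1 - x\<^sup>2" "1 - x\<^sup>2 \<le> 2 * (1 - x)" "0 < 1 - x\<^sup>2"
proof -
  have e: "1 - x\<^sup>2 = (1 - x) * (1 + x)" by (simp add: power2_eq_square algebra_simps)
  show 1: "1 - x \<le> 1 - x\<^sup>2" unfolding e using assms mult_left_mono[of 1 "1 + x" "1 - x"] by simp
  show "1 - x\<^sup>2 \<le> 2 * (1 - x)" unfolding e using assms mult_left_mono[of "1 + x" 2 "1 - x"] by simp
  show "0 < 1 - x\<^sup>2" using 1 assms by simp
qed

lemma Q_lower:
  assumes "cmod z < 1" "cmod w < 1"
  shows "(dd z w)\<^sup>2 \<le> 4 * Q z w * (1 - cmod z) * (1 - cmod w)"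
proof -
  let ?a = "1 - (cmod z)\<^sup>2" and ?b = "1 - (cmod w)\<^sup>2"
  note zw = one_minus_sq[OF norm_ge_zero assms(1)] one_minus_sq[OF norm_ge_zero assms(2)]
  have ab: "0 < ?a" "0 < ?b" using zw by auto
  have "(dd z w)\<^sup>2 = Q z w * (?a * ?b)" unfolding Q_def using ab by simp
  also have "\<dots> \<le> Q z w * ((2 * (1 - cmod z)) * (2 * (1 - cmod w)))"
    using ab assms zw by (intro mult_left_mono mult_mono) (auto simp: Q_def less_imp_le)
  also have "\<dots> = 4 * Q z w * (1 - cmod z) * (1 - cmod w)"
    by algebra
  finally show ?thesis .
qed

lemma Q_upper:
  assumes "cmod z < 1" "cmod w < 1"
  shows "Q z w \<le> (dd z w)\<^sup>2 / ((1 - cmod z) * (1 - cmod w))"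
  unfolding Q_def
  using assms one_minus_sq[OF norm_ge_zero assms(1)] one_minus_sq[OF norm_ge_zero assms(2)]
  by (intro divide_left_mono mult_mono mult_pos_pos) (auto simp: less_imp_le)

lemma Q_ge_1:
  assumes "cmod z < 1" "cmod w < 1"
  shows "1 \<le> Q z w"
proof -
  have "0 < (1 - (cmod z)\<^sup>2) * (1 - (cmod w)\<^sup>2)"
    using assms one_minus_sq by (intro mult_pos_pos) auto
  moreover have "(1 - (cmod z)\<^sup>2) * (1 - (cmod w)\<^sup>2) \<le> (dd z w)\<^sup>2"
    using dd_sq[of z w] zero_le_power2[of "cmod (z - w)"] by linarith
  ultimately show ?thesis unfolding Q_def by simp
qed

text \<open>In the bound of \<open>(dd z w)\<^sup>2\<close> by \<open>4 * Q z w\<close> times both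
  boundary distances, one of these is at most \<open>dd z w\<close> itself and cancels. Points of
  one hyperbolic disc thus have comparable boundary distances, also comparable to
  \<open>dd z w\<close>.\<close>

lemma Q_dd_less:
  assumes "cmod z < 1" "cmod w < 1" "Q z w < R"
  shows "dd z w < 4 * R * (1 - cmod z)" "dd z w < 4 * R * (1 - cmod w)"
proof -
  have w: "1 - cmod w \<le> dd z w" and z: "1 - cmod z \<le> dd z w"
    using dd_ge[of w z] dd_ge[of z w] assms by (auto simp: dd_commute)
  have pos: "0 < dd z w" using w assms by linarith
  have R: "Q z w > 0" using Q_ge_1[of z w] assms by linarith
  have "dd z w * dd z w \<le> 4 * Q z w * (1 - cmod z) * (1 - cmod w)"
    using Q_lower[OF assms(1,2)] by (simp add: power2_eq_square)
  also have "\<dots> \<le> 4 * Q z w * (1 - cmod z) * dd z w"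
    using w R assms by (intro mult_left_mono) auto
  also have "\<dots> < 4 * R * (1 - cmod z) * dd z w"
    using assms pos by (intro mult_strict_right_mono mult_strict_left_mono) auto
  finally show "dd z w < 4 * R * (1 - cmod z)" using pos by simp
  have "dd z w * dd z w \<le> 4 * Q z w * (1 - cmod w) * (1 - cmod z)"
    using Q_lower[OF assms(1,2)] by (simp only: power2_eq_square mult_ac)
  also have "\<dots> \<le> 4 * Q z w * (1 - cmod w) * dd z w"
    using z R assms by (intro mult_left_mono) auto
  also have "\<dots> < 4 * R * (1 - cmod w) * dd z w"
    using assms pos by (intro mult_strict_right_mono mult_strict_left_mono) auto
  finally show "dd z w < 4 * R * (1 - cmod w)" using pos by simp
qed

text \<open>The square of \<open>cosh (a + b) \<le> 2 * cosh a * cosh b\<close>. It rests on the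
  algebraic identity \<open>id\<close>, in which both products are at most
  \<open>dd z x * dd x w\<close> in modulus.\<close>

lemma Q_triangle:
  assumes "cmod z < 1" "cmod w < 1" "cmod x < 1"
  shows "Q z w \<le> 4 * Q z x * Q x w"
proof -
  let ?a = "1 - (cmod z)\<^sup>2" and ?b = "1 - (cmod w)\<^sup>2" and ?c = "1 - (cmod x)\<^sup>2"
  have abc: "0 < ?a" "0 < ?b" "0 < ?c" using assms one_minus_sq by auto
  have nx: "of_real ((cmod x)\<^sup>2) = x * cnj x" by (rule complex_norm_square)
  have id: "of_real ?c * (1 - cnj z * w) = (1 - cnj z * x) * (1 - cnj x * w) - (cnj x - cnj z) * (x - w)"
    unfolding of_real_diff of_real_1 nx by (simp add: algebra_simps)
  have "?c * dd z w = cmod (of_real ?c * (1 - cnj z * w))"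
    using abc unfolding dd_def norm_mult norm_of_real by simp
  also have "\<dots> \<le> dd z x * dd x w + cmod (z - x) * cmod (x - w)"
    unfolding id dd_def norm_mult[symmetric]
    by (rule order_trans[OF norm_triangle_ineq4]) (simp add: norm_mult norm_minus_commute flip: complex_cnj_diff)
  also have "\<dots> \<le> dd z x * dd x w + dd z x * dd x w"
    using dist_le_dd[of z x] dist_le_dd[of x w] assms by (intro add_left_mono mult_mono) (auto simp: dd_def)
  finally have "?c * dd z w \<le> 2 * (dd z x * dd x w)" by linarith
  then have "(?c * dd z w)\<^sup>2 \<le> (2 * (dd z x * dd x w))\<^sup>2"
    using abc by (intro power_mono) (auto simp: dd_def)
  then have "?c\<^sup>2 * (dd z w)\<^sup>2 \<le> 4 * ((dd z x)\<^sup>2 * (dd x w)\<^sup>2)"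
    by (simp add: power_mult_distrib)
  then have "(dd z w)\<^sup>2 \<le> 4 * ((dd z x)\<^sup>2 * (dd x w)\<^sup>2) / ?c\<^sup>2"
    using abc by (simp add: field_simps)
  then have "(dd z w)\<^sup>2 / (?a * ?b) \<le> 4 * ((dd z x)\<^sup>2 * (dd x w)\<^sup>2) / ?c\<^sup>2 / (?a * ?b)"
    using abc by (intro divide_right_mono) auto
  also have "\<dots> = 4 * Q z x * Q x w"
    unfolding Q_def power2_eq_square[of ?c] by (simp only: times_divide_eq_left times_divide_eq_right divide_divide_eq_left mult_ac)
  finally show ?thesis unfolding Q_def .
qed

section \<open>Hyperbolic discs as sublevel sets of \<open>Q\<close>\<close>

definition hball :: "complex \<Rightarrow> real \<Rightarrow> complex set" where
  "hball z R = {w \<in> ball 0 1. Q z w < R}"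

text \<open>\<open>v = (1 + q) / (1 - q)\<close> is the exponential of twice the hyperbolic
  distance. Since \<open>Q z w = 1 / (1 - q\<^sup>2) = (v + 1 / v + 2) / 4\<close> increases with
  \<open>v \<ge> 1\<close>, the condition \<open>v < exp (2 * r)\<close> means
  \<open>Q z w < (cosh r)\<^sup>2\<close>.\<close>

lemma hyp_disc_eq_hball:
  assumes z: "cmod z < 1" and r: "0 < r"
  shows "hyp_disc z r = hball z ((cosh r)\<^sup>2)"
proof -
  have "hyp_dist z w < r \<longleftrightarrow> Q z w < (cosh r)\<^sup>2" if w: "cmod w < 1" for w
  proof -
    define q where "q = cmod (disc_involution z w)"
    have d: "0 < dd z w" using dd_ge[of w z] z w by linarith
    have q: "q = cmod (z - w) / dd z w"
      unfolding q_def disc_involution_def dd_def by (rule norm_divide)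
    have ab: "0 < (1 - (cmod z)\<^sup>2) * (1 - (cmod w)\<^sup>2)"
      using z w one_minus_sq by (intro mult_pos_pos) auto
    have "1 - q\<^sup>2 = ((dd z w)\<^sup>2 - (cmod (z - w))\<^sup>2) / (dd z w)\<^sup>2"
      unfolding q using d by (simp add: power_divide diff_divide_distrib)
    then have q2: "1 - q\<^sup>2 = 1 / Q z w"
      unfolding dd_sq Q_def by simp
    have Q1: "1 \<le> Q z w" using Q_ge_1 z w by blast
    have q0: "0 \<le> q" by (simp add: q_def)
    have "0 < 1 - q\<^sup>2" using q2 Q1 by simp
    then have q1: "q < 1" using q0 by (simp add: power_less_one_iff abs_square_less_1)
    define v where "v = (1 + q) / (1 - q)"
    have v1: "1 \<le> v" using q0 q1 by (simp add: v_def)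
    have Qv: "Q z w = (v + 1 / v + 2) / 4"
    proof -
      have "Q z w = 1 / (1 - q\<^sup>2)" using q2 Q1 by simp
      also have "1 - q\<^sup>2 = (1 - q) * (1 + q)" by (simp add: power2_eq_square algebra_simps)
      also have "1 / ((1 - q) * (1 + q)) = (v + 1 / v + 2) / 4"
        using q0 q1 unfolding v_def by (simp add: divide_simps) (simp add: algebra_simps)
      finally show ?thesis .
    qed
    define V where "V = exp (2 * r)"
    have V1: "1 < V" using r by (simp add: V_def)
    have e: "V = (exp r)\<^sup>2" by (simp add: V_def power2_eq_square flip: exp_add)
    have cV: "(cosh r)\<^sup>2 = (V + 1 / V + 2) / 4"
      unfolding e cosh_def by (simp add: exp_minus power2_eq_square field_simps)
    have "hyp_dist z w < r \<longleftrightarrow> ln v < 2 * r"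
      unfolding hyp_dist_def v_def q_def by auto
    also have "\<dots> \<longleftrightarrow> v < V"
      using v1 unfolding V_def by (metis exp_less_cancel_iff exp_ln less_le_trans zero_less_one)
    also have "\<dots> \<longleftrightarrow> v + 1 / v < V + 1 / V"
    proof -
      have "(V + 1 / V) - (v + 1 / v) = (V - v) * (1 - 1 / (v * V))"
        using v1 V1 by (simp add: field_simps)
      moreover have "0 < 1 - 1 / (v * V)"
        using v1 V1 mult_le_less_imp_less[of 1 v 1 V] by simp
      ultimately show ?thesis
        by (smt (verit) mult_pos_pos mult_le_0_iff)
    qed
    also have "\<dots> \<longleftrightarrow> Q z w < (cosh r)\<^sup>2"
      unfolding Qv cV by auto
    finally show ?thesis .
  qed
  then show ?thesis unfolding hyp_disc_def hball_def by auto
qed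

lemma hball_measurable [measurable]: "hball z R \<in> sets borel"
proof -
  have "hball z R = ball 0 1 \<inter> {w. Q z w < R}" by (auto simp: hball_def)
  also have "\<dots> \<in> sets borel" unfolding Q_def by measurable
  finally show ?thesis .
qed

lemma hball_commute: "cmod z < 1 \<Longrightarrow> w \<in> hball z R \<Longrightarrow> z \<in> hball w R"
  by (auto simp: hball_def Q_commute)

lemma hball_triangle:
  assumes "cmod z < 1" "x \<in> hball z R" "w \<in> hball x R'"
  shows "w \<in> hball z (4 * R * R')"
proof -
  have n: "cmod x < 1" "cmod w < 1" and q: "Q z x < R" "Q x w < R'" using assms by (auto simp: hball_def)
  have "Q z w \<le> 4 * Q z x * Q x w" using assms n by (intro Q_triangle) auto
  also have "\<dots> = 4 * (Q z x * Q x w)" by simp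
  also have "Q z x * Q x w < R * R'"
    using q Q_ge_1[of z x] Q_ge_1[of x w] assms n by (intro mult_strict_mono) auto
  finally show ?thesis using n by (simp add: hball_def)
qed

lemma hball_mono: "R \<le> R' \<Longrightarrow> hball z R \<subseteq> hball z R'"
  by (auto simp: hball_def)

section \<open>Arcs, Carleson boxes and averages over hyperbolic discs\<close>

lemma sin_chord:
  assumes "0 \<le> x" "x \<le> pi / 2"
  shows "2 * x / pi \<le> sin x"
proof -
  have "convex_on {0..pi} (\<lambda>x. - sin x)"
    by (rule f''_ge0_imp_convex[where f' = "\<lambda>x. - cos x" and f'' = sin])
       (auto intro!: derivative_eq_intros sin_ge_zero)
  from convex_onD[OF this, of "2 * x / pi" 0 "pi / 2"] show ?thesis
    using assms by (simp add: field_simps)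
qed

lemma circ_chord:
  assumes "0 \<le> t" "t \<le> 1"
  shows "4 * min t (1 - t) \<le> cmod (1 - circ t)"
proof -
  have "cmod (1 - circ t) = cmod (exp (\<i> * of_real (2 * pi * t)) - 1)"
    by (simp add: cis_conv_exp norm_minus_commute)
  also have "\<dots> = 2 * \<bar>sin (pi * t)\<bar>" unfolding dist_exp_i_1 by simp
  finally have e: "cmod (1 - circ t) = 2 * \<bar>sin (pi * t)\<bar>" .
  have s: "sin (pi * t) = sin (pi * (1 - t))"
    by (simp add: algebra_simps sin_diff)
  show ?thesis
  proof (cases "t \<le> 1 / 2")
    case True
    then have "2 * (pi * t) / pi \<le> sin (pi * t)" using assms by (intro sin_chord) auto
    then show ?thesis using e True by simp
  next
    case False
    then have "2 * (pi * (1 - t)) / pi \<le> sin (pi * (1 - t))" using assms by (intro sin_chord) auto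
    then show ?thesis using e False s by simp
  qed
qed

text \<open>After a rotation \<open>cnj z * v\<close> is a number \<open>\<rho>\<close> in
  \<open>[0, 1]\<close>. Replacing \<open>\<rho>\<close> by \<open>1\<close> at most doubles the
  distance to \<open>1\<close>, so by the chord estimate \<open>t\<close> is within
  \<open>x / 2\<close> of \<open>0\<close> or \<open>1\<close>: two intervals of length
  \<open>x / 2\<close>.\<close>

lemma arc_measure:
  assumes z: "cmod z \<le> 1" and v: "cmod v \<le> 1" and x: "0 \<le> x"
  shows "(\<integral>\<^sup>+t. indicator {w. dd z w < x} (circ t * v) * indicator {0..1} t \<partial>lborel) \<le> ennreal x"
proof -
  define \<rho> where "\<rho> = cmod (cnj z * v)"
  have "cmod z * cmod v \<le> 1 * 1" using z v by (intro mult_mono) auto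
  then have \<rho>: "0 \<le> \<rho>" "\<rho> \<le> 1" by (auto simp: \<rho>_def norm_mult)
  define F :: "complex \<Rightarrow> ennreal" where "F = indicator {u. cmod (1 - u) < x}"
  have [measurable]: "F \<in> borel_measurable borel" unfolding F_def by measurable
  have "(\<integral>\<^sup>+t. indicator {w. dd z w < x} (circ t * v) * indicator {0..1} t \<partial>lborel)
      = (\<integral>\<^sup>+t. F (circ t * (cnj z * v)) * indicator {0..1} t \<partial>lborel)"
    by (intro nn_integral_cong) (auto simp: F_def dd_def indicator_def mult_ac)
  also have "\<dots> = (\<integral>\<^sup>+t. F (circ t * of_real \<rho>) * indicator {0..1} t \<partial>lborel)"
    by (rule nn_integral_circ_rotate) (simp_all add: \<rho>_def)
  also have "\<dots> \<le> (\<integral>\<^sup>+t. indicator {0..x / 2} t + indicator {1 - x / 2..1} t \<partial>lborel)"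
  proof (rule nn_integral_mono)
    fix t :: real
    show "F (circ t * of_real \<rho>) * indicator {0..1} t \<le> indicator {0..x / 2} t + indicator {1 - x / 2..1} t"
    proof (cases "t \<in> {0..1} \<and> cmod (1 - circ t * of_real \<rho>) < x")
      case True
      have "cmod (1 - circ t) \<le> cmod (1 - circ t * of_real \<rho>) + cmod (circ t * of_real \<rho> - circ t)"
        using norm_triangle_ineq[of "1 - circ t * of_real \<rho>" "circ t * of_real \<rho> - circ t"] by simp
      also have "circ t * of_real \<rho> - circ t = circ t * of_real (\<rho> - 1)" by (simp add: algebra_simps)
      also have "cmod (circ t * of_real (\<rho> - 1)) = 1 - \<rho>"
        unfolding norm_mult norm_of_real using \<rho> by simp
      also have "1 - \<rho> \<le> cmod (1 - circ t * of_real \<rho>)"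
        using norm_triangle_ineq2[of 1 "circ t * of_real \<rho>"] \<rho> by (simp add: norm_mult)
      finally have "cmod (1 - circ t) \<le> 2 * x" using True by simp
      then have "min t (1 - t) \<le> x / 2" using circ_chord[of t] True by simp
      then have "t \<le> x / 2 \<or> 1 - x / 2 \<le> t" by linarith
      then have "t \<in> {0..x / 2} \<or> t \<in> {1 - x / 2..1}" using True by auto
      then show ?thesis by (auto simp: indicator_def F_def)
    qed (auto simp: F_def indicator_def)
  qed
  also have "\<dots> = ennreal (x / 2) + ennreal (x / 2)"
    using x by (subst nn_integral_add) auto
  also have "\<dots> = ennreal x" using x by (subst ennreal_plus[symmetric]) auto
  finally show ?thesis .
qed

text \<open>Every circle about the origin meets the box in an arc of measure at most
  \<open>x\<close>, and circles of radius below \<open>1 - x\<close> do not meet it.\<close>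

lemma nn_integral_box:
  fixes h :: "real \<Rightarrow> ennreal"
  assumes [measurable]: "h \<in> borel_measurable borel" and z: "cmod z \<le> 1" and x: "0 \<le> x"
  shows "(\<integral>\<^sup>+w. h (cmod w) * indicator (ball 0 1) w * indicator {w. dd z w < x} w \<partial>lborel)
    \<le> ennreal x * (\<integral>\<^sup>+r. h r * ennreal (2 * pi * r) * indicator {max 0 (1 - x)..<1} r \<partial>lborel)"
proof -
  have "(\<integral>\<^sup>+w. h (cmod w) * indicator (ball 0 1) w * indicator {w. dd z w < x} w \<partial>lborel)
      = (\<integral>\<^sup>+w. (\<integral>\<^sup>+t. (h (cmod (circ t * w)) * indicator (ball 0 1) (circ t * w) * indicator {w. dd z w < x} (circ t * w)) * indicator {0..1} t \<partial>lborel) \<partial>lborel)"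
    by (rule nn_integral_lborel_circle) measurable
  also have "\<dots> = (\<integral>\<^sup>+w. (\<integral>\<^sup>+t. (h (cmod w) * indicator (ball 0 1) w) * (indicator {w. dd z w < x} (circ t * w) * indicator {0..1} t) \<partial>lborel) \<partial>lborel)"
    by (intro nn_integral_cong) (auto simp: norm_mult indicator_def)
  also have "\<dots> = (\<integral>\<^sup>+w. (h (cmod w) * indicator (ball 0 1) w) * (\<integral>\<^sup>+t. indicator {w. dd z w < x} (circ t * w) * indicator {0..1} t \<partial>lborel) \<partial>lborel)"
    by (intro nn_integral_cong nn_integral_cmult) measurable
  also have "\<dots> \<le> (\<integral>\<^sup>+w. ennreal x * ((h (cmod w) * indicator {1 - x..} (cmod w)) * indicator (ball 0 1) w) \<partial>lborel)"
  proof (rule nn_integral_mono)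
    fix w :: complex
    let ?I = "\<integral>\<^sup>+t. indicator {w. dd z w < x} (circ t * w) * indicator {0..1} t \<partial>lborel"
    show "(h (cmod w) * indicator (ball 0 1) w) * ?I \<le> ennreal x * ((h (cmod w) * indicator {1 - x..} (cmod w)) * indicator (ball 0 1) w)"
    proof (cases "cmod w < 1")
      case w: True
      show ?thesis
      proof (cases "1 - x \<le> cmod w")
        case True
        have "?I \<le> ennreal x" using w z x by (intro arc_measure) auto
        then have "h (cmod w) * ?I \<le> h (cmod w) * ennreal x" by (rule mult_left_mono) simp
        then show ?thesis using True w by (simp add: mult.commute)
      next
        case False
        have "\<not> dd z (circ t * w) < x" for t
          using dd_ge[of z "circ t * w"] False z by (simp add: dd_commute[of z] norm_mult)
        then have "?I = 0" by simp
        then show ?thesis by simp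
      qed
    qed simp
  qed
  also have "\<dots> = ennreal x * (\<integral>\<^sup>+w. (h (cmod w) * indicator {1 - x..} (cmod w)) * indicator (ball 0 1) w \<partial>lborel)"
    by (rule nn_integral_cmult) measurable
  also have "(\<integral>\<^sup>+w. (h (cmod w) * indicator {1 - x..} (cmod w)) * indicator (ball 0 1) w \<partial>lborel)
      = (\<integral>\<^sup>+r. h r * indicator {1 - x..} r * ennreal (2 * pi * r) * indicator {0..<1} r \<partial>lborel)"
    by (rule nn_integral_lborel_radial) measurable
  also have "\<dots> = (\<integral>\<^sup>+r. h r * ennreal (2 * pi * r) * indicator {max 0 (1 - x)..<1} r \<partial>lborel)"
    by (intro nn_integral_cong) (auto simp: indicator_def)
  finally show ?thesis .
qed

text \<open>Sub-mean value property on the Euclidean disc about \<open>x\<close> with half the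
  boundary distance as radius, then an exchange of integrals. The averaging point \<open>w\<close>
  becomes the outer variable, so that the rough density \<open>h\<close> is seen only through
  integrals over hyperbolic discs.\<close>

lemma nn_integral_local_average:
  fixes G :: "complex \<Rightarrow> complex" and u h :: "complex \<Rightarrow> ennreal"
  assumes hol: "G holomorphic_on ball 0 1" and R: "13 \<le> R"
    and [measurable]: "u \<in> borel_measurable borel" "h \<in> borel_measurable borel"
  shows "(\<integral>\<^sup>+x. ennreal (cmod (G x)) * u x * (h x * indicator (ball 0 1) x) \<partial>lborel)
    \<le> (\<integral>\<^sup>+w. ennreal (9 / pi * cmod (G w) / (1 - cmod w)\<^sup>2) * indicator (ball 0 1) w *
          (\<integral>\<^sup>+x. u x * indicator (hball w R) x * (h x * indicator (ball 0 1) x) \<partial>lborel) \<partial>lborel)"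
proof -
  define G0 where "G0 z = indicator (ball 0 1) z *\<^sub>R G z" for z
  have [measurable]: "G0 \<in> borel_measurable borel"
    unfolding G0_def[abs_def] by (rule holomorphic_ball_indicator_measurable[OF hol])
  define K where "K w = ennreal (9 / pi * cmod (G0 w) / (1 - cmod w)\<^sup>2) * indicator (ball 0 1) w" for w
  have [measurable]: "K \<in> borel_measurable borel" unfolding K_def[abs_def] by measurable
  have pt: "ennreal (cmod (G x)) \<le> (\<integral>\<^sup>+w. K w * indicator (hball w R) x \<partial>lborel)" if x: "cmod x < 1" for x
  proof -
    \<comment> \<open>On this disc \<open>\<rho> \<le> 1 - cmod w \<le> 3 * \<rho>\<close> and
      \<open>dd w x \<le> 5 * \<rho>\<close>, hence \<open>Q w x \<le> 25 / 2\<close>. These numbers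
      are the origin of \<open>9\<close> in the kernel and of the hypothesis
      \<open>13 \<le> R\<close>.\<close>
    define \<rho> where "\<rho> = (1 - cmod x) / 2"
    have \<rho>: "0 < \<rho>" using x by (simp add: \<rho>_def)
    have sub: "ball x \<rho> \<subseteq> ball 0 1"
    proof
      fix w assume "w \<in> ball x \<rho>"
      then have "cmod (w - x) < \<rho>" by (simp add: dist_norm norm_minus_commute)
      then have "cmod w < cmod x + \<rho>" using norm_triangle_sub[of w x] by linarith
      moreover have "\<rho> < 1 - cmod x" using x by (simp add: \<rho>_def)
      ultimately have "cmod w < 1" by linarith
      then show "w \<in> ball 0 1" by simp
    qed
    have "ennreal (cmod (G x)) = ennreal (1 / (pi * \<rho>\<^sup>2)) * ennreal (pi * \<rho>\<^sup>2 * cmod (G x))"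
      using \<rho> by (simp add: ennreal_mult'[symmetric])
    also have "\<dots> \<le> ennreal (1 / (pi * \<rho>\<^sup>2)) * (\<integral>\<^sup>+w. ennreal (cmod (G w)) * indicator (ball x \<rho>) w \<partial>lborel)"
      by (intro mult_left_mono area_submean holomorphic_on_subset[OF hol sub] \<rho>) auto
    also have "(\<integral>\<^sup>+w. ennreal (cmod (G w)) * indicator (ball x \<rho>) w \<partial>lborel) = (\<integral>\<^sup>+w. ennreal (cmod (G0 w)) * indicator (ball x \<rho>) w \<partial>lborel)"
      using sub by (intro nn_integral_cong) (auto simp: G0_def indicator_def)
    also have "ennreal (1 / (pi * \<rho>\<^sup>2)) * \<dots> = (\<integral>\<^sup>+w. ennreal (1 / (pi * \<rho>\<^sup>2)) * (ennreal (cmod (G0 w)) * indicator (ball x \<rho>) w) \<partial>lborel)"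
      by (rule nn_integral_cmult[symmetric]) measurable
    also have "\<dots> \<le> (\<integral>\<^sup>+w. K w * indicator (hball w R) x \<partial>lborel)"
    proof (rule nn_integral_mono)
      fix w
      show "ennreal (1 / (pi * \<rho>\<^sup>2)) * (ennreal (cmod (G0 w)) * indicator (ball x \<rho>) w) \<le> K w * indicator (hball w R) x"
      proof (cases "w \<in> ball x \<rho>")
        case True
        have w1: "cmod w < 1" using True sub by auto
        have dw: "cmod (w - x) < \<rho>" using True by (simp add: dist_norm norm_minus_commute)
        have up: "1 - cmod w \<le> 3 * \<rho>" and lo: "\<rho> \<le> 1 - cmod w"
          using norm_triangle_ineq2[of x w] norm_triangle_ineq2[of w x] dw
          by (auto simp: \<rho>_def norm_minus_commute field_simps)
        have "dd w x \<le> 5 * \<rho>"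
        proof -
          have "1 - cnj w * x = of_real (1 - (cmod x)\<^sup>2) - cnj (w - x) * x"
            unfolding of_real_diff complex_norm_square by (simp add: algebra_simps)
          then have "dd w x \<le> \<bar>1 - (cmod x)\<^sup>2\<bar> + cmod (w - x) * cmod x"
            unfolding dd_def using norm_triangle_ineq4[of "of_real (1 - (cmod x)\<^sup>2)" "cnj (w - x) * x"]
            by (simp only: norm_mult complex_mod_cnj norm_of_real)
          also have "\<bar>1 - (cmod x)\<^sup>2\<bar> \<le> 2 * (1 - cmod x)" using one_minus_sq[of "cmod x"] x by simp
          also have "cmod (w - x) * cmod x \<le> \<rho> * 1" using dw x \<rho> by (intro mult_mono) auto
          finally show ?thesis by (simp add: \<rho>_def field_simps)
        qed
        have "Q w x \<le> (dd w x)\<^sup>2 / ((1 - cmod w) * (1 - cmod x))"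
          by (rule Q_upper[OF w1 x])
        also have "\<dots> \<le> (5 * \<rho>)\<^sup>2 / (\<rho> * (2 * \<rho>))"
          using \<open>dd w x \<le> 5 * \<rho>\<close> lo \<rho> x w1
          by (intro frac_le power_mono mult_mono mult_pos_pos) (auto simp: dd_def \<rho>_def less_imp_le)
        also have "\<dots> = 25 / 2" using \<rho> by (simp add: power2_eq_square)
        finally have "x \<in> hball w R" using R x by (simp add: hball_def)
        moreover have "1 / (pi * \<rho>\<^sup>2) * cmod (G0 w) \<le> 9 / pi * cmod (G0 w) / (1 - cmod w)\<^sup>2"
        proof -
          have "(1 - cmod w)\<^sup>2 \<le> (3 * \<rho>)\<^sup>2" using up w1 by (intro power_mono) auto
          then have "1 / \<rho>\<^sup>2 \<le> 9 / (1 - cmod w)\<^sup>2" using \<rho> w1 by (simp add: power_mult_distrib field_simps)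
          then have "1 / \<rho>\<^sup>2 * (cmod (G0 w) / pi) \<le> 9 / (1 - cmod w)\<^sup>2 * (cmod (G0 w) / pi)"
            by (intro mult_right_mono) auto
          then show ?thesis by (simp add: mult_ac)
        qed
        ultimately show ?thesis using True w1
          by (simp add: K_def ennreal_mult'[symmetric] ennreal_leI)
      qed simp
    qed
    finally show ?thesis .
  qed
  have "(\<integral>\<^sup>+x. ennreal (cmod (G x)) * u x * (h x * indicator (ball 0 1) x) \<partial>lborel)
      \<le> (\<integral>\<^sup>+x. (\<integral>\<^sup>+w. K w * indicator (hball w R) x * (u x * (h x * indicator (ball 0 1) x)) \<partial>lborel) \<partial>lborel)"
  proof (rule nn_integral_mono)
    fix x
    show "ennreal (cmod (G x)) * u x * (h x * indicator (ball 0 1) x)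
        \<le> (\<integral>\<^sup>+w. K w * indicator (hball w R) x * (u x * (h x * indicator (ball 0 1) x)) \<partial>lborel)"
    proof (cases "cmod x < 1")
      case True
      have [measurable]: "(\<lambda>w. indicator (hball w R) x :: ennreal) \<in> borel_measurable borel"
        unfolding indicator_def hball_def Q_def dd_def mem_Collect_eq by measurable
      have "(\<integral>\<^sup>+w. K w * indicator (hball w R) x * (u x * (h x * indicator (ball 0 1) x)) \<partial>lborel)
          = (\<integral>\<^sup>+w. K w * indicator (hball w R) x \<partial>lborel) * (u x * (h x * indicator (ball 0 1) x))"
        by (rule nn_integral_multc) measurable
      then show ?thesis
        using mult_right_mono[OF pt[OF True], of "u x * (h x * indicator (ball 0 1) x)"] by (simp add: mult.assoc)
    qed simp
  qed
  also have "\<dots> = (\<integral>\<^sup>+w. (\<integral>\<^sup>+x. K w * indicator (hball w R) x * (u x * (h x * indicator (ball 0 1) x)) \<partial>lborel) \<partial>lborel)"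
  proof (rule lborel_pair.Fubini')
    have [measurable]: "(\<lambda>p. indicator (hball (fst p) R) (snd p) :: ennreal) \<in> borel_measurable (borel \<Otimes>\<^sub>M borel)"
      unfolding indicator_def hball_def Q_def dd_def mem_Collect_eq by measurable
    show "(\<lambda>(w, x). K w * indicator (hball w R) x * (u x * (h x * indicator (ball 0 1) x))) \<in> borel_measurable (lborel \<Otimes>\<^sub>M lborel)"
      unfolding case_prod_beta by measurable
  qed
  also have "\<dots> = (\<integral>\<^sup>+w. K w * (\<integral>\<^sup>+x. u x * indicator (hball w R) x * (h x * indicator (ball 0 1) x) \<partial>lborel) \<partial>lborel)"
    by (subst nn_integral_cmult[symmetric]) (auto simp: mult_ac)
  also have "\<dots> = (\<integral>\<^sup>+w. ennreal (9 / pi * cmod (G w) / (1 - cmod w)\<^sup>2) * indicator (ball 0 1) w *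
          (\<integral>\<^sup>+x. u x * indicator (hball w R) x * (h x * indicator (ball 0 1) x) \<partial>lborel) \<partial>lborel)"
    by (intro nn_integral_cong) (simp add: K_def G0_def indicator_def)
  finally show ?thesis .
qed

section \<open>Estimates for the weight and its regularisation\<close>

context D_weight
begin

definition hm :: "complex \<Rightarrow> ennreal" where
  "hm w = ennreal (wt \<omega> (cmod w) / pi)"

text \<open>
  A substitute for \<open>\<omega>\<close>, which may vanish on Whitney regions: both weights give comparable mass to
  Carleson boxes, but this one is almost constant on hyperbolic discs.
\<close>

definition hn :: "complex \<Rightarrow> ennreal" where
  "hn w = ennreal (\<tau> (1 - cmod w) / (1 - cmod w))"

lemma hm_meas [measurable]: "hm \<in> borel_measurable borel"
  unfolding hm_def[abs_def] by measurable

lemma hn_meas [measurable]: "hn \<in> borel_measurable borel"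
  unfolding hn_def[abs_def] by measurable

lemma hm_outside: "\<not> cmod w < 1 \<Longrightarrow> hm w = 0"
  by (auto simp: hm_def wt_def)

lemma hn_outside: "\<not> cmod w < 1 \<Longrightarrow> hn w = 0"
  by (auto simp: hn_def tau_nonpos)

text \<open>Reverse doubling makes \<open>\<tau> v\<close> vanish like
  \<open>v powr \<alpha>\<close> at \<open>0\<close>, which compensates the singularity
  \<open>v powr (- \<gamma> - 1)\<close> for \<open>\<gamma> < \<alpha>\<close>.\<close>

lemma tau_power_integral:
  assumes t: "0 < t" "t \<le> 8" and g: "\<gamma> < \<alpha>"
  shows "(\<integral>\<^sup>+v. ennreal (v powr (- \<gamma> - 1) * \<tau> v) * indicator {0..t} v \<partial>lborel)
    \<le> ennreal (A / (\<alpha> - \<gamma>) * t powr (- \<gamma>) * \<tau> t)"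
proof -
  have "(\<integral>\<^sup>+v. ennreal (v powr (- \<gamma> - 1) * \<tau> v) * indicator {0..t} v \<partial>lborel)
      \<le> (\<integral>\<^sup>+v. ennreal (A * t powr (- \<alpha>) * \<tau> t) * (ennreal (v powr ((\<alpha> - \<gamma>) - 1)) * indicator {0..t} v) \<partial>lborel)"
  proof (rule nn_integral_mono)
    fix v :: real
    show "ennreal (v powr (- \<gamma> - 1) * \<tau> v) * indicator {0..t} v
        \<le> ennreal (A * t powr (- \<alpha>) * \<tau> t) * (ennreal (v powr ((\<alpha> - \<gamma>) - 1)) * indicator {0..t} v)"
    proof (cases "0 < v \<and> v \<le> t")
      case True
      have "v powr (- \<gamma> - 1) * \<tau> v \<le> v powr (- \<gamma> - 1) * (A * (v / t) powr \<alpha> * \<tau> t)"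
        using True t by (intro mult_left_mono rev) auto
      also have "\<dots> = A * t powr (- \<alpha>) * \<tau> t * (v powr (- \<gamma> - 1) * v powr \<alpha>)"
        using True t by (simp add: powr_divide powr_minus field_simps)
      also have "v powr (- \<gamma> - 1) * v powr \<alpha> = v powr ((\<alpha> - \<gamma>) - 1)"
        by (simp add: powr_add[symmetric] algebra_simps)
      finally show ?thesis
        using True A \<tau>_pos[of t] t by (simp add: ennreal_mult'[symmetric] ennreal_leI)
    next
      case False
      then show ?thesis by (auto simp: indicator_def tau_nonpos)
    qed
  qed
  also have "\<dots> = ennreal (A * t powr (- \<alpha>) * \<tau> t) * ennreal (t powr (\<alpha> - \<gamma>) / (\<alpha> - \<gamma>))"
    using t g nn_integral_powr_Icc[of "\<alpha> - \<gamma>" t] by (subst nn_integral_cmult) auto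
  also have "\<dots> = ennreal (A / (\<alpha> - \<gamma>) * (t powr (- \<alpha>) * t powr (\<alpha> - \<gamma>)) * \<tau> t)"
    using A g \<tau>_pos[of t] t by (simp add: ennreal_mult'[symmetric] mult_ac)
  also have "t powr (- \<alpha>) * t powr (\<alpha> - \<gamma>) = t powr (- \<gamma>)"
    by (simp add: powr_add[symmetric])
  finally show ?thesis .
qed

text \<open>The sets \<open>{w. dd z w < t}\<close> play the role of Carleson boxes.\<close>

definition box_bounded :: "(complex \<Rightarrow> ennreal) \<Rightarrow> bool" where
  "box_bounded h \<longleftrightarrow> h \<in> borel_measurable borel \<and> (\<forall>w. \<not> cmod w < 1 \<longrightarrow> h w = 0) \<and>
    (\<forall>\<gamma>. 0 \<le> \<gamma> \<longrightarrow> \<gamma> < \<alpha> \<longrightarrow> (\<exists>C\<ge>0. \<forall>z t. cmod z < 1 \<longrightarrow> 0 < t \<longrightarrow> t \<le> 4 \<longrightarrow>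
      (\<integral>\<^sup>+w. ennreal ((1 - cmod w) powr (- \<gamma>)) * indicator {w. dd z w < t} w * h w \<partial>lborel)
        \<le> ennreal (C * t powr (1 - \<gamma>) * \<tau> t)))"

lemma box_bounded_hn: "box_bounded hn"
  unfolding box_bounded_def
proof (intro conjI allI impI hn_outside hn_meas)
  fix \<gamma> :: real assume g: "0 \<le> \<gamma>" "\<gamma> < \<alpha>"
  show "\<exists>C\<ge>0. \<forall>z t. cmod z < 1 \<longrightarrow> 0 < t \<longrightarrow> t \<le> 4 \<longrightarrow>
      (\<integral>\<^sup>+w. ennreal ((1 - cmod w) powr (- \<gamma>)) * indicator {w. dd z w < t} w * hn w \<partial>lborel)
        \<le> ennreal (C * t powr (1 - \<gamma>) * \<tau> t)"
  proof (intro exI[of _ "2 * pi * (A / (\<alpha> - \<gamma>))"] conjI allI impI)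
    fix z :: complex and t :: real assume z: "cmod z < 1" and t: "0 < t" "t \<le> 4"
    have "(\<integral>\<^sup>+w. ennreal ((1 - cmod w) powr (- \<gamma>)) * indicator {w. dd z w < t} w * hn w \<partial>lborel)
        = (\<integral>\<^sup>+w. ennreal ((1 - cmod w) powr (- \<gamma> - 1) * \<tau> (1 - cmod w)) * indicator (ball 0 1) w * indicator {w. dd z w < t} w \<partial>lborel)"
    proof (rule nn_integral_cong)
      fix w :: complex
      show "ennreal ((1 - cmod w) powr (- \<gamma>)) * indicator {w. dd z w < t} w * hn w
          = ennreal ((1 - cmod w) powr (- \<gamma> - 1) * \<tau> (1 - cmod w)) * indicator (ball 0 1) w * indicator {w. dd z w < t} w"
      proof (cases "cmod w < 1")
        case True
        have e: "(1 - cmod w) powr (- \<gamma> - 1) = (1 - cmod w) powr (- \<gamma>) / (1 - cmod w)"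
          using True by (simp add: powr_diff)
        show ?thesis
          using True \<tau>_pos[of "1 - cmod w"] unfolding e hn_def
          by (auto simp: indicator_def ennreal_mult'[symmetric])
      qed (simp add: hn_outside)
    qed
    also have "\<dots> \<le> ennreal t * (\<integral>\<^sup>+r. ennreal ((1 - r) powr (- \<gamma> - 1) * \<tau> (1 - r)) * ennreal (2 * pi * r) * indicator {max 0 (1 - t)..<1} r \<partial>lborel)"
      using z t by (intro nn_integral_box[where h = "\<lambda>r. ennreal ((1 - r) powr (- \<gamma> - 1) * \<tau> (1 - r))"]) auto
    also have "\<dots> \<le> ennreal t * (\<integral>\<^sup>+r. ennreal (2 * pi) * (ennreal ((1 - r) powr (- \<gamma> - 1) * \<tau> (1 - r)) * indicator {0..t} (1 - r)) \<partial>lborel)"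
    proof (rule mult_left_mono[OF nn_integral_mono])
      fix r :: real
      show "ennreal ((1 - r) powr (- \<gamma> - 1) * \<tau> (1 - r)) * ennreal (2 * pi * r) * indicator {max 0 (1 - t)..<1} r
        \<le> ennreal (2 * pi) * (ennreal ((1 - r) powr (- \<gamma> - 1) * \<tau> (1 - r)) * indicator {0..t} (1 - r))"
      proof (cases "max 0 (1 - t) \<le> r \<and> r < 1")
        case True
        then have "ennreal (2 * pi * r) \<le> ennreal (2 * pi)" by (intro ennreal_leI) (simp add: mult_left_le)
        from mult_left_mono[OF this, of "ennreal ((1 - r) powr (- \<gamma> - 1) * \<tau> (1 - r))"]
        show ?thesis using True t by (simp add: mult.commute)
      qed (auto simp: indicator_def)
    qed simp
    also have "\<dots> = ennreal t * (ennreal (2 * pi) * (\<integral>\<^sup>+r. ennreal ((1 - r) powr (- \<gamma> - 1) * \<tau> (1 - r)) * indicator {0..t} (1 - r) \<partial>lborel))"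
      by (subst nn_integral_cmult) auto
    also have "(\<integral>\<^sup>+r. ennreal ((1 - r) powr (- \<gamma> - 1) * \<tau> (1 - r)) * indicator {0..t} (1 - r) \<partial>lborel)
        = (\<integral>\<^sup>+v. ennreal (v powr (- \<gamma> - 1) * \<tau> v) * indicator {0..t} v \<partial>lborel)"
      by (subst nn_integral_real_affine[where c = "-1" and t = 1]) auto
    also have "ennreal t * (ennreal (2 * pi) * \<dots>) \<le> ennreal t * (ennreal (2 * pi) * ennreal (A / (\<alpha> - \<gamma>) * t powr (- \<gamma>) * \<tau> t))"
      using t g by (intro mult_left_mono tau_power_integral) auto
    also have "\<dots> = ennreal (2 * pi * (A / (\<alpha> - \<gamma>)) * (t * t powr (- \<gamma>)) * \<tau> t)"
      using t g A \<tau>_pos[of t] by (simp add: ennreal_mult'[symmetric] mult_ac)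
    also have "t * t powr (- \<gamma>) = t powr (1 - \<gamma>)"
      using t by (simp add: powr_diff powr_minus field_simps)
    finally show "(\<integral>\<^sup>+w. ennreal ((1 - cmod w) powr (- \<gamma>)) * indicator {w. dd z w < t} w * hn w \<partial>lborel)
        \<le> ennreal (2 * pi * (A / (\<alpha> - \<gamma>)) * t powr (1 - \<gamma>) * \<tau> t)" .
  qed (use A g in simp)
qed

lemma hm_box:
  fixes \<phi> :: "real \<Rightarrow> ennreal"
  assumes z: "cmod z \<le> 1" and t: "0 \<le> t" and [measurable]: "\<phi> \<in> borel_measurable borel"
  shows "(\<integral>\<^sup>+w. \<phi> (cmod w) * indicator {w. dd z w < t} w * hm w \<partial>lborel)
    \<le> ennreal (2 * t) * (\<integral>\<^sup>+r. ennreal (wt \<omega> r) * (\<phi> r * indicator {1 - t..} r) \<partial>lborel)"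
proof -
  have "(\<integral>\<^sup>+w. \<phi> (cmod w) * indicator {w. dd z w < t} w * hm w \<partial>lborel)
      = (\<integral>\<^sup>+w. (\<phi> (cmod w) * ennreal (wt \<omega> (cmod w) / pi)) * indicator (ball 0 1) w * indicator {w. dd z w < t} w \<partial>lborel)"
  proof (rule nn_integral_cong)
    fix w :: complex
    show "\<phi> (cmod w) * indicator {w. dd z w < t} w * hm w
        = (\<phi> (cmod w) * ennreal (wt \<omega> (cmod w) / pi)) * indicator (ball 0 1) w * indicator {w. dd z w < t} w"
      by (cases "cmod w < 1") (auto simp: hm_outside indicator_def, simp add: hm_def)
  qed
  also have "\<dots> \<le> ennreal t * (\<integral>\<^sup>+r. (\<phi> r * ennreal (wt \<omega> r / pi)) * ennreal (2 * pi * r) * indicator {max 0 (1 - t)..<1} r \<partial>lborel)"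
    by (rule nn_integral_box[where h = "\<lambda>r. \<phi> r * ennreal (wt \<omega> r / pi)"]) (use z t in auto)
  also have "\<dots> \<le> ennreal t * (\<integral>\<^sup>+r. ennreal 2 * (ennreal (wt \<omega> r) * (\<phi> r * indicator {1 - t..} r)) \<partial>lborel)"
  proof (rule mult_left_mono[OF nn_integral_mono])
    fix r :: real
    show "(\<phi> r * ennreal (wt \<omega> r / pi)) * ennreal (2 * pi * r) * indicator {max 0 (1 - t)..<1} r
        \<le> ennreal 2 * (ennreal (wt \<omega> r) * (\<phi> r * indicator {1 - t..} r))"
    proof (cases "max 0 (1 - t) \<le> r \<and> r < 1")
      case True
      have "ennreal (wt \<omega> r / pi) * ennreal (2 * pi * r) = ennreal (2 * wt \<omega> r * r)"
        using True wt_nonneg[OF rw, of r] by (simp add: ennreal_mult'[symmetric])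
      also have "\<dots> \<le> ennreal (2 * wt \<omega> r)"
        using True wt_nonneg[OF rw, of r] by (intro ennreal_leI) (simp add: mult_left_le)
      finally have "\<phi> r * (ennreal (wt \<omega> r / pi) * ennreal (2 * pi * r)) \<le> \<phi> r * ennreal (2 * wt \<omega> r)"
        by (intro mult_left_mono) auto
      then show ?thesis using True wt_nonneg[OF rw, of r]
        by (simp add: ennreal_mult' mult_ac)
    qed (auto simp: indicator_def)
  qed simp
  also have "\<dots> = ennreal (2 * t) * (\<integral>\<^sup>+r. ennreal (wt \<omega> r) * (\<phi> r * indicator {1 - t..} r) \<partial>lborel)"
    using t by (subst nn_integral_cmult) (auto simp: ennreal_mult' mult_ac)
  finally show ?thesis .
qed

lemma hm_box_mass:
  assumes "cmod z \<le> 1" "0 < t"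
  shows "(\<integral>\<^sup>+w. indicator {w. dd z w < t} w * hm w \<partial>lborel) \<le> ennreal (2 * t * \<tau> t)"
  using hm_box[OF assms(1), of t "\<lambda>_. 1"] assms tau_nn_integral[OF rw assms(2)]
  by (simp add: ennreal_mult')

lemma box_bounded_hm: "box_bounded hm"
  unfolding box_bounded_def
proof (intro conjI allI impI hm_outside hm_meas)
  fix \<gamma> :: real assume g: "0 \<le> \<gamma>" "\<gamma> < \<alpha>"
  \<comment> \<open>Makes
    \<open>y powr (- \<gamma>) = c * (2 * y) powr (- \<gamma> - 1) * y\<close>, so the negative
    power is at most the integral of \<open>c * v powr (- \<gamma> - 1)\<close> over
    \<open>{y..2 * y}\<close> and the layer formula applies. Because of the upper end
    \<open>2 * t\<close>, reverse doubling is needed up to \<open>8\<close>.\<close>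
  define c where "c = 2 powr (\<gamma> + 1)"
  have c: "c > 0" by (simp add: c_def)
  define C where "C = 2 * c * (A / (\<alpha> - \<gamma>)) * 2 ^ l"
  show "\<exists>C\<ge>0. \<forall>z t. cmod z < 1 \<longrightarrow> 0 < t \<longrightarrow> t \<le> 4 \<longrightarrow>
      (\<integral>\<^sup>+w. ennreal ((1 - cmod w) powr (- \<gamma>)) * indicator {w. dd z w < t} w * hm w \<partial>lborel)
        \<le> ennreal (C * t powr (1 - \<gamma>) * \<tau> t)"
  proof (intro exI[of _ C] conjI allI impI)
    fix z :: complex and t :: real assume z: "cmod z < 1" and t: "0 < t" "t \<le> 4"
    define q where "q v = ennreal (c * v powr (- \<gamma> - 1)) * indicator {0..2 * t} v" for v
    have [measurable]: "q \<in> borel_measurable borel" unfolding q_def[abs_def] by measurable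
    have q_low: "ennreal ((1 - r) powr (- \<gamma>)) * indicator {1 - t..} r \<le> (\<integral>\<^sup>+v. q v * indicator {1 - r..} v \<partial>lborel)" if r: "r < 1" for r
    proof (cases "1 - t \<le> r")
      case True
      define y where "y = 1 - r"
      have y: "0 < y" "y \<le> t" using r True by (auto simp: y_def)
      have "y powr (- \<gamma>) = c * (2 * y) powr (- \<gamma> - 1) * y"
        using y by (simp add: c_def powr_mult powr_diff powr_add powr_minus field_simps)
      then have "ennreal (y powr (- \<gamma>)) = (\<integral>\<^sup>+v. ennreal (c * (2 * y) powr (- \<gamma> - 1)) * indicator {y..2 * y} v \<partial>lborel)"
        using y c by (simp add: nn_integral_cmult ennreal_mult'[symmetric])
      also have "\<dots> \<le> (\<integral>\<^sup>+v. q v * indicator {1 - r..} v \<partial>lborel)"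
      proof (rule nn_integral_mono)
        fix v :: real
        show "ennreal (c * (2 * y) powr (- \<gamma> - 1)) * indicator {y..2 * y} v \<le> q v * indicator {1 - r..} v"
        proof (cases "y \<le> v \<and> v \<le> 2 * y")
          case True
          then have "(2 * y) powr (- \<gamma> - 1) \<le> v powr (- \<gamma> - 1)"
            using g y by (intro powr_mono2') auto
          then show ?thesis using True y c by (auto simp: q_def y_def[symmetric] intro!: ennreal_leI)
        qed (auto simp: indicator_def)
      qed
      finally show ?thesis using True by (simp add: y_def)
    qed simp
    have "(\<integral>\<^sup>+r. ennreal (wt \<omega> r) * (\<integral>\<^sup>+v. q v * indicator {1 - r..} v \<partial>lborel) \<partial>lborel)
        = (\<integral>\<^sup>+v. q v * ennreal (\<tau> v) * indicator {0<..} v \<partial>lborel)"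
      by (rule nn_integral_wt_layer[OF rw]) measurable
    also have "\<dots> \<le> (\<integral>\<^sup>+v. ennreal c * (ennreal (v powr (- \<gamma> - 1) * \<tau> v) * indicator {0..2 * t} v) \<partial>lborel)"
      using c by (intro nn_integral_mono) (auto simp: q_def indicator_def ennreal_mult'[symmetric] less_imp_le[OF \<tau>_pos] mult_ac)
    also have "\<dots> = ennreal c * (\<integral>\<^sup>+v. ennreal (v powr (- \<gamma> - 1) * \<tau> v) * indicator {0..2 * t} v \<partial>lborel)"
      by (rule nn_integral_cmult) measurable
    also have "\<dots> \<le> ennreal c * ennreal (A / (\<alpha> - \<gamma>) * (2 * t) powr (- \<gamma>) * \<tau> (2 * t))"
      using t g by (intro mult_left_mono tau_power_integral) auto
    finally have J: "(\<integral>\<^sup>+r. ennreal (wt \<omega> r) * (\<integral>\<^sup>+v. q v * indicator {1 - r..} v \<partial>lborel) \<partial>lborel)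
        \<le> ennreal c * ennreal (A / (\<alpha> - \<gamma>) * (2 * t) powr (- \<gamma>) * \<tau> (2 * t))" .
    have "(\<integral>\<^sup>+w. ennreal ((1 - cmod w) powr (- \<gamma>)) * indicator {w. dd z w < t} w * hm w \<partial>lborel)
        \<le> ennreal (2 * t) * (\<integral>\<^sup>+r. ennreal (wt \<omega> r) * (ennreal ((1 - r) powr (- \<gamma>)) * indicator {1 - t..} r) \<partial>lborel)"
      using z t by (intro hm_box[where \<phi> = "\<lambda>r. ennreal ((1 - r) powr (- \<gamma>))"]) auto
    also have "\<dots> \<le> ennreal (2 * t) * (\<integral>\<^sup>+r. ennreal (wt \<omega> r) * (\<integral>\<^sup>+v. q v * indicator {1 - r..} v \<partial>lborel) \<partial>lborel)"
    proof (rule mult_left_mono[OF nn_integral_mono])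
      fix r :: real
      show "ennreal (wt \<omega> r) * (ennreal ((1 - r) powr (- \<gamma>)) * indicator {1 - t..} r)
          \<le> ennreal (wt \<omega> r) * (\<integral>\<^sup>+v. q v * indicator {1 - r..} v \<partial>lborel)"
        using q_low[of r] by (cases "r < 1") (auto simp: wt_def intro!: mult_left_mono)
    qed simp
    also have "\<dots> \<le> ennreal (2 * t) * (ennreal c * ennreal (A / (\<alpha> - \<gamma>) * (2 * t) powr (- \<gamma>) * \<tau> (2 * t)))"
      by (rule mult_left_mono[OF J]) simp
    also have "\<dots> = ennreal (2 * t * (c * (A / (\<alpha> - \<gamma>) * (2 * t) powr (- \<gamma>) * \<tau> (2 * t))))"
    proof -
      have "0 \<le> 2 * t" "0 \<le> c" using t c by auto
      then show ?thesis by (simp only: ennreal_mult'[OF \<open>0 \<le> 2 * t\<close>] ennreal_mult'[OF \<open>0 \<le> c\<close>])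
    qed
    also have "\<dots> \<le> ennreal (2 * t * (c * (A / (\<alpha> - \<gamma>) * t powr (- \<gamma>) * (2 ^ l * \<tau> t))))"
      using t c g A \<tau>_pos[of "2 * t"] dbl[of t]
      by (intro ennreal_leI mult_left_mono mult_mono powr_mono2') auto
    also have "2 * t * (c * (A / (\<alpha> - \<gamma>) * t powr (- \<gamma>) * (2 ^ l * \<tau> t))) = C * (t * t powr (- \<gamma>)) * \<tau> t"
      by (simp add: C_def)
    also have "t * t powr (- \<gamma>) = t powr (1 - \<gamma>)"
      using t by (simp add: powr_diff powr_minus field_simps)
    finally show "(\<integral>\<^sup>+w. ennreal ((1 - cmod w) powr (- \<gamma>)) * indicator {w. dd z w < t} w * hm w \<partial>lborel)
        \<le> ennreal (C * t powr (1 - \<gamma>) * \<tau> t)" .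
  qed (use A g c in \<open>simp add: C_def\<close>)
qed

text \<open>A hyperbolic disc lies in the box of size \<open>4 * R * (1 - cmod z)\<close>, and
  doubling brings the tail back to \<open>1 - cmod z\<close>.\<close>

lemma hyperbolic_disc_mass_upper:
  assumes R: "1 \<le> R"
  obtains C where "0 < C"
    "\<And>z. cmod z < 1 \<Longrightarrow> (\<integral>\<^sup>+w. indicator (hball z R) w * hm w \<partial>lborel) \<le> ennreal (C * (1 - cmod z) * \<tau> (1 - cmod z))"
proof
  show "0 < 2 * (4 * R) * (2 ^ l * (4 * R) ^ l)" using R by simp
  fix z :: complex assume z: "cmod z < 1"
  let ?x = "1 - cmod z"
  have x: "0 < ?x" "?x \<le> 4 * R * ?x" using z R mult_right_mono[of 1 "4 * R" "1 - cmod z"] by auto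
  have "(\<integral>\<^sup>+w. indicator (hball z R) w * hm w \<partial>lborel) \<le> (\<integral>\<^sup>+w. indicator {w. dd z w < 4 * R * ?x} w * hm w \<partial>lborel)"
    using z Q_dd_less(1)[of z _ R] by (intro nn_integral_mono mult_right_mono) (auto simp: indicator_def hball_def)
  also have "\<dots> \<le> ennreal (2 * (4 * R * ?x) * \<tau> (4 * R * ?x))"
    using z x R by (intro hm_box_mass) auto
  also have "\<dots> \<le> ennreal (2 * (4 * R * ?x) * (2 ^ l * (4 * R * ?x / ?x) ^ l * \<tau> ?x))"
    using x R by (intro ennreal_leI mult_left_mono \<tau>_power) auto
  also have "4 * R * ?x / ?x = 4 * R" using x by simp
  finally show "(\<integral>\<^sup>+w. indicator (hball z R) w * hm w \<partial>lborel) \<le> ennreal (2 * (4 * R) * (2 ^ l * (4 * R) ^ l) * ?x * \<tau> ?x)"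
    by (simp only: mult_ac)
qed

text \<open>\<open>K\<close> is so large that \<open>A / K powr \<alpha> \<le> 1 / 2\<close>.
  Boundary distances between \<open>t / K\<close> and \<open>t\<close> then carry at least half of
  the tail mass, wherever in this shell the weight may sit.\<close>

lemma tail_gap:
  obtains K where "2 \<le> K" "\<And>t. 0 < t \<Longrightarrow> t \<le> 8 \<Longrightarrow> \<tau> (t / K) \<le> \<tau> t / 2"
proof -
  define K where "K = max 2 ((2 * A) powr (1 / \<alpha>))"
  have K: "2 \<le> K" by (simp add: K_def)
  have "(2 * A) powr 1 = ((2 * A) powr (1 / \<alpha>)) powr \<alpha>" using \<alpha> by (simp add: powr_powr)
  also have "\<dots> \<le> K powr \<alpha>" using \<alpha> by (intro powr_mono2) (auto simp: K_def)
  finally have KA: "2 * A \<le> K powr \<alpha>" using A by simp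
  have "\<tau> (t / K) \<le> \<tau> t / 2" if t: "0 < t" "t \<le> 8" for t
  proof -
    have "\<tau> (t / K) \<le> A * ((t / K) / t) powr \<alpha> * \<tau> t"
      using t K by (intro rev) (auto simp: field_simps mult_left_le)
    also have "(t / K) / t = 1 / K" using t by simp
    also have "(1 / K) powr \<alpha> = 1 / K powr \<alpha>" using K by (simp add: powr_divide)
    also have "A * (1 / K powr \<alpha>) * \<tau> t \<le> 1 / 2 * \<tau> t"
      using KA \<tau>_pos[OF t(1)] K by (intro mult_right_mono) (auto simp: field_simps)
    finally show ?thesis by simp
  qed
  with K show ?thesis by (rule that)
qed

lemma shell_mass:
  assumes K: "1 < K" and t: "0 < t" and gap: "\<tau> (t / K) \<le> \<tau> t / 2"
  shows "ennreal (\<tau> t / 2) \<le> (\<integral>\<^sup>+r. ennreal (wt \<omega> r) * indicator {1 - t..<1 - t / K} r \<partial>lborel)"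
proof -
  have tK: "0 < t / K" "t / K \<le> t" using K t by (auto simp: field_simps)
  have "ennreal (\<tau> t) = (\<integral>\<^sup>+r. ennreal (wt \<omega> r) * indicator {1 - t..<1 - t / K} r + ennreal (wt \<omega> r) * indicator {1 - t / K..} r \<partial>lborel)"
    unfolding tau_nn_integral[OF rw t, symmetric] using tK
    by (intro nn_integral_cong) (auto simp: indicator_def)
  also have "\<dots> = (\<integral>\<^sup>+r. ennreal (wt \<omega> r) * indicator {1 - t..<1 - t / K} r \<partial>lborel) + ennreal (\<tau> (t / K))"
    by (subst nn_integral_add) (auto simp: tau_nn_integral[OF rw tK(1)])
  also have "\<dots> \<le> (\<integral>\<^sup>+r. ennreal (wt \<omega> r) * indicator {1 - t..<1 - t / K} r \<partial>lborel) + ennreal (\<tau> t / 2)"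
    using gap by (intro add_left_mono ennreal_leI)
  finally have "ennreal (\<tau> t / 2 + \<tau> t / 2) \<le> (\<integral>\<^sup>+r. ennreal (wt \<omega> r) * indicator {1 - t..<1 - t / K} r \<partial>lborel) + ennreal (\<tau> t / 2)"
    by simp
  then show ?thesis
    using \<tau>_pos[OF t] by (subst (asm) ennreal_plus) auto
qed

text \<open>The weight may vanish near the circle through \<open>z\<close>, but the shell of
  boundary distances between \<open>x / K / K\<close> and \<open>x / K\<close> carries at least half
  of \<open>\<tau> (x / K)\<close>. A disc of fixed large hyperbolic radius reaches this shell and
  contains at least the proportion \<open>x / 8\<close> of each of its circles.\<close>

lemma hyperbolic_disc_mass_lower:
  obtains R0 c where "1 \<le> R0" "0 < c"
    "\<And>z. cmod z < 1 \<Longrightarrow> ennreal (c * (1 - cmod z) * \<tau> (1 - cmod z)) \<le> (\<integral>\<^sup>+w. indicator (hball z R0) w * hm w \<partial>lborel)"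
proof -
  obtain K where K: "2 \<le> K" and gap: "\<And>t. 0 < t \<Longrightarrow> t \<le> 8 \<Longrightarrow> \<tau> (t / K) \<le> \<tau> t / 2"
    using tail_gap by blast
  obtain k :: nat where k: "K < 2 ^ k" using real_arch_pow[of 2 K] by auto
  \<comment> \<open>For the points in question \<open>dd z w \<le> 3 * x\<close> and
    \<open>1 - cmod w > x / K / K\<close>, so \<open>Q z w \<le> 9 * K\<^sup>2\<close>.\<close>
  define R0 where "R0 = 9 * K\<^sup>2 + 1"
  \<comment> \<open>\<open>1 / 8\<close> is the arc, \<open>1 / 4\<close> comes from half the tail
    and a radial factor \<open>r \<ge> 1 / 2\<close>, and the power of \<open>2 ^ l\<close> covers
    the passage from \<open>\<tau> x\<close> to \<open>\<tau> (x / K)\<close>.\<close>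
  define c :: real where "c = 1 / (32 * (2 ^ l) ^ Suc k)"
  have "ennreal (c * (1 - cmod z) * \<tau> (1 - cmod z)) \<le> (\<integral>\<^sup>+w. indicator (hball z R0) w * hm w \<partial>lborel)" if z: "cmod z < 1" for z
  proof -
    define x where "x = 1 - cmod z"
    have x: "0 < x" "x \<le> 1" using z by (auto simp: x_def)
    define e where "e = (if z = 0 then 1 else sgn z)"
    have "cmod e = 1" by (simp add: e_def norm_sgn)
    moreover have "z = of_real (1 - x) * e" by (simp add: e_def x_def sgn_eq)
    ultimately have e: "cmod e = 1" "z = of_real (1 - x) * e" by auto
    \<comment> \<open>The shell starts at \<open>x / K\<close> and not at \<open>x\<close>, which
      keeps its radii above \<open>1 / 2\<close>, where the factor \<open>r\<close> of polar
      coordinates does no harm.\<close>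
    define I where "I = {1 - x / K..<1 - x / K / K}"
    have xK: "0 < x / K" "x / K \<le> x" "x / K \<le> 1 / 2" "0 < x / K / K"
      using x K by (auto simp: field_simps mult_left_le)
    have ang: "ennreal (x / 8) \<le> (\<integral>\<^sup>+t. indicator (hball z R0) (circ t * w) * indicator {0..1} t \<partial>lborel)" if w: "cmod w \<in> I" for w
    proof -
      define v where "v = of_real (cmod w) * e"
      have w1: "1 - cmod w \<le> x / K" "x / K / K < 1 - cmod w" using w by (auto simp: I_def)
      then have w1: "cmod w < 1" "0 < cmod w" "1 - cmod w \<le> x / K" "x / K / K < 1 - cmod w" using xK by linarith+
      have v: "cmod v = cmod w" by (simp add: v_def norm_mult e)
      have "circ t * v \<in> hball z R0" if t: "0 \<le> t" "t \<le> x / 8" for t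
      proof -
        have ee: "cnj e * e = 1"
          using complex_norm_square[of e] e(1) by (simp add: mult.commute)
        have "cnj z * (circ t * v) = of_real ((1 - x) * cmod w) * circ t * (cnj e * e)"
          by (subst e(2)) (simp add: v_def mult_ac)
        then have "1 - cnj z * (circ t * v) = of_real (1 - (1 - x) * cmod w) + of_real ((1 - x) * cmod w) * (1 - circ t)"
          unfolding ee by (simp add: algebra_simps)
        then have "dd z (circ t * v) \<le> \<bar>1 - (1 - x) * cmod w\<bar> + \<bar>(1 - x) * cmod w\<bar> * cmod (1 - circ t)"
          unfolding dd_def using norm_triangle_ineq[of "of_real (1 - (1 - x) * cmod w)" "of_real ((1 - x) * cmod w) * (1 - circ t)"]
          by (simp only: norm_mult norm_of_real)
        also have "\<bar>1 - (1 - x) * cmod w\<bar> \<le> 2 * x"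
        proof -
          have "0 \<le> (1 - x) * cmod w" "(1 - x) * cmod w \<le> 1 * 1"
            using x w1 mult_mono[of "1 - x" 1 "cmod w" 1] by auto
          moreover have "1 - (1 - x) * cmod w = (1 - cmod w) + x * cmod w" by (simp add: algebra_simps)
          moreover have "x * cmod w \<le> x" using x w1 by (simp add: mult_left_le)
          ultimately show ?thesis using w1 xK by linarith
        qed
        also have "\<bar>(1 - x) * cmod w\<bar> * cmod (1 - circ t) \<le> 1 * (2 * pi * t)"
        proof (rule mult_mono)
          have "(1 - x) * cmod w \<le> 1 * 1" using x w1 by (intro mult_mono) auto
          then show "\<bar>(1 - x) * cmod w\<bar> \<le> 1" using x w1 by (simp add: abs_mult)
          have "cmod (1 - circ t) = cmod (exp (\<i> * of_real (2 * pi * t)) - 1)"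
            by (simp add: cis_conv_exp norm_minus_commute)
          also have "\<dots> = 2 * \<bar>sin (2 * pi * t / 2)\<bar>" unfolding dist_exp_i_1 by simp
          also have "\<dots> \<le> 2 * \<bar>2 * pi * t / 2\<bar>" by (intro mult_left_mono abs_sin_x_le_abs_x) auto
          finally show "cmod (1 - circ t) \<le> 2 * pi * t" using t by simp
        qed auto
        also have "1 * (2 * pi * t) \<le> 8 * (x / 8)"
          using t pi_less_4 mult_mono[of "2 * pi" 8 t "x / 8"] by simp
        finally have d: "dd z (circ t * v) \<le> 3 * x" by simp
        have cv: "cmod (circ t * v) = cmod w" using v by (simp add: norm_mult)
        have "Q z (circ t * v) \<le> (dd z (circ t * v))\<^sup>2 / ((1 - cmod z) * (1 - cmod (circ t * v)))"
          using z w1 v by (intro Q_upper) (auto simp: norm_mult)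
        also have "\<dots> \<le> (3 * x)\<^sup>2 / (x * (x / K / K))"
          using d w1 x K xK unfolding cv x_def[symmetric]
          by (intro frac_le power_mono mult_mono mult_pos_pos) (auto simp: dd_def)
        also have "\<dots> = 9 * K\<^sup>2" using x K by (simp add: power2_eq_square field_simps)
        finally show ?thesis using w1 v by (simp add: hball_def R0_def norm_mult)
      qed
      then have "(\<integral>\<^sup>+t. indicator {0..x / 8} t \<partial>lborel) \<le> (\<integral>\<^sup>+t. indicator (hball z R0) (circ t * v) * indicator {0..1::real} t \<partial>lborel)"
        using x by (intro nn_integral_mono) (auto simp: indicator_def)
      moreover have "(\<integral>\<^sup>+t. indicator (hball z R0) (circ t * v) * indicator {0..1} t \<partial>lborel) = (\<integral>\<^sup>+t. (indicator (hball z R0) (circ t * w) :: ennreal) * indicator {0..1} t \<partial>lborel)"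
        using v by (intro nn_integral_circ_rotate) auto
      ultimately show ?thesis using x by simp
    qed
    have "\<tau> x \<le> (2 ^ l) ^ k * \<tau> (x / K)"
    proof -
      have it: "\<tau> (2 ^ n * s) \<le> (2 ^ l) ^ n * \<tau> s" if "0 < s" for n s
      proof (induction n)
        case (Suc n)
        have "\<tau> (2 * (2 ^ n * s)) \<le> 2 ^ l * \<tau> (2 ^ n * s)" using that by (intro dbl) auto
        also have "\<dots> \<le> 2 ^ l * ((2 ^ l) ^ n * \<tau> s)" using Suc by (intro mult_left_mono) auto
        finally show ?case by (simp add: mult_ac)
      qed simp
      have "x \<le> 2 ^ k * (x / K)" using k K x by (simp add: field_simps)
      then have "\<tau> x \<le> \<tau> (2 ^ k * (x / K))" using x by (intro \<tau>_mono) auto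
      also have "\<dots> \<le> (2 ^ l) ^ k * \<tau> (x / K)" using xK by (intro it) auto
      finally show ?thesis .
    qed
    also have "\<dots> \<le> (2 ^ l) ^ Suc k * \<tau> (x / K)"
      using \<tau>_pos[OF xK(1)] by (intro mult_right_mono power_increasing) (auto simp: one_le_power)
    finally have tx: "c * x * \<tau> x \<le> x / 8 * (\<tau> (x / K) / 4)"
      using x by (simp add: c_def field_simps)
    have "ennreal (\<tau> (x / K) / 4) = ennreal (1 / 2) * ennreal (\<tau> (x / K) / 2)"
      by (subst ennreal_mult'[symmetric]) auto
    also have "\<dots> \<le> ennreal (1 / 2) * (\<integral>\<^sup>+r. ennreal (wt \<omega> r) * indicator I r \<partial>lborel)"
    proof (intro mult_left_mono)
      have "x / K \<le> 8" using xK(3) by linarith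
      then show "ennreal (\<tau> (x / K) / 2) \<le> (\<integral>\<^sup>+r. ennreal (wt \<omega> r) * indicator I r \<partial>lborel)"
        unfolding I_def using K by (intro shell_mass gap xK(1)) auto
    qed auto
    also have "\<dots> = (\<integral>\<^sup>+r. ennreal (1 / 2) * (ennreal (wt \<omega> r) * indicator I r) \<partial>lborel)"
      unfolding I_def by (rule nn_integral_cmult[symmetric]) measurable
    also have "\<dots> \<le> (\<integral>\<^sup>+r. (ennreal (wt \<omega> r / pi) * indicator I r) * ennreal (2 * pi * r) * indicator {0..<1} r \<partial>lborel)"
    proof (rule nn_integral_mono)
      fix r :: real
      show "ennreal (1 / 2) * (ennreal (wt \<omega> r) * indicator I r) \<le> (ennreal (wt \<omega> r / pi) * indicator I r) * ennreal (2 * pi * r) * indicator {0..<1} r"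
      proof (cases "r \<in> I")
        case True
        then have r: "1 / 2 \<le> r" "r < 1" using xK by (auto simp: I_def)
        have "1 / 2 * wt \<omega> r \<le> wt \<omega> r / pi * (2 * pi * r)"
          using r wt_nonneg[OF rw, of r] mult_right_mono[of "1 / 2" "2 * r" "wt \<omega> r"] by (simp add: mult_ac)
        moreover have "ennreal (1 / 2) * ennreal (wt \<omega> r) = ennreal (1 / 2 * wt \<omega> r)"
          by (rule ennreal_mult'[symmetric]) simp
        moreover have "ennreal (wt \<omega> r / pi) * ennreal (2 * pi * r) = ennreal (wt \<omega> r / pi * (2 * pi * r))"
          using wt_nonneg[OF rw, of r] by (intro ennreal_mult'[symmetric]) simp
        moreover have "indicator I r = (1::ennreal)" "indicator {0..<1} r = (1::ennreal)"
          using True r by auto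
        ultimately show ?thesis
          by (simp only: mult_1_right ennreal_leI)
      qed simp
    qed
    also have "\<dots> = (\<integral>\<^sup>+w. (ennreal (wt \<omega> (cmod w) / pi) * indicator I (cmod w)) * indicator (ball 0 1) w \<partial>lborel)"
      unfolding I_def by (rule nn_integral_lborel_radial[symmetric]) measurable
    finally have S: "ennreal (\<tau> (x / K) / 4) \<le> (\<integral>\<^sup>+w. (ennreal (wt \<omega> (cmod w) / pi) * indicator I (cmod w)) * indicator (ball 0 1) w \<partial>lborel)" .
    have "ennreal (c * x * \<tau> x) \<le> ennreal (x / 8 * (\<tau> (x / K) / 4))" by (rule ennreal_leI[OF tx])
    also have "\<dots> = ennreal (x / 8) * ennreal (\<tau> (x / K) / 4)"
      using x by (intro ennreal_mult') simp
    also have "\<dots> \<le> ennreal (x / 8) * (\<integral>\<^sup>+w. (ennreal (wt \<omega> (cmod w) / pi) * indicator I (cmod w)) * indicator (ball 0 1) w \<partial>lborel)"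
      by (rule mult_left_mono[OF S]) simp
    also have "\<dots> = (\<integral>\<^sup>+w. ennreal (x / 8) * ((ennreal (wt \<omega> (cmod w) / pi) * indicator I (cmod w)) * indicator (ball 0 1) w) \<partial>lborel)"
      unfolding I_def by (rule nn_integral_cmult[symmetric]) measurable
    also have "\<dots> \<le> (\<integral>\<^sup>+w. hm w * (\<integral>\<^sup>+t. indicator (hball z R0) (circ t * w) * indicator {0..1} t \<partial>lborel) \<partial>lborel)"
    proof (rule nn_integral_mono)
      fix w :: complex
      show "ennreal (x / 8) * ((ennreal (wt \<omega> (cmod w) / pi) * indicator I (cmod w)) * indicator (ball 0 1) w)
          \<le> hm w * (\<integral>\<^sup>+t. indicator (hball z R0) (circ t * w) * indicator {0..1} t \<partial>lborel)"
      proof (cases "cmod w \<in> I \<and> cmod w < 1")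
        case True
        then show ?thesis using mult_left_mono[OF ang[of w], of "hm w"] by (simp add: hm_def mult_ac)
      qed (auto simp: indicator_def)
    qed
    also have "\<dots> = (\<integral>\<^sup>+w. (\<integral>\<^sup>+t. (indicator (hball z R0) (circ t * w) * hm (circ t * w)) * indicator {0..1} t \<partial>lborel) \<partial>lborel)"
    proof (rule nn_integral_cong)
      fix w :: complex
      have "hm (circ t * w) = hm w" for t by (simp add: hm_def norm_mult)
      then show "hm w * (\<integral>\<^sup>+t. indicator (hball z R0) (circ t * w) * indicator {0..1} t \<partial>lborel)
          = (\<integral>\<^sup>+t. (indicator (hball z R0) (circ t * w) * hm (circ t * w)) * indicator {0..1} t \<partial>lborel)"
        by (subst nn_integral_cmult[symmetric]) (auto simp: mult_ac)
    qed
    also have "\<dots> = (\<integral>\<^sup>+w. indicator (hball z R0) w * hm w \<partial>lborel)"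
      by (rule nn_integral_lborel_circle[symmetric]) measurable
    finally show ?thesis by (simp add: x_def)
  qed
  moreover have "1 \<le> R0" by (simp add: R0_def)
  moreover have "0 < c" by (simp add: c_def)
  ultimately show ?thesis by (intro that[of R0 c]) auto
qed

end

section \<open>Norms of analytic functions and a Schur test\<close>

context D_weight
begin

lemma nn_integral_radial_mean:
  fixes F :: "complex \<Rightarrow> ennreal" and h :: "real \<Rightarrow> ennreal"
  assumes [measurable]: "F \<in> borel_measurable borel" "h \<in> borel_measurable borel"
  shows "(\<integral>\<^sup>+w. F w * (h (cmod w) * indicator (ball 0 1) w) \<partial>lborel)
    = (\<integral>\<^sup>+r. (\<integral>\<^sup>+t. F (circ t * of_real r) * indicator {0..1} t \<partial>lborel) * h r * ennreal (2 * pi * r) * indicator {0..<1} r \<partial>lborel)"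
proof -
  have "(\<integral>\<^sup>+w. F w * (h (cmod w) * indicator (ball 0 1) w) \<partial>lborel)
      = (\<integral>\<^sup>+w. (\<integral>\<^sup>+t. (F (circ t * w) * (h (cmod (circ t * w)) * indicator (ball 0 1) (circ t * w))) * indicator {0..1} t \<partial>lborel) \<partial>lborel)"
    by (rule nn_integral_lborel_circle) measurable
  also have "\<dots> = (\<integral>\<^sup>+w. ((\<integral>\<^sup>+t. F (circ t * of_real (cmod w)) * indicator {0..1} t \<partial>lborel) * h (cmod w)) * indicator (ball 0 1) w \<partial>lborel)"
  proof (rule nn_integral_cong)
    fix w :: complex
    have "(\<integral>\<^sup>+t. (F (circ t * w) * (h (cmod (circ t * w)) * indicator (ball 0 1) (circ t * w))) * indicator {0..1} t \<partial>lborel)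
        = (\<integral>\<^sup>+t. (F (circ t * w) * indicator {0..1} t) * (h (cmod w) * indicator (ball 0 1) w) \<partial>lborel)"
      by (intro nn_integral_cong) (auto simp: norm_mult indicator_def)
    also have "\<dots> = (\<integral>\<^sup>+t. F (circ t * w) * indicator {0..1} t \<partial>lborel) * (h (cmod w) * indicator (ball 0 1) w)"
      by (rule nn_integral_multc) measurable
    also have "(\<integral>\<^sup>+t. F (circ t * w) * indicator {0..1} t \<partial>lborel) = (\<integral>\<^sup>+t. F (circ t * of_real (cmod w)) * indicator {0..1} t \<partial>lborel)"
      by (rule nn_integral_circ_rotate) auto
    finally show "(\<integral>\<^sup>+t. (F (circ t * w) * (h (cmod (circ t * w)) * indicator (ball 0 1) (circ t * w))) * indicator {0..1} t \<partial>lborel)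
        = ((\<integral>\<^sup>+t. F (circ t * of_real (cmod w)) * indicator {0..1} t \<partial>lborel) * h (cmod w)) * indicator (ball 0 1) w"
      by (simp add: mult.assoc)
  qed
  also have "\<dots> = (\<integral>\<^sup>+r. (\<integral>\<^sup>+t. F (circ t * of_real r) * indicator {0..1} t \<partial>lborel) * h r * ennreal (2 * pi * r) * indicator {0..<1} r \<partial>lborel)"
    by (rule nn_integral_lborel_radial[where h = "\<lambda>r. (\<integral>\<^sup>+t. F (circ t * of_real r) * indicator {0..1} t \<partial>lborel) * h r"]) measurable
  finally show ?thesis .
qed

lemma hm_alt: "hm w = ennreal (wt \<omega> (cmod w) / pi) * indicator (ball 0 1) w"
  by (cases "cmod w < 1") (auto simp: hm_outside, simp add: hm_def)

lemma hn_alt: "hn w = ennreal (\<tau> (1 - cmod w) / (1 - cmod w)) * indicator (ball 0 1) w"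
  by (cases "cmod w < 1") (auto simp: hn_outside, simp add: hn_def)

text \<open>The tail \<open>\<tau> (1 - r)\<close> is at most twice the mass of
  \<open>\<omega>\<close> in a shell just outside \<open>r\<close>, and the circular mean of
  \<open>cmod (g w) powr s\<close> only grows when moved from \<open>r\<close> into that shell.
  After exchanging integrals, each \<open>r'\<close> collects a range of \<open>r\<close> over which
  \<open>1 / (1 - r)\<close> has integral at most \<open>K\<close>.\<close>

lemma regularised_norm_le:
  fixes s :: real
  assumes s: "1 < s"
  obtains C where "0 < C" "\<And>g. g holomorphic_on ball 0 1 \<Longrightarrow>
    (\<integral>\<^sup>+w. ennreal (cmod (g w) powr s) * hn w \<partial>lborel) \<le> ennreal C * (\<integral>\<^sup>+w. ennreal (cmod (g w) powr s) * hm w \<partial>lborel)"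
proof -
  obtain K where K: "2 \<le> K" and gap: "\<And>t. 0 < t \<Longrightarrow> t \<le> 8 \<Longrightarrow> \<tau> (t / K) \<le> \<tau> t / 2"
    using tail_gap by blast
  have "(\<integral>\<^sup>+w. ennreal (cmod (g w) powr s) * hn w \<partial>lborel) \<le> ennreal (2 * pi * K) * (\<integral>\<^sup>+w. ennreal (cmod (g w) powr s) * hm w \<partial>lborel)"
    if hol: "g holomorphic_on ball 0 1" for g
  proof -
    define F :: "complex \<Rightarrow> ennreal" where "F = (\<lambda>w. ennreal (cmod (indicator (ball 0 1) w *\<^sub>R g w) powr s))"
    have [measurable]: "F \<in> borel_measurable borel"
      unfolding F_def using holomorphic_ball_indicator_measurable[OF hol] by measurable
    have F: "F w = ennreal (cmod (g w) powr s)" if "cmod w < 1" for w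
      using that by (simp add: F_def)
    define P where "P r = (\<integral>\<^sup>+t. F (circ t * of_real r) * indicator {0..1} t \<partial>lborel)" for r
    have [measurable]: "P \<in> borel_measurable borel" unfolding P_def[abs_def] by measurable
    have P_mono: "P r \<le> P r'" if r: "0 \<le> r" "r \<le> r'" "r' < 1" for r r'
    proof -
      have "(\<integral>\<^sup>+t. ennreal (cmod (g (circ t * of_real r)) powr s) * indicator {0..1} t \<partial>lborel)
          \<le> (\<integral>\<^sup>+t. ennreal (cmod (g (circ t * of_real r')) powr s) * indicator {0..1} t \<partial>lborel)"
        using r by (intro circle_mean_powr_mono[OF hol s]) auto
      then show ?thesis using r by (simp add: P_def F norm_mult)
    qed
    have Lm: "(\<integral>\<^sup>+w. ennreal (cmod (g w) powr s) * hm w \<partial>lborel) = (\<integral>\<^sup>+r. P r * ennreal (wt \<omega> r / pi) * ennreal (2 * pi * r) * indicator {0..<1} r \<partial>lborel)"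
    proof -
      have "(\<integral>\<^sup>+w. ennreal (cmod (g w) powr s) * hm w \<partial>lborel) = (\<integral>\<^sup>+w. F w * (ennreal (wt \<omega> (cmod w) / pi) * indicator (ball 0 1) w) \<partial>lborel)"
        by (intro nn_integral_cong) (auto simp: hm_alt F indicator_def)
      then show ?thesis
        unfolding P_def by (simp only:) (rule nn_integral_radial_mean, measurable)
    qed
    have Ln: "(\<integral>\<^sup>+w. ennreal (cmod (g w) powr s) * hn w \<partial>lborel) = (\<integral>\<^sup>+r. P r * ennreal (\<tau> (1 - r) / (1 - r)) * ennreal (2 * pi * r) * indicator {0..<1} r \<partial>lborel)"
    proof -
      have "(\<integral>\<^sup>+w. ennreal (cmod (g w) powr s) * hn w \<partial>lborel) = (\<integral>\<^sup>+w. F w * (ennreal (\<tau> (1 - cmod w) / (1 - cmod w)) * indicator (ball 0 1) w) \<partial>lborel)"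
        by (intro nn_integral_cong) (auto simp: hn_alt F indicator_def)
      then show ?thesis
        unfolding P_def by (simp only:) (rule nn_integral_radial_mean, measurable)
    qed
    \<comment> \<open>Incidence kernel of the shells: \<open>r'\<close> lies in the shell attached
      to \<open>r\<close>, weighted by the singular factor of \<open>hn\<close> at
      \<open>r\<close>.\<close>
    define J where "J r r' = (if 0 \<le> r \<and> r < 1 \<and> 1 - r' \<le> 1 - r \<and> 1 - r < K * (1 - r') then ennreal (1 / (1 - r)) else 0)" for r r'
    have [measurable]: "(\<lambda>p. J (fst p) (snd p)) \<in> borel_measurable (borel \<Otimes>\<^sub>M borel)"
      "(\<lambda>p. J (snd p) (fst p)) \<in> borel_measurable (borel \<Otimes>\<^sub>M borel)"
      unfolding J_def by measurable
    have [measurable]: "J r \<in> borel_measurable borel" "(\<lambda>r. J r r') \<in> borel_measurable borel" for r r'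
      unfolding J_def[abs_def] by measurable
    have step: "P r * ennreal (\<tau> (1 - r) / (1 - r)) * ennreal (2 * pi * r) * indicator {0..<1} r
        \<le> (\<integral>\<^sup>+r'. ennreal (4 * pi) * (P r' * ennreal r' * ennreal (wt \<omega> r') * J r r') \<partial>lborel)" for r
    proof (cases "0 \<le> r \<and> r < 1")
      case r: True
      have x: "0 < 1 - r" "1 - r \<le> 8" using r by auto
      have "ennreal (\<tau> (1 - r)) = ennreal 2 * ennreal (\<tau> (1 - r) / 2)"
        by (subst ennreal_mult'[symmetric]) auto
      also have "\<dots> \<le> ennreal 2 * (\<integral>\<^sup>+r'. ennreal (wt \<omega> r') * indicator {1 - (1 - r)..<1 - (1 - r) / K} r' \<partial>lborel)"
        using K gap[OF x] x by (intro mult_left_mono shell_mass) auto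
      finally have t: "ennreal (\<tau> (1 - r)) \<le> ennreal 2 * (\<integral>\<^sup>+r'. ennreal (wt \<omega> r') * indicator {1 - (1 - r)..<1 - (1 - r) / K} r' \<partial>lborel)" .
      have "P r * ennreal (\<tau> (1 - r) / (1 - r)) * ennreal (2 * pi * r) * indicator {0..<1} r
          = (P r * ennreal (2 * pi * r) * ennreal (1 / (1 - r))) * ennreal (\<tau> (1 - r))"
      proof -
        have "ennreal (\<tau> (1 - r) / (1 - r)) = ennreal (1 / (1 - r)) * ennreal (\<tau> (1 - r))"
          using x by (subst ennreal_mult'[symmetric]) auto
        then show ?thesis using r by (simp add: mult_ac)
      qed
      also have "\<dots> \<le> (P r * ennreal (2 * pi * r) * ennreal (1 / (1 - r))) * (ennreal 2 * (\<integral>\<^sup>+r'. ennreal (wt \<omega> r') * indicator {1 - (1 - r)..<1 - (1 - r) / K} r' \<partial>lborel))"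
        by (intro mult_left_mono t) auto
      also have "\<dots> = (\<integral>\<^sup>+r'. (P r * ennreal (2 * pi * r) * ennreal (1 / (1 - r))) * (ennreal 2 * (ennreal (wt \<omega> r') * indicator {1 - (1 - r)..<1 - (1 - r) / K} r')) \<partial>lborel)"
      proof -
        have "ennreal 2 * (\<integral>\<^sup>+r'. ennreal (wt \<omega> r') * indicator {1 - (1 - r)..<1 - (1 - r) / K} r' \<partial>lborel)
            = (\<integral>\<^sup>+r'. ennreal 2 * (ennreal (wt \<omega> r') * indicator {1 - (1 - r)..<1 - (1 - r) / K} r') \<partial>lborel)"
          by (rule nn_integral_cmult[symmetric]) measurable
        then show ?thesis
          by (simp only:) (rule nn_integral_cmult[symmetric], measurable)
      qed
      also have "\<dots> \<le> (\<integral>\<^sup>+r'. ennreal (4 * pi) * (P r' * ennreal r' * ennreal (wt \<omega> r') * J r r') \<partial>lborel)"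
      proof (rule nn_integral_mono)
        fix r' :: real
        show "(P r * ennreal (2 * pi * r) * ennreal (1 / (1 - r))) * (ennreal 2 * (ennreal (wt \<omega> r') * indicator {1 - (1 - r)..<1 - (1 - r) / K} r'))
            \<le> ennreal (4 * pi) * (P r' * ennreal r' * ennreal (wt \<omega> r') * J r r')"
        proof (cases "r \<le> r' \<and> r' < 1 - (1 - r) / K")
          case True
          have "0 < (1 - r) / K" using x K by simp
          then have r': "r' < 1" using True by linarith
          have "1 - r < K * (1 - r')" using True K x by (simp add: field_simps)
          then have J: "J r r' = ennreal (1 / (1 - r))" using True r by (simp add: J_def)
          have "P r * ennreal r \<le> P r' * ennreal r'"
            using True r r' by (intro mult_mono P_mono ennreal_leI) auto
          then have "(P r * ennreal r) * (ennreal (4 * pi) * ennreal (1 / (1 - r)) * ennreal (wt \<omega> r'))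
              \<le> (P r' * ennreal r') * (ennreal (4 * pi) * ennreal (1 / (1 - r)) * ennreal (wt \<omega> r'))"
            by (intro mult_right_mono) auto
          moreover have "(P r * ennreal (2 * pi * r) * ennreal (1 / (1 - r))) * (ennreal 2 * (ennreal (wt \<omega> r') * indicator {1 - (1 - r)..<1 - (1 - r) / K} r'))
              = (P r * ennreal r) * (ennreal (4 * pi) * ennreal (1 / (1 - r)) * ennreal (wt \<omega> r'))"
          proof -
            have ind: "indicator {1 - (1 - r)..<1 - (1 - r) / K} r' = (1::ennreal)" using True by simp
            have "ennreal (2 * pi * r) * ennreal 2 = ennreal (2 * pi * r * 2)"
              using r by (intro ennreal_mult'[symmetric]) simp
            also have "2 * pi * r * 2 = r * (4 * pi)" by simp
            also have "ennreal (r * (4 * pi)) = ennreal r * ennreal (4 * pi)"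
              using r by (intro ennreal_mult') simp
            finally have e: "ennreal (2 * pi * r) * ennreal 2 = ennreal r * ennreal (4 * pi)" .
            have "(P r * ennreal (2 * pi * r) * ennreal (1 / (1 - r))) * (ennreal 2 * (ennreal (wt \<omega> r') * 1))
                = P r * (ennreal (2 * pi * r) * ennreal 2) * (ennreal (1 / (1 - r)) * ennreal (wt \<omega> r'))"
              by (simp only: mult_ac mult_1_right mult_1_left)
            also have "\<dots> = (P r * ennreal r) * (ennreal (4 * pi) * ennreal (1 / (1 - r)) * ennreal (wt \<omega> r'))"
              unfolding e by (simp only: mult_ac)
            finally show ?thesis unfolding ind .
          qed
          ultimately show ?thesis by (simp add: J mult_ac)
        qed (auto simp: indicator_def)
      qed
      finally show ?thesis .
    qed simp
    have Jint: "(\<integral>\<^sup>+r. J r r' \<partial>lborel) \<le> ennreal K" for r'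
    proof (cases "r' < 1")
      case True
      define y where "y = 1 - r'"
      have y: "0 < y" using True by (simp add: y_def)
      have "(\<integral>\<^sup>+r. J r r' \<partial>lborel) \<le> (\<integral>\<^sup>+r. ennreal (1 / y) * indicator {1 - K * y..1} r \<partial>lborel)"
      proof (rule nn_integral_mono)
        fix r
        show "J r r' \<le> ennreal (1 / y) * indicator {1 - K * y..1} r"
          using y by (auto simp: J_def y_def[symmetric] indicator_def intro!: ennreal_leI divide_left_mono)
      qed
      also have "\<dots> = ennreal K"
        using y K by (simp add: nn_integral_cmult ennreal_mult'[symmetric])
      finally show ?thesis .
    next
      case False
      have "J r r' = 0" for r
      proof -
        have "K * (1 - r') \<le> 0" using False K by (simp add: mult_nonneg_nonpos)
        then show ?thesis by (simp add: J_def)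
      qed
      then show ?thesis by simp
    qed
    have "(\<integral>\<^sup>+w. ennreal (cmod (g w) powr s) * hn w \<partial>lborel)
        \<le> (\<integral>\<^sup>+r. (\<integral>\<^sup>+r'. ennreal (4 * pi) * (P r' * ennreal r' * ennreal (wt \<omega> r') * J r r') \<partial>lborel) \<partial>lborel)"
      unfolding Ln by (intro nn_integral_mono step)
    also have "\<dots> = (\<integral>\<^sup>+r'. (\<integral>\<^sup>+r. ennreal (4 * pi) * (P r' * ennreal r' * ennreal (wt \<omega> r') * J r r') \<partial>lborel) \<partial>lborel)"
      by (rule lborel_pair.Fubini') measurable
    also have "\<dots> = (\<integral>\<^sup>+r'. ennreal (4 * pi) * (P r' * ennreal r' * ennreal (wt \<omega> r') * (\<integral>\<^sup>+r. J r r' \<partial>lborel)) \<partial>lborel)"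
      by (intro nn_integral_cong) (subst nn_integral_cmult, measurable, subst nn_integral_cmult, measurable)
    also have "\<dots> \<le> (\<integral>\<^sup>+r. ennreal (2 * pi * K) * (P r * ennreal (wt \<omega> r / pi) * ennreal (2 * pi * r) * indicator {0..<1} r) \<partial>lborel)"
    proof (rule nn_integral_mono)
      fix r :: real
      show "ennreal (4 * pi) * (P r * ennreal r * ennreal (wt \<omega> r) * (\<integral>\<^sup>+r'. J r' r \<partial>lborel))
          \<le> ennreal (2 * pi * K) * (P r * ennreal (wt \<omega> r / pi) * ennreal (2 * pi * r) * indicator {0..<1} r)"
      proof (cases "0 \<le> r \<and> r < 1")
        case True
        have "ennreal (4 * pi) * (P r * ennreal r * ennreal (wt \<omega> r) * (\<integral>\<^sup>+r'. J r' r \<partial>lborel))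
            \<le> ennreal (4 * pi) * (P r * ennreal r * ennreal (wt \<omega> r) * ennreal K)"
          by (intro mult_left_mono Jint) auto
        also have "\<dots> = P r * (ennreal (4 * pi) * (ennreal r * (ennreal (wt \<omega> r) * ennreal K)))"
          by (simp only: mult_ac)
        also have "ennreal (4 * pi) * (ennreal r * (ennreal (wt \<omega> r) * ennreal K)) = ennreal (4 * pi * (r * (wt \<omega> r * K)))"
        proof -
          have n: "0 \<le> 4 * pi" "0 \<le> r" "0 \<le> wt \<omega> r" using True wt_nonneg[OF rw, of r] by auto
          show ?thesis by (simp only: ennreal_mult'[OF n(1)] ennreal_mult'[OF n(2)] ennreal_mult'[OF n(3)])
        qed
        also have "4 * pi * (r * (wt \<omega> r * K)) = 2 * pi * K * (wt \<omega> r / pi * (2 * pi * r))"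
          by simp
        also have "ennreal \<dots> = ennreal (2 * pi * K) * (ennreal (wt \<omega> r / pi) * ennreal (2 * pi * r))"
        proof -
          have n: "0 \<le> 2 * pi * K" "0 \<le> wt \<omega> r / pi" using K wt_nonneg[OF rw, of r] by auto
          show ?thesis by (simp only: ennreal_mult'[OF n(1)] ennreal_mult'[OF n(2)])
        qed
        finally show ?thesis using True by (simp add: mult_ac)
      qed (auto simp: wt_def)
    qed
    also have "\<dots> = ennreal (2 * pi * K) * (\<integral>\<^sup>+w. ennreal (cmod (g w) powr s) * hm w \<partial>lborel)"
      unfolding Lm by (rule nn_integral_cmult) measurable
    finally show ?thesis .
  qed
  moreover have "0 < 2 * pi * K" using K by simp
  ultimately show ?thesis by (intro that[of "2 * pi * K"]) auto
qed

text \<open>The kernel bound \<open>1 / (dd z w * \<tau> (dd z w))\<close> times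
  \<open>Q z w powr \<delta>\<close>, with \<open>1 - (cmod z)\<^sup>2\<close> replaced by
  \<open>1 - cmod z\<close> and likewise for \<open>w\<close>.\<close>

definition kk :: "real \<Rightarrow> complex \<Rightarrow> complex \<Rightarrow> real" where
  "kk \<delta> z w = dd z w powr (2 * \<delta> - 1) / \<tau> (dd z w) * ((1 - cmod z) powr (- \<delta>) * (1 - cmod w) powr (- \<delta>))"

lemma kk_commute: "kk \<delta> z w = kk \<delta> w z"
  by (simp add: kk_def dd_commute[of z w] mult.commute)

lemma kk_nonneg: "0 \<le> kk \<delta> z w"
proof -
  have "0 \<le> \<tau> t" for t by (cases "0 < t") (auto simp: \<tau>_pos less_imp_le tau_nonpos)
  then show ?thesis by (simp add: kk_def)
qed

lemma tau_measurable_comp [measurable]: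
  "f \<in> borel_measurable M \<Longrightarrow> (\<lambda>x. \<tau> (f x)) \<in> borel_measurable M"
  by (rule measurable_compose[OF _ \<tau>_meas])

lemma kk_measurable [measurable]:
  "(\<lambda>p. kk \<delta> (fst p) (snd p)) \<in> borel_measurable (borel \<Otimes>\<^sub>M borel)"
  unfolding kk_def by measurable

lemma kk_measurable1 [measurable]: "kk \<delta> z \<in> borel_measurable borel"
  unfolding kk_def[abs_def] by measurable

text \<open>The factor depending on \<open>dd z w\<close> is spread over the scales
  \<open>t > dd z w\<close>, so that exchanging integrals leaves box integrals with exponent
  \<open>\<gamma> = \<delta> + \<eta>\<close>. The scale \<open>t\<close> contributes
  \<open>t powr (- (\<gamma> - 2 * \<delta>) - 1)\<close>, integrable from \<open>1 - cmod z\<close>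
  upward because \<open>\<delta> < \<eta>\<close>.\<close>

lemma schur_kernel_bound:
  assumes h: "box_bounded h" and d: "0 < \<delta>" "\<delta> \<le> 1 / 2" "\<delta> < \<eta>" "\<delta> + \<eta> < \<alpha>"
  obtains C where "0 < C" "\<And>z. cmod z < 1 \<Longrightarrow>
    (\<integral>\<^sup>+w. ennreal (kk \<delta> z w * (1 - cmod w) powr (- \<eta>)) * h w \<partial>lborel) \<le> ennreal (C * (1 - cmod z) powr (- \<eta>))"
proof -
  note [measurable] = h[unfolded box_bounded_def, THEN conjunct1]
  have h0: "\<not> cmod w < 1 \<Longrightarrow> h w = 0" for w using h by (auto simp: box_bounded_def)
  define \<gamma> where "\<gamma> = \<delta> + \<eta>"
  have g: "0 \<le> \<gamma>" "\<gamma> < \<alpha>" "2 * \<delta> < \<gamma>" using d by (auto simp: \<gamma>_def)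
  obtain B where B: "0 \<le> B" and box: "\<And>z t. cmod z < 1 \<Longrightarrow> 0 < t \<Longrightarrow> t \<le> 4 \<Longrightarrow>
      (\<integral>\<^sup>+w. ennreal ((1 - cmod w) powr (- \<gamma>)) * indicator {w. dd z w < t} w * h w \<partial>lborel)
        \<le> ennreal (B * t powr (1 - \<gamma>) * \<tau> t)"
    using h g unfolding box_bounded_def by blast
  \<comment> \<open>\<open>4\<close> compares \<open>t powr (2 * \<delta> - 2)\<close> on
    \<open>{a<..2 * a}\<close> with its value at \<open>a\<close>, and \<open>2 ^ l\<close> does the
    same for the tail.\<close>
  define c :: real where "c = 2 ^ (l + 2)"
  have c: "0 < c" by (simp add: c_def)
  define C where "C = c * B / (\<gamma> - 2 * \<delta>) + 1"
  have "(\<integral>\<^sup>+w. ennreal (kk \<delta> z w * (1 - cmod w) powr (- \<eta>)) * h w \<partial>lborel) \<le> ennreal (C * (1 - cmod z) powr (- \<eta>))"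
    if z: "cmod z < 1" for z
  proof -
    define X where "X = 1 - cmod z"
    have X: "0 < X" using z by (simp add: X_def)
    \<comment> \<open>The cut at \<open>4\<close> fits \<open>dd z w < 2\<close>, since only scales
      up to twice \<open>dd z w\<close> are used; it keeps \<open>t\<close> in the range of
      \<open>box_bounded\<close>.\<close>
    define q where "q t = t powr (2 * \<delta> - 2) / \<tau> t * indicator {X..4} t" for t
    have [measurable]: "q \<in> borel_measurable borel" unfolding q_def[abs_def] by measurable
    have q0: "0 \<le> q t" for t
      using X \<tau>_pos[of t] by (cases "t \<ge> X") (auto simp: q_def indicator_def)
    have pt: "ennreal (a powr (2 * \<delta> - 1) / \<tau> a) \<le> (\<integral>\<^sup>+t. ennreal (c * q t) * indicator {a<..} t \<partial>lborel)" if a: "X \<le> a" "a < 2" for a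
    proof -
      have a0: "0 < a" using a X by simp
      have "ennreal (a powr (2 * \<delta> - 1) / \<tau> a) = ennreal (a powr (2 * \<delta> - 2) / \<tau> a) * ennreal (2 * a - a)"
        using a0 \<tau>_pos[OF a0] by (simp add: ennreal_mult'[symmetric] powr_diff power2_eq_square)
      also have "\<dots> = (\<integral>\<^sup>+t. ennreal (a powr (2 * \<delta> - 2) / \<tau> a) * indicator {a<..2 * a} t \<partial>lborel)"
        using a0 by (subst nn_integral_cmult) auto
      also have "\<dots> \<le> (\<integral>\<^sup>+t. ennreal (c * q t) * indicator {a<..} t \<partial>lborel)"
      proof (rule nn_integral_mono)
        fix t :: real
        show "ennreal (a powr (2 * \<delta> - 2) / \<tau> a) * indicator {a<..2 * a} t \<le> ennreal (c * q t) * indicator {a<..} t"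
        proof (cases "a < t \<and> t \<le> 2 * a")
          case True
          have t0: "0 < t" using True a0 by simp
          have "a powr (2 * \<delta> - 2) \<le> (t / 2) powr (2 * \<delta> - 2)"
            using True a0 d by (intro powr_mono2') auto
          also have "\<dots> = t powr (2 * \<delta> - 2) * 2 powr (2 - 2 * \<delta>)"
            using t0 by (simp add: powr_divide powr_diff field_simps)
          also have "\<dots> \<le> t powr (2 * \<delta> - 2) * 2 powr 2"
            using d by (intro mult_left_mono powr_mono) auto
          finally have 1: "a powr (2 * \<delta> - 2) \<le> 4 * t powr (2 * \<delta> - 2)" by simp
          have "\<tau> t \<le> \<tau> (2 * a)" using True t0 by (intro \<tau>_mono) auto
          also have "\<dots> \<le> 2 ^ l * \<tau> a" using a0 by (rule dbl)
          finally have 2: "1 / \<tau> a \<le> 2 ^ l / \<tau> t"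
            using \<tau>_pos[OF a0] \<tau>_pos[OF t0] by (simp add: field_simps)
          have "a powr (2 * \<delta> - 2) * (1 / \<tau> a) \<le> (4 * t powr (2 * \<delta> - 2)) * (2 ^ l / \<tau> t)"
            using 1 2 \<tau>_pos[OF a0] by (intro mult_mono) auto
          also have "\<dots> = c * q t"
            using True a by (simp add: q_def c_def power_add)
          finally show ?thesis using True by (simp add: ennreal_leI)
        qed simp
      qed
      finally show ?thesis .
    qed
    have "(\<integral>\<^sup>+w. ennreal (kk \<delta> z w * (1 - cmod w) powr (- \<eta>)) * h w \<partial>lborel)
        \<le> (\<integral>\<^sup>+w. (\<integral>\<^sup>+t. ennreal (X powr (- \<delta>)) * (ennreal (c * q t) * (ennreal ((1 - cmod w) powr (- \<gamma>)) * indicator {0<..} (t - dd z w) * h w)) \<partial>lborel) \<partial>lborel)"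
    proof (rule nn_integral_mono)
      fix w :: complex
      show "ennreal (kk \<delta> z w * (1 - cmod w) powr (- \<eta>)) * h w
          \<le> (\<integral>\<^sup>+t. ennreal (X powr (- \<delta>)) * (ennreal (c * q t) * (ennreal ((1 - cmod w) powr (- \<gamma>)) * indicator {0<..} (t - dd z w) * h w)) \<partial>lborel)"
      proof (cases "cmod w < 1")
        case w: True
        have "kk \<delta> z w * (1 - cmod w) powr (- \<eta>)
            = X powr (- \<delta>) * (1 - cmod w) powr (- \<gamma>) * (dd z w powr (2 * \<delta> - 1) / \<tau> (dd z w))"
        proof -
          have "(1 - cmod w) powr (- \<delta>) * (1 - cmod w) powr (- \<eta>) = (1 - cmod w) powr (- \<gamma>)"
            by (simp add: \<gamma>_def powr_add[symmetric])
          then show ?thesis by (simp add: kk_def X_def mult.assoc mult.left_commute)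
        qed
        then have "ennreal (kk \<delta> z w * (1 - cmod w) powr (- \<eta>))
            = ennreal (X powr (- \<delta>) * (1 - cmod w) powr (- \<gamma>)) * ennreal (dd z w powr (2 * \<delta> - 1) / \<tau> (dd z w))"
        proof -
          assume "kk \<delta> z w * (1 - cmod w) powr (- \<eta>)
            = X powr (- \<delta>) * (1 - cmod w) powr (- \<gamma>) * (dd z w powr (2 * \<delta> - 1) / \<tau> (dd z w))"
          then show ?thesis by (simp only:) (rule ennreal_mult', simp)
        qed
        also have "\<dots> \<le> ennreal (X powr (- \<delta>) * (1 - cmod w) powr (- \<gamma>)) * (\<integral>\<^sup>+t. ennreal (c * q t) * indicator {dd z w<..} t \<partial>lborel)"
          using w z dd_ge[of w z] dd_lt_2[of z w] by (intro mult_left_mono pt) (auto simp: X_def)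
        finally have "ennreal (kk \<delta> z w * (1 - cmod w) powr (- \<eta>)) * h w
            \<le> ennreal (X powr (- \<delta>) * (1 - cmod w) powr (- \<gamma>)) * (\<integral>\<^sup>+t. ennreal (c * q t) * indicator {dd z w<..} t \<partial>lborel) * h w"
          by (rule mult_right_mono) simp
        also have "\<dots> = (\<integral>\<^sup>+t. ennreal (X powr (- \<delta>) * (1 - cmod w) powr (- \<gamma>)) * (ennreal (c * q t) * indicator {dd z w<..} t) * h w \<partial>lborel)"
          by (subst nn_integral_multc, measurable, subst nn_integral_cmult, measurable)
        also have "\<dots> = (\<integral>\<^sup>+t. ennreal (X powr (- \<delta>)) * (ennreal (c * q t) * (ennreal ((1 - cmod w) powr (- \<gamma>)) * indicator {0<..} (t - dd z w) * h w)) \<partial>lborel)"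
          by (intro nn_integral_cong) (auto simp: indicator_def ennreal_mult' mult_ac)
        finally show ?thesis .
      qed (simp add: h0)
    qed
    also have "\<dots> = (\<integral>\<^sup>+t. (\<integral>\<^sup>+w. ennreal (X powr (- \<delta>)) * (ennreal (c * q t) * (ennreal ((1 - cmod w) powr (- \<gamma>)) * indicator {0<..} (t - dd z w) * h w)) \<partial>lborel) \<partial>lborel)"
      by (rule lborel_pair.Fubini') measurable
    also have "\<dots> = (\<integral>\<^sup>+t. ennreal (X powr (- \<delta>)) * (ennreal (c * q t) * (\<integral>\<^sup>+w. ennreal ((1 - cmod w) powr (- \<gamma>)) * indicator {w. dd z w < t} w * h w \<partial>lborel)) \<partial>lborel)"
    proof (rule nn_integral_cong)
      fix t :: real
      have "(\<lambda>w. indicator {0<..} (t - dd z w) :: ennreal) = indicator {w. dd z w < t}"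
        by (auto simp: indicator_def)
      then show "(\<integral>\<^sup>+w. ennreal (X powr (- \<delta>)) * (ennreal (c * q t) * (ennreal ((1 - cmod w) powr (- \<gamma>)) * indicator {0<..} (t - dd z w) * h w)) \<partial>lborel)
          = ennreal (X powr (- \<delta>)) * (ennreal (c * q t) * (\<integral>\<^sup>+w. ennreal ((1 - cmod w) powr (- \<gamma>)) * indicator {w. dd z w < t} w * h w \<partial>lborel))"
        by (subst nn_integral_cmult, measurable, subst nn_integral_cmult, measurable) (metis (no_types, lifting))
    qed
    also have "\<dots> \<le> (\<integral>\<^sup>+t. ennreal (X powr (- \<delta>) * c * B) * (ennreal (t powr (- (\<gamma> - 2 * \<delta>) - 1)) * indicator {X..} t) \<partial>lborel)"
    proof (rule nn_integral_mono)
      fix t :: real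
      show "ennreal (X powr (- \<delta>)) * (ennreal (c * q t) * (\<integral>\<^sup>+w. ennreal ((1 - cmod w) powr (- \<gamma>)) * indicator {w. dd z w < t} w * h w \<partial>lborel))
          \<le> ennreal (X powr (- \<delta>) * c * B) * (ennreal (t powr (- (\<gamma> - 2 * \<delta>) - 1)) * indicator {X..} t)"
      proof (cases "X \<le> t \<and> t \<le> 4")
        case True
        have t0: "0 < t" using True X by simp
        have "ennreal (X powr (- \<delta>)) * (ennreal (c * q t) * (\<integral>\<^sup>+w. ennreal ((1 - cmod w) powr (- \<gamma>)) * indicator {w. dd z w < t} w * h w \<partial>lborel))
            \<le> ennreal (X powr (- \<delta>)) * (ennreal (c * q t) * ennreal (B * t powr (1 - \<gamma>) * \<tau> t))"
          using True t0 by (intro mult_left_mono box z) auto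
        also have "\<dots> = ennreal (X powr (- \<delta>) * ((c * q t) * (B * t powr (1 - \<gamma>) * \<tau> t)))"
          using c q0[of t] B by (simp add: ennreal_mult')
        also have "X powr (- \<delta>) * ((c * q t) * (B * t powr (1 - \<gamma>) * \<tau> t)) = X powr (- \<delta>) * c * B * (t powr (2 * \<delta> - 2) * t powr (1 - \<gamma>))"
          using True \<tau>_pos[OF t0] by (simp add: q_def)
        also have "t powr (2 * \<delta> - 2) * t powr (1 - \<gamma>) = t powr (- (\<gamma> - 2 * \<delta>) - 1)"
          by (simp add: powr_add[symmetric])
        finally show ?thesis using True c B by (simp add: ennreal_mult')
      qed (auto simp: q_def indicator_def)
    qed
    also have "\<dots> = ennreal (X powr (- \<delta>) * c * B) * ennreal (X powr (- (\<gamma> - 2 * \<delta>)) / (\<gamma> - 2 * \<delta>))"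
      using nn_integral_powr_atLeast[OF X, of "\<gamma> - 2 * \<delta>"] g by (subst nn_integral_cmult) auto
    also have "\<dots> = ennreal (c * B / (\<gamma> - 2 * \<delta>) * (X powr (- \<delta>) * X powr (- (\<gamma> - 2 * \<delta>))))"
      using c B by (simp add: ennreal_mult'[symmetric] mult_ac)
    also have "X powr (- \<delta>) * X powr (- (\<gamma> - 2 * \<delta>)) = X powr (- \<eta>)"
      by (simp add: powr_add[symmetric] \<gamma>_def)
    also have "ennreal (c * B / (\<gamma> - 2 * \<delta>) * X powr (- \<eta>)) \<le> ennreal (C * X powr (- \<eta>))"
      by (intro ennreal_leI mult_right_mono) (auto simp: C_def)
    finally show ?thesis unfolding X_def .
  qed
  moreover have "0 < C" using c B g by (auto simp: C_def intro!: add_nonneg_pos)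
  ultimately show ?thesis by (intro that[of C]) auto
qed

end

section \<open>A Schur test from one weight to the other\<close>

context D_weight
begin

lemma kk_measurable_swap [measurable]:
  "(\<lambda>p. kk \<delta> (snd p) (fst p)) \<in> borel_measurable (borel \<Otimes>\<^sub>M borel)"
proof -
  have "(\<lambda>p. kk \<delta> (snd p) (fst p)) = (\<lambda>p. kk \<delta> (fst p) (snd p))"
    by (rule ext) (rule kk_commute)
  then show ?thesis by simp
qed

text \<open>The test function is \<open>(1 - cmod w) powr (- \<epsilon>)\<close>, with one kernel
  integral taken against \<open>hn\<close> and the other against \<open>hm\<close>. In place of
  Hoelder's inequality \<open>u\<close> is split at \<open>\<mu>\<close> times a power of the test
  function, and \<open>\<mu>\<close> is optimised for each \<open>z\<close>. The bound
  \<open>\<delta> * s < \<alpha>\<close> is exported for the integrability of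
  \<open>(1 - cmod z) powr (- (\<delta> * s))\<close>.\<close>

lemma schur_test:
  fixes s :: real
  assumes s: "1 < s"
  obtains \<delta> C where "0 < \<delta>" "\<delta> * s < \<alpha>" "0 < C"
    "\<And>H u. (\<And>z. 0 \<le> H z) \<Longrightarrow> (\<And>z. 0 \<le> u z) \<Longrightarrow> u \<in> borel_measurable borel \<Longrightarrow>
      (\<And>z. cmod z < 1 \<Longrightarrow> ennreal (H z) \<le> (\<integral>\<^sup>+w. ennreal (kk \<delta> z w * u w) * hn w \<partial>lborel)) \<Longrightarrow>
      (\<integral>\<^sup>+z. ennreal (H z powr s) * hm z \<partial>lborel) \<le> ennreal C * (\<integral>\<^sup>+w. ennreal (u w powr s) * hn w \<partial>lborel)"
proof -
  define s' where "s' = s / (s - 1)"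
  have s': "1 < s'" "s' * (s - 1) = s" using s by (auto simp: s'_def)
  \<comment> \<open>Both exponents \<open>\<epsilon> * s\<close> and \<open>\<epsilon> * s'\<close>
    are at most \<open>\<alpha> / 4\<close> and stay, after adding the smaller
    \<open>\<delta>\<close>, in the range of the box estimates.\<close>
  define \<epsilon> where "\<epsilon> = \<alpha> / (4 * max s s')"
  have eps: "0 < \<epsilon>" "\<epsilon> * s \<le> \<alpha> / 4" "\<epsilon> * s' \<le> \<alpha> / 4" "\<epsilon> \<le> \<alpha> / 4"
  proof -
    have mx: "0 < max s s'" "1 \<le> max s s'" using s by auto
    show "0 < \<epsilon>" using mx \<alpha> by (simp add: \<epsilon>_def)
    have e: "\<epsilon> * max s s' = \<alpha> / 4" using mx by (simp add: \<epsilon>_def)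
    show "\<epsilon> * s \<le> \<alpha> / 4" "\<epsilon> * s' \<le> \<alpha> / 4" "\<epsilon> \<le> \<alpha> / 4"
      unfolding e[symmetric] using mx \<open>0 < \<epsilon>\<close> by auto
  qed
  have es: "\<epsilon> \<le> \<epsilon> * s" "\<epsilon> \<le> \<epsilon> * s'" using eps s s' by auto
  \<comment> \<open>Half of \<open>\<epsilon>\<close> lies strictly below both Schur exponents, as
    the convergence in \<open>schur_kernel_bound\<close> demands.\<close>
  define \<delta> where "\<delta> = min (1 / 2) (\<epsilon> / 2)"
  have d: "0 < \<delta>" "\<delta> \<le> 1 / 2" "\<delta> \<le> \<epsilon> / 2" using eps by (auto simp: \<delta>_def)
  have dl: "\<delta> < \<epsilon> * s" "\<delta> < \<epsilon> * s'" "\<delta> + \<epsilon> * s < \<alpha>" "\<delta> + \<epsilon> * s' < \<alpha>"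
    using d es eps \<alpha> by linarith+
  have ds: "\<delta> * s < \<alpha>"
  proof -
    have "\<delta> * s \<le> \<epsilon> / 2 * s" using d s by (intro mult_right_mono) auto
    also have "\<dots> = \<epsilon> * s / 2" by simp
    finally show ?thesis using eps \<alpha> by linarith
  qed
  obtain C1 where C1: "0 < C1" and b1: "\<And>z. cmod z < 1 \<Longrightarrow>
      (\<integral>\<^sup>+w. ennreal (kk \<delta> z w * (1 - cmod w) powr (- (\<epsilon> * s'))) * hn w \<partial>lborel) \<le> ennreal (C1 * (1 - cmod z) powr (- (\<epsilon> * s')))"
    using schur_kernel_bound[OF box_bounded_hn d(1,2) dl(2,4)] by blast
  obtain C2 where C2: "0 < C2" and b2: "\<And>z. cmod z < 1 \<Longrightarrow>
      (\<integral>\<^sup>+w. ennreal (kk \<delta> z w * (1 - cmod w) powr (- (\<epsilon> * s))) * hm w \<partial>lborel) \<le> ennreal (C2 * (1 - cmod z) powr (- (\<epsilon> * s)))"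
    using schur_kernel_bound[OF box_bounded_hm d(1,2) dl(1,3)] by blast
  define C where "C = (C1 + 1) powr s * C2"
  have "(\<integral>\<^sup>+z. ennreal (H z powr s) * hm z \<partial>lborel) \<le> ennreal C * (\<integral>\<^sup>+w. ennreal (u w powr s) * hn w \<partial>lborel)"
    if H: "\<And>z. 0 \<le> H z" and u: "\<And>z. 0 \<le> u z" and um [measurable]: "u \<in> borel_measurable borel"
      and le: "\<And>z. cmod z < 1 \<Longrightarrow> ennreal (H z) \<le> (\<integral>\<^sup>+w. ennreal (kk \<delta> z w * u w) * hn w \<partial>lborel)" for H u :: "complex \<Rightarrow> real"
  proof -
    \<comment> \<open>The exponent is dictated by
      \<open>\<epsilon> * s' * (s - 1) = \<epsilon> * s\<close>: where \<open>u w\<close> exceeds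
      \<open>\<mu> * (1 - cmod w) powr (- (\<epsilon> * s'))\<close>, it is at most
      \<open>\<mu> powr (1 - s) * V w\<close>.\<close>
    define V where "V w = (1 - cmod w) powr (\<epsilon> * s) * u w powr s" for w
    have V0: "0 \<le> V w" for w by (simp add: V_def)
    have [measurable]: "V \<in> borel_measurable borel" unfolding V_def[abs_def] by measurable
    define I where "I z = (\<integral>\<^sup>+w. ennreal (kk \<delta> z w) * (ennreal (V w) * hn w) \<partial>lborel)" for z
    have [measurable]: "I \<in> borel_measurable borel" unfolding I_def[abs_def] by measurable
    have split: "ennreal (H z) \<le> ennreal (\<mu> * (C1 * (1 - cmod z) powr (- (\<epsilon> * s')))) + ennreal (\<mu> powr (1 - s)) * I z"
      if z: "cmod z < 1" and lam: "0 < \<mu>" for z \<mu>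
    proof -
      have "ennreal (H z) \<le> (\<integral>\<^sup>+w. ennreal (kk \<delta> z w * u w) * hn w \<partial>lborel)" by (rule le[OF z])
      also have "\<dots> \<le> (\<integral>\<^sup>+w. ennreal \<mu> * (ennreal (kk \<delta> z w * (1 - cmod w) powr (- (\<epsilon> * s'))) * hn w)
          + ennreal (\<mu> powr (1 - s)) * (ennreal (kk \<delta> z w) * (ennreal (V w) * hn w)) \<partial>lborel)"
      proof (rule nn_integral_mono)
        fix w :: complex
        show "ennreal (kk \<delta> z w * u w) * hn w \<le> ennreal \<mu> * (ennreal (kk \<delta> z w * (1 - cmod w) powr (- (\<epsilon> * s'))) * hn w)
          + ennreal (\<mu> powr (1 - s)) * (ennreal (kk \<delta> z w) * (ennreal (V w) * hn w))"
        proof (cases "cmod w < 1")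
          case True
          define Y where "Y = 1 - cmod w"
          have Y: "0 < Y" using True by (simp add: Y_def)
          have pt: "u w \<le> \<mu> * Y powr (- (\<epsilon> * s')) + \<mu> powr (1 - s) * V w"
          proof (cases "u w * Y powr (\<epsilon> * s') \<le> \<mu>")
            case True
            then have "u w \<le> \<mu> * Y powr (- (\<epsilon> * s'))"
              using Y by (simp add: powr_minus field_simps)
            then show ?thesis using V0[of w] by (smt (verit) mult_nonneg_nonneg powr_ge_zero)
          next
            case False
            then have big: "1 \<le> u w * Y powr (\<epsilon> * s') / \<mu>" using lam by simp
            then have u0: "0 < u w" using u[of w] lam Y by (cases "u w = 0") auto
            have "1 \<le> (u w * Y powr (\<epsilon> * s') / \<mu>) powr (s - 1)"
              using big s by (intro ge_one_powr_ge_zero) auto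
            then have "u w * 1 \<le> u w * (u w * Y powr (\<epsilon> * s') / \<mu>) powr (s - 1)"
              using u0 by (intro mult_left_mono) auto
            also have "(u w * Y powr (\<epsilon> * s') / \<mu>) powr (s - 1) = u w powr (s - 1) * Y powr (\<epsilon> * s' * (s - 1)) * \<mu> powr (1 - s)"
              using u0 Y lam by (simp add: powr_mult powr_divide powr_powr powr_minus_divide[of \<mu> "s - 1", simplified])
            also have "\<epsilon> * s' * (s - 1) = \<epsilon> * s" using s'(2) by (simp add: mult.assoc)
            also have "u w * (u w powr (s - 1) * Y powr (\<epsilon> * s) * \<mu> powr (1 - s)) = \<mu> powr (1 - s) * V w"
              using u0 by (simp add: V_def Y_def powr_diff)
            finally show ?thesis using lam by (simp add: add_increasing)
          qed
          have "kk \<delta> z w * u w \<le> kk \<delta> z w * (\<mu> * Y powr (- (\<epsilon> * s')) + \<mu> powr (1 - s) * V w)"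
            by (rule mult_left_mono[OF pt kk_nonneg])
          also have "\<dots> = \<mu> * (kk \<delta> z w * Y powr (- (\<epsilon> * s'))) + \<mu> powr (1 - s) * (kk \<delta> z w * V w)"
            by (simp add: algebra_simps)
          finally have "ennreal (kk \<delta> z w * u w) \<le> ennreal (\<mu> * (kk \<delta> z w * Y powr (- (\<epsilon> * s'))) + \<mu> powr (1 - s) * (kk \<delta> z w * V w))"
            by (rule ennreal_leI)
          also have "\<dots> = ennreal \<mu> * ennreal (kk \<delta> z w * Y powr (- (\<epsilon> * s'))) + ennreal (\<mu> powr (1 - s)) * (ennreal (kk \<delta> z w) * ennreal (V w))"
            using lam kk_nonneg[of \<delta> z w] V0[of w]
            by (subst ennreal_plus) (auto simp: ennreal_mult)
          finally have "ennreal (kk \<delta> z w * u w) * hn w \<le> (ennreal \<mu> * ennreal (kk \<delta> z w * Y powr (- (\<epsilon> * s'))) + ennreal (\<mu> powr (1 - s)) * (ennreal (kk \<delta> z w) * ennreal (V w))) * hn w"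
            by (rule mult_right_mono) simp
          then show ?thesis by (simp only: Y_def distrib_right mult.assoc)
        qed (simp add: hn_outside)
      qed
      also have "\<dots> = ennreal \<mu> * (\<integral>\<^sup>+w. ennreal (kk \<delta> z w * (1 - cmod w) powr (- (\<epsilon> * s'))) * hn w \<partial>lborel) + ennreal (\<mu> powr (1 - s)) * I z"
        unfolding I_def by (subst nn_integral_add) (auto simp: nn_integral_cmult)
      also have "\<dots> \<le> ennreal \<mu> * ennreal (C1 * (1 - cmod z) powr (- (\<epsilon> * s'))) + ennreal (\<mu> powr (1 - s)) * I z"
        by (intro add_right_mono mult_left_mono b1 z) auto
      finally show ?thesis using lam by (simp add: ennreal_mult')
    qed
    have ptw: "ennreal (H z powr s) * hm z \<le> ennreal ((C1 + 1) powr s) * (ennreal ((1 - cmod z) powr (- (\<epsilon> * s))) * hm z * I z)" for z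
    proof (cases "cmod z < 1")
      case z: True
      define X where "X = 1 - cmod z"
      have X: "0 < X" using z by (simp add: X_def)
      have "ennreal (H z powr s) \<le> ennreal ((C1 + 1) powr s) * (ennreal (X powr (- (\<epsilon> * s))) * I z)"
      proof (cases "I z")
        case top
        have "ennreal (X powr (- (\<epsilon> * s))) * I z = top" using X by (simp add: top ennreal_mult_top)
        then show ?thesis using C1 by (simp add: ennreal_mult_top)
      next
        case (real i)
        have bd: "H z \<le> \<mu> * (C1 * X powr (- (\<epsilon> * s'))) + \<mu> powr (1 - s) * i" if lam: "0 < \<mu>" for \<mu>
        proof -
          have "ennreal (H z) \<le> ennreal (\<mu> * (C1 * X powr (- (\<epsilon> * s')))) + ennreal (\<mu> powr (1 - s)) * ennreal i"
            using split[OF z lam] by (simp add: real X_def)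
          also have "\<dots> = ennreal (\<mu> * (C1 * X powr (- (\<epsilon> * s'))) + \<mu> powr (1 - s) * i)"
            using lam C1 real by (subst ennreal_plus) (auto simp: ennreal_mult')
          finally show ?thesis
            using lam C1 real by (subst (asm) ennreal_le_iff) (auto intro!: add_nonneg_nonneg)
        qed
        show ?thesis
        proof (cases "i = 0")
          case True
          \<comment> \<open>Now \<open>bd\<close> bounds \<open>H z\<close> by an arbitrarily small
            multiple of a fixed number; \<open>\<mu> = H z / (2 * k)\<close> is small enough for a
            contradiction.\<close>
          have "H z = 0"
          proof (rule ccontr)
            assume "H z \<noteq> 0"
            then have Hz: "0 < H z" using H[of z] by simp
            define k where "k = C1 * X powr (- (\<epsilon> * s'))"
            have k: "0 < k" using C1 X by (simp add: k_def)
            have "H z \<le> (H z / (2 * k)) * k"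
              using bd[of "H z / (2 * k)"] Hz k True by (simp add: k_def[symmetric])
            also have "\<dots> = H z / 2" using k by simp
            finally show False using Hz by simp
          qed
          then show ?thesis by simp
        next
          case False
          then have i: "0 < i" using real by simp
          \<comment> \<open>Balances the two terms of \<open>bd\<close>: the second one becomes
            \<open>\<mu> * X powr (- (\<epsilon> * s'))\<close>, which is the first one divided by
            \<open>C1\<close>.\<close>
          define \<mu> where "\<mu> = (i * X powr (\<epsilon> * s')) powr (1 / s)"
          have lam: "0 < \<mu>" using i X by (simp add: \<mu>_def)
          have lams: "\<mu> powr s = i * X powr (\<epsilon> * s')"
            using s i X by (simp add: \<mu>_def powr_powr)
          have "\<mu> powr (1 - s) * i = \<mu> / \<mu> powr s * i"
            using lam by (simp add: powr_diff)
          also have "\<dots> = \<mu> * X powr (- (\<epsilon> * s'))"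
            unfolding lams using i X by (simp add: powr_minus field_simps)
          finally have "H z \<le> (C1 + 1) * (\<mu> * X powr (- (\<epsilon> * s')))"
            using bd[OF lam] by (simp add: algebra_simps)
          then have "H z powr s \<le> ((C1 + 1) * (\<mu> * X powr (- (\<epsilon> * s')))) powr s"
            using H s by (intro powr_mono2) auto
          also have "\<dots> = (C1 + 1) powr s * (\<mu> powr s * X powr (- (\<epsilon> * s' * s)))"
            using C1 lam X by (simp add: powr_mult powr_powr mult.assoc)
          also have "\<mu> powr s * X powr (- (\<epsilon> * s' * s)) = i * (X powr (\<epsilon> * s') * X powr (- (\<epsilon> * s' * s)))"
            by (simp add: lams)
          also have "X powr (\<epsilon> * s') * X powr (- (\<epsilon> * s' * s)) = X powr (- (\<epsilon> * s))"
          proof -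
            have "\<epsilon> * s' - \<epsilon> * s' * s = - (\<epsilon> * (s' * (s - 1)))" by (simp add: algebra_simps)
            then show ?thesis by (simp add: powr_add[symmetric] s'(2))
          qed
          finally have "ennreal (H z powr s) \<le> ennreal ((C1 + 1) powr s * (i * X powr (- (\<epsilon> * s))))"
            by (rule ennreal_leI)
          then show ?thesis using real by (simp add: ennreal_mult' mult.commute)
        qed
      qed
      then have "ennreal (H z powr s) * hm z \<le> ennreal ((C1 + 1) powr s) * (ennreal (X powr (- (\<epsilon> * s))) * I z) * hm z"
        by (rule mult_right_mono) simp
      then show ?thesis by (simp add: X_def mult_ac)
    qed (simp add: hm_outside)
    have "(\<integral>\<^sup>+z. ennreal (H z powr s) * hm z \<partial>lborel)
        \<le> (\<integral>\<^sup>+z. ennreal ((C1 + 1) powr s) * (ennreal ((1 - cmod z) powr (- (\<epsilon> * s))) * hm z * I z) \<partial>lborel)"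
      by (intro nn_integral_mono ptw)
    also have "\<dots> = ennreal ((C1 + 1) powr s) * (\<integral>\<^sup>+z. ennreal ((1 - cmod z) powr (- (\<epsilon> * s))) * hm z * I z \<partial>lborel)"
      by (rule nn_integral_cmult) measurable
    also have "(\<integral>\<^sup>+z. ennreal ((1 - cmod z) powr (- (\<epsilon> * s))) * hm z * I z \<partial>lborel)
        = (\<integral>\<^sup>+z. (\<integral>\<^sup>+w. (ennreal ((1 - cmod z) powr (- (\<epsilon> * s))) * hm z) * (ennreal (kk \<delta> z w) * (ennreal (V w) * hn w)) \<partial>lborel) \<partial>lborel)"
      unfolding I_def by (intro nn_integral_cong nn_integral_cmult[symmetric]) measurable
    also have "\<dots> = (\<integral>\<^sup>+w. (\<integral>\<^sup>+z. (ennreal ((1 - cmod z) powr (- (\<epsilon> * s))) * hm z) * (ennreal (kk \<delta> z w) * (ennreal (V w) * hn w)) \<partial>lborel) \<partial>lborel)"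
      by (rule lborel_pair.Fubini') measurable
    also have "\<dots> = (\<integral>\<^sup>+w. (ennreal (V w) * hn w) * (\<integral>\<^sup>+z. ennreal (kk \<delta> w z * (1 - cmod z) powr (- (\<epsilon> * s))) * hm z \<partial>lborel) \<partial>lborel)"
    proof (rule nn_integral_cong)
      fix w :: complex
      have "(\<integral>\<^sup>+z. (ennreal ((1 - cmod z) powr (- (\<epsilon> * s))) * hm z) * (ennreal (kk \<delta> z w) * (ennreal (V w) * hn w)) \<partial>lborel)
          = (\<integral>\<^sup>+z. (ennreal (V w) * hn w) * (ennreal (kk \<delta> w z * (1 - cmod z) powr (- (\<epsilon> * s))) * hm z) \<partial>lborel)"
        by (intro nn_integral_cong) (simp only: kk_commute[of \<delta> w] ennreal_mult'[OF kk_nonneg] mult_ac)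
      also have "\<dots> = (ennreal (V w) * hn w) * (\<integral>\<^sup>+z. ennreal (kk \<delta> w z * (1 - cmod z) powr (- (\<epsilon> * s))) * hm z \<partial>lborel)"
        by (rule nn_integral_cmult) measurable
      finally show "(\<integral>\<^sup>+z. (ennreal ((1 - cmod z) powr (- (\<epsilon> * s))) * hm z) * (ennreal (kk \<delta> z w) * (ennreal (V w) * hn w)) \<partial>lborel)
        = (ennreal (V w) * hn w) * (\<integral>\<^sup>+z. ennreal (kk \<delta> w z * (1 - cmod z) powr (- (\<epsilon> * s))) * hm z \<partial>lborel)" .
    qed
    also have "ennreal ((C1 + 1) powr s) * \<dots> \<le> ennreal ((C1 + 1) powr s) * (\<integral>\<^sup>+w. ennreal C2 * (ennreal (u w powr s) * hn w) \<partial>lborel)"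
    proof (rule mult_left_mono[OF nn_integral_mono])
      fix w :: complex
      show "(ennreal (V w) * hn w) * (\<integral>\<^sup>+z. ennreal (kk \<delta> w z * (1 - cmod z) powr (- (\<epsilon> * s))) * hm z \<partial>lborel) \<le> ennreal C2 * (ennreal (u w powr s) * hn w)"
      proof (cases "cmod w < 1")
        case True
        have "(ennreal (V w) * hn w) * (\<integral>\<^sup>+z. ennreal (kk \<delta> w z * (1 - cmod z) powr (- (\<epsilon> * s))) * hm z \<partial>lborel)
            \<le> (ennreal (V w) * hn w) * ennreal (C2 * (1 - cmod w) powr (- (\<epsilon> * s)))"
          by (intro mult_left_mono b2 True) auto
        also have "\<dots> = (ennreal (V w) * ennreal (C2 * (1 - cmod w) powr (- (\<epsilon> * s)))) * hn w"
          by (simp only: mult_ac)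
        also have "ennreal (V w) * ennreal (C2 * (1 - cmod w) powr (- (\<epsilon> * s))) = ennreal (V w * (C2 * (1 - cmod w) powr (- (\<epsilon> * s))))"
          by (rule ennreal_mult'[symmetric, OF V0])
        also have "V w * (C2 * (1 - cmod w) powr (- (\<epsilon> * s))) = C2 * u w powr s"
          using True by (simp add: V_def powr_minus field_simps)
        also have "ennreal (C2 * u w powr s) = ennreal C2 * ennreal (u w powr s)"
          using C2 by (intro ennreal_mult') simp
        finally show ?thesis by (simp only: mult.assoc)
      qed (simp add: hn_outside)
    qed simp
    also have "\<dots> = ennreal C * (\<integral>\<^sup>+w. ennreal (u w powr s) * hn w \<partial>lborel)"
      using C1 C2 by (simp add: nn_integral_cmult C_def ennreal_mult' mult.assoc)
    finally show ?thesis .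
  qed
  moreover have "0 < C" using C1 C2 by (simp add: C_def)
  ultimately show ?thesis using that d ds by blast
qed

end

text \<open>
  A function that oscillates by at most \<open>K\<close> at bounded hyperbolic distance is compared at two
  points by moving both radially to the height \<open>dd z w\<close>, doubling the distance to the boundary in
  each step.
\<close>

lemma oscillation_chain:
  fixes b :: "complex \<Rightarrow> complex"
  assumes d: "0 < \<delta>"
  obtains C where "0 < C"
    "\<And>b :: complex \<Rightarrow> complex. \<And>K z w. 0 \<le> K \<Longrightarrow>
      (\<And>z w. cmod z < 1 \<Longrightarrow> cmod w < 1 \<Longrightarrow> Q z w < 10 \<Longrightarrow> cmod (b z - b w) \<le> K) \<Longrightarrow>
      cmod z < 1 \<Longrightarrow> cmod w < 1 \<Longrightarrow> cmod (b z - b w) \<le> C * K * Q z w powr \<delta>"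
proof -
  \<comment> \<open>Sum of the geometric series of \<open>2 powr (- \<delta>)\<close>. The relation
    \<open>C1 = 1 + C1 * 2 powr (- \<delta>)\<close> lets the induction over the doubling steps
    close with the same constant.\<close>
  define C1 where "C1 = 1 / (1 - 2 powr (- \<delta>))"
  have p2: "2 powr (- \<delta>) < (1::real)" using d by (simp add: powr_less_one)
  have C1: "1 \<le> C1" and C1e: "C1 * (1 - 2 powr (- \<delta>)) = 1"
    using p2 by (auto simp: C1_def)
  define C where "C = 2 * C1 * 4 powr \<delta> + 1"
  have C: "0 < C" using C1 by (simp add: C_def add_nonneg_pos)
  have "cmod (b z - b w) \<le> C * K * Q z w powr \<delta>"
    if K: "0 \<le> K" and osc: "\<And>z w. cmod z < 1 \<Longrightarrow> cmod w < 1 \<Longrightarrow> Q z w < 10 \<Longrightarrow> cmod (b z - b w) \<le> K"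
      and z: "cmod z < 1" and w: "cmod w < 1" for b :: "complex \<Rightarrow> complex" and K z w
  proof -
    \<comment> \<open>The point on the ray through \<open>z\<close> at boundary distance
      \<open>t\<close>. For \<open>z = 0\<close> the direction \<open>sgn z\<close> is
      \<open>0\<close>, which is consistent because only \<open>t = 1\<close> occurs then.\<close>
    define pt where "pt z t = of_real (1 - t) * sgn z" for z :: complex and t :: real
    have norm_pt: "cmod (pt z t) = 1 - t" if "1 - cmod z \<le> t" "t \<le> 1" for z t
    proof (cases "z = 0")
      case True
      then show ?thesis using that by (simp add: pt_def)
    next
      case False
      then show ?thesis using that by (simp add: pt_def norm_mult norm_sgn del: of_real_diff)
    qed
    have pt_self: "pt z (1 - cmod z) = z" for z
      by (simp add: pt_def sgn_eq)
    have radial: "cmod (b z - b (pt z t)) \<le> C1 * K * (t / (1 - cmod z)) powr \<delta>"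
      if "t \<le> 2 ^ n * (1 - cmod z)" "cmod z < 1" "1 - cmod z \<le> t" "t \<le> 1" for n t z
      using that
    proof (induction n arbitrary: z)
      case 0
      then have "t = 1 - cmod z" by simp
      then show ?case using C1 K by (simp add: pt_self)
    next
      case (Suc n)
      define X where "X = 1 - cmod z"
      have X: "0 < X" "X \<le> t" "cmod z = 1 - X" using Suc.prems by (auto simp: X_def)
      have one: "1 \<le> (t / X) powr \<delta>" using X d by (intro ge_one_powr_ge_zero) auto
      \<comment> \<open>A radial step to at most twice the boundary distance keeps \<open>Q\<close>
        at most \<open>9\<close>, below the threshold \<open>10\<close>. The case
        \<open>t' = 1\<close> ends at the origin and is estimated separately.\<close>
      have step: "cmod (b z - b (pt z t')) \<le> K" if t': "X \<le> t'" "t' \<le> 2 * X" "t' \<le> 1" for t'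
      proof (cases "t' = 1")
        case True
        have "Q z 0 \<le> (dd z 0)\<^sup>2 / ((1 - cmod z) * (1 - cmod 0))"
          using Suc.prems by (intro Q_upper) auto
        also have "\<dots> = 1 / X" by (simp add: dd_def X_def)
        also have "\<dots> \<le> 2" using t' True X by (simp add: field_simps)
        finally show ?thesis using osc[of z 0] Suc.prems True by (simp add: pt_def)
      next
        case False
        have np: "cmod (pt z t') = 1 - t'" using t' by (intro norm_pt) (auto simp: X_def)
        have z0: "z \<noteq> 0" using t' False X by auto
        have "cnj z * pt z t' = of_real ((1 - X) * (1 - t'))"
        proof -
          have "cnj z * sgn z = of_real (cmod z)"
          proof -
            have "cnj z * sgn z = z * cnj z / of_real (cmod z)" by (simp add: sgn_eq)
            also have "\<dots> = of_real ((cmod z)\<^sup>2) / of_real (cmod z)" by (simp only: complex_norm_square)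
            also have "\<dots> = of_real (cmod z)" by (simp add: power2_eq_square)
            finally show ?thesis .
          qed
          then show ?thesis by (simp add: pt_def X(3) mult.left_commute)
        qed
        then have "dd z (pt z t') = \<bar>1 - (1 - X) * (1 - t')\<bar>"
          unfolding dd_def by (metis norm_of_real of_real_1 of_real_diff)
        also have "\<dots> \<le> 3 * X"
        proof -
          have "0 \<le> (1 - X) * (1 - t')" "(1 - X) * (1 - t') \<le> 1"
            using X t' Suc.prems by (auto simp: mult_le_one)
          moreover have "1 - (1 - X) * (1 - t') = X + t' - X * t'" by (simp add: algebra_simps)
          moreover have "0 \<le> X * t'" using X t' by simp
          ultimately show ?thesis using t' by linarith
        qed
        finally have d3: "dd z (pt z t') \<le> 3 * X" .
        have "Q z (pt z t') \<le> (dd z (pt z t'))\<^sup>2 / ((1 - cmod z) * (1 - cmod (pt z t')))"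
          using Suc.prems np t' X by (intro Q_upper) auto
        also have "\<dots> \<le> (3 * X)\<^sup>2 / (X * X)"
          using d3 np t' X by (intro frac_le power_mono mult_mono mult_pos_pos) (auto simp: dd_def)
        also have "\<dots> = 9" using X by (simp add: power2_eq_square)
        finally show ?thesis using Suc.prems np t' X by (intro osc) auto
      qed
      show ?case
      proof (cases "t \<le> 2 * X")
        case True
        have "cmod (b z - b (pt z t)) \<le> K" using True X Suc.prems by (intro step) auto
        also have "K = 1 * K * 1" by simp
        also have "\<dots> \<le> C1 * K * (t / X) powr \<delta>"
          using C1 K one by (intro mult_mono) auto
        finally show ?thesis by (simp add: X_def)
      next
        case False
        define z' where "z' = pt z (2 * X)"
        have nz': "cmod z' = 1 - 2 * X" unfolding z'_def using X False Suc.prems by (intro norm_pt) auto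
        have z0: "z \<noteq> 0" using False X Suc.prems by auto
        have sg: "sgn z' = sgn z"
        proof -
          have "0 < 1 - 2 * X" using False Suc.prems by simp
          then have "sgn (complex_of_real (1 - 2 * X)) = 1" by (simp only: sgn_of_real) simp
          then show ?thesis by (simp add: z'_def pt_def sgn_mult del: of_real_diff)
        qed
        have "cmod (b z' - b (pt z' t)) \<le> C1 * K * (t / (1 - cmod z')) powr \<delta>"
        proof (rule Suc.IH)
          show "t \<le> 2 ^ n * (1 - cmod z')" using Suc.prems(1) unfolding nz' by (simp add: X_def algebra_simps)
          show "cmod z' < 1" using nz' X by simp
          show "1 - cmod z' \<le> t" using nz' False by simp
          show "t \<le> 1" by (rule Suc.prems(4))
        qed
        moreover have "(t / (1 - cmod z')) powr \<delta> = 2 powr (- \<delta>) * (t / X) powr \<delta>"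
        proof -
          have "t / (1 - cmod z') = t / X / 2" unfolding nz' by simp
          moreover have "(t / X / 2) powr \<delta> = (t / X) powr \<delta> / 2 powr \<delta>" by (rule powr_divide)
          ultimately show ?thesis by (simp only:) (simp add: powr_minus_divide)
        qed
        moreover have "pt z' t = pt z t" by (simp add: pt_def sg)
        ultimately have 1: "cmod (b z' - b (pt z t)) \<le> C1 * K * (2 powr (- \<delta>) * (t / X) powr \<delta>)"
          by (simp only:)
        have 2: "cmod (b z - b z') \<le> K * (t / X) powr \<delta>"
        proof -
          have "cmod (b z - b z') \<le> K" unfolding z'_def using X False Suc.prems by (intro step) auto
          also have "\<dots> \<le> K * (t / X) powr \<delta>" using K one mult_left_mono[of 1 "(t / X) powr \<delta>" K] by simp
          finally show ?thesis .
        qed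
        have "cmod (b z - b (pt z t)) \<le> cmod (b z - b z') + cmod (b z' - b (pt z t))"
          using norm_triangle_ineq[of "b z - b z'" "b z' - b (pt z t)"] by simp
        also have "\<dots> \<le> K * (t / X) powr \<delta> + C1 * K * (2 powr (- \<delta>) * (t / X) powr \<delta>)"
          by (rule add_mono[OF 2 1])
        also have "\<dots> = K * (t / X) powr \<delta> * (C1 * (1 - 2 powr (- \<delta>)) + C1 * 2 powr (- \<delta>))"
          unfolding C1e by (simp add: algebra_simps)
        also have "\<dots> = C1 * K * (t / X) powr \<delta>" by (simp add: algebra_simps)
        finally show ?thesis by (simp add: X_def)
      qed
    qed
    \<comment> \<open>The height at which the two rays have come close; the cap \<open>1\<close>
      stops at the origin.\<close>
    define t where "t = min (dd z w) 1"
    have xt: "1 - cmod z \<le> t" "1 - cmod w \<le> t" "t \<le> 1"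
      using dd_ge[of w z] dd_ge[of z w] z w by (auto simp: t_def dd_commute)
    have Q1: "1 \<le> Q z w" using Q_ge_1[OF z w] .
    have t0: "0 < t" using xt z by linarith
    \<comment> \<open>Both quotients are at least \<open>1\<close>, so the bound for the product
      bounds each of them.\<close>
    have prod: "(t / (1 - cmod z)) * (t / (1 - cmod w)) \<le> 4 * Q z w"
    proof -
      have "t * t \<le> dd z w * dd z w" using t0 by (intro mult_mono) (auto simp: t_def)
      also have "\<dots> \<le> 4 * Q z w * (1 - cmod z) * (1 - cmod w)"
        using Q_lower[OF z w] by (simp add: power2_eq_square)
      finally have "t * t \<le> 4 * Q z w * ((1 - cmod z) * (1 - cmod w))" by (simp only: mult.assoc)
      then have "(t * t) / ((1 - cmod z) * (1 - cmod w)) \<le> 4 * Q z w"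
        using z w by (subst pos_divide_le_eq) auto
      then show ?thesis by simp
    qed
    have r1: "1 \<le> t / (1 - cmod z)" "1 \<le> t / (1 - cmod w)" using xt z w by auto
    have rz: "t / (1 - cmod z) \<le> 4 * Q z w" and rw': "t / (1 - cmod w) \<le> 4 * Q z w"
      using prod r1 mult_left_mono[OF r1(2), of "t / (1 - cmod z)"] mult_right_mono[OF r1(1), of "t / (1 - cmod w)"] by linarith+
    have ends: "cmod (b (pt z t) - b (pt w t)) \<le> K"
    proof (cases "t = 1")
      case True
      then show ?thesis using K by (simp add: pt_def)
    next
      case False
      then have td: "t = dd z w" and t1: "t < 1" by (auto simp: t_def min_def split: if_splits)
      have nz: "cmod (pt z t) = 1 - t" "cmod (pt w t) = 1 - t" using xt by (auto intro: norm_pt)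
      define e where "e = cnj (sgn z) * sgn w"
      have e: "cmod e \<le> 1" by (auto simp: e_def norm_mult norm_sgn)
      have zz: "z = of_real (cmod z) * sgn z" "w = of_real (cmod w) * sgn w" by (auto simp: sgn_eq)
      have 1: "cnj z * w = of_real (cmod z * cmod w) * e"
        by (subst zz(1), subst zz(2)) (simp add: e_def mult_ac)
      have 2: "cnj (pt z t) * pt w t = of_real ((1 - t) * (1 - t)) * e"
        by (simp add: pt_def e_def mult_ac)
      \<comment> \<open>Moving both points along their rays changes \<open>cnj z * w\<close> by a
        real multiple of the product \<open>e\<close> of directions, in modulus at most
        \<open>2 * t\<close>. Hence \<open>dd\<close> grows from \<open>t\<close> to at most
        \<open>3 * t\<close>.\<close>
      have "1 - cnj (pt z t) * pt w t = (1 - cnj z * w) + of_real (cmod z * cmod w - (1 - t) * (1 - t)) * e"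
        unfolding 1 2 by (simp add: algebra_simps)
      then have "dd (pt z t) (pt w t) \<le> dd z w + \<bar>cmod z * cmod w - (1 - t) * (1 - t)\<bar> * cmod e"
        unfolding dd_def using norm_triangle_ineq[of "1 - cnj z * w" "of_real (cmod z * cmod w - (1 - t) * (1 - t)) * e"]
        by (simp only: norm_mult norm_of_real)
      also have "\<bar>cmod z * cmod w - (1 - t) * (1 - t)\<bar> * cmod e \<le> (2 * t) * 1"
      proof (rule mult_mono[OF _ e])
        have "(1 - t) * (1 - t) \<le> cmod z * cmod w" using xt t1 by (intro mult_mono) auto
        moreover have "cmod z * cmod w \<le> 1" using z w by (simp add: mult_le_one)
        moreover have "1 - 2 * t \<le> (1 - t) * (1 - t)" by (simp add: algebra_simps)
        ultimately show "\<bar>cmod z * cmod w - (1 - t) * (1 - t)\<bar> \<le> 2 * t" by linarith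
      qed (use t0 in auto)
      finally have d3: "dd (pt z t) (pt w t) \<le> 3 * t" by (simp add: td)
      have "Q (pt z t) (pt w t) \<le> (dd (pt z t) (pt w t))\<^sup>2 / ((1 - cmod (pt z t)) * (1 - cmod (pt w t)))"
        using nz t0 by (intro Q_upper) auto
      also have "\<dots> \<le> (3 * t)\<^sup>2 / (t * t)"
        unfolding nz using d3 t0 by (intro frac_le power_mono) (auto simp: dd_def)
      also have "\<dots> = 9" using t0 by (simp add: power2_eq_square)
      finally show ?thesis using nz t0 by (intro osc) auto
    qed
    have rad: "cmod (b x - b (pt x t)) \<le> C1 * K * (4 powr \<delta> * Q z w powr \<delta>)"
      if x: "cmod x < 1" "1 - cmod x \<le> t" "t / (1 - cmod x) \<le> 4 * Q z w" for x
    proof -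
      obtain n where "t / (1 - cmod x) < 2 ^ n" using real_arch_pow[of 2] by auto
      then have "t \<le> 2 ^ n * (1 - cmod x)" using x by (simp add: field_simps)
      then have "cmod (b x - b (pt x t)) \<le> C1 * K * (t / (1 - cmod x)) powr \<delta>"
        using x xt by (intro radial) auto
      also have "\<dots> \<le> C1 * K * (4 * Q z w) powr \<delta>"
        using x t0 d C1 K by (intro mult_left_mono powr_mono2) auto
      finally show ?thesis using Q1 by (simp add: powr_mult)
    qed
    have "cmod (b z - b w) \<le> cmod (b z - b (pt z t)) + cmod (b (pt z t) - b (pt w t)) + cmod (b w - b (pt w t))"
    proof -
      have "b z - b w = (b z - b (pt z t)) + (b (pt z t) - b (pt w t)) - (b w - b (pt w t))" by simp
      then show ?thesis
        by (metis norm_triangle_ineq4 norm_triangle_ineq add_right_mono order_trans)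
    qed
    also have "\<dots> \<le> C1 * K * (4 powr \<delta> * Q z w powr \<delta>) + K * Q z w powr \<delta> + C1 * K * (4 powr \<delta> * Q z w powr \<delta>)"
    proof (intro add_mono)
      have "1 \<le> Q z w powr \<delta>" using Q1 d by (intro ge_one_powr_ge_zero) auto
      then have "K * 1 \<le> K * Q z w powr \<delta>" using K by (rule mult_left_mono)
      then show "cmod (b (pt z t) - b (pt w t)) \<le> K * Q z w powr \<delta>" using ends by linarith
    qed (use rad[of z] rad[of w] z w xt rz rw' in auto)
    also have "\<dots> = C * K * Q z w powr \<delta>" by (simp add: C_def algebra_simps)
    finally show ?thesis .
  qed
  with C show ?thesis using that by blast
qed

section \<open>Little Hankel operators with symbols of bounded mean oscillation\<close>

context D_weight
begin

abbreviation wm where "wm \<equiv> weight_measure \<omega>"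

lemma space_wm [simp]: "space wm = ball 0 1"
  by (simp add: weight_measure_def space_restrict_space)

lemma sets_wm: "sets wm = sets (restrict_space borel (ball 0 1))"
  by (simp add: weight_measure_def cong: sets_restrict_space_cong)

lemma wm_measurable:
  assumes "f \<in> borel_measurable borel"
  shows "f \<in> borel_measurable wm"
proof -
  have "f \<in> borel_measurable (restrict_space borel (ball 0 1))"
    by (rule measurable_restrict_space1[OF assms])
  then show ?thesis by (simp add: measurable_cong_sets[OF sets_wm refl])
qed

lemma wm_borel_iff:
  fixes f :: "complex \<Rightarrow> complex"
  shows "f \<in> borel_measurable wm \<longleftrightarrow> (\<lambda>z. indicator (ball 0 1) z *\<^sub>R f z) \<in> borel_measurable borel"
  unfolding measurable_cong_sets[OF sets_wm refl] by (rule borel_measurable_restrict_space_iff) simp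

lemma nn_integral_wm:
  assumes [measurable]: "F \<in> borel_measurable borel"
  shows "(\<integral>\<^sup>+z. F z \<partial>wm) = (\<integral>\<^sup>+z. F z * hm z \<partial>lborel)"
proof -
  have eq: "ennreal (\<omega> (cmod z) / pi) = hm z" if "z \<in> ball 0 1" for z :: complex
    using that by (simp add: hm_def wt_def)
  have "hm \<in> borel_measurable (restrict_space lborel (ball 0 1))"
    by (rule measurable_restrict_space1) simp
  then have 1: "(\<lambda>z. ennreal (\<omega> (cmod z) / pi)) \<in> borel_measurable (restrict_space lborel (ball 0 1))"
    by (rule measurable_cong[THEN iffD1, rotated]) (simp add: eq space_restrict_space)
  have 2: "F \<in> borel_measurable (restrict_space lborel (ball 0 1))"
    by (rule measurable_restrict_space1) simp
  have "(\<integral>\<^sup>+z. F z \<partial>wm) = (\<integral>\<^sup>+z. ennreal (\<omega> (cmod z) / pi) * F z \<partial>restrict_space lborel (ball 0 1))"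
    unfolding weight_measure_def by (rule nn_integral_density[OF 1 2])
  also have "\<dots> = (\<integral>\<^sup>+z. (ennreal (\<omega> (cmod z) / pi) * F z) * indicator (ball 0 1) z \<partial>lborel)"
    by (rule nn_integral_restrict_space) simp
  also have "\<dots> = (\<integral>\<^sup>+z. F z * hm z \<partial>lborel)"
  proof (rule nn_integral_cong)
    fix z :: complex
    show "(ennreal (\<omega> (cmod z) / pi) * F z) * indicator (ball 0 1) z = F z * hm z"
      using eq[of z] hm_outside[of z] by (cases "cmod z < 1") (simp_all add: mult.commute)
  qed
  finally show ?thesis .
qed

lemma hm_total: "(\<integral>\<^sup>+z. hm z \<partial>lborel) = ennreal (2 * moment \<omega> 1)"
proof -
  have "(\<integral>\<^sup>+z. hm z \<partial>lborel) = (\<integral>\<^sup>+z. ennreal (wt \<omega> (cmod z) / pi) * indicator (ball 0 1) z \<partial>lborel)"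
    by (intro nn_integral_cong) (rule hm_alt)
  also have "\<dots> = (\<integral>\<^sup>+r. ennreal (wt \<omega> r / pi) * ennreal (2 * pi * r) * indicator {0..<1} r \<partial>lborel)"
    by (rule nn_integral_lborel_radial) measurable
  also have "\<dots> = (\<integral>\<^sup>+r. ennreal 2 * ennreal (wt \<omega> r * (r powr 1 * (1 - r) ^ 0)) \<partial>lborel)"
  proof (rule nn_integral_cong)
    fix r :: real
    show "ennreal (wt \<omega> r / pi) * ennreal (2 * pi * r) * indicator {0..<1} r = ennreal 2 * ennreal (wt \<omega> r * (r powr 1 * (1 - r) ^ 0))"
    proof (cases "0 \<le> r \<and> r < 1")
      case True
      have "ennreal (wt \<omega> r / pi) * ennreal (2 * pi * r) = ennreal (wt \<omega> r / pi * (2 * pi * r))"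
        using wt_nonneg[OF rw, of r] by (intro ennreal_mult'[symmetric]) simp
      also have "wt \<omega> r / pi * (2 * pi * r) = 2 * (wt \<omega> r * (r powr 1 * (1 - r) ^ 0))"
        using True by simp
      also have "ennreal \<dots> = ennreal 2 * ennreal (wt \<omega> r * (r powr 1 * (1 - r) ^ 0))"
        by (rule ennreal_mult') simp
      finally show ?thesis using True by simp
    qed (auto simp: wt_def)
  qed
  also have "\<dots> = ennreal 2 * ennreal (Mom 0 1)"
    by (subst nn_integral_cmult) (measurable, subst Mom_nn_integral, auto)
  also have "\<dots> = ennreal (2 * moment \<omega> 1)"
    unfolding moment_eq_Mom by (rule ennreal_mult'[symmetric]) simp
  finally show ?thesis .
qed

lemma emeasure_wm: "S \<in> sets borel \<Longrightarrow> S \<subseteq> ball 0 1 \<Longrightarrow> emeasure wm S = (\<integral>\<^sup>+z. indicator S z * hm z \<partial>lborel)"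
proof -
  assume S: "S \<in> sets borel" "S \<subseteq> ball 0 1"
  then have "S \<in> sets wm" unfolding sets_wm by (auto simp: sets_restrict_space_iff)
  then have "emeasure wm S = (\<integral>\<^sup>+z. indicator S z \<partial>wm)" by simp
  also have "\<dots> = (\<integral>\<^sup>+z. indicator S z * hm z \<partial>lborel)"
    using S by (intro nn_integral_wm) simp
  finally show ?thesis .
qed

lemma moment1_pos: "0 < moment \<omega> 1"
  using m_pos[of 0] by (simp add: m_def)

lemma emeasure_wm_space: "emeasure wm (ball 0 1) = ennreal (2 * moment \<omega> 1)"
proof -
  have "emeasure wm (ball 0 1) = (\<integral>\<^sup>+z. indicator (ball 0 1) z * hm z \<partial>lborel)"
    by (rule emeasure_wm) auto
  also have "\<dots> = (\<integral>\<^sup>+z. hm z \<partial>lborel)"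
    by (intro nn_integral_cong) (auto simp: indicator_def hm_outside)
  finally show ?thesis by (simp add: hm_total)
qed

lemma finite_measure_wm: "finite_measure wm"
  by (rule finite_measureI) (simp add: emeasure_wm_space)

lemma measure_wm_space: "measure wm (ball 0 1) = 2 * moment \<omega> 1"
  using moment1_pos by (simp add: measure_def emeasure_wm_space)

lemma distr_wm_rotate:
  assumes c: "cmod c = 1"
  shows "distr wm wm ((*) c) = wm"
proof (rule measure_eqI)
  have c0: "c \<noteq> 0" using c by auto
  have mc: "(*) c \<in> measurable wm wm"
  proof -
    have "(*) c \<in> measurable (restrict_space borel (ball 0 1)) (restrict_space borel (ball 0 1))"
      by (rule measurable_restrict_space3) (auto simp: norm_mult c)
    then show ?thesis by (simp add: measurable_cong_sets[OF sets_wm sets_wm])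
  qed
  fix S assume "S \<in> sets (distr wm wm ((*) c))"
  then have SA: "S \<in> sets wm" by simp
  then have S: "S \<in> sets borel" "S \<subseteq> ball 0 1" unfolding sets_wm by (auto simp: sets_restrict_space_iff)
  have "emeasure (distr wm wm ((*) c)) S = emeasure wm ((*) c -` S \<inter> ball 0 1)"
    using SA mc by (subst emeasure_distr) auto
  also have "\<dots> = (\<integral>\<^sup>+z. indicator ((*) c -` S \<inter> ball 0 1) z * hm z \<partial>lborel)"
  proof (rule emeasure_wm)
    have "(*) c -` S \<in> sets borel" using measurable_sets_borel[of "(*) c" borel S] S by simp
    then show "(*) c -` S \<inter> ball 0 1 \<in> sets borel" by (rule sets.Int) simp
  qed auto
  also have "\<dots> = (\<integral>\<^sup>+z. (indicator S (c * z) * hm (c * z)) \<partial>lborel)"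
    using S by (intro nn_integral_cong) (auto simp: indicator_def hm_def norm_mult c)
  also have "\<dots> = (\<integral>\<^sup>+z. indicator S z * hm z \<partial>lborel)"
    using S by (intro nn_integral_lborel_rotate[where F = "\<lambda>z. indicator S z * hm z"] c
        borel_measurable_times_ennreal borel_measurable_indicator hm_meas) simp
  also have "\<dots> = emeasure wm S" using S by (simp add: emeasure_wm)
  finally show "emeasure (distr wm wm ((*) c)) S = emeasure wm S" .
qed simp

text \<open>The integral does not change when the argument is rotated; averaging over all angles and
  exchanging the integrals leaves the circular mean value \<open>G 0\<close> at each point.
  Boundedness of \<open>G\<close> supplies the integrability for Fubini.\<close>

lemma radial_mean_value:
  assumes hol: "G holomorphic_on ball 0 1" and bd: "\<And>z. cmod z < 1 \<Longrightarrow> cmod (G z) \<le> B"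
  shows "integral\<^sup>L wm G = G 0 * of_real (2 * moment \<omega> 1)"
proof -
  interpret W: finite_measure wm by (rule finite_measure_wm)
  interpret P: pair_sigma_finite lborel wm ..
  define G0 where "G0 z = indicator (ball 0 1) z *\<^sub>R G z" for z
  have G0m [measurable]: "G0 \<in> borel_measurable borel"
    unfolding G0_def[abs_def] by (rule holomorphic_ball_indicator_measurable[OF hol])
  have B0: "0 \<le> B" using order_trans[OF norm_ge_zero bd[of 0]] by simp
  have G0b: "cmod (G0 z) \<le> B" for z using bd[of z] B0 by (auto simp: G0_def indicator_def)
  have G0r: "integral\<^sup>L wm G = (\<integral>w. G0 (circ t * w) \<partial>wm)" for t
  proof -
    have mc: "(*) (circ t) \<in> measurable wm wm"
    proof -
      have "(*) (circ t) \<in> measurable (restrict_space borel (ball 0 1)) (restrict_space borel (ball 0 1))"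
        by (rule measurable_restrict_space3) (auto simp: norm_mult)
      then show ?thesis by (simp add: measurable_cong_sets[OF sets_wm sets_wm])
    qed
    have "integral\<^sup>L wm G = (\<integral>w. G0 w \<partial>wm)"
      by (intro Bochner_Integration.integral_cong) (auto simp: G0_def)
    also have "\<dots> = (\<integral>w. G0 w \<partial>distr wm wm ((*) (circ t)))"
      by (simp add: distr_wm_rotate)
    also have "\<dots> = (\<integral>w. G0 (circ t * w) \<partial>wm)"
      by (rule integral_distr[OF mc wm_measurable[OF G0m]])
    finally show ?thesis .
  qed
  define f where "f t w = indicator {0..1} t *\<^sub>R G0 (circ t * w)" for t :: real and w
  have fm: "case_prod f \<in> borel_measurable (lborel \<Otimes>\<^sub>M wm)"
  proof -
    have [measurable]: "(\<lambda>p::real \<times> complex. snd p) \<in> borel_measurable (lborel \<Otimes>\<^sub>M wm)"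
      using measurable_compose[OF measurable_snd wm_measurable[of "\<lambda>x. x"]] by simp
    have [measurable]: "(\<lambda>p::real \<times> complex. fst p) \<in> borel_measurable (lborel \<Otimes>\<^sub>M wm)"
      using measurable_fst[of "lborel::real measure" wm] by simp
    show ?thesis unfolding f_def case_prod_beta by measurable
  qed
  have fint: "integrable (lborel \<Otimes>\<^sub>M wm) (case_prod f)"
  proof (rule integrableI_bounded[OF fm])
    have "(\<integral>\<^sup>+p. ennreal (norm (case_prod f p)) \<partial>(lborel \<Otimes>\<^sub>M wm)) \<le> (\<integral>\<^sup>+p. ennreal B * indicator ({0..1::real} \<times> space wm) p \<partial>(lborel \<Otimes>\<^sub>M wm))"
      using G0b B0 by (intro nn_integral_mono) (auto simp: f_def indicator_def space_pair_measure intro!: ennreal_leI)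
    also have "\<dots> = ennreal B * (emeasure lborel {0..1::real} * emeasure wm (space wm))"
      by (subst nn_integral_cmult_indicator) (auto simp: W.emeasure_pair_measure_Times simp del: space_wm)
    also have "\<dots> < \<infinity>" by (simp add: emeasure_wm_space ennreal_mult_less_top)
    finally show "(\<integral>\<^sup>+p. ennreal (norm (case_prod f p)) \<partial>(lborel \<Otimes>\<^sub>M wm)) < \<infinity>" .
  qed
  have inner: "(\<integral>t. f t w \<partial>lborel) = G 0" if w: "w \<in> space wm" for w
  proof -
    have mv: "((\<lambda>t. G (0 + circ t * w)) has_integral G 0) {0..1}"
      using w by (intro circle_mean_value[OF hol]) simp
    have cont: "continuous_on {0..1} (\<lambda>t. G (circ t * w))"
      by (rule continuous_on_compose2[OF holomorphic_on_imp_continuous_on[OF hol]])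
         (use w in \<open>auto intro!: continuous_intros simp: norm_mult\<close>)
    have "(\<integral>t. f t w \<partial>lborel) = (LINT t:{0..1}|lborel. G (circ t * w))"
      unfolding set_lebesgue_integral_def using w
      by (intro Bochner_Integration.integral_cong) (auto simp: f_def G0_def indicator_def norm_mult)
    also have "\<dots> = integral {0..1} (\<lambda>t. G (circ t * w))"
      by (intro set_borel_integral_eq_integral borel_integrable_atLeastAtMost' cont)
    also have "\<dots> = G 0" using mv by (simp add: has_integral_iff)
    finally show ?thesis .
  qed
  have "integral\<^sup>L wm G = (\<integral>t. indicator {0..1::real} t *\<^sub>R integral\<^sup>L wm G \<partial>lborel)"
    by (simp add: measure_def)
  also have "\<dots> = (\<integral>t. (\<integral>w. f t w \<partial>wm) \<partial>lborel)"
  proof (rule Bochner_Integration.integral_cong[OF refl])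
    fix t :: real
    show "indicator {0..1} t *\<^sub>R integral\<^sup>L wm G = (\<integral>w. f t w \<partial>wm)"
      unfolding f_def by (subst G0r[of t]) simp
  qed
  also have "\<dots> = (\<integral>w. (\<integral>t. f t w \<partial>lborel) \<partial>wm)"
    by (rule P.Fubini_integral[OF fint, symmetric])
  also have "\<dots> = (\<integral>w. G 0 \<partial>wm)"
    by (rule Bochner_Integration.integral_cong[OF refl inner])
  also have "\<dots> = G 0 * of_real (2 * moment \<omega> 1)"
    by (simp add: measure_wm_space scaleR_conv_of_real mult.commute)
  finally show ?thesis .
qed

section \<open>Oscillation on hyperbolic balls of large radius\<close>

definition mass :: "real \<Rightarrow> complex \<Rightarrow> ennreal" where
  "mass R z = (\<integral>\<^sup>+w. indicator (hball z R) w * hm w \<partial>lborel)"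

text \<open>The centres \<open>b\<close> are left free, hyperbolic means being one choice; first
  powers are what local averaging consumes.\<close>

definition oscillates :: "(complex \<Rightarrow> complex) \<Rightarrow> (complex \<Rightarrow> complex) \<Rightarrow> real \<Rightarrow> real \<Rightarrow> bool" where
  "oscillates f b R N \<longleftrightarrow> (\<forall>z. cmod z < 1 \<longrightarrow>
    (\<integral>\<^sup>+x. ennreal (cmod (f x - b z)) * indicator (hball z R) x * hm x \<partial>lborel) \<le> ennreal N * mass R z)"

text \<open>\<open>13\<close> is what local averaging demands. The mass is bounded from below
  already for the parameter \<open>R / 40\<close>: if \<open>Q z w < 10\<close>, this smaller ball
  about \<open>z\<close> lies in the ball of parameter \<open>R\<close> about \<open>w\<close>,
  since the triangle inequality gives \<open>4 * 10 * (R / 40) = R\<close>.\<close>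

definition large_radius :: "real \<Rightarrow> bool" where
  "large_radius R \<longleftrightarrow> 13 \<le> R \<and> (\<exists>c>0. \<forall>z. cmod z < 1 \<longrightarrow>
    ennreal (c * (1 - cmod z) * \<tau> (1 - cmod z)) \<le> mass (R / 40) z)"

lemma mass_mono: "R \<le> R' \<Longrightarrow> mass R z \<le> mass R' z"
  unfolding mass_def using hball_mono[of R R' z]
  by (intro nn_integral_mono mult_right_mono) (auto simp: indicator_def)

lemma large_radius_mono: "large_radius R \<Longrightarrow> R \<le> R' \<Longrightarrow> large_radius R'"
proof -
  assume R: "large_radius R" "R \<le> R'"
  then obtain c where c: "0 < c" "\<And>z. cmod z < 1 \<Longrightarrow> ennreal (c * (1 - cmod z) * \<tau> (1 - cmod z)) \<le> mass (R / 40) z" and R13: "13 \<le> R"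
    unfolding large_radius_def by blast
  have "ennreal (c * (1 - cmod z) * \<tau> (1 - cmod z)) \<le> mass (R' / 40) z" if "cmod z < 1" for z
    using c(2)[OF that] mass_mono[of "R / 40" "R' / 40" z] R(2) by (intro order_trans[OF c(2)[OF that]]) simp
  then show ?thesis using c(1) R13 R(2) unfolding large_radius_def by auto
qed

lemma ex_large_radius: "\<exists>R. large_radius R"
proof -
  obtain R0 c where R0: "1 \<le> R0" "0 < c"
    "\<And>z. cmod z < 1 \<Longrightarrow> ennreal (c * (1 - cmod z) * \<tau> (1 - cmod z)) \<le> (\<integral>\<^sup>+w. indicator (hball z R0) w * hm w \<partial>lborel)"
    using hyperbolic_disc_mass_lower by blast
  have "large_radius (40 * R0)"
    unfolding large_radius_def mass_def using R0 by (intro conjI exI[of _ c]) auto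
  then show ?thesis by blast
qed

lemma large_radius_mass_lower:
  assumes "large_radius R"
  obtains c where "0 < c" "\<And>z. cmod z < 1 \<Longrightarrow> ennreal (c * (1 - cmod z) * \<tau> (1 - cmod z)) \<le> mass R z"
proof -
  obtain c where c: "0 < c" "\<And>z. cmod z < 1 \<Longrightarrow> ennreal (c * (1 - cmod z) * \<tau> (1 - cmod z)) \<le> mass (R / 40) z" and R: "13 \<le> R"
    using assms unfolding large_radius_def by blast
  have "ennreal (c * (1 - cmod z) * \<tau> (1 - cmod z)) \<le> mass R z" if "cmod z < 1" for z
    using order_trans[OF c(2)[OF that] mass_mono[of "R / 40" R z]] R by simp
  with c(1) show ?thesis by (rule that)
qed

lemma mass_upper:
  assumes "1 \<le> R"
  obtains C where "0 < C" "\<And>z. cmod z < 1 \<Longrightarrow> mass R z \<le> ennreal (C * (1 - cmod z) * \<tau> (1 - cmod z))"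
  using hyperbolic_disc_mass_upper[OF assms] unfolding mass_def by blast

text \<open>For \<open>Q z w < 10\<close> the constant \<open>cmod (b z - b w)\<close> is integrated
  over a small ball contained in both large ones, whose mass is comparable to theirs. Chaining such
  steps gives the power of \<open>Q\<close>.\<close>

lemma oscillates_power:
  assumes R: "large_radius R" and d: "0 < \<delta>"
  obtains C where "0 < C"
    "\<And>f b N z w. f \<in> borel_measurable borel \<Longrightarrow> 0 \<le> N \<Longrightarrow> oscillates f b R N \<Longrightarrow> cmod z < 1 \<Longrightarrow> cmod w < 1 \<Longrightarrow>
      cmod (b z - b w) \<le> C * N * Q z w powr \<delta>"
proof -
  obtain c where c: "0 < c" and low: "\<And>z. cmod z < 1 \<Longrightarrow> ennreal (c * (1 - cmod z) * \<tau> (1 - cmod z)) \<le> mass (R / 40) z" and R13: "13 \<le> R"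
    using R unfolding large_radius_def by blast
  obtain Cu where Cu: "0 < Cu" and up: "\<And>z. cmod z < 1 \<Longrightarrow> mass R z \<le> ennreal (Cu * (1 - cmod z) * \<tau> (1 - cmod z))"
    using mass_upper[of R] R13 by auto
  obtain Cc where Cc: "0 < Cc" and chain: "\<And>b :: complex \<Rightarrow> complex. \<And>K z w. 0 \<le> K \<Longrightarrow>
      (\<And>z w. cmod z < 1 \<Longrightarrow> cmod w < 1 \<Longrightarrow> Q z w < 10 \<Longrightarrow> cmod (b z - b w) \<le> K) \<Longrightarrow>
      cmod z < 1 \<Longrightarrow> cmod w < 1 \<Longrightarrow> cmod (b z - b w) \<le> Cc * K * Q z w powr \<delta>"
    using oscillation_chain[OF d] by blast
  \<comment> \<open>The second summand stems from \<open>w\<close>: for \<open>Q z w < 10\<close>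
    its boundary distance is at most \<open>40\<close> times that of \<open>z\<close>, and doubling
    transfers this to the tail.\<close>
  define K0 where "K0 = (Cu + Cu * 40 * (2 ^ l * 40 ^ l)) / c"
  have K0: "0 < K0" using Cu c by (simp add: K0_def add_pos_pos)
  have step: "cmod (b z - b w) \<le> K0 * N"
    if fm [measurable]: "f \<in> borel_measurable borel" and N: "0 \<le> N" and osc: "oscillates f b R N"
      and z: "cmod z < 1" and w: "cmod w < 1" and q: "Q z w < 10" for f b N z w
  proof -
    define X Y where "X = 1 - cmod z" and "Y = 1 - cmod w"
    have X: "0 < X" and Y: "0 < Y" using z w by (auto simp: X_def Y_def)
    have YX: "Y \<le> 40 * X"
      using Q_dd_less(1)[OF z w q] dd_ge[of z w] z by (simp add: X_def Y_def dd_commute)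
    let ?S = "hball z (R / 40)"
    have S1: "?S \<subseteq> hball z R" using R13 by (intro hball_mono) simp
    have S2: "?S \<subseteq> hball w R"
    proof
      fix x assume x: "x \<in> ?S"
      have "z \<in> hball w 10" using q z by (simp add: hball_def Q_commute)
      from hball_triangle[OF w this x] show "x \<in> hball w R" by simp
    qed
    have \<tau>Y: "Y * \<tau> Y \<le> 40 * X * (2 ^ l * 40 ^ l * \<tau> X)"
    proof (rule mult_mono[OF YX])
      have "\<tau> Y \<le> \<tau> (40 * X)" using Y YX by (intro \<tau>_mono) auto
      also have "\<dots> \<le> 2 ^ l * (40 * X / X) ^ l * \<tau> X" using X by (intro \<tau>_power) auto
      finally show "\<tau> Y \<le> 2 ^ l * 40 ^ l * \<tau> X" using X by simp
    qed (use X \<tau>_pos[OF Y] in auto)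
    have "ennreal (cmod (b z - b w) * (c * X * \<tau> X)) \<le> ennreal (cmod (b z - b w)) * mass (R / 40) z"
      using low[OF z] by (simp add: ennreal_mult' X_def mult_left_mono)
    also have "\<dots> = (\<integral>\<^sup>+x. ennreal (cmod (b z - b w)) * (indicator ?S x * hm x) \<partial>lborel)"
      unfolding mass_def by (rule nn_integral_cmult[symmetric]) measurable
    also have "\<dots> \<le> (\<integral>\<^sup>+x. ennreal (cmod (f x - b z)) * indicator (hball z R) x * hm x
        + ennreal (cmod (f x - b w)) * indicator (hball w R) x * hm x \<partial>lborel)"
    proof (rule nn_integral_mono)
      fix x
      show "ennreal (cmod (b z - b w)) * (indicator ?S x * hm x) \<le> ennreal (cmod (f x - b z)) * indicator (hball z R) x * hm x
        + ennreal (cmod (f x - b w)) * indicator (hball w R) x * hm x"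
      proof (cases "x \<in> ?S")
        case True
        have "cmod (b z - b w) \<le> cmod (f x - b z) + cmod (f x - b w)"
          using norm_triangle_ineq4[of "f x - b w" "f x - b z"] by simp
        from ennreal_leI[OF this]
        have "ennreal (cmod (b z - b w)) \<le> ennreal (cmod (f x - b z)) + ennreal (cmod (f x - b w))"
          by simp
        then have "ennreal (cmod (b z - b w)) * hm x \<le> (ennreal (cmod (f x - b z)) + ennreal (cmod (f x - b w))) * hm x"
          by (rule mult_right_mono) simp
        then show ?thesis using True S1 S2 by (simp add: subset_eq distrib_right)
      qed simp
    qed
    also have "\<dots> = (\<integral>\<^sup>+x. ennreal (cmod (f x - b z)) * indicator (hball z R) x * hm x \<partial>lborel)
        + (\<integral>\<^sup>+x. ennreal (cmod (f x - b w)) * indicator (hball w R) x * hm x \<partial>lborel)"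
      by (rule nn_integral_add) measurable
    also have "\<dots> \<le> ennreal N * mass R z + ennreal N * mass R w"
      using osc z w unfolding oscillates_def by (intro add_mono) auto
    also have "\<dots> \<le> ennreal N * ennreal (Cu * X * \<tau> X) + ennreal N * ennreal (Cu * Y * \<tau> Y)"
      using up[OF z] up[OF w] by (intro add_mono mult_left_mono) (auto simp: X_def Y_def)
    also have "\<dots> = ennreal (N * (Cu * X * \<tau> X) + N * (Cu * Y * \<tau> Y))"
      using N Cu X Y \<tau>_pos[OF X] \<tau>_pos[OF Y] by (simp add: ennreal_mult')
    also have "\<dots> \<le> ennreal (K0 * N * (c * X * \<tau> X))"
    proof (rule ennreal_leI)
      have "N * (Cu * (Y * \<tau> Y)) \<le> N * (Cu * (40 * X * (2 ^ l * 40 ^ l * \<tau> X)))"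
        using N Cu \<tau>Y by (intro mult_left_mono) auto
      then show "N * (Cu * X * \<tau> X) + N * (Cu * Y * \<tau> Y) \<le> K0 * N * (c * X * \<tau> X)"
      proof -
        have kc: "K0 * c = Cu + Cu * 40 * (2 ^ l * 40 ^ l)" using c by (simp add: K0_def)
        have "K0 * N * (c * X * \<tau> X) = (K0 * c) * (N * (X * \<tau> X))" by (simp only: mult_ac)
        then show ?thesis
          using \<open>N * (Cu * (Y * \<tau> Y)) \<le> N * (Cu * (40 * X * (2 ^ l * 40 ^ l * \<tau> X)))\<close>
          unfolding kc by (simp add: algebra_simps)
      qed
    qed
    finally have "cmod (b z - b w) * (c * X * \<tau> X) \<le> K0 * N * (c * X * \<tau> X)"
      using K0 N c X \<tau>_pos[OF X] by (subst (asm) ennreal_le_iff) auto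
    then show ?thesis using c X \<tau>_pos[OF X] by simp
  qed
  have "cmod (b z - b w) \<le> (Cc * K0) * N * Q z w powr \<delta>"
    if "f \<in> borel_measurable borel" "0 \<le> N" "oscillates f b R N" "cmod z < 1" "cmod w < 1" for f b N z w
    using chain[of "K0 * N" b z w] step[OF that(1-3)] that K0 by (simp add: mult_ac)
  moreover have "0 < Cc * K0" using Cc K0 by simp
  ultimately show ?thesis using that by blast
qed

text \<open>Local averaging moves the modulus of \<open>G\<close> from \<open>x\<close> to
  \<open>w\<close>. Over the ball about \<open>w\<close> the function
  \<open>cmod (f x - b z)\<close> has average at most \<open>N + cmod (b w - b z)\<close>; the mass
  of the ball, at most of order \<open>Y * \<tau> Y\<close>, divided by the area factor
  \<open>Y\<^sup>2\<close> produces the density \<open>hn\<close>.\<close>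

lemma oscillation_against_analytic:
  assumes R: "large_radius R" and d: "0 < \<delta>"
  obtains C where "0 < C"
    "\<And>f b N z G. f \<in> borel_measurable borel \<Longrightarrow> 0 \<le> N \<Longrightarrow> oscillates f b R N \<Longrightarrow> cmod z < 1 \<Longrightarrow> G holomorphic_on ball 0 1 \<Longrightarrow>
      (\<integral>\<^sup>+x. ennreal (cmod (G x)) * ennreal (cmod (f x - b z)) * hm x \<partial>lborel)
        \<le> (\<integral>\<^sup>+w. ennreal (C * N * cmod (G w) * Q z w powr \<delta>) * hn w \<partial>lborel)"
proof -
  have R13: "13 \<le> R" using R by (simp add: large_radius_def)
  obtain C1 where C1: "0 < C1" and pow: "\<And>f b N z w. f \<in> borel_measurable borel \<Longrightarrow> 0 \<le> N \<Longrightarrow> oscillates f b R N \<Longrightarrow> cmod z < 1 \<Longrightarrow> cmod w < 1 \<Longrightarrow>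
      cmod (b z - b w) \<le> C1 * N * Q z w powr \<delta>"
    using oscillates_power[OF R d] by blast
  obtain Cu where Cu: "0 < Cu" and up: "\<And>z. cmod z < 1 \<Longrightarrow> mass R z \<le> ennreal (Cu * (1 - cmod z) * \<tau> (1 - cmod z))"
    using mass_upper[of R] R13 by auto
  define C where "C = 9 / pi * (1 + C1) * Cu"
  have "(\<integral>\<^sup>+x. ennreal (cmod (G x)) * ennreal (cmod (f x - b z)) * hm x \<partial>lborel)
        \<le> (\<integral>\<^sup>+w. ennreal (C * N * cmod (G w) * Q z w powr \<delta>) * hn w \<partial>lborel)"
    if fm [measurable]: "f \<in> borel_measurable borel" and N: "0 \<le> N" and osc: "oscillates f b R N"
      and z: "cmod z < 1" and hol: "G holomorphic_on ball 0 1" for f b N z G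
  proof -
    have hmb: "hm x * indicator (ball 0 1) x = hm x" for x
      by (cases "cmod x < 1") (auto simp: hm_outside)
    have "(\<integral>\<^sup>+x. ennreal (cmod (G x)) * ennreal (cmod (f x - b z)) * (hm x * indicator (ball 0 1) x) \<partial>lborel)
      \<le> (\<integral>\<^sup>+w. ennreal (9 / pi * cmod (G w) / (1 - cmod w)\<^sup>2) * indicator (ball 0 1) w *
          (\<integral>\<^sup>+x. ennreal (cmod (f x - b z)) * indicator (hball w R) x * (hm x * indicator (ball 0 1) x) \<partial>lborel) \<partial>lborel)"
      by (rule nn_integral_local_average[OF hol R13]) measurable
    also have "\<dots> \<le> (\<integral>\<^sup>+w. ennreal (C * N * cmod (G w) * Q z w powr \<delta>) * hn w \<partial>lborel)"
    proof (rule nn_integral_mono)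
      fix w :: complex
      show "ennreal (9 / pi * cmod (G w) / (1 - cmod w)\<^sup>2) * indicator (ball 0 1) w *
          (\<integral>\<^sup>+x. ennreal (cmod (f x - b z)) * indicator (hball w R) x * (hm x * indicator (ball 0 1) x) \<partial>lborel)
          \<le> ennreal (C * N * cmod (G w) * Q z w powr \<delta>) * hn w"
      proof (cases "cmod w < 1")
        case w: True
        define Y where "Y = 1 - cmod w"
        have Y: "0 < Y" using w by (simp add: Y_def)
        have q1: "1 \<le> Q z w powr \<delta>" using Q_ge_1[OF z w] d by (intro ge_one_powr_ge_zero) auto
        have "(\<integral>\<^sup>+x. ennreal (cmod (f x - b z)) * indicator (hball w R) x * (hm x * indicator (ball 0 1) x) \<partial>lborel)
            \<le> (\<integral>\<^sup>+x. ennreal (cmod (f x - b w)) * indicator (hball w R) x * hm x + ennreal (cmod (b w - b z)) * (indicator (hball w R) x * hm x) \<partial>lborel)"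
        proof (rule nn_integral_mono)
          fix x
          have "cmod (f x - b z) \<le> cmod (f x - b w) + cmod (b w - b z)"
            using norm_triangle_ineq[of "f x - b w" "b w - b z"] by simp
          from ennreal_leI[OF this]
          have "ennreal (cmod (f x - b z)) \<le> ennreal (cmod (f x - b w)) + ennreal (cmod (b w - b z))"
            by simp
          then have "ennreal (cmod (f x - b z)) * (indicator (hball w R) x * hm x) \<le> (ennreal (cmod (f x - b w)) + ennreal (cmod (b w - b z))) * (indicator (hball w R) x * hm x)"
            by (rule mult_right_mono) simp
          then show "ennreal (cmod (f x - b z)) * indicator (hball w R) x * (hm x * indicator (ball 0 1) x)
              \<le> ennreal (cmod (f x - b w)) * indicator (hball w R) x * hm x + ennreal (cmod (b w - b z)) * (indicator (hball w R) x * hm x)"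
            unfolding hmb by (simp only: distrib_right mult.assoc)
        qed
        also have "\<dots> = (\<integral>\<^sup>+x. ennreal (cmod (f x - b w)) * indicator (hball w R) x * hm x \<partial>lborel) + ennreal (cmod (b w - b z)) * mass R w"
          unfolding mass_def by (subst nn_integral_add) (auto simp: nn_integral_cmult)
        also have "\<dots> \<le> ennreal N * mass R w + ennreal (C1 * N * Q z w powr \<delta>) * mass R w"
          using osc w pow[OF fm N osc z w]
          by (intro add_mono mult_right_mono) (auto simp: oscillates_def norm_minus_commute intro!: ennreal_leI)
        also have "\<dots> = ennreal (N + C1 * N * Q z w powr \<delta>) * mass R w"
          using N C1 by (simp add: distrib_right[symmetric])
        also have "\<dots> \<le> ennreal (N * (1 + C1) * Q z w powr \<delta>) * ennreal (Cu * Y * \<tau> Y)"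
        proof (rule mult_mono)
          have "N * 1 \<le> N * Q z w powr \<delta>" using N q1 by (intro mult_left_mono) auto
          then show "ennreal (N + C1 * N * Q z w powr \<delta>) \<le> ennreal (N * (1 + C1) * Q z w powr \<delta>)"
            by (intro ennreal_leI) (simp add: algebra_simps)
          show "mass R w \<le> ennreal (Cu * Y * \<tau> Y)" using up[OF w] by (simp add: Y_def)
        qed auto
        also have "\<dots> = ennreal (N * (1 + C1) * Q z w powr \<delta> * (Cu * Y * \<tau> Y))"
          using N C1 by (intro ennreal_mult'[symmetric]) simp
        finally have I: "(\<integral>\<^sup>+x. ennreal (cmod (f x - b z)) * indicator (hball w R) x * (hm x * indicator (ball 0 1) x) \<partial>lborel)
            \<le> ennreal (N * (1 + C1) * Q z w powr \<delta> * (Cu * Y * \<tau> Y))" .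
        have "ennreal (9 / pi * cmod (G w) / (1 - cmod w)\<^sup>2) * indicator (ball 0 1) w *
            (\<integral>\<^sup>+x. ennreal (cmod (f x - b z)) * indicator (hball w R) x * (hm x * indicator (ball 0 1) x) \<partial>lborel)
            \<le> ennreal (9 / pi * cmod (G w) / Y\<^sup>2) * ennreal (N * (1 + C1) * Q z w powr \<delta> * (Cu * Y * \<tau> Y))"
          using w mult_left_mono[OF I, of "ennreal (9 / pi * cmod (G w) / Y\<^sup>2)"] by (simp add: Y_def)
        also have "\<dots> = ennreal (9 / pi * cmod (G w) / Y\<^sup>2 * (N * (1 + C1) * Q z w powr \<delta> * (Cu * Y * \<tau> Y)))"
          by (intro ennreal_mult'[symmetric]) simp
        also have "9 / pi * cmod (G w) / Y\<^sup>2 * (N * (1 + C1) * Q z w powr \<delta> * (Cu * Y * \<tau> Y)) = C * N * cmod (G w) * Q z w powr \<delta> * (\<tau> Y / Y)"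
          using Y by (simp add: C_def power2_eq_square)
        also have "ennreal \<dots> = ennreal (C * N * cmod (G w) * Q z w powr \<delta>) * ennreal (\<tau> Y / Y)"
          using N C1 Cu by (intro ennreal_mult') (simp add: C_def)
        finally show ?thesis by (simp only: hn_def Y_def)
      qed simp
    qed
    finally show ?thesis unfolding hmb .
  qed
  moreover have "0 < C" using C1 Cu by (simp add: C_def)
  ultimately show ?thesis using that by blast
qed

section \<open>Analyticity and size of the kernel\<close>

lemma kernel_holomorphic:
  assumes z: "cmod z < 1"
  shows "bergman_kernel \<omega> z holomorphic_on ball 0 1"
proof (rule power_series_holomorphic[where a = "\<lambda>n. of_real (1 / m n) * cnj z ^ n / 2"])
  fix w :: complex assume "w \<in> ball 0 1"
  then have zw: "cmod (cnj z * w) < 1"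
    using z mult_strict_mono'[of "cmod z" 1 "cmod w" 1] by (simp add: norm_mult)
  have "(\<lambda>n. of_real (1 / m n) * (cnj z * w) ^ n / 2) sums ((\<Sum>n. of_real (1 / m n) * (cnj z * w) ^ n) / 2)"
    by (intro sums_divide summable_sums kernel_summable zw)
  then show "(\<lambda>n. of_real (1 / m n) * cnj z ^ n / 2 * (w - 0) ^ n) sums bergman_kernel \<omega> z w"
    unfolding bergman_kernel_eq[OF zw] by (simp add: power_mult_distrib mult_ac)
qed

lemma kernel_bound:
  obtains C where "0 < C" "\<And>z w. cmod z < 1 \<Longrightarrow> cmod w < 1 \<Longrightarrow> cmod (bergman_kernel \<omega> z w) \<le> C / (dd z w * \<tau> (dd z w))"
proof -
  obtain C where C: "0 < C" "\<And>u::complex. cmod u < 1 \<Longrightarrow> cmod (\<Sum>n. of_real (1 / m n) * u ^ n) \<le> C / (cmod (1 - u) * \<tau> (cmod (1 - u)))"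
    using kernel_series_bound by blast
  have "cmod (bergman_kernel \<omega> z w) \<le> C / (dd z w * \<tau> (dd z w))" if "cmod z < 1" "cmod w < 1" for z w
  proof -
    have zw: "cmod (cnj z * w) < 1"
      using that mult_strict_mono'[of "cmod z" 1 "cmod w" 1] by (simp add: norm_mult)
    have "cmod (bergman_kernel \<omega> z w) \<le> cmod (\<Sum>n. of_real (1 / m n) * (cnj z * w) ^ n)"
      unfolding bergman_kernel_eq[OF zw] by (simp add: norm_divide)
    also have "\<dots> \<le> C / (dd z w * \<tau> (dd z w))"
      unfolding dd_def by (rule C(2)[OF zw])
    finally show ?thesis .
  qed
  with C(1) show ?thesis by (rule that)
qed

lemma kernel_at_0: "bergman_kernel \<omega> z 0 = 1 / of_real (2 * moment \<omega> 1)"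
proof -
  have "bergman_kernel \<omega> z 0 = (\<Sum>n. of_real (1 / m n) * (0::complex) ^ n) / 2"
    using bergman_kernel_eq[of z 0] by simp
  also have "(\<Sum>n. of_real (1 / m n) * (0::complex) ^ n) = of_real (1 / m 0)"
    by (rule powser_zero)
  finally show ?thesis by (simp add: m_def)
qed

end

lemma powr_add_le:
  fixes x y p :: real
  assumes "0 \<le> x" "0 \<le> y" "0 \<le> p"
  shows "(x + y) powr p \<le> 2 powr p * (x powr p + y powr p)"
proof -
  have "(x + y) powr p \<le> (2 * max x y) powr p"
    using assms by (intro powr_mono2) auto
  also have "\<dots> = 2 powr p * max x y powr p"
    using assms by (simp add: powr_mult)
  also have "\<dots> \<le> 2 powr p * (x powr p + y powr p)"
    by (intro mult_left_mono) (auto simp: max_def)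
  finally show ?thesis .
qed

section \<open>Pointwise and norm estimates of the operator\<close>

context D_weight
begin

lemma holomorphic_wm_measurable:
  "G holomorphic_on ball 0 1 \<Longrightarrow> G \<in> borel_measurable wm"
  unfolding wm_borel_iff by (rule holomorphic_ball_indicator_measurable)

lemma nn_integral_wm_holomorphic:
  assumes hol: "G holomorphic_on ball 0 1"
  shows "(\<integral>\<^sup>+z. ennreal (cmod (G z) powr s) \<partial>wm) = (\<integral>\<^sup>+z. ennreal (cmod (G z) powr s) * hm z \<partial>lborel)"
proof -
  define G0 where "G0 z = indicator (ball 0 1) z *\<^sub>R G z" for z
  have [measurable]: "G0 \<in> borel_measurable borel"
    unfolding G0_def[abs_def] by (rule holomorphic_ball_indicator_measurable[OF hol])
  have "(\<integral>\<^sup>+z. ennreal (cmod (G z) powr s) \<partial>wm) = (\<integral>\<^sup>+z. ennreal (cmod (G0 z) powr s) \<partial>wm)"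
    by (intro nn_integral_cong) (simp add: G0_def)
  also have "\<dots> = (\<integral>\<^sup>+z. ennreal (cmod (G0 z) powr s) * hm z \<partial>lborel)"
    by (rule nn_integral_wm) measurable
  also have "\<dots> = (\<integral>\<^sup>+z. ennreal (cmod (G z) powr s) * hm z \<partial>lborel)"
    by (intro nn_integral_cong) (simp add: G0_def hm_alt indicator_def)
  finally show ?thesis .
qed

text \<open>Circular means of \<open>cmod (g w) powr s\<close> are smallest at the origin;
  integrating against a rotation invariant density produces its total mass.\<close>

lemma value_at_0_le_norm:
  assumes hol: "g holomorphic_on ball 0 1" and s: "1 < s"
  shows "ennreal (cmod (g 0) powr s) * ennreal (2 * moment \<omega> 1) \<le> (\<integral>\<^sup>+w. ennreal (cmod (g w) powr s) * hm w \<partial>lborel)"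
proof -
  define F :: "complex \<Rightarrow> ennreal" where "F = (\<lambda>w. ennreal (cmod (indicator (ball 0 1) w *\<^sub>R g w) powr s))"
  have [measurable]: "F \<in> borel_measurable borel"
    unfolding F_def using holomorphic_ball_indicator_measurable[OF hol] by measurable
  have F: "F w = ennreal (cmod (g w) powr s)" if "cmod w < 1" for w
    using that by (simp add: F_def)
  have "ennreal (cmod (g 0) powr s) * ennreal (2 * moment \<omega> 1) = (\<integral>\<^sup>+w. ennreal (cmod (g 0) powr s) * hm w \<partial>lborel)"
    by (simp add: nn_integral_cmult hm_total)
  also have "\<dots> \<le> (\<integral>\<^sup>+w. (\<integral>\<^sup>+t. (F (circ t * w) * hm (circ t * w)) * indicator {0..1} t \<partial>lborel) \<partial>lborel)"
  proof (rule nn_integral_mono)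
    fix w :: complex
    show "ennreal (cmod (g 0) powr s) * hm w \<le> (\<integral>\<^sup>+t. (F (circ t * w) * hm (circ t * w)) * indicator {0..1} t \<partial>lborel)"
    proof (cases "cmod w < 1")
      case True
      have "ennreal (cmod (g 0) powr s) = (\<integral>\<^sup>+t. ennreal (cmod (g (circ t * 0)) powr s) * indicator {0..1::real} t \<partial>lborel)"
        by (simp add: nn_integral_cmult)
      also have "\<dots> \<le> (\<integral>\<^sup>+t. ennreal (cmod (g (circ t * w)) powr s) * indicator {0..1} t \<partial>lborel)"
        using True by (intro circle_mean_powr_mono[OF hol s]) auto
      also have "\<dots> = (\<integral>\<^sup>+t. F (circ t * w) * indicator {0..1} t \<partial>lborel)"
        using True by (intro nn_integral_cong) (simp add: F norm_mult)
      finally have "ennreal (cmod (g 0) powr s) * hm w \<le> (\<integral>\<^sup>+t. F (circ t * w) * indicator {0..1} t \<partial>lborel) * hm w"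
        by (rule mult_right_mono) simp
      also have "\<dots> = (\<integral>\<^sup>+t. (F (circ t * w) * indicator {0..1} t) * hm w \<partial>lborel)"
        by (rule nn_integral_multc[symmetric]) measurable
      also have "\<dots> = (\<integral>\<^sup>+t. (F (circ t * w) * hm (circ t * w)) * indicator {0..1} t \<partial>lborel)"
        by (intro nn_integral_cong) (auto simp: hm_def norm_mult indicator_def)
      finally show ?thesis .
    qed (simp add: hm_outside)
  qed
  also have "\<dots> = (\<integral>\<^sup>+w. F w * hm w \<partial>lborel)"
    by (rule nn_integral_lborel_circle[symmetric]) measurable
  also have "\<dots> = (\<integral>\<^sup>+w. ennreal (cmod (g w) powr s) * hm w \<partial>lborel)"
    by (intro nn_integral_cong) (simp add: F_def hm_alt indicator_def)
  finally show ?thesis .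
qed

lemma H_infinityD:
  assumes "g \<in> H_infinity"
  obtains B where "0 \<le> B" "\<And>z. cmod z < 1 \<Longrightarrow> cmod (g z) \<le> B" "g holomorphic_on ball 0 1"
proof -
  obtain B where B: "\<And>x. x \<in> g ` ball 0 1 \<Longrightarrow> cmod x \<le> B"
    using assms unfolding H_infinity_def bounded_iff by auto
  have "cmod (g z) \<le> B" if "cmod z < 1" for z using B[of "g z"] that by auto
  moreover have "0 \<le> B" using order_trans[OF norm_ge_zero calculation[of 0]] by simp
  ultimately show ?thesis using that assms by (auto simp: H_infinity_def)
qed

lemma kernel_times_osc:
  obtains C where "0 < C"
    "\<And>z w. cmod z < 1 \<Longrightarrow> cmod w < 1 \<Longrightarrow> 0 < \<delta> \<Longrightarrow> cmod (bergman_kernel \<omega> z w) * Q z w powr \<delta> \<le> C * kk \<delta> z w"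
proof -
  obtain C where C: "0 < C" "\<And>z w. cmod z < 1 \<Longrightarrow> cmod w < 1 \<Longrightarrow> cmod (bergman_kernel \<omega> z w) \<le> C / (dd z w * \<tau> (dd z w))"
    using kernel_bound by blast
  have "cmod (bergman_kernel \<omega> z w) * Q z w powr \<delta> \<le> C * kk \<delta> z w" if z: "cmod z < 1" and w: "cmod w < 1" and d: "0 < \<delta>" for z w
  proof -
    define X Y D where "X = 1 - cmod z" and "Y = 1 - cmod w" and "D = dd z w"
    have X: "0 < X" and Y: "0 < Y" using z w by (auto simp: X_def Y_def)
    have D: "0 < D" using dd_ge[of w z] w X by (simp add: D_def X_def)
    have "Q z w powr \<delta> \<le> (D\<^sup>2 / (X * Y)) powr \<delta>"
      using Q_upper[OF z w] Q_ge_1[OF z w] d unfolding X_def Y_def D_def by (intro powr_mono2) auto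
    also have "\<dots> = D powr (2 * \<delta>) * (X powr (- \<delta>) * Y powr (- \<delta>))"
    proof -
      have "D\<^sup>2 = D powr 2" using D by simp
      then have "(D\<^sup>2 / (X * Y)) powr \<delta> = D powr (2 * \<delta>) / (X powr \<delta> * Y powr \<delta>)"
        using X Y by (simp only: powr_divide powr_mult powr_powr)
      then show ?thesis by (simp add: powr_minus_divide)
    qed
    finally have "cmod (bergman_kernel \<omega> z w) * Q z w powr \<delta> \<le> C / (D * \<tau> D) * (D powr (2 * \<delta>) * (X powr (- \<delta>) * Y powr (- \<delta>)))"
      using C(2)[OF z w] C(1) D \<tau>_pos[OF D] by (intro mult_mono) (auto simp: D_def)
    also have "\<dots> = C * kk \<delta> z w"
      using D by (simp add: kk_def X_def Y_def D_def powr_diff)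
    finally show ?thesis .
  qed
  with C(1) show ?thesis using that by blast
qed

text \<open>For fixed \<open>z\<close> the kernel is bounded in \<open>w\<close> because
  \<open>dd z w \<ge> 1 - cmod z\<close>. This supplies the boundedness required by
  \<open>radial_mean_value\<close>.\<close>

lemma kernel_times_bounded:
  assumes g: "g holomorphic_on ball 0 1" "\<And>z. cmod z < 1 \<Longrightarrow> cmod (g z) \<le> B" and z: "cmod z < 1"
  obtains B' where "0 \<le> B'" "\<And>w. cmod w < 1 \<Longrightarrow> cmod (g w * bergman_kernel \<omega> z w) \<le> B'"
    "(\<lambda>w. g w * bergman_kernel \<omega> z w) holomorphic_on ball 0 1"
proof -
  obtain C where C: "0 < C" "\<And>z w. cmod z < 1 \<Longrightarrow> cmod w < 1 \<Longrightarrow> cmod (bergman_kernel \<omega> z w) \<le> C / (dd z w * \<tau> (dd z w))"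
    using kernel_bound by blast
  define X where "X = 1 - cmod z"
  have X: "0 < X" using z by (simp add: X_def)
  have B: "0 \<le> B" using order_trans[OF norm_ge_zero g(2)[of 0]] by simp
  have "cmod (g w * bergman_kernel \<omega> z w) \<le> B * (C / (X * \<tau> X))" if w: "cmod w < 1" for w
  proof -
    have D: "X \<le> dd z w" using dd_ge[of w z] w by (simp add: X_def)
    have "C / (dd z w * \<tau> (dd z w)) \<le> C / (X * \<tau> X)"
      using C(1) X D \<tau>_pos[OF X] \<tau>_mono[OF X D] by (intro divide_left_mono mult_mono mult_pos_pos) (auto intro: \<tau>_pos)
    then have "cmod (bergman_kernel \<omega> z w) \<le> C / (X * \<tau> X)" using C(2)[OF z w] by linarith
    then show ?thesis unfolding norm_mult using g(2)[OF w] B by (intro mult_mono) auto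
  qed
  moreover have "0 \<le> B * (C / (X * \<tau> X))" using B C X \<tau>_pos[OF X] by simp
  moreover have "(\<lambda>w. g w * bergman_kernel \<omega> z w) holomorphic_on ball 0 1"
    by (intro holomorphic_intros g kernel_holomorphic z)
  ultimately show ?thesis using that by blast
qed

text \<open>
  Since the kernel reproduces \<open>g\<close> at the origin, the symbol may be centred at \<open>b z\<close> at the price
  of the term \<open>b z * g 0\<close>.
\<close>

lemma little_hankel_pointwise:
  assumes f: "f \<in> borel_measurable borel" "integrable wm f" and g: "g \<in> H_infinity" and z: "cmod z < 1"
  shows "ennreal (cmod (little_hankel \<omega> f g z) - cmod (c * g 0))
    \<le> (\<integral>\<^sup>+x. ennreal (cmod (g x * bergman_kernel \<omega> z x)) * ennreal (cmod (f x - c)) * hm x \<partial>lborel)"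
proof -
  interpret W: finite_measure wm by (rule finite_measure_wm)
  obtain B where B: "0 \<le> B" "\<And>z. cmod z < 1 \<Longrightarrow> cmod (g z) \<le> B" and hol: "g holomorphic_on ball 0 1"
    using H_infinityD[OF g] by blast
  define G where "G w = g w * bergman_kernel \<omega> z w" for w
  obtain B' where B': "0 \<le> B'" "\<And>w. cmod w < 1 \<Longrightarrow> cmod (G w) \<le> B'" and holG: "G holomorphic_on ball 0 1"
    using kernel_times_bounded[OF hol B(2) z] unfolding G_def by blast
  have Gm: "G \<in> borel_measurable wm" by (rule holomorphic_wm_measurable[OF holG])
  have fm: "f \<in> borel_measurable wm" by (rule wm_measurable[OF f(1)])
  have Gint: "integrable wm G"
    by (rule W.integrable_const_bound[where B = B']) (use B' Gm in auto)
  have fGint: "integrable wm (\<lambda>x. f x * G x)"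
  proof (rule Bochner_Integration.integrable_bound)
    show "integrable wm (\<lambda>x. B' *\<^sub>R f x)" using f(2) by simp
    show "AE x in wm. norm (f x * G x) \<le> norm (B' *\<^sub>R f x)"
      using B' by (intro AE_I2) (simp add: norm_mult mult.commute[of B'] mult_left_mono)
  qed (use fm Gm in measurable)
  have dint: "integrable wm (\<lambda>x. (f x - c) * G x)"
    using Bochner_Integration.integrable_diff[OF fGint integrable_mult_right[OF Gint, of c]]
    by (simp add: left_diff_distrib)
  have "integral\<^sup>L wm G = G 0 * of_real (2 * moment \<omega> 1)"
    by (rule radial_mean_value[OF holG B'(2)])
  also have "\<dots> = g 0" using moment1_pos by (simp add: G_def kernel_at_0)
  finally have I: "integral\<^sup>L wm G = g 0" .
  have "little_hankel \<omega> f g z = (\<integral>x. f x * G x \<partial>wm)"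
    unfolding little_hankel_def G_def by (simp add: mult.assoc)
  also have "\<dots> = (\<integral>x. (f x - c) * G x + c * G x \<partial>wm)"
    by (simp add: left_diff_distrib)
  also have "\<dots> = (\<integral>x. (f x - c) * G x \<partial>wm) + c * g 0"
    using dint Gint by (subst Bochner_Integration.integral_add) (auto simp: I)
  finally have "cmod (little_hankel \<omega> f g z) - cmod (c * g 0) \<le> cmod (\<integral>x. (f x - c) * G x \<partial>wm)"
    using norm_triangle_ineq[of "\<integral>x. (f x - c) * G x \<partial>wm" "c * g 0"] by simp
  then have "ennreal (cmod (little_hankel \<omega> f g z) - cmod (c * g 0)) \<le> ennreal (cmod (\<integral>x. (f x - c) * G x \<partial>wm))"
    by (rule ennreal_leI)
  also have "\<dots> \<le> (\<integral>\<^sup>+x. ennreal (norm ((f x - c) * G x)) \<partial>wm)"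
    by (rule integral_norm_bound_ennreal[OF dint])
  also have "\<dots> = (\<integral>\<^sup>+x. ennreal (norm ((f x - c) * (indicator (ball 0 1) x *\<^sub>R G x))) \<partial>wm)"
    by (intro nn_integral_cong) simp
  also have "\<dots> = (\<integral>\<^sup>+x. ennreal (norm ((f x - c) * (indicator (ball 0 1) x *\<^sub>R G x))) * hm x \<partial>lborel)"
  proof (rule nn_integral_wm)
    note [measurable] = f(1) holomorphic_ball_indicator_measurable[OF holG]
    show "(\<lambda>x. ennreal (norm ((f x - c) * (indicator (ball 0 1) x *\<^sub>R G x)))) \<in> borel_measurable borel"
      by measurable
  qed
  also have "\<dots> = (\<integral>\<^sup>+x. ennreal (cmod (G x)) * ennreal (cmod (f x - c)) * hm x \<partial>lborel)"
  proof (rule nn_integral_cong)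
    fix x :: complex
    show "ennreal (norm ((f x - c) * (indicator (ball 0 1) x *\<^sub>R G x))) * hm x = ennreal (cmod (G x)) * ennreal (cmod (f x - c)) * hm x"
      by (cases "cmod x < 1") (simp_all add: hm_outside norm_mult ennreal_mult' mult.commute)
  qed
  finally show ?thesis by (simp add: G_def)
qed

text \<open>The kernel is a power series in \<open>cnj z\<close>. As \<open>g\<close> is bounded and
  \<open>f\<close> integrable, it may be integrated term by term, so the conjugate of the result is
  a power series in \<open>z\<close>.\<close>

lemma little_hankel_antiholomorphic:
  assumes f: "integrable wm f" and g: "g \<in> H_infinity"
  shows "(\<lambda>z. cnj (little_hankel \<omega> f g z)) holomorphic_on ball 0 1"
proof -
  obtain B where B: "0 \<le> B" "\<And>z. cmod z < 1 \<Longrightarrow> cmod (g z) \<le> B" and hol: "g holomorphic_on ball 0 1"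
    using H_infinityD[OF g] by blast
  have gm: "g \<in> borel_measurable wm" by (rule holomorphic_wm_measurable[OF hol])
  have xm: "(\<lambda>x. x) \<in> borel_measurable wm" by (rule wm_measurable) simp
  define c where "c n = (\<integral>x. f x * g x * x ^ n \<partial>wm)" for n
  have int: "integrable wm (\<lambda>x. f x * g x * x ^ n)" and bd: "(\<integral>x. norm (f x * g x * x ^ n) \<partial>wm) \<le> B * (\<integral>x. norm (f x) \<partial>wm)" for n
  proof -
    have fi: "integrable wm (\<lambda>x. B * norm (f x))" using f by simp
    have le: "norm (f x * g x * x ^ n) \<le> B * norm (f x)" if "x \<in> space wm" for x
    proof -
      have "cmod (g x) * cmod x ^ n \<le> B * 1"
        using that B by (intro mult_mono power_le_one) auto
      from mult_left_mono[OF this, of "cmod (f x)"] show ?thesis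
        by (simp add: norm_mult norm_power mult_ac)
    qed
    have mm: "(\<lambda>x. f x * g x * x ^ n) \<in> borel_measurable wm"
      using borel_measurable_integrable[OF f] gm xm by measurable
    show int: "integrable wm (\<lambda>x. f x * g x * x ^ n)"
      by (rule Bochner_Integration.integrable_bound[OF fi mm]) (use le B in \<open>auto intro!: AE_I2 simp del: space_wm\<close>)
    have "(\<integral>x. norm (f x * g x * x ^ n) \<partial>wm) \<le> (\<integral>x. B * norm (f x) \<partial>wm)"
      using int fi le by (intro integral_mono) auto
    then show "(\<integral>x. norm (f x * g x * x ^ n) \<partial>wm) \<le> B * (\<integral>x. norm (f x) \<partial>wm)" by simp
  qed
  show ?thesis
  proof (rule power_series_holomorphic[where a = "\<lambda>n. cnj (c n * of_real (1 / m n) / 2)"])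
    fix z :: complex assume "z \<in> ball 0 1"
    then have z: "cmod z < 1" by simp
    define \<phi> where "\<phi> n x = (of_real (1 / m n) * cnj z ^ n / 2) * (f x * g x * x ^ n)" for n x
    have \<phi>: "f x * g x * (of_real (1 / m n) * (cnj z * x) ^ n / 2) = \<phi> n x" for n x
      by (simp add: \<phi>_def power_mult_distrib mult_ac)
    have "(\<lambda>n. integral\<^sup>L wm (\<phi> n)) sums (\<integral>x. (\<Sum>n. \<phi> n x) \<partial>wm)"
    proof (rule sums_integral)
      show "integrable wm (\<phi> n)" for n unfolding \<phi>_def by (intro integrable_mult_right int)
      show "AE x in wm. summable (\<lambda>n. norm (\<phi> n x))"
      proof (rule AE_I2)
        fix x assume "x \<in> space wm"
        then have zx: "cmod z * cmod x < 1" using z mult_strict_mono'[of "cmod z" 1 "cmod x" 1] by simp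
        have "norm (\<phi> n x) = cmod (f x * g x) / 2 * (1 / m n * (cmod z * cmod x) ^ n)" for n
          unfolding \<phi>[symmetric] using m_pos[of n] by (simp add: norm_mult norm_divide norm_power)
        then show "summable (\<lambda>n. norm (\<phi> n x))"
          using zx by (simp only:) (intro summable_mult kernel_summable_aux, auto)
      qed
      show "summable (\<lambda>n. \<integral>x. norm (\<phi> n x) \<partial>wm)"
      proof (rule summable_comparison_test'[of "\<lambda>n. (B * (\<integral>x. norm (f x) \<partial>wm)) * (1 / m n * cmod z ^ n)" 0])
        show "summable (\<lambda>n. (B * (\<integral>x. norm (f x) \<partial>wm)) * (1 / m n * cmod z ^ n))"
          using z by (intro summable_mult kernel_summable_aux) auto
        fix n :: nat
        have "(\<integral>x. norm (\<phi> n x) \<partial>wm) = (1 / m n * cmod z ^ n / 2) * (\<integral>x. norm (f x * g x * x ^ n) \<partial>wm)"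
          unfolding \<phi>_def using m_pos[of n] by (simp add: norm_mult norm_divide norm_power)
        also have "\<dots> \<le> (1 / m n * cmod z ^ n) * (B * (\<integral>x. norm (f x) \<partial>wm))"
        proof (rule mult_mono[OF _ bd])
          show "0 \<le> 1 / m n * cmod z ^ n" using m_pos[of n] by simp
          moreover have "x / 2 \<le> x" if "0 \<le> x" for x :: real using that by simp
          ultimately show "1 / m n * cmod z ^ n / 2 \<le> 1 / m n * cmod z ^ n" by blast
        qed simp
        finally show "norm (\<integral>x. norm (\<phi> n x) \<partial>wm) \<le> (B * (\<integral>x. norm (f x) \<partial>wm)) * (1 / m n * cmod z ^ n)"
          by (simp add: mult.commute)
      qed
    qed
    moreover have "integral\<^sup>L wm (\<phi> n) = c n * of_real (1 / m n) / 2 * cnj z ^ n" for n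
    proof -
      have "integral\<^sup>L wm (\<phi> n) = of_real (1 / m n) * cnj z ^ n / 2 * c n"
        unfolding \<phi>_def c_def by (rule integral_mult_right_zero)
      then show ?thesis by simp
    qed
    moreover have "(\<integral>x. (\<Sum>n. \<phi> n x) \<partial>wm) = little_hankel \<omega> f g z"
      unfolding little_hankel_def
    proof (rule Bochner_Integration.integral_cong[OF refl])
      fix x assume "x \<in> space wm"
      then have zx: "cmod (cnj z * x) < 1" using z mult_strict_mono'[of "cmod z" 1 "cmod x" 1] by (simp add: norm_mult)
      have "(\<Sum>n. \<phi> n x) = (\<Sum>n. f x * g x * (of_real (1 / m n) * (cnj z * x) ^ n / 2))"
        by (simp only: \<phi>)
      also have "\<dots> = f x * g x * (\<Sum>n. of_real (1 / m n) * (cnj z * x) ^ n / 2)"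
        by (rule suminf_mult[OF summable_divide[OF kernel_summable[OF zx]]])
      also have "(\<Sum>n. of_real (1 / m n) * (cnj z * x) ^ n / 2) = bergman_kernel \<omega> z x"
        unfolding bergman_kernel_eq[OF zx] by (rule suminf_divide[OF kernel_summable[OF zx]])
      finally show "(\<Sum>n. \<phi> n x) = f x * g x * bergman_kernel \<omega> z x" .
    qed
    ultimately have "(\<lambda>n. c n * of_real (1 / m n) / 2 * cnj z ^ n) sums little_hankel \<omega> f g z"
      by simp
    then have "(\<lambda>n. cnj (c n * of_real (1 / m n) / 2 * cnj z ^ n)) sums cnj (little_hankel \<omega> f g z)"
      by (simp only: sums_cnj)
    then show "(\<lambda>n. cnj (c n * of_real (1 / m n) / 2) * (z - 0) ^ n) sums cnj (little_hankel \<omega> f g z)"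
      by simp
  qed
qed

text \<open>The excess of \<open>cmod (h z)\<close> over the term from centring is handled by the
  Schur test with input proportional to \<open>cmod (g w)\<close>. The centring term is dominated by
  a radial function with integrable power \<open>s\<close> times \<open>cmod (g 0)\<close>, which
  the norm of \<open>g\<close> controls.\<close>

lemma little_hankel_norm_estimate:
  assumes R: "large_radius R" and s: "1 < s"
  obtains C where "0 < C"
    "\<And>f b N g. f \<in> borel_measurable borel \<Longrightarrow> integrable wm f \<Longrightarrow> 0 \<le> N \<Longrightarrow> oscillates f b R N \<Longrightarrow> g \<in> H_infinity \<Longrightarrow>
      (\<integral>\<^sup>+z. ennreal (cmod (little_hankel \<omega> f g z) powr s) * hm z \<partial>lborel)
        \<le> ennreal (C * (N + cmod (b 0)) powr s) * (\<integral>\<^sup>+z. ennreal (cmod (g z) powr s) * hm z \<partial>lborel)"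
proof -
  obtain \<delta> Cs where d: "0 < \<delta>" "\<delta> * s < \<alpha>" and Cs: "0 < Cs" and schur:
    "\<And>H u. (\<And>z. 0 \<le> H z) \<Longrightarrow> (\<And>z. 0 \<le> u z) \<Longrightarrow> u \<in> borel_measurable borel \<Longrightarrow>
      (\<And>z. cmod z < 1 \<Longrightarrow> ennreal (H z) \<le> (\<integral>\<^sup>+w. ennreal (kk \<delta> z w * u w) * hn w \<partial>lborel)) \<Longrightarrow>
      (\<integral>\<^sup>+z. ennreal (H z powr s) * hm z \<partial>lborel) \<le> ennreal Cs * (\<integral>\<^sup>+w. ennreal (u w powr s) * hn w \<partial>lborel)"
    using schur_test[OF s] by blast
  obtain Co where Co: "0 < Co" and osc_an: "\<And>f b N z G. f \<in> borel_measurable borel \<Longrightarrow> 0 \<le> N \<Longrightarrow> oscillates f b R N \<Longrightarrow> cmod z < 1 \<Longrightarrow> G holomorphic_on ball 0 1 \<Longrightarrow>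
      (\<integral>\<^sup>+x. ennreal (cmod (G x)) * ennreal (cmod (f x - b z)) * hm x \<partial>lborel)
        \<le> (\<integral>\<^sup>+w. ennreal (Co * N * cmod (G w) * Q z w powr \<delta>) * hn w \<partial>lborel)"
    using oscillation_against_analytic[OF R d(1)] by blast
  obtain Cp where Cp: "0 < Cp" and pow: "\<And>f b N z w. f \<in> borel_measurable borel \<Longrightarrow> 0 \<le> N \<Longrightarrow> oscillates f b R N \<Longrightarrow> cmod z < 1 \<Longrightarrow> cmod w < 1 \<Longrightarrow>
      cmod (b z - b w) \<le> Cp * N * Q z w powr \<delta>"
    using oscillates_power[OF R d(1)] by blast
  obtain Ck where Ck: "0 < Ck" and ker: "\<And>z w. cmod z < 1 \<Longrightarrow> cmod w < 1 \<Longrightarrow> 0 < \<delta> \<Longrightarrow> cmod (bergman_kernel \<omega> z w) * Q z w powr \<delta> \<le> Ck * kk \<delta> z w"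
    using kernel_times_osc[of \<delta>] by blast
  obtain Cr where Cr: "0 < Cr" and reg: "\<And>g. g holomorphic_on ball 0 1 \<Longrightarrow>
    (\<integral>\<^sup>+w. ennreal (cmod (g w) powr s) * hn w \<partial>lborel) \<le> ennreal Cr * (\<integral>\<^sup>+w. ennreal (cmod (g w) powr s) * hm w \<partial>lborel)"
    using regularised_norm_le[OF s] by blast
  obtain Cb where Cb: "0 \<le> Cb" and pint: "(\<integral>\<^sup>+w. ennreal ((1 - cmod w) powr (- (\<delta> * s))) * hm w \<partial>lborel) \<le> ennreal Cb"
  proof -
    have "0 \<le> \<delta> * s" using d s by simp
    then obtain C where C: "0 \<le> C" "\<And>z t. cmod z < 1 \<Longrightarrow> 0 < t \<Longrightarrow> t \<le> 4 \<Longrightarrow>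
      (\<integral>\<^sup>+w. ennreal ((1 - cmod w) powr (- (\<delta> * s))) * indicator {w. dd z w < t} w * hm w \<partial>lborel)
        \<le> ennreal (C * t powr (1 - \<delta> * s) * \<tau> t)"
      using box_bounded_hm d unfolding box_bounded_def by blast
    \<comment> \<open>Since \<open>dd 0 w = 1\<close>, the box of size \<open>2\<close> at the
      origin is everything, and the box estimate becomes global integrability for the exponent
      \<open>\<delta> * s < \<alpha>\<close>.\<close>
    have "{w. dd 0 w < 2} = UNIV" by (auto simp: dd_def)
    then have "(\<integral>\<^sup>+w. ennreal ((1 - cmod w) powr (- (\<delta> * s))) * hm w \<partial>lborel) \<le> ennreal (C * 2 powr (1 - \<delta> * s) * \<tau> 2)"
      using C(2)[of 0 2] by simp
    moreover have "0 \<le> C * 2 powr (1 - \<delta> * s) * \<tau> 2" using C(1) \<tau>_pos[of 2] by simp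
    ultimately show ?thesis using that by blast
  qed
  define M where "M = 2 * moment \<omega> 1"
  have M: "0 < M" using moment1_pos by (simp add: M_def)
  define D where "D = Co * Ck"
  have D: "0 < D" using Co Ck by (simp add: D_def)
  define C where "C = 2 powr s * (Cs * D powr s * Cr + 2 powr s * (1 + Cp powr s * Cb / M))"
  have C: "0 < C" using Cs D Cr M Cb by (auto simp: C_def intro!: mult_pos_pos add_pos_nonneg)
  have "(\<integral>\<^sup>+z. ennreal (cmod (little_hankel \<omega> f g z) powr s) * hm z \<partial>lborel)
        \<le> ennreal (C * (N + cmod (b 0)) powr s) * (\<integral>\<^sup>+z. ennreal (cmod (g z) powr s) * hm z \<partial>lborel)"
    if f: "f \<in> borel_measurable borel" "integrable wm f" and N: "0 \<le> N" and osc: "oscillates f b R N" and g: "g \<in> H_infinity" for f b N g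
  proof -
    obtain B where hol: "g holomorphic_on ball 0 1" using H_infinityD[OF g] by blast
    define h where "h = little_hankel \<omega> f g"
    define J where "J = (\<integral>\<^sup>+z. ennreal (cmod (g z) powr s) * hm z \<partial>lborel)"
    define E where "E = N + cmod (b 0)"
    have E: "0 \<le> E" "N \<le> E" "cmod (b 0) \<le> E" using N by (auto simp: E_def)
    define u where "u w = D * N * cmod (indicator (ball 0 1) w *\<^sub>R g w)" for w
    have [measurable]: "u \<in> borel_measurable borel"
      unfolding u_def[abs_def] using holomorphic_ball_indicator_measurable[OF hol] by measurable
    have u0: "0 \<le> u w" for w using D N by (simp add: u_def)
    \<comment> \<open>Explicit majorant of \<open>cmod (b z)\<close> obtained by comparing
      \<open>b z\<close> with \<open>b 0\<close>, where \<open>Q z 0 \<le> 1 / (1 - cmod z)\<close>.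
      It is measurable, while \<open>b\<close> is arbitrary.\<close>
    define W where "W z = E + Cp * E * (1 - cmod z) powr (- \<delta>)" for z :: complex
    have W0: "0 \<le> W z" for z using E Cp by (simp add: W_def)
    have bW: "cmod (b z) \<le> W z" if z: "cmod z < 1" for z
    proof -
      define X where "X = 1 - cmod z"
      have X: "0 < X" using z by (simp add: X_def)
      have "Q z 0 \<le> 1 / X" using Q_upper[OF z, of 0] by (simp add: dd_def X_def)
      then have "Q z 0 powr \<delta> \<le> (1 / X) powr \<delta>" using Q_ge_1[OF z, of 0] d by (intro powr_mono2) auto
      also have "\<dots> = X powr (- \<delta>)" using X by (simp add: powr_divide powr_minus_divide)
      finally have q: "Q z 0 powr \<delta> \<le> X powr (- \<delta>)" .
      have "cmod (b z) \<le> cmod (b 0) + cmod (b z - b 0)" using norm_triangle_sub[of "b z" "b 0"] by simp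
      also have "\<dots> \<le> E + Cp * E * X powr (- \<delta>)"
      proof (rule add_mono[OF E(3)])
        have "cmod (b z - b 0) \<le> Cp * N * Q z 0 powr \<delta>" using pow[OF f(1) N osc z, of 0] by simp
        also have "\<dots> \<le> Cp * E * X powr (- \<delta>)" using q Cp N E by (intro mult_mono) auto
        finally show "cmod (b z - b 0) \<le> Cp * E * X powr (- \<delta>)" .
      qed
      finally show ?thesis by (simp add: W_def X_def)
    qed
    define h0 where "h0 z = indicator (ball 0 1) z *\<^sub>R cnj (h z)" for z
    have [measurable]: "h0 \<in> borel_measurable borel"
      unfolding h0_def[abs_def] h_def
      by (rule holomorphic_ball_indicator_measurable[OF little_hankel_antiholomorphic[OF f(2) g]])
    \<comment> \<open>Truncated at \<open>0\<close> because the Schur test requires a nonnegative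
      function; the subtracted term returns when the powers are split.\<close>
    define H where "H z = (if cmod z < 1 then max 0 (cmod (h0 z) - W z * cmod (g 0)) else 0)" for z
    have H_eq: "H z = max 0 (cmod (h z) - W z * cmod (g 0))" if "cmod z < 1" for z
      using that by (simp add: H_def h0_def)
    have [measurable]: "H \<in> borel_measurable borel"
      unfolding H_def[abs_def] W_def by measurable
    have H0: "0 \<le> H z" for z by (simp add: H_def)
    have key: "ennreal (H z) \<le> (\<integral>\<^sup>+w. ennreal (kk \<delta> z w * u w) * hn w \<partial>lborel)" if z: "cmod z < 1" for z
    proof -
      have "cmod (b z * g 0) \<le> W z * cmod (g 0)"
        using bW[OF z] by (simp add: norm_mult mult_right_mono)
      then have "ennreal (H z) \<le> ennreal (cmod (h z) - cmod (b z * g 0))"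
        unfolding H_eq[OF z] by (cases "cmod (h z) \<le> W z * cmod (g 0)") (auto simp: max_def intro!: ennreal_leI)
      also have "\<dots> \<le> (\<integral>\<^sup>+x. ennreal (cmod (g x * bergman_kernel \<omega> z x)) * ennreal (cmod (f x - b z)) * hm x \<partial>lborel)"
        unfolding h_def by (rule little_hankel_pointwise[OF f g z])
      also have "\<dots> \<le> (\<integral>\<^sup>+w. ennreal (Co * N * cmod (g w * bergman_kernel \<omega> z w) * Q z w powr \<delta>) * hn w \<partial>lborel)"
        by (rule osc_an[OF f(1) N osc z]) (intro holomorphic_intros hol kernel_holomorphic z)
      also have "\<dots> \<le> (\<integral>\<^sup>+w. ennreal (kk \<delta> z w * u w) * hn w \<partial>lborel)"
      proof (rule nn_integral_mono)
        fix w :: complex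
        show "ennreal (Co * N * cmod (g w * bergman_kernel \<omega> z w) * Q z w powr \<delta>) * hn w \<le> ennreal (kk \<delta> z w * u w) * hn w"
        proof (cases "cmod w < 1")
          case True
          have "Co * N * cmod (g w * bergman_kernel \<omega> z w) * Q z w powr \<delta> = Co * N * cmod (g w) * (cmod (bergman_kernel \<omega> z w) * Q z w powr \<delta>)"
            by (simp add: norm_mult)
          also have "\<dots> \<le> Co * N * cmod (g w) * (Ck * kk \<delta> z w)"
            using Co N by (intro mult_left_mono ker z True d) auto
          also have "\<dots> = kk \<delta> z w * u w" using True by (simp add: u_def D_def)
          finally show ?thesis by (intro mult_right_mono ennreal_leI) auto
        qed (simp add: hn_outside)
      qed
      finally show ?thesis .
    qed
    have "(\<integral>\<^sup>+z. ennreal (H z powr s) * hm z \<partial>lborel) \<le> ennreal Cs * (\<integral>\<^sup>+w. ennreal (u w powr s) * hn w \<partial>lborel)"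
      by (rule schur[OF H0 u0 _ key]) measurable
    also have "(\<integral>\<^sup>+w. ennreal (u w powr s) * hn w \<partial>lborel) = (\<integral>\<^sup>+w. ennreal ((D * N) powr s) * (ennreal (cmod (indicator (ball 0 1) w *\<^sub>R g w) powr s) * hn w) \<partial>lborel)"
      using D N by (intro nn_integral_cong) (simp add: u_def powr_mult ennreal_mult' mult.assoc)
    also have "\<dots> = ennreal ((D * N) powr s) * (\<integral>\<^sup>+w. ennreal (cmod (indicator (ball 0 1) w *\<^sub>R g w) powr s) * hn w \<partial>lborel)"
    proof (rule nn_integral_cmult)
      note [measurable] = holomorphic_ball_indicator_measurable[OF hol]
      show "(\<lambda>w. ennreal (cmod (indicator (ball 0 1) w *\<^sub>R g w) powr s) * hn w) \<in> borel_measurable lborel" by measurable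
    qed
    also have "(\<integral>\<^sup>+w. ennreal (cmod (indicator (ball 0 1) w *\<^sub>R g w) powr s) * hn w \<partial>lborel) = (\<integral>\<^sup>+w. ennreal (cmod (g w) powr s) * hn w \<partial>lborel)"
      by (intro nn_integral_cong) (simp add: hn_alt indicator_def)
    finally have "(\<integral>\<^sup>+z. ennreal (H z powr s) * hm z \<partial>lborel) \<le> ennreal Cs * (ennreal ((D * N) powr s) * (\<integral>\<^sup>+w. ennreal (cmod (g w) powr s) * hn w \<partial>lborel))" .
    also have "\<dots> \<le> ennreal Cs * (ennreal ((D * N) powr s) * (ennreal Cr * J))"
      unfolding J_def by (intro mult_left_mono reg hol) auto
    also have "\<dots> = ennreal (Cs * ((D * N) powr s * Cr)) * J"
      using Cs by (simp add: ennreal_mult' mult.assoc)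
    also have "\<dots> \<le> ennreal (Cs * (D powr s * E powr s * Cr)) * J"
      using Cs Cr D N E s by (intro mult_right_mono ennreal_leI mult_left_mono) (auto simp: powr_mult intro!: powr_mono2 mult_left_mono)
    finally have IH: "(\<integral>\<^sup>+z. ennreal (H z powr s) * hm z \<partial>lborel) \<le> ennreal (Cs * (D powr s * E powr s * Cr)) * J" .
    define v where "v z = 2 powr s * E powr s * (1 + Cp powr s * (1 - cmod z) powr (- (\<delta> * s)))" for z :: complex
    have v0: "0 \<le> v z" for z by (simp add: v_def)
    have [measurable]: "v \<in> borel_measurable borel" unfolding v_def[abs_def] by measurable
    have bz: "W z powr s \<le> v z" if z: "cmod z < 1" for z
    proof -
      define X where "X = 1 - cmod z"
      have X: "0 < X" using z by (simp add: X_def)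
      have "W z powr s = (E + Cp * E * X powr (- \<delta>)) powr s" by (simp add: W_def X_def)
      also have "\<dots> \<le> 2 powr s * (E powr s + (Cp * E * X powr (- \<delta>)) powr s)"
        using E Cp s by (intro powr_add_le) auto
      also have "(Cp * E * X powr (- \<delta>)) powr s = Cp powr s * E powr s * X powr (- (\<delta> * s))"
        using Cp E X by (simp add: powr_mult powr_powr)
      finally show ?thesis by (simp add: v_def X_def algebra_simps)
    qed
    have vint: "(\<integral>\<^sup>+z. ennreal (v z) * hm z \<partial>lborel) \<le> ennreal (2 powr s * E powr s * (M + Cp powr s * Cb))"
    proof -
      have "(\<integral>\<^sup>+z. ennreal (v z) * hm z \<partial>lborel)
          = (\<integral>\<^sup>+z. ennreal (2 powr s * E powr s) * (hm z + ennreal (Cp powr s) * (ennreal ((1 - cmod z) powr (- (\<delta> * s))) * hm z)) \<partial>lborel)"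
        unfolding v_def by (intro nn_integral_cong) (simp add: ennreal_mult' distrib_right mult.assoc)
      also have "\<dots> = ennreal (2 powr s * E powr s) * (ennreal M + ennreal (Cp powr s) * (\<integral>\<^sup>+z. ennreal ((1 - cmod z) powr (- (\<delta> * s))) * hm z \<partial>lborel))"
        by (simp add: nn_integral_cmult nn_integral_add hm_total M_def)
      also have "\<dots> \<le> ennreal (2 powr s * E powr s) * (ennreal M + ennreal (Cp powr s) * ennreal Cb)"
        by (intro mult_left_mono add_left_mono pint) auto
      also have "\<dots> = ennreal (2 powr s * E powr s * (M + Cp powr s * Cb))"
        using M Cb by (simp add: ennreal_mult')
      finally show ?thesis .
    qed
    have "(\<integral>\<^sup>+z. ennreal (cmod (h z) powr s) * hm z \<partial>lborel)
        \<le> (\<integral>\<^sup>+z. ennreal (2 powr s) * (ennreal (H z powr s) * hm z + ennreal (cmod (g 0) powr s) * (ennreal (v z) * hm z)) \<partial>lborel)"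
    proof (rule nn_integral_mono)
      fix z :: complex
      show "ennreal (cmod (h z) powr s) * hm z \<le> ennreal (2 powr s) * (ennreal (H z powr s) * hm z + ennreal (cmod (g 0) powr s) * (ennreal (v z) * hm z))"
      proof (cases "cmod z < 1")
        case z: True
        have "cmod (h z) \<le> H z + W z * cmod (g 0)" using H_eq[OF z] by simp
        then have "cmod (h z) powr s \<le> (H z + W z * cmod (g 0)) powr s" using s by (intro powr_mono2) auto
        also have "\<dots> \<le> 2 powr s * (H z powr s + (W z * cmod (g 0)) powr s)"
          using H0 W0 s by (intro powr_add_le) auto
        also have "(W z * cmod (g 0)) powr s = cmod (g 0) powr s * W z powr s"
          using W0[of z] by (simp add: powr_mult mult.commute)
        also have "2 powr s * (H z powr s + cmod (g 0) powr s * W z powr s) \<le> 2 powr s * (H z powr s + cmod (g 0) powr s * v z)"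
          by (intro mult_left_mono add_left_mono bz z) auto
        finally have "ennreal (cmod (h z) powr s) \<le> ennreal (2 powr s * (H z powr s + cmod (g 0) powr s * v z))"
          by (rule ennreal_leI)
        also have "\<dots> = ennreal (2 powr s) * (ennreal (H z powr s) + ennreal (cmod (g 0) powr s) * ennreal (v z))"
          using v0[of z] by (simp add: ennreal_mult')
        finally have "ennreal (cmod (h z) powr s) * hm z \<le> ennreal (2 powr s) * (ennreal (H z powr s) + ennreal (cmod (g 0) powr s) * ennreal (v z)) * hm z"
          by (rule mult_right_mono) simp
        then show ?thesis by (simp only: mult.assoc distrib_right)
      qed (simp add: hm_outside)
    qed
    also have "\<dots> = ennreal (2 powr s) * ((\<integral>\<^sup>+z. ennreal (H z powr s) * hm z \<partial>lborel) + ennreal (cmod (g 0) powr s) * (\<integral>\<^sup>+z. ennreal (v z) * hm z \<partial>lborel))"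
      by (simp add: nn_integral_cmult nn_integral_add)
    also have "\<dots> \<le> ennreal (2 powr s) * (ennreal (Cs * (D powr s * E powr s * Cr)) * J + ennreal (cmod (g 0) powr s) * ennreal (2 powr s * E powr s * (M + Cp powr s * Cb)))"
      by (intro mult_left_mono add_mono IH vint) auto
    \<comment> \<open>The total mass \<open>M\<close> is split off so that
      \<open>value_at_0_le_norm\<close> applies.\<close>
    also have "ennreal (cmod (g 0) powr s) * ennreal (2 powr s * E powr s * (M + Cp powr s * Cb))
        = ennreal (2 powr s * E powr s * (1 + Cp powr s * Cb / M)) * (ennreal (cmod (g 0) powr s) * ennreal M)"
    proof -
      have "ennreal (cmod (g 0) powr s) * ennreal (2 powr s * E powr s * (M + Cp powr s * Cb))
          = ennreal (cmod (g 0) powr s * (2 powr s * E powr s * (M + Cp powr s * Cb)))"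
        by (rule ennreal_mult'[symmetric]) simp
      also have "cmod (g 0) powr s * (2 powr s * E powr s * (M + Cp powr s * Cb))
          = 2 powr s * E powr s * (1 + Cp powr s * Cb / M) * (cmod (g 0) powr s * M)"
        using M by (simp add: field_simps)
      also have "ennreal \<dots> = ennreal (2 powr s * E powr s * (1 + Cp powr s * Cb / M)) * (ennreal (cmod (g 0) powr s) * ennreal M)"
        using M Cb by (subst ennreal_mult', simp, subst ennreal_mult', simp, simp)
      finally show ?thesis .
    qed
    also have "ennreal (2 powr s) * (ennreal (Cs * (D powr s * E powr s * Cr)) * J + ennreal (2 powr s * E powr s * (1 + Cp powr s * Cb / M)) * (ennreal (cmod (g 0) powr s) * ennreal M))
        \<le> ennreal (2 powr s) * (ennreal (Cs * (D powr s * E powr s * Cr)) * J + ennreal (2 powr s * E powr s * (1 + Cp powr s * Cb / M)) * J)"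
      unfolding J_def M_def by (intro mult_left_mono add_left_mono value_at_0_le_norm hol s) auto
    also have "\<dots> = ennreal (C * E powr s) * J"
    proof -
      have n: "0 \<le> Cs * (D powr s * E powr s * Cr)" "0 \<le> 2 powr s * E powr s * (1 + Cp powr s * Cb / M)"
        using Cs Cr M Cb by auto
      have e: "C * E powr s = 2 powr s * (Cs * (D powr s * E powr s * Cr) + 2 powr s * E powr s * (1 + Cp powr s * Cb / M))"
        by (simp add: C_def algebra_simps)
      show ?thesis unfolding e
        by (subst ennreal_mult', simp, subst ennreal_plus[OF n]) (simp only: distrib_right mult.assoc)
    qed
    finally show ?thesis by (simp add: h_def J_def E_def)
  qed
  with C show ?thesis using that by blast
qed

end

section \<open>Bounded mean oscillation\<close>

context D_weight
begin

lemma hyp_mean_cong: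
  assumes "\<And>z. cmod z < 1 \<Longrightarrow> f z = g z"
  shows "hyp_mean \<omega> r f = hyp_mean \<omega> r g"
proof
  fix z
  have "(LINT \<zeta>:hyp_disc z r|wm. f \<zeta>) = (LINT \<zeta>:hyp_disc z r|wm. g \<zeta>)"
    unfolding set_lebesgue_integral_def by (intro Bochner_Integration.integral_cong) (auto simp: assms)
  then show "hyp_mean \<omega> r f z = hyp_mean \<omega> r g z" by (simp add: hyp_mean_def)
qed

lemma mean_osc_cong:
  assumes "\<And>z. cmod z < 1 \<Longrightarrow> f z = g z"
  shows "mean_osc \<omega> p r f = mean_osc \<omega> p r g"
proof
  fix z
  have hm: "hyp_mean \<omega> r f = hyp_mean \<omega> r g" by (rule hyp_mean_cong) (rule assms)
  have "(LINT \<zeta>:hyp_disc z r|wm. cmod (f \<zeta> - hyp_mean \<omega> r f z) powr p) = (LINT \<zeta>:hyp_disc z r|wm. cmod (g \<zeta> - hyp_mean \<omega> r g z) powr p)"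
    unfolding set_lebesgue_integral_def hm
    by (intro Bochner_Integration.integral_cong) (auto simp: assms)
  then show "mean_osc \<omega> p r f z = mean_osc \<omega> p r g z" by (simp add: mean_osc_def)
qed

lemma little_hankel_cong:
  assumes "\<And>z. cmod z < 1 \<Longrightarrow> f z = g z"
  shows "little_hankel \<omega> f = little_hankel \<omega> g"
  unfolding little_hankel_def fun_eq_iff
  by (intro allI Bochner_Integration.integral_cong) (auto simp: assms)

text \<open>Members of \<open>Lp_space\<close> are measurable on the disc only. The cut-off makes
  them Borel on the plane and changes neither the oscillation nor the operator.\<close>

definition trunc :: "(complex \<Rightarrow> complex) \<Rightarrow> complex \<Rightarrow> complex" where
  "trunc f z = indicator (ball 0 1) z *\<^sub>R f z"

lemma trunc_eq: "cmod z < 1 \<Longrightarrow> trunc f z = f z"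
  by (simp add: trunc_def)

lemma Lp_space_iff:
  "f \<in> Lp_space \<omega> p \<longleftrightarrow> trunc f \<in> borel_measurable borel \<and> integrable wm (\<lambda>z. cmod (trunc f z) powr p)"
proof -
  have "integrable wm (\<lambda>z. cmod (f z) powr p) \<longleftrightarrow> integrable wm (\<lambda>z. cmod (trunc f z) powr p)"
    by (intro Bochner_Integration.integrable_cong) (auto simp: trunc_def)
  then show ?thesis unfolding Lp_space_def mem_Collect_eq wm_borel_iff trunc_def[abs_def] by simp
qed

lemma integrable_powr_diff:
  assumes f: "f \<in> borel_measurable borel" "integrable wm (\<lambda>z. cmod (f z) powr p)" and p: "1 < p"
  shows "integrable wm (\<lambda>z. cmod (f z - c) powr p)"
proof (rule Bochner_Integration.integrable_bound)
  interpret W: finite_measure wm by (rule finite_measure_wm)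
  show "integrable wm (\<lambda>z. 2 powr p * (cmod (f z) powr p + cmod c powr p))"
    using f(2) by (intro integrable_mult_right Bochner_Integration.integrable_add W.integrable_const)
  show "(\<lambda>z. cmod (f z - c) powr p) \<in> borel_measurable wm"
    using f(1) by (intro wm_measurable) measurable
  show "AE z in wm. norm (cmod (f z - c) powr p) \<le> norm (2 powr p * (cmod (f z) powr p + cmod c powr p))"
  proof (rule AE_I2)
    fix z
    have "cmod (f z - c) powr p \<le> (cmod (f z) + cmod c) powr p"
      using p by (intro powr_mono2 norm_triangle_ineq4) auto
    also have "\<dots> \<le> 2 powr p * (cmod (f z) powr p + cmod c powr p)"
      using p by (intro powr_add_le) auto
    finally show "norm (cmod (f z - c) powr p) \<le> norm (2 powr p * (cmod (f z) powr p + cmod c powr p))" by simp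
  qed
qed

lemma powr_integrable_imp_integrable:
  assumes f: "f \<in> borel_measurable borel" "integrable wm (\<lambda>z. cmod (f z) powr p)" and p: "1 < p"
  shows "integrable wm f"
proof (rule Bochner_Integration.integrable_bound)
  interpret W: finite_measure wm by (rule finite_measure_wm)
  show "integrable wm (\<lambda>z. 1 + cmod (f z) powr p)"
    using f(2) by (intro Bochner_Integration.integrable_add W.integrable_const)
  show "f \<in> borel_measurable wm" using f(1) by (rule wm_measurable)
  show "AE z in wm. norm (f z) \<le> norm (1 + cmod (f z) powr p)"
  proof (rule AE_I2)
    fix z
    show "norm (f z) \<le> norm (1 + cmod (f z) powr p)"
    proof (cases "cmod (f z) \<le> 1")
      case False
      then have "cmod (f z) powr 1 \<le> cmod (f z) powr p" using p by (intro powr_mono) auto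
      then show ?thesis using False by simp
    qed (simp add: add_increasing2)
  qed
qed

lemma hball_subset: "hball z R \<subseteq> ball 0 1"
  by (auto simp: hball_def)

lemma hball_sets_wm: "hball z R \<in> sets wm"
  unfolding sets_wm using hball_subset[of z R] hball_measurable[of z R]
  by (auto simp: sets_restrict_space_iff)

lemma mass_eq_measure: "ennreal (measure wm (hball z R)) = mass R z"
proof -
  interpret W: finite_measure wm by (rule finite_measure_wm)
  have "emeasure wm (hball z R) = mass R z"
    unfolding mass_def by (rule emeasure_wm[OF hball_measurable hball_subset])
  then show ?thesis by (simp add: W.emeasure_eq_measure)
qed

lemma set_integral_osc:
  assumes f: "f \<in> borel_measurable borel" "integrable wm (\<lambda>z. cmod (f z) powr p)" and p: "1 < p"
  shows "ennreal (LINT x:hball z R|wm. cmod (f x - c) powr p)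
    = (\<integral>\<^sup>+x. ennreal (cmod (f x - c) powr p) * indicator (hball z R) x * hm x \<partial>lborel)"
proof -
  note [measurable] = f(1)
  note hs = hball_sets_wm[of z R]
  have "integrable wm (\<lambda>x. indicator (hball z R) x *\<^sub>R cmod (f x - c) powr p)"
    using integrable_powr_diff[OF f p] hs by (intro integrable_mult_indicator) auto
  then have "ennreal (LINT x:hball z R|wm. cmod (f x - c) powr p) = (\<integral>\<^sup>+x. ennreal (indicator (hball z R) x *\<^sub>R cmod (f x - c) powr p) \<partial>wm)"
    unfolding set_lebesgue_integral_def by (intro nn_integral_eq_integral[symmetric]) auto
  also have "\<dots> = (\<integral>\<^sup>+x. ennreal (indicator (hball z R) x *\<^sub>R cmod (f x - c) powr p) * hm x \<partial>lborel)"
    by (rule nn_integral_wm) measurable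
  also have "\<dots> = (\<integral>\<^sup>+x. ennreal (cmod (f x - c) powr p) * indicator (hball z R) x * hm x \<partial>lborel)"
    by (intro nn_integral_cong) (auto simp: indicator_def)
  finally show ?thesis .
qed

text \<open>Positive mass allows clearing the quotient, and integrability of the power
  \<open>p\<close> allows passing to nonnegative integrals, in which all further estimates are
  made.\<close>

lemma mean_osc_le_iff:
  assumes f: "f \<in> borel_measurable borel" "integrable wm (\<lambda>z. cmod (f z) powr p)" and p: "1 < p"
    and z: "cmod z < 1" and r: "0 < r" and pos: "0 < measure wm (hball z ((cosh r)\<^sup>2))" and N: "0 < N"
  shows "mean_osc \<omega> p r f z \<le> N \<longleftrightarrow>
    (\<integral>\<^sup>+x. ennreal (cmod (f x - hyp_mean \<omega> r f z) powr p) * indicator (hball z ((cosh r)\<^sup>2)) x * hm x \<partial>lborel)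
      \<le> ennreal (N powr p) * mass ((cosh r)\<^sup>2) z"
proof -
  define I where "I = (LINT x:hball z ((cosh r)\<^sup>2)|wm. cmod (f x - hyp_mean \<omega> r f z) powr p)"
  define \<mu> where "\<mu> = measure wm (hball z ((cosh r)\<^sup>2))"
  have I0: "0 \<le> I"
    unfolding I_def set_lebesgue_integral_def by (intro Bochner_Integration.integral_nonneg) auto
  have \<mu>: "0 < \<mu>" using pos by (simp add: \<mu>_def)
  have "mean_osc \<omega> p r f z = (I / \<mu>) powr (1 / p)"
    by (simp add: mean_osc_def hyp_disc_eq_hball[OF z r] I_def \<mu>_def)
  moreover have "(I / \<mu>) powr (1 / p) \<le> N \<longleftrightarrow> I / \<mu> \<le> N powr p"
  proof
    assume "(I / \<mu>) powr (1 / p) \<le> N"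
    then have "((I / \<mu>) powr (1 / p)) powr p \<le> N powr p" using p by (intro powr_mono2) auto
    then show "I / \<mu> \<le> N powr p" using p I0 \<mu> by (simp add: powr_powr)
  next
    assume "I / \<mu> \<le> N powr p"
    then have "(I / \<mu>) powr (1 / p) \<le> (N powr p) powr (1 / p)" using p I0 \<mu> by (intro powr_mono2) auto
    then show "(I / \<mu>) powr (1 / p) \<le> N" using p N by (simp add: powr_powr)
  qed
  moreover have "I / \<mu> \<le> N powr p \<longleftrightarrow> ennreal I \<le> ennreal (N powr p) * ennreal \<mu>"
    using \<mu> by (simp add: ennreal_mult'[symmetric] field_simps)
  ultimately show ?thesis
    unfolding I_def set_integral_osc[OF f p] \<mu>_def mass_eq_measure by simp
qed

text \<open>Integrates \<open>x \<le> N + N powr (1 - p) * x powr p\<close>, a substitute for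
  Jensen's inequality; both terms contribute \<open>N\<close>.\<close>

lemma osc_powr_imp_osc:
  assumes f: "f \<in> borel_measurable borel" and p: "1 < p" and N: "0 < N"
    and le: "(\<integral>\<^sup>+x. ennreal (cmod (f x - c) powr p) * indicator (hball z R) x * hm x \<partial>lborel) \<le> ennreal (N powr p) * mass R z"
  shows "(\<integral>\<^sup>+x. ennreal (cmod (f x - c)) * indicator (hball z R) x * hm x \<partial>lborel) \<le> ennreal (2 * N) * mass R z"
proof -
  note [measurable] = f
  have pt: "x \<le> N + N powr (1 - p) * x powr p" if x: "0 \<le> x" for x :: real
  proof (cases "x \<le> N")
    case True
    then show ?thesis by (simp add: add_increasing2)
  next
    case False
    have "1 \<le> (x / N) powr (p - 1)" using False N p by (intro ge_one_powr_ge_zero) auto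
    then have "x * 1 \<le> x * (x / N) powr (p - 1)" using x by (intro mult_left_mono) auto
    also have "\<dots> = N powr (1 - p) * x powr p"
      using False N x by (simp add: powr_divide powr_diff)
    finally show ?thesis using N by simp
  qed
  have "(\<integral>\<^sup>+x. ennreal (cmod (f x - c)) * indicator (hball z R) x * hm x \<partial>lborel)
      \<le> (\<integral>\<^sup>+x. ennreal N * (indicator (hball z R) x * hm x) + ennreal (N powr (1 - p)) * (ennreal (cmod (f x - c) powr p) * indicator (hball z R) x * hm x) \<partial>lborel)"
  proof (rule nn_integral_mono)
    fix x
    have "ennreal (cmod (f x - c)) \<le> ennreal (N + N powr (1 - p) * cmod (f x - c) powr p)"
      by (intro ennreal_leI pt) simp
    also have "\<dots> = ennreal N + ennreal (N powr (1 - p)) * ennreal (cmod (f x - c) powr p)"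
      using N by (simp add: ennreal_mult')
    finally have "ennreal (cmod (f x - c)) * (indicator (hball z R) x * hm x) \<le> (ennreal N + ennreal (N powr (1 - p)) * ennreal (cmod (f x - c) powr p)) * (indicator (hball z R) x * hm x)"
      by (rule mult_right_mono) simp
    then show "ennreal (cmod (f x - c)) * indicator (hball z R) x * hm x
        \<le> ennreal N * (indicator (hball z R) x * hm x) + ennreal (N powr (1 - p)) * (ennreal (cmod (f x - c) powr p) * indicator (hball z R) x * hm x)"
      by (simp only: distrib_right mult.assoc)
  qed
  also have "\<dots> = ennreal N * mass R z + ennreal (N powr (1 - p)) * (\<integral>\<^sup>+x. ennreal (cmod (f x - c) powr p) * indicator (hball z R) x * hm x \<partial>lborel)"
    unfolding mass_def by (subst nn_integral_add) (auto simp: nn_integral_cmult)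
  also have "\<dots> \<le> ennreal N * mass R z + ennreal (N powr (1 - p)) * (ennreal (N powr p) * mass R z)"
    by (intro add_left_mono mult_left_mono le) auto
  also have "\<dots> = ennreal (N + N powr (1 - p) * N powr p) * mass R z"
    using N by (simp add: ennreal_mult' distrib_right mult.assoc)
  also have "N + N powr (1 - p) * N powr p = 2 * N"
    using N by (simp add: powr_add[symmetric])
  finally show ?thesis .
qed

text \<open>An arbitrary centre may be replaced by the mean: the two differ by at most
  \<open>2 * N\<close>, and
  \<open>2 powr p * (N powr p + (2 * N) powr p) \<le> (8 * N) powr p\<close>.\<close>

lemma mean_osc_le:
  assumes f: "f \<in> borel_measurable borel" "integrable wm (\<lambda>z. cmod (f z) powr p)" and p: "1 < p"
    and z: "cmod z < 1" and r: "0 < r" and pos: "0 < measure wm (hball z ((cosh r)\<^sup>2))" and N: "0 < N"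
    and le: "(\<integral>\<^sup>+x. ennreal (cmod (f x - c) powr p) * indicator (hball z ((cosh r)\<^sup>2)) x * hm x \<partial>lborel)
      \<le> ennreal (N powr p) * mass ((cosh r)\<^sup>2) z"
  shows "mean_osc \<omega> p r f z \<le> 8 * N"
proof -
  interpret W: finite_measure wm by (rule finite_measure_wm)
  note [measurable] = f(1)
  define S where "S = hball z ((cosh r)\<^sup>2)"
  define \<mu> where "\<mu> = measure wm S"
  define mn where "mn = hyp_mean \<omega> r f z"
  have \<mu>: "0 < \<mu>" using pos by (simp add: \<mu>_def S_def)
  have hs: "S \<in> sets wm" unfolding S_def by (rule hball_sets_wm)
  have Sm [measurable]: "S \<in> sets borel" by (simp add: S_def hball_measurable)
  have SB: "S \<inter> ball 0 1 = S" using hball_subset by (auto simp: S_def)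
  have fi: "integrable wm f" by (rule powr_integrable_imp_integrable[OF f p])
  have fS: "integrable wm (\<lambda>x. indicator S x *\<^sub>R f x)" "integrable wm (\<lambda>x. indicator S x *\<^sub>R c)"
    using fi hs by (auto intro!: integrable_mult_indicator)
  have "(\<integral>x. indicator S x *\<^sub>R (f x - c) \<partial>wm) = (\<integral>x. indicator S x *\<^sub>R f x \<partial>wm) - (\<integral>x. indicator S x *\<^sub>R c \<partial>wm)"
    unfolding scaleR_diff_right by (rule Bochner_Integration.integral_diff[OF fS])
  also have "(\<integral>x. indicator S x *\<^sub>R c \<partial>wm) = of_real \<mu> * c"
    using hs SB by (simp add: \<mu>_def scaleR_conv_of_real)
  also have "(\<integral>x. indicator S x *\<^sub>R f x \<partial>wm) = of_real \<mu> * mn"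
    using \<mu> unfolding mn_def hyp_mean_def hyp_disc_eq_hball[OF z r] set_lebesgue_integral_def
    by (simp add: \<mu>_def S_def)
  finally have "of_real \<mu> * (mn - c) = (\<integral>x. indicator S x *\<^sub>R (f x - c) \<partial>wm)"
    by (simp add: right_diff_distrib)
  then have "\<mu> * cmod (mn - c) = cmod (\<integral>x. indicator S x *\<^sub>R (f x - c) \<partial>wm)"
    using \<mu> by (metis abs_of_pos norm_mult norm_of_real)
  then have "ennreal (\<mu> * cmod (mn - c)) \<le> (\<integral>\<^sup>+x. ennreal (norm (indicator S x *\<^sub>R (f x - c))) \<partial>wm)"
    using Bochner_Integration.integrable_diff[OF fS]
    by (simp only: scaleR_diff_right[symmetric]) (rule integral_norm_bound_ennreal)
  also have "\<dots> = (\<integral>\<^sup>+x. ennreal (norm (indicator S x *\<^sub>R (f x - c))) * hm x \<partial>lborel)"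
    by (rule nn_integral_wm) measurable
  also have "\<dots> = (\<integral>\<^sup>+x. ennreal (cmod (f x - c)) * indicator S x * hm x \<partial>lborel)"
    by (intro nn_integral_cong) (auto simp: indicator_def)
  also have "\<dots> \<le> ennreal (2 * N) * mass ((cosh r)\<^sup>2) z"
    unfolding S_def by (rule osc_powr_imp_osc[OF f(1) p N le])
  also have "\<dots> = ennreal (2 * N * \<mu>)"
    unfolding mass_eq_measure[symmetric] \<mu>_def S_def using N by (intro ennreal_mult'[symmetric]) simp
  finally have "\<mu> * cmod (mn - c) \<le> 2 * N * \<mu>" using N \<mu> by (subst (asm) ennreal_le_iff) auto
  then have mc: "cmod (mn - c) \<le> 2 * N" using \<mu> by (simp add: mult.commute[of \<mu>])
  have "(\<integral>\<^sup>+x. ennreal (cmod (f x - mn) powr p) * indicator S x * hm x \<partial>lborel)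
      \<le> (\<integral>\<^sup>+x. ennreal (2 powr p) * (ennreal (cmod (f x - c) powr p) * indicator S x * hm x + ennreal ((2 * N) powr p) * (indicator S x * hm x)) \<partial>lborel)"
  proof (rule nn_integral_mono)
    fix x
    have "cmod (f x - mn) powr p \<le> (cmod (f x - c) + 2 * N) powr p"
      using p mc norm_triangle_ineq4[of "f x - c" "mn - c"] by (intro powr_mono2) auto
    also have "\<dots> \<le> 2 powr p * (cmod (f x - c) powr p + (2 * N) powr p)"
      using p N by (intro powr_add_le) auto
    finally have "ennreal (cmod (f x - mn) powr p) \<le> ennreal (2 powr p * (cmod (f x - c) powr p + (2 * N) powr p))"
      by (rule ennreal_leI)
    also have "\<dots> = ennreal (2 powr p) * (ennreal (cmod (f x - c) powr p) + ennreal ((2 * N) powr p))"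
      by (simp add: ennreal_mult')
    finally have "ennreal (cmod (f x - mn) powr p) * (indicator S x * hm x) \<le> ennreal (2 powr p) * (ennreal (cmod (f x - c) powr p) + ennreal ((2 * N) powr p)) * (indicator S x * hm x)"
      by (rule mult_right_mono) simp
    then show "ennreal (cmod (f x - mn) powr p) * indicator S x * hm x
        \<le> ennreal (2 powr p) * (ennreal (cmod (f x - c) powr p) * indicator S x * hm x + ennreal ((2 * N) powr p) * (indicator S x * hm x))"
      by (simp only: mult.assoc distrib_right)
  qed
  also have "\<dots> = ennreal (2 powr p) * ((\<integral>\<^sup>+x. ennreal (cmod (f x - c) powr p) * indicator S x * hm x \<partial>lborel) + ennreal ((2 * N) powr p) * mass ((cosh r)\<^sup>2) z)"
    unfolding mass_def S_def[symmetric] by (simp add: nn_integral_cmult nn_integral_add)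
  also have "\<dots> \<le> ennreal (2 powr p) * (ennreal (N powr p) * mass ((cosh r)\<^sup>2) z + ennreal ((2 * N) powr p) * mass ((cosh r)\<^sup>2) z)"
    using le unfolding S_def by (intro mult_left_mono add_right_mono) auto
  also have "\<dots> = ennreal (2 powr p * (N powr p + (2 * N) powr p)) * mass ((cosh r)\<^sup>2) z"
    by (simp add: ennreal_mult' distrib_right mult.assoc)
  also have "\<dots> \<le> ennreal ((8 * N) powr p) * mass ((cosh r)\<^sup>2) z"
  proof (intro mult_right_mono ennreal_leI)
    have "N powr p \<le> (2 * N) powr p" using N p by (intro powr_mono2) auto
    then have "2 powr p * (N powr p + (2 * N) powr p) \<le> 2 powr p * (2 * (2 * N) powr p)"
      by (intro mult_left_mono) auto
    also have "\<dots> \<le> 2 powr p * (2 powr p * (2 * N) powr p)"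
      using p powr_mono[of 1 p 2] by (intro mult_left_mono mult_right_mono) auto
    also have "\<dots> = (8 * N) powr p"
    proof -
      have "(8 * N) powr p = (2 * (2 * (2 * N))) powr p" by simp
      then show ?thesis using N by (simp only: powr_mult)
    qed
    finally show "2 powr p * (N powr p + (2 * N) powr p) \<le> (8 * N) powr p" .
  qed simp
  finally show ?thesis
    using mean_osc_le_iff[OF f p z r pos, of "8 * N"] N by (simp add: mn_def S_def)
qed

text \<open>Free centres avoid the mean over a particular disc, which would change with the
  radius.\<close>

definition osc_bounded :: "(complex \<Rightarrow> complex) \<Rightarrow> real \<Rightarrow> real \<Rightarrow> bool" where
  "osc_bounded f p R \<longleftrightarrow> (\<exists>N>0. \<exists>b. \<forall>z. cmod z < 1 \<longrightarrow>
    (\<integral>\<^sup>+x. ennreal (cmod (f x - b z) powr p) * indicator (hball z R) x * hm x \<partial>lborel) \<le> ennreal (N powr p) * mass R z)"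

lemma mass_pos:
  assumes "large_radius R" "cmod z < 1"
  shows "0 < measure wm (hball z R)"
proof -
  obtain c where c: "0 < c" "\<And>z. cmod z < 1 \<Longrightarrow> ennreal (c * (1 - cmod z) * \<tau> (1 - cmod z)) \<le> mass R z"
    using large_radius_mass_lower[OF assms(1)] by blast
  have "0 < c * (1 - cmod z) * \<tau> (1 - cmod z)" using c(1) assms(2) \<tau>_pos[of "1 - cmod z"] by simp
  moreover have "ennreal (c * (1 - cmod z) * \<tau> (1 - cmod z)) \<le> ennreal (measure wm (hball z R))"
    using c(2)[OF assms(2)] by (simp add: mass_eq_measure)
  ultimately show ?thesis by (subst (asm) ennreal_le_iff) auto
qed

lemma BMO_space_iff:
  assumes p: "1 < p" and r: "0 < r" and R: "large_radius ((cosh r)\<^sup>2)"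
  shows "f \<in> BMO_space \<omega> p r \<longleftrightarrow> f \<in> Lp_space \<omega> p \<and> osc_bounded (trunc f) p ((cosh r)\<^sup>2)"
proof (cases "f \<in> Lp_space \<omega> p")
  case True
  then have f: "trunc f \<in> borel_measurable borel" "integrable wm (\<lambda>z. cmod (trunc f z) powr p)"
    unfolding Lp_space_iff by auto
  have eq: "mean_osc \<omega> p r f = mean_osc \<omega> p r (trunc f)"
    by (rule mean_osc_cong) (simp add: trunc_eq)
  have "bdd_above (mean_osc \<omega> p r (trunc f) ` ball 0 1) \<longleftrightarrow> osc_bounded (trunc f) p ((cosh r)\<^sup>2)"
  proof
    assume "bdd_above (mean_osc \<omega> p r (trunc f) ` ball 0 1)"
    then obtain B where B: "\<forall>x\<in>ball 0 1. mean_osc \<omega> p r (trunc f) x \<le> B"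
      by (auto simp: bdd_above_def)
    \<comment> \<open>The maximum secures a positive level even when all oscillations
      vanish.\<close>
    have "mean_osc \<omega> p r (trunc f) z \<le> max B 1" if "cmod z < 1" for z
      using bspec[OF B, of z] that by simp
    then show "osc_bounded (trunc f) p ((cosh r)\<^sup>2)"
      unfolding osc_bounded_def
      using mean_osc_le_iff[OF f p _ r mass_pos[OF R], of _ "max B 1"]
      by (intro exI[of _ "max B 1"] conjI exI[of _ "hyp_mean \<omega> r (trunc f)"]) auto
  next
    assume "osc_bounded (trunc f) p ((cosh r)\<^sup>2)"
    then obtain N b where "0 < N" "\<And>z. cmod z < 1 \<Longrightarrow>
      (\<integral>\<^sup>+x. ennreal (cmod (trunc f x - b z) powr p) * indicator (hball z ((cosh r)\<^sup>2)) x * hm x \<partial>lborel) \<le> ennreal (N powr p) * mass ((cosh r)\<^sup>2) z"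
      unfolding osc_bounded_def by blast
    then have "mean_osc \<omega> p r (trunc f) z \<le> 8 * N" if "cmod z < 1" for z
      using that by (intro mean_osc_le[OF f p _ r mass_pos[OF R]]) auto
    then show "bdd_above (mean_osc \<omega> p r (trunc f) ` ball 0 1)" by (intro bdd_aboveI2[of _ _ "8 * N"]) auto
  qed
  then show ?thesis using True by (simp add: BMO_space_def eq)
qed (simp add: BMO_space_def)

text \<open>Shrinking the radius takes only comparable masses. For enlarging it, local averaging
  with the constant function \<open>1\<close> spreads each point \<open>x\<close> over balls of
  parameter \<open>R0\<close> that contain it; their centres \<open>w\<close> lie in a larger ball
  about \<open>z\<close>, on which \<open>b w\<close> stays within a bounded distance of
  \<open>b z\<close>.\<close>

lemma osc_bounded_radius:
  assumes R0: "large_radius R0" and le: "R0 \<le> R" and p: "1 < p" and f: "f \<in> borel_measurable borel"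
  shows "osc_bounded f p R \<longleftrightarrow> osc_bounded f p R0"
proof
  note [measurable] = f
  have R: "large_radius R" by (rule large_radius_mono[OF R0 le])
  have R13: "13 \<le> R0" "13 \<le> R" using R0 R by (auto simp: large_radius_def)
  obtain c0 where c0: "0 < c0" "\<And>z. cmod z < 1 \<Longrightarrow> ennreal (c0 * (1 - cmod z) * \<tau> (1 - cmod z)) \<le> mass R0 z"
    using large_radius_mass_lower[OF R0] by blast
  {
    obtain Cu where Cu: "0 < Cu" "\<And>z. cmod z < 1 \<Longrightarrow> mass R z \<le> ennreal (Cu * (1 - cmod z) * \<tau> (1 - cmod z))"
      using mass_upper[of R] R13 by auto
    define K where "K = Cu / c0"
    have K: "0 < K" using Cu c0 by (simp add: K_def)
    have mK: "mass R z \<le> ennreal K * mass R0 z" if z: "cmod z < 1" for z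
    proof -
      have "mass R z \<le> ennreal (K * (c0 * (1 - cmod z) * \<tau> (1 - cmod z)))"
        using Cu(2)[OF z] c0(1) by (simp add: K_def mult.assoc)
      also have "\<dots> = ennreal K * ennreal (c0 * (1 - cmod z) * \<tau> (1 - cmod z))" using K by (intro ennreal_mult') simp
      also have "\<dots> \<le> ennreal K * mass R0 z" by (intro mult_left_mono c0(2) z) simp
      finally show ?thesis .
    qed
    assume "osc_bounded f p R"
    then obtain N b where N: "0 < N" and osc: "\<And>z. cmod z < 1 \<Longrightarrow>
      (\<integral>\<^sup>+x. ennreal (cmod (f x - b z) powr p) * indicator (hball z R) x * hm x \<partial>lborel) \<le> ennreal (N powr p) * mass R z"
      unfolding osc_bounded_def by blast
    define N' where "N' = N * K powr (1 / p)"
    have N': "0 < N'" "N' powr p = N powr p * K" using N K p by (auto simp: N'_def powr_mult powr_powr)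
    have "(\<integral>\<^sup>+x. ennreal (cmod (f x - b z) powr p) * indicator (hball z R0) x * hm x \<partial>lborel) \<le> ennreal (N' powr p) * mass R0 z"
      if z: "cmod z < 1" for z
    proof -
      have "(\<integral>\<^sup>+x. ennreal (cmod (f x - b z) powr p) * indicator (hball z R0) x * hm x \<partial>lborel)
          \<le> (\<integral>\<^sup>+x. ennreal (cmod (f x - b z) powr p) * indicator (hball z R) x * hm x \<partial>lborel)"
        using hball_mono[OF le, of z] by (intro nn_integral_mono mult_right_mono mult_left_mono) (auto simp: indicator_def)
      also have "\<dots> \<le> ennreal (N powr p) * (ennreal K * mass R0 z)"
        by (rule order_trans[OF osc[OF z] mult_left_mono[OF mK[OF z]]]) simp
      also have "\<dots> = ennreal (N' powr p) * mass R0 z" unfolding N' by (simp add: ennreal_mult' mult.assoc)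
      finally show ?thesis .
    qed
    then show "osc_bounded f p R0" unfolding osc_bounded_def using N'(1) by blast
  }
  {
    obtain Cu where Cu: "0 < Cu" "\<And>z. cmod z < 1 \<Longrightarrow> mass R0 z \<le> ennreal (Cu * (1 - cmod z) * \<tau> (1 - cmod z))"
      using mass_upper[of R0] R13 by auto
    obtain C1 where C1: "0 < C1" and pow: "\<And>f b N z w. f \<in> borel_measurable borel \<Longrightarrow> 0 \<le> N \<Longrightarrow> oscillates f b R0 N \<Longrightarrow> cmod z < 1 \<Longrightarrow> cmod w < 1 \<Longrightarrow>
      cmod (b z - b w) \<le> C1 * N * Q z w powr 1"
      using oscillates_power[OF R0, of 1] by auto
    obtain c where c: "0 < c" "\<And>z. cmod z < 1 \<Longrightarrow> ennreal (c * (1 - cmod z) * \<tau> (1 - cmod z)) \<le> mass R z"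
      using large_radius_mass_lower[OF R] by blast
    assume "osc_bounded f p R0"
    then obtain N b where N: "0 < N" and osc: "\<And>z. cmod z < 1 \<Longrightarrow>
      (\<integral>\<^sup>+x. ennreal (cmod (f x - b z) powr p) * indicator (hball z R0) x * hm x \<partial>lborel) \<le> ennreal (N powr p) * mass R0 z"
      unfolding osc_bounded_def by blast
    have "oscillates f b R0 (2 * N)"
      unfolding oscillates_def using osc_powr_imp_osc[OF f p N osc] by blast
    note bpow = pow[OF f _ this]
    \<comment> \<open>From the triangle inequality: if the ball of parameter \<open>R0\<close> about
      \<open>w\<close> meets the one of parameter \<open>R\<close> about \<open>z\<close>, then
      \<open>w\<close> is in \<open>hball z R2\<close>.\<close>
    define R2 where "R2 = 4 * R * R0"
    have R2: "1 \<le> R2" using R13 mult_mono[of 1 R 1 R0] by (simp add: R2_def)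
    \<comment> \<open>Bounds the average of the power \<open>p\<close> of
      \<open>cmod (f x - b z)\<close> over a small ball about \<open>w\<close>: the oscillation
      about \<open>b w\<close> and the distance of the centres, at most
      \<open>C1 * (2 * N) * R2\<close>.\<close>
    define L where "L = 2 powr p * (N powr p + (C1 * (2 * N) * R2) powr p)"
    have L: "0 \<le> L" by (simp add: L_def)
    define T where "T = 9 / pi * L * Cu * (2 ^ l * (4 * R2) ^ l) * (4 * R2)"
    have T: "0 \<le> T" using L Cu R2 by (simp add: T_def)
    define K where "K = T * (pi * (4 * R2)\<^sup>2) / c + 1"
    have K: "0 < K" using T c by (simp add: K_def add_nonneg_pos)
    have "(\<integral>\<^sup>+x. ennreal (cmod (f x - b z) powr p) * indicator (hball z R) x * hm x \<partial>lborel) \<le> ennreal K * mass R z"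
      if z: "cmod z < 1" for z
    proof -
      define X where "X = 1 - cmod z"
      have X: "0 < X" using z by (simp add: X_def)
      have hmb: "hm x * indicator (ball 0 1) x = hm x" for x
        by (cases "cmod x < 1") (auto simp: hm_outside)
      define u where "u x = ennreal (cmod (f x - b z) powr p) * indicator (hball z R) x" for x
      have [measurable]: "u \<in> borel_measurable borel" unfolding u_def[abs_def] by measurable
      have "(\<integral>\<^sup>+x. ennreal (cmod (1::complex)) * u x * (hm x * indicator (ball 0 1) x) \<partial>lborel)
        \<le> (\<integral>\<^sup>+w. ennreal (9 / pi * cmod (1::complex) / (1 - cmod w)\<^sup>2) * indicator (ball 0 1) w *
          (\<integral>\<^sup>+x. u x * indicator (hball w R0) x * (hm x * indicator (ball 0 1) x) \<partial>lborel) \<partial>lborel)"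
        by (rule nn_integral_local_average[where G = "\<lambda>_. 1"]) (use R13 in auto)
      also have "\<dots> \<le> (\<integral>\<^sup>+w. ennreal (T * \<tau> X / X) * indicator (ball z (4 * R2 * X)) w \<partial>lborel)"
      proof (rule nn_integral_mono)
        fix w :: complex
        let ?I = "\<integral>\<^sup>+x. u x * indicator (hball w R0) x * (hm x * indicator (ball 0 1) x) \<partial>lborel"
        show "ennreal (9 / pi * cmod (1::complex) / (1 - cmod w)\<^sup>2) * indicator (ball 0 1) w * ?I
            \<le> ennreal (T * \<tau> X / X) * indicator (ball z (4 * R2 * X)) w"
        proof (cases "w \<in> hball z R2")
          case True
          then have w: "cmod w < 1" and q: "Q z w < R2" by (auto simp: hball_def)
          define Y where "Y = 1 - cmod w"
          have Y: "0 < Y" using w by (simp add: Y_def)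
          have dzw: "dd z w < 4 * R2 * X" "dd z w < 4 * R2 * Y"
            using Q_dd_less[OF z w q] by (auto simp: X_def Y_def)
          have XY: "X \<le> 4 * R2 * Y" "Y \<le> 4 * R2 * X"
            using dzw dd_ge[of w z] dd_ge[of z w] z w by (auto simp: X_def Y_def dd_commute)
          have wb: "w \<in> ball z (4 * R2 * X)"
            using dist_le_dd[of z w] dzw(1) z w by (simp add: dist_norm)
          have "?I \<le> (\<integral>\<^sup>+x. ennreal (2 powr p) * (ennreal (cmod (f x - b w) powr p) * indicator (hball w R0) x * hm x + ennreal ((C1 * (2 * N) * R2) powr p) * (indicator (hball w R0) x * hm x)) \<partial>lborel)"
          proof (rule nn_integral_mono)
            fix x
            have "cmod (b w - b z) \<le> C1 * (2 * N) * Q w z powr 1"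
              using N by (intro bpow w z) auto
            also have "\<dots> \<le> C1 * (2 * N) * R2"
              using q Q_ge_1[OF w z] C1 N by (intro mult_left_mono) (auto simp: Q_commute)
            finally have bb: "cmod (b w - b z) \<le> C1 * (2 * N) * R2" .
            have "cmod (f x - b z) \<le> cmod (f x - b w) + cmod (b w - b z)"
              using norm_triangle_ineq[of "f x - b w" "b w - b z"] by simp
            then have "cmod (f x - b z) powr p \<le> (cmod (f x - b w) + C1 * (2 * N) * R2) powr p"
              using p bb by (intro powr_mono2) auto
            also have "\<dots> \<le> 2 powr p * (cmod (f x - b w) powr p + (C1 * (2 * N) * R2) powr p)"
              using p C1 N R2 by (intro powr_add_le) auto
            finally have "ennreal (cmod (f x - b z) powr p) \<le> ennreal (2 powr p * (cmod (f x - b w) powr p + (C1 * (2 * N) * R2) powr p))"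
              by (rule ennreal_leI)
            also have "\<dots> = ennreal (2 powr p) * (ennreal (cmod (f x - b w) powr p) + ennreal ((C1 * (2 * N) * R2) powr p))"
              by (simp add: ennreal_mult')
            finally have "ennreal (cmod (f x - b z) powr p) * (indicator (hball w R0) x * hm x)
                \<le> ennreal (2 powr p) * (ennreal (cmod (f x - b w) powr p) + ennreal ((C1 * (2 * N) * R2) powr p)) * (indicator (hball w R0) x * hm x)"
              by (rule mult_right_mono) simp
            moreover have "u x * indicator (hball w R0) x * (hm x * indicator (ball 0 1) x) \<le> ennreal (cmod (f x - b z) powr p) * (indicator (hball w R0) x * hm x)"
              unfolding hmb u_def by (auto simp: indicator_def)
            ultimately show "u x * indicator (hball w R0) x * (hm x * indicator (ball 0 1) x)
                \<le> ennreal (2 powr p) * (ennreal (cmod (f x - b w) powr p) * indicator (hball w R0) x * hm x + ennreal ((C1 * (2 * N) * R2) powr p) * (indicator (hball w R0) x * hm x))"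
              by (simp only: mult.assoc distrib_right)
          qed
          also have "\<dots> = ennreal (2 powr p) * ((\<integral>\<^sup>+x. ennreal (cmod (f x - b w) powr p) * indicator (hball w R0) x * hm x \<partial>lborel) + ennreal ((C1 * (2 * N) * R2) powr p) * mass R0 w)"
            unfolding mass_def by (simp add: nn_integral_cmult nn_integral_add)
          also have "\<dots> \<le> ennreal (2 powr p) * (ennreal (N powr p) * mass R0 w + ennreal ((C1 * (2 * N) * R2) powr p) * mass R0 w)"
            by (intro mult_left_mono add_right_mono osc w) auto
          also have "\<dots> = ennreal L * mass R0 w"
            unfolding L_def by (simp add: ennreal_mult' distrib_right mult.assoc)
          also have "\<dots> \<le> ennreal L * ennreal (Cu * Y * \<tau> Y)"
            using Cu(2)[OF w] by (intro mult_left_mono) (auto simp: Y_def)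
          also have "\<dots> = ennreal (L * (Cu * Y * \<tau> Y))" using L by (rule ennreal_mult'[symmetric])
          finally have I: "?I \<le> ennreal (L * (Cu * Y * \<tau> Y))" .
          have "ennreal (9 / pi * cmod (1::complex) / (1 - cmod w)\<^sup>2) * indicator (ball 0 1) w * ?I
              \<le> ennreal (9 / pi / Y\<^sup>2) * ennreal (L * (Cu * Y * \<tau> Y))"
            using w mult_left_mono[OF I, of "ennreal (9 / pi / Y\<^sup>2)"] by (simp add: Y_def)
          also have "\<dots> = ennreal (9 / pi / Y\<^sup>2 * (L * (Cu * Y * \<tau> Y)))" by (intro ennreal_mult'[symmetric]) simp
          also have "9 / pi / Y\<^sup>2 * (L * (Cu * Y * \<tau> Y)) = 9 / pi * L * Cu * (\<tau> Y / Y)"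
            using Y by (simp add: power2_eq_square)
          also have "\<dots> \<le> T * \<tau> X / X"
          proof -
            have "\<tau> Y \<le> \<tau> (4 * R2 * X)" using Y XY by (intro \<tau>_mono) auto
            also have "\<dots> \<le> 2 ^ l * (4 * R2 * X / X) ^ l * \<tau> X"
              using X R2 mult_right_mono[of 1 "4 * R2" X] by (intro \<tau>_power) auto
            finally have t: "\<tau> Y \<le> 2 ^ l * (4 * R2) ^ l * \<tau> X" using X by simp
            have i: "1 / Y \<le> 4 * R2 / X" using XY X Y by (simp add: field_simps)
            have "\<tau> Y * (1 / Y) \<le> (2 ^ l * (4 * R2) ^ l * \<tau> X) * (4 * R2 / X)"
              using t i Y \<tau>_pos[OF X] R2 by (intro mult_mono) auto
            then have "9 / pi * L * Cu * (\<tau> Y * (1 / Y)) \<le> 9 / pi * L * Cu * ((2 ^ l * (4 * R2) ^ l * \<tau> X) * (4 * R2 / X))"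
              using L Cu by (intro mult_left_mono) auto
            then show ?thesis by (simp add: T_def mult_ac)
          qed
          finally show ?thesis using wb by (simp add: ennreal_leI)
        next
          case False
          have "indicator (ball 0 1) w * (u x * indicator (hball w R0) x * (hm x * indicator (ball 0 1) x)) = 0" for x
          proof (rule ccontr)
            assume "indicator (ball 0 1) w * (u x * indicator (hball w R0) x * (hm x * indicator (ball 0 1) x)) \<noteq> 0"
            then have "cmod w < 1" "x \<in> hball z R" "x \<in> hball w R0" by (auto simp: u_def indicator_def split: if_splits)
            then have "w \<in> hball z (4 * R * R0)"
              using hball_triangle[OF z, of x R w R0] hball_commute[of w x R0] by blast
            then show False using False by (simp add: R2_def)
          qed
          note zero = this
          have "indicator (ball 0 1) w * ?I = (\<integral>\<^sup>+x. indicator (ball 0 1) w * (u x * indicator (hball w R0) x * (hm x * indicator (ball 0 1) x)) \<partial>lborel)"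
            by (rule nn_integral_cmult[symmetric]) measurable
          also have "\<dots> = 0" unfolding zero by simp
          finally have "indicator (ball 0 1) w * ?I = 0" .
          then have "ennreal (9 / pi * cmod (1::complex) / (1 - cmod w)\<^sup>2) * indicator (ball 0 1) w * ?I = 0"
            by (simp only: mult.assoc mult_zero_right)
          then show ?thesis by (simp only: zero_le)
        qed
      qed
      also have "\<dots> = ennreal (T * \<tau> X / X) * ennreal (pi * (4 * R2 * X)\<^sup>2)"
        using X R2 by (subst nn_integral_cmult_indicator) (auto simp: emeasure_ball unit_ball_vol_2)
      also have "\<dots> = ennreal (T * \<tau> X / X * (pi * (4 * R2 * X)\<^sup>2))"
        using T X \<tau>_pos[OF X] by (intro ennreal_mult'[symmetric]) simp
      also have "T * \<tau> X / X * (pi * (4 * R2 * X)\<^sup>2) = (T * (pi * (4 * R2)\<^sup>2) / c) * (c * X * \<tau> X)"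
        using X c by (simp add: power2_eq_square)
      also have "ennreal \<dots> \<le> ennreal (K * (c * X * \<tau> X))"
        using c X \<tau>_pos[OF X] by (intro ennreal_leI mult_right_mono) (auto simp: K_def)
      also have "\<dots> = ennreal K * ennreal (c * X * \<tau> X)" using K by (intro ennreal_mult') simp
      also have "\<dots> \<le> ennreal K * mass R z" using c(2)[OF z] by (intro mult_left_mono) (auto simp: X_def)
      finally show ?thesis unfolding hmb by (simp add: u_def)
    qed
    moreover have "(K powr (1 / p)) powr p = K" using K p by (simp add: powr_powr)
    ultimately have "\<forall>z. cmod z < 1 \<longrightarrow> (\<integral>\<^sup>+x. ennreal (cmod (f x - b z) powr p) * indicator (hball z R) x * hm x \<partial>lborel) \<le> ennreal ((K powr (1 / p)) powr p) * mass R z"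
      by simp
    moreover have "0 < K powr (1 / p)" using K by simp
    ultimately show "osc_bounded f p R" unfolding osc_bounded_def by blast
  }
qed

end

section \<open>The norm estimate\<close>

lemma cosh_ge_half: "r \<le> 2 * cosh r" for r :: real
proof -
  have "r \<le> exp r" using exp_ge_add_one_self[of r] by linarith
  also have "\<dots> \<le> 2 * cosh r" by (simp add: cosh_def)
  finally show ?thesis .
qed

section \<open>Conjugate symbols and operator norms\<close>

context D_weight
begin

lemma hyp_mean_cnj: "hyp_mean \<omega> r (\<lambda>x. cnj (f x)) z = cnj (hyp_mean \<omega> r f z)"
proof -
  have "(LINT x:S|wm. cnj (f x)) = cnj (LINT x:S|wm. f x)" for S
    unfolding set_lebesgue_integral_def using Bochner_Integration.integral_cnj[of wm "\<lambda>x. indicator S x *\<^sub>R f x"]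
    by (simp add: scaleR_conv_of_real)
  then show ?thesis by (simp add: hyp_mean_def)
qed

lemma mean_osc_cnj: "mean_osc \<omega> p r (\<lambda>x. cnj (f x)) = mean_osc \<omega> p r f"
proof
  fix z
  have "cmod (cnj (f x) - hyp_mean \<omega> r (\<lambda>x. cnj (f x)) z) = cmod (f x - hyp_mean \<omega> r f z)" for x
    unfolding hyp_mean_cnj by (metis complex_cnj_diff complex_mod_cnj)
  then show "mean_osc \<omega> p r (\<lambda>x. cnj (f x)) z = mean_osc \<omega> p r f z"
    by (simp only: mean_osc_def)
qed

lemma BMO_space_cnj: "f \<in> BMO_space \<omega> p r \<Longrightarrow> (\<lambda>x. cnj (f x)) \<in> BMO_space \<omega> p r"
  unfolding BMO_space_def Lp_space_def by (auto simp: mean_osc_cnj)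

lemma BMO_seminorm_cnj: "BMO_seminorm \<omega> p r (\<lambda>x. cnj (f x)) = BMO_seminorm \<omega> p r f"
  by (simp add: BMO_seminorm_def mean_osc_cnj)

lemma Lp_norm_powr:
  assumes "1 < s" and "integrable wm (\<lambda>z. cmod (F z) powr s)"
  shows "ennreal (Lp_norm \<omega> s F powr s) = (\<integral>\<^sup>+z. ennreal (cmod (F z) powr s) \<partial>wm)"
proof -
  have "Lp_norm \<omega> s F powr s = (LINT z|wm. cmod (F z) powr s)"
    using assms(1) by (simp add: Lp_norm_def powr_powr integral_nonneg_AE)
  then show ?thesis using assms(2) by (simp add: nn_integral_eq_integral)
qed

lemma H_infinity_integrable:
  assumes g: "g \<in> H_infinity" and s: "1 < s"
  shows "integrable wm (\<lambda>z. cmod (g z) powr s)"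
proof -
  interpret W: finite_measure wm by (rule finite_measure_wm)
  obtain B where B: "0 \<le> B" "\<And>z. cmod z < 1 \<Longrightarrow> cmod (g z) \<le> B" and hol: "g holomorphic_on ball 0 1"
    using H_infinityD[OF g] by blast
  have [measurable]: "g \<in> borel_measurable wm" by (rule holomorphic_wm_measurable[OF hol])
  show ?thesis
  proof (rule W.integrable_const_bound[of _ "B powr s"])
    show "AE z in wm. norm (cmod (g z) powr s) \<le> B powr s"
      using B s by (intro AE_I2) (auto intro!: powr_mono2)
  qed measurable
qed

text \<open>The root of order \<open>s\<close> turns \<open>C\<close> into
  \<open>C powr (1 / s)\<close>. Membership in the target space comes from analyticity of the
  conjugate and finiteness of the same integral.\<close>

lemma little_hankel_bound_of_oscillation:
  assumes R: "large_radius R" and s: "1 < s"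
  obtains C where "0 < C"
    "\<And>f b N. f \<in> borel_measurable borel \<Longrightarrow> integrable wm f \<Longrightarrow> 0 \<le> N \<Longrightarrow> oscillates f b R N \<Longrightarrow>
      little_hankel_bound \<omega> s f (C * (N + cmod (b 0)))"
proof -
  obtain C where C: "0 < C" and est:
    "\<And>f b N g. f \<in> borel_measurable borel \<Longrightarrow> integrable wm f \<Longrightarrow> 0 \<le> N \<Longrightarrow> oscillates f b R N \<Longrightarrow> g \<in> H_infinity \<Longrightarrow>
      (\<integral>\<^sup>+z. ennreal (cmod (little_hankel \<omega> f g z) powr s) * hm z \<partial>lborel)
        \<le> ennreal (C * (N + cmod (b 0)) powr s) * (\<integral>\<^sup>+z. ennreal (cmod (g z) powr s) * hm z \<partial>lborel)"
    using little_hankel_norm_estimate[OF R s] by blast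
  have "little_hankel_bound \<omega> s f (C powr (1 / s) * (N + cmod (b 0)))"
    if f: "f \<in> borel_measurable borel" "integrable wm f" and N: "0 \<le> N" and osc: "oscillates f b R N" for f b N
    unfolding little_hankel_bound_def
  proof (intro conjI ballI)
    define E where "E = N + cmod (b 0)"
    have E: "0 \<le> E" using N by (simp add: E_def)
    show "0 \<le> C powr (1 / s) * (N + cmod (b 0))" using N by simp
    fix g assume g: "g \<in> H_infinity"
    define h where "h = little_hankel \<omega> f g"
    have hol: "(\<lambda>z. cnj (h z)) holomorphic_on ball 0 1"
      unfolding h_def by (rule little_hankel_antiholomorphic[OF f(2) g])
    have holg: "g holomorphic_on ball 0 1" using g by (simp add: H_infinity_def)
    have gi: "integrable wm (\<lambda>z. cmod (g z) powr s)" by (rule H_infinity_integrable[OF g s])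
    have "(\<integral>\<^sup>+z. ennreal (cmod (h z) powr s) \<partial>wm) = (\<integral>\<^sup>+z. ennreal (cmod (h z) powr s) * hm z \<partial>lborel)"
      using nn_integral_wm_holomorphic[OF hol, of s] by simp
    also have "\<dots> \<le> ennreal (C * E powr s) * (\<integral>\<^sup>+z. ennreal (cmod (g z) powr s) * hm z \<partial>lborel)"
      unfolding h_def E_def by (rule est[OF f N osc g])
    also have "\<dots> = ennreal (C * E powr s) * (\<integral>\<^sup>+z. ennreal (cmod (g z) powr s) \<partial>wm)"
      by (simp only: nn_integral_wm_holomorphic[OF holg])
    also have "\<dots> = ennreal (C * E powr s * Lp_norm \<omega> s g powr s)"
      using C by (simp add: Lp_norm_powr[OF s gi, symmetric] ennreal_mult')
    finally have le: "(\<integral>\<^sup>+z. ennreal (cmod (h z) powr s) \<partial>wm) \<le> ennreal (C * E powr s * Lp_norm \<omega> s g powr s)" .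
    have cm [measurable]: "(\<lambda>z. cnj (h z)) \<in> borel_measurable wm" by (rule holomorphic_wm_measurable[OF hol])
    have hi: "integrable wm (\<lambda>z. cmod (cnj (h z)) powr s)"
    proof (rule integrableI_bounded)
      show "(\<integral>\<^sup>+z. ennreal (norm (cmod (cnj (h z)) powr s)) \<partial>wm) < \<infinity>"
        using le by (simp add: order_le_less_trans[OF le ennreal_less_top])
    qed measurable
    have "(\<lambda>z. cnj (h z)) \<in> bergman_space \<omega> s"
      using hol hi cm by (simp add: bergman_space_def Lp_space_def)
    then show "little_hankel \<omega> f g \<in> conj_bergman_space \<omega> s"
      unfolding conj_bergman_space_def h_def by (auto intro!: exI[of _ "\<lambda>z. cnj (little_hankel \<omega> f g z)"])
    have n0: "0 \<le> Lp_norm \<omega> s F" for F by (simp add: Lp_norm_def)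
    have "ennreal (Lp_norm \<omega> s h powr s) \<le> ennreal (C * E powr s * Lp_norm \<omega> s g powr s)"
      using le hi by (subst Lp_norm_powr[OF s]) simp_all
    then have "Lp_norm \<omega> s h powr s \<le> C * E powr s * Lp_norm \<omega> s g powr s"
      using C by (subst (asm) ennreal_le_iff) auto
    also have "\<dots> = (C powr (1 / s) * E * Lp_norm \<omega> s g) powr s"
      using C E n0 s by (simp add: powr_mult powr_powr)
    finally have le': "Lp_norm \<omega> s h powr s \<le> (C powr (1 / s) * E * Lp_norm \<omega> s g) powr s" .
    have "(Lp_norm \<omega> s h powr s) powr (1 / s) \<le> ((C powr (1 / s) * E * Lp_norm \<omega> s g) powr s) powr (1 / s)"
      by (rule powr_mono2[OF _ _ le']) (use s in simp_all)
    moreover have "0 \<le> C powr (1 / s) * E * Lp_norm \<omega> s g" using E n0 by simp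
    ultimately show "Lp_norm \<omega> s (little_hankel \<omega> f g) \<le> C powr (1 / s) * (N + cmod (b 0)) * Lp_norm \<omega> s g"
      using n0[of h] s by (simp add: powr_powr h_def E_def)
  qed
  then show ?thesis using that[of "C powr (1 / s)"] C by simp
qed

lemma little_hankel_bound_mono:
  assumes "little_hankel_bound \<omega> s f K" "K \<le> K'"
  shows "little_hankel_bound \<omega> s f K'"
proof -
  have "K * Lp_norm \<omega> s g \<le> K' * Lp_norm \<omega> s g" for g
    using assms(2) by (intro mult_right_mono) (simp_all add: Lp_norm_def)
  then show ?thesis
    using assms unfolding little_hankel_bound_def by (meson order_trans)
qed

lemma little_hankel_norm_le: "little_hankel_bound \<omega> s f K \<Longrightarrow> little_hankel_norm \<omega> s f \<le> K"
  unfolding little_hankel_norm_def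
  by (rule cInf_lower) (auto intro!: bdd_belowI[of _ 0] simp: little_hankel_bound_def)

lemma little_hankel_norm_BMO:
  assumes p: "1 < p" and s: "1 < s" and r: "0 < r" and R: "large_radius ((cosh r)\<^sup>2)"
  obtains C where "0 < C" "\<And>f. f \<in> BMO_space \<omega> p r \<Longrightarrow> little_hankel_bounded \<omega> s f \<and>
    little_hankel_norm \<omega> s f \<le> C * (BMO_seminorm \<omega> p r f + cmod (hyp_mean \<omega> r f 0))"
proof -
  obtain C where C: "0 < C" and bd:
    "\<And>f b N. f \<in> borel_measurable borel \<Longrightarrow> integrable wm f \<Longrightarrow> 0 \<le> N \<Longrightarrow> oscillates f b ((cosh r)\<^sup>2) N \<Longrightarrow>
      little_hankel_bound \<omega> s f (C * (N + cmod (b 0)))"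
    using little_hankel_bound_of_oscillation[OF R s] by blast
  have "little_hankel_bounded \<omega> s f \<and>
    little_hankel_norm \<omega> s f \<le> 2 * C * (BMO_seminorm \<omega> p r f + cmod (hyp_mean \<omega> r f 0))"
    if f: "f \<in> BMO_space \<omega> p r" for f
  proof -
    define f0 where "f0 = trunc f"
    define b where "b = hyp_mean \<omega> r f0"
    define S where "S = BMO_seminorm \<omega> p r f"
    have f0: "f0 \<in> borel_measurable borel" "integrable wm (\<lambda>z. cmod (f0 z) powr p)"
      using f unfolding BMO_space_def f0_def by (auto simp: Lp_space_iff)
    have fi: "integrable wm f0" by (rule powr_integrable_imp_integrable[OF f0 p])
    have hb: "b = hyp_mean \<omega> r f"
      unfolding b_def by (rule hyp_mean_cong) (simp add: f0_def trunc_eq)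
    have osc: "mean_osc \<omega> p r f0 z \<le> S" if "cmod z < 1" for z
    proof -
      have "mean_osc \<omega> p r f0 = mean_osc \<omega> p r f"
        by (rule mean_osc_cong) (simp add: f0_def trunc_eq)
      then show ?thesis
        using f that unfolding S_def BMO_seminorm_def BMO_space_def by (auto intro!: cSUP_upper)
    qed
    have S0: "0 \<le> S"
      using osc[of 0] by (rule order_trans[rotated]) (simp_all add: mean_osc_def)
    have lh: "little_hankel \<omega> f0 = little_hankel \<omega> f"
      by (rule little_hankel_cong) (simp add: f0_def trunc_eq)
    \<comment> \<open>The seminorm may be zero while the oscillation lemmas ask for a positive
      level, so \<open>e\<close> is added here and removed at the end. The factor \<open>2\<close>
      is the loss in passing from powers \<open>p\<close> to first powers.\<close>
    have bound: "little_hankel_bound \<omega> s f (2 * C * (S + cmod (hyp_mean \<omega> r f 0)) + 2 * C * e)" if e: "0 < e" for e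
    proof -
      have Se: "0 < S + e" using S0 e by simp
      have "oscillates f0 b ((cosh r)\<^sup>2) (2 * (S + e))"
        unfolding oscillates_def
      proof (intro allI impI)
        fix z :: complex assume z: "cmod z < 1"
        have "mean_osc \<omega> p r f0 z \<le> S + e" using osc[OF z] e by simp
        then have "(\<integral>\<^sup>+x. ennreal (cmod (f0 x - b z) powr p) * indicator (hball z ((cosh r)\<^sup>2)) x * hm x \<partial>lborel)
            \<le> ennreal ((S + e) powr p) * mass ((cosh r)\<^sup>2) z"
          unfolding b_def using mean_osc_le_iff[OF f0 p z r mass_pos[OF R z] Se] by simp
        then show "(\<integral>\<^sup>+x. ennreal (cmod (f0 x - b z)) * indicator (hball z ((cosh r)\<^sup>2)) x * hm x \<partial>lborel)
            \<le> ennreal (2 * (S + e)) * mass ((cosh r)\<^sup>2) z"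
          by (rule osc_powr_imp_osc[OF f0(1) p Se])
      qed
      then have "little_hankel_bound \<omega> s f0 (C * (2 * (S + e) + cmod (b 0)))"
        using Se by (intro bd f0 fi) auto
      moreover have "C * (2 * (S + e) + cmod (b 0)) \<le> 2 * C * (S + cmod (hyp_mean \<omega> r f 0)) + 2 * C * e"
        using C by (simp add: hb algebra_simps)
      ultimately have "little_hankel_bound \<omega> s f0 (2 * C * (S + cmod (hyp_mean \<omega> r f 0)) + 2 * C * e)"
        by (rule little_hankel_bound_mono)
      then show ?thesis by (simp add: little_hankel_bound_def lh)
    qed
    have "little_hankel_norm \<omega> s f \<le> 2 * C * (S + cmod (hyp_mean \<omega> r f 0)) + e" if "0 < e" for e
      using little_hankel_norm_le[OF bound[of "e / (2 * C)"]] that C by simp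
    then have "little_hankel_norm \<omega> s f \<le> 2 * C * (S + cmod (hyp_mean \<omega> r f 0))"
      by (rule field_le_epsilon)
    moreover have "little_hankel_bounded \<omega> s f"
      using bound[of 1] by (auto simp: little_hankel_bounded_def)
    ultimately show ?thesis by (simp add: S_def)
  qed
  then show ?thesis using that[of "2 * C"] C by simp
qed

lemma ex_large_hyp_radius:
  obtains r\<^sub>0 where "0 < r\<^sub>0" "\<And>r. r\<^sub>0 \<le> r \<Longrightarrow> large_radius ((cosh r)\<^sup>2)"
proof -
  obtain R where R: "large_radius R" using ex_large_radius by blast
  then have R13: "13 \<le> R" by (simp add: large_radius_def)
  have "large_radius ((cosh r)\<^sup>2)" if r: "2 * R \<le> r" for r
  proof (rule large_radius_mono[OF R])
    have "R \<le> cosh r" using cosh_ge_half[of r] r by linarith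
    moreover have "cosh r \<le> (cosh r)\<^sup>2"
      using cosh_real_ge_1[of r] by (simp add: power2_eq_square)
    ultimately show "R \<le> (cosh r)\<^sup>2" by linarith
  qed
  then show ?thesis using that[of "2 * R"] R13 by simp
qed

lemma BMO_stable_radiusI:
  assumes r0: "0 < r\<^sub>0" and R: "\<And>r. r\<^sub>0 \<le> r \<Longrightarrow> large_radius ((cosh r)\<^sup>2)"
  shows "BMO_stable_radius \<omega> r\<^sub>0"
  unfolding BMO_stable_radius_def
proof (intro conjI allI impI ballI r0)
  fix r and z :: complex assume r: "r\<^sub>0 \<le> r" and z: "z \<in> ball 0 1"
  show "0 < measure wm (hyp_disc z r)"
    using mass_pos[OF R[OF r], of z] z r r0 by (simp add: hyp_disc_eq_hball)
next
  fix p r :: real assume p: "1 < p" and r: "r\<^sub>0 \<le> r"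
  have "cosh r\<^sub>0 \<le> cosh r" using r r0 by (intro cosh_real_nonneg_le_iff[THEN iffD2]) auto
  then have le: "(cosh r\<^sub>0)\<^sup>2 \<le> (cosh r)\<^sup>2" by (intro power_mono) auto
  have "f \<in> BMO_space \<omega> p r \<longleftrightarrow> f \<in> BMO_space \<omega> p r\<^sub>0" for f
  proof (cases "f \<in> Lp_space \<omega> p")
    case True
    then have "trunc f \<in> borel_measurable borel" by (simp add: Lp_space_iff)
    then show ?thesis
      using r r0 osc_bounded_radius[OF R[OF order_refl] le p] by (simp add: BMO_space_iff[OF p _ R])
  qed (simp add: BMO_space_def)
  then show "BMO_space \<omega> p r = BMO_space \<omega> p r\<^sub>0" by blast
qed

end

theorem theorem13:
  fixes \<omega> :: "real \<Rightarrow> real"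
  assumes "\<omega> \<in> D_class"
  shows "\<exists>r\<^sub>0. BMO_stable_radius \<omega> r\<^sub>0 \<and>
    (\<forall>p s r :: real. 1 < p \<longrightarrow> 1 < s \<longrightarrow> r\<^sub>0 \<le> r \<longrightarrow>
      (\<exists>C. \<forall>f \<in> BMO_space \<omega> p r.
        little_hankel_bounded \<omega> s f \<and>
        little_hankel_bounded \<omega> s (\<lambda>\<zeta>. cnj (f \<zeta>)) \<and>
        little_hankel_norm \<omega> s f + little_hankel_norm \<omega> s (\<lambda>\<zeta>. cnj (f \<zeta>))
          \<le> C * (BMO_seminorm \<omega> p r f + cmod (hyp_mean \<omega> r f 0))))"
proof -
  obtain l \<alpha> A where "D_weight \<omega> l \<alpha> A" using D_class_imp_D_weight[OF assms] .
  then interpret D_weight \<omega> l \<alpha> A .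
  obtain r\<^sub>0 where r0: "0 < r\<^sub>0" and R: "\<And>r. r\<^sub>0 \<le> r \<Longrightarrow> large_radius ((cosh r)\<^sup>2)"
    using ex_large_hyp_radius by blast
  show ?thesis
  proof (rule exI[of _ "r\<^sub>0"], intro conjI allI impI)
    show "BMO_stable_radius \<omega> r\<^sub>0" by (rule BMO_stable_radiusI[OF r0 R])
    fix p s r :: real assume p: "1 < p" and s: "1 < s" and r: "r\<^sub>0 \<le> r"
    have r': "0 < r" using r0 r by simp
    obtain C where C: "0 < C" "\<And>f. f \<in> BMO_space \<omega> p r \<Longrightarrow> little_hankel_bounded \<omega> s f \<and>
      little_hankel_norm \<omega> s f \<le> C * (BMO_seminorm \<omega> p r f + cmod (hyp_mean \<omega> r f 0))"
      using little_hankel_norm_BMO[OF p s r' R[OF r]] by blast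
    show "\<exists>C. \<forall>f \<in> BMO_space \<omega> p r.
        little_hankel_bounded \<omega> s f \<and>
        little_hankel_bounded \<omega> s (\<lambda>\<zeta>. cnj (f \<zeta>)) \<and>
        little_hankel_norm \<omega> s f + little_hankel_norm \<omega> s (\<lambda>\<zeta>. cnj (f \<zeta>))
          \<le> C * (BMO_seminorm \<omega> p r f + cmod (hyp_mean \<omega> r f 0))"
    \<comment> \<open>Conjugating the symbol preserves the space, the seminorm and the modulus of
      the mean at the origin, so one bound serves both operators and is counted twice.\<close>
    proof (intro exI[of _ "2 * C"] ballI)
      fix f assume f: "f \<in> BMO_space \<omega> p r"
      show "little_hankel_bounded \<omega> s f \<and>
        little_hankel_bounded \<omega> s (\<lambda>\<zeta>. cnj (f \<zeta>)) \<and>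
        little_hankel_norm \<omega> s f + little_hankel_norm \<omega> s (\<lambda>\<zeta>. cnj (f \<zeta>))
          \<le> 2 * C * (BMO_seminorm \<omega> p r f + cmod (hyp_mean \<omega> r f 0))"
        using C(2)[OF f] C(2)[OF BMO_space_cnj[OF f]] by (simp add: BMO_seminorm_cnj hyp_mean_cnj)
    qed
  qed
qed

end
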